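(* Let Assumption (C) be satisfied (see context). Let $(\bar u(\cdot);\bar X(\cdot))$ be an admissible pair with associated adjoint process $(\bar p(\cdot),\bar q(\cdot))$. Suppose that for almost all $(t,\omega)\in[0,T]\times\Omega$: 1. $\mathcal H(t,x,x',u,\bar p(t),\bar q(t))$ is convex in $(x,x',u)$; 2. $\Phi(x,x')$ is convex in $(x,x')$; 3. $\mathcal H(t,\bar X(t),\mathbb E[\bar X(t)],\bar u(t),\bar p(t),\bar q(t))=\min_{u\in\mathscr U}\mathcal H(t,\bar X(t),\mathbb E[\bar X(t)],u,\bar p(t),\bar q(t))$. Then $(\bar u(\cdot);\bar X(\cdot))$ is an optimal pair of the problem of minimizing $J$ over $\mathcal A$.
   Context: Fix $T>0$ and a complete probability space $(\Omega,\mathscr F,\mathbb P)$ carrying a one-dimensional Brownian motion $W$, with $\mathbb F=(\mathscr F_t)_{0\le t\le T}$ its natural filtration augmented by all $\mathbb P$-null sets and $\mathscr P$ the predictable $\sigma$-algebra. $V\subset H=H^*\subset V^*$ is a Gelfand triple ($H$ separable Hilbert, $V$ reflexive Banach, densely and continuously embedded in $H$), with pairing $\langle\cdot,\cdot\rangle$ between $V$ and $V^*$. $\mathcal M^2_{\mathscr F}(0,T;E)$: $E$-valued adapted processes $f$ with $\mathbb E\int_0^T\|f\|_E^2dt<\infty$; $\mathcal S^2_{\mathscr F}(0,T;E)$: $E$-valued adapted càdlàg processes with $\mathbb E\sup_t\|f(t)\|_E^2<\infty$. State equation ($x\in H$): $$dX(t)=[-A(t)X(t)+h(t,X(t),\mathbb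 E[X(t)],u(t))]dt+g(t,X(t),\mathbb E[X(t)],u(t))\,dW(t),\quad X(0)=x,$$ cost functional $$J(u(\cdot))=\mathbb E\Big[\int_0^Tl(t,X(t),\mathbb E[X(t)],u(t))dt+\Phi(X(T),\mathbb E[X(T)])\Big],$$ where $A:[0,T]\times\Omega\to\mathscr L(V,V^* )$, $h,g:[0,T]\times\Omega\times H\times H\times\mathscr U\to H$, $l:[0,T]\times\Omega\times H\times H\times\mathscr U\to\mathbb R$, $\Phi:\Omega\times H\times H\to\mathbb R$; arguments are written $(t,x,x',u)$ and $(x,x')$, with subscripts $x,x',u$ denoting partial Gâteaux derivatives. Equations in the Gelfand triple are understood in $V^*$ (tested against $\phi\in V$), with state in $\mathcal M^2_{\mathscr F}(0,T;V)$. Assumption (C): (i) $\mathscr U$ is a nonempty convex closed subset of a real separable Hilbert space $U$. (ii) $A$ is $\mathscr P/\mathscr B(\mathscr L(V,V^* ))$-measurable, and for some constants $\alpha>0,\lambda,C$: $\langle A(t)x,x\rangle+\lambda\|x\|_H^2\ge\alpha\|x\|_V^2$ for $x\in V$, and $\sup_{(t,\omega)}\|A(t,\omega)\|_{\mathscr L(V,V^* )}\le C$. (iii) $h,g$ are $\mathscr P\otimes\mathscr B(H)\otimes\mathscr B(H)\otimes\mathscr B(\mathscr U)/\mathscr B(H)$-measurable, $h(\cdot,0,0,0),g(\cdot,0,0,0)\in\mathcal M^2_{\mathscr F}(0,T;H)$, and for a.e. $(t,\omega)$, $h,g$ have continuous and uniformly bounded Gâteaux derivatives $h_x,h_{x'},h_u,g_x,g_{x'},g_u$.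 (iv) $l$ is $\mathscr P\otimes\mathscr B(H)\otimes\mathscr B(H)\otimes\mathscr B(\mathscr U)/\mathscr B(\mathbb R)$-measurable, $\Phi$ is $\mathscr F_T\otimes\mathscr B(H)\otimes\mathscr B(H)/\mathscr B(\mathbb R)$-measurable; for a.e. $(t,\omega)$, $l$ has continuous Gâteaux derivatives $l_x,l_{x'},l_u$ and $\Phi$ has continuous Gâteaux derivatives $\Phi_x,\Phi_{x'}$, and for some constant $C>0$ and all $(x,x',u)\in H\times H\times\mathscr U$: $|l(t,x,x',u)|\le C(1+\|x\|_H^2+\|x'\|_H^2+\|u\|_U^2)$; $\|l_x\|_H+\|l_{x'}\|_H+\|l_u\|_U\le C(1+\|x\|_H+\|x'\|_H+\|u\|_U)$; $|\Phi(x,x')|\le C(1+\|x\|_H^2+\|x'\|_H^2)$; $\|\Phi_x(x,x')\|_H+\|\Phi_{x'}(x,x')\|_H\le C(1+\|x\|_H+\|x'\|_H)$. Admissible controls $\mathcal A$: predictable processes $u\in\mathcal M^2_{\mathscr F}(0,T;U)$ with $u(t)\in\mathscr U$ for a.e. $t$, $\mathbb P$-a.s. Under Assumption (C) each $u\in\mathcal A$ has a unique state $X\in\mathcal S^2_{\mathscr F}(0,T;H)\cap\mathcal M^2_{\mathscr F}(0,T;V)$; $(u;X)$ is an admissible pair. $\bar u\in\mathcal A$ is optimal if $J(\bar u)=\inf_{u\in\mathcal A}J(u)$; with its state $\bar X$, $(\bar u;\bar X)$ is an optimal pair. Hamiltonian: $\mathcal H(t,x,x',u,p,q)=(h(t,x,x',u),p)_H+(g(t,x,x',u),q)_H+l(t,x,x',u)$.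 The adjoint process associated with an admissible pair $(u;X)$ is the unique solution $(p,q)$, $p\in\mathcal S^2_{\mathscr F}(0,T;H)\cap\mathcal M^2_{\mathscr F}(0,T;V)$, $q\in\mathcal M^2_{\mathscr F}(0,T;H)$, of $$dp(t)=-\{-A^*(t)p(t)+\mathcal H_x(t)+\mathbb E[\mathcal H_{x'}(t)]\}dt+q(t)dW(t),\quad p(T)=\Phi_x(X(T),\mathbb E[X(T)])+\mathbb E[\Phi_{x'}(X(T),\mathbb E[X(T)])],$$ where $A^*$ is the adjoint of $A$ and $\mathcal H_\cdot(t)=\mathcal H_\cdot(t,X(t),\mathbb E[X(t)],u(t),p(t),q(t))$. *)

theory Defs
  imports "HOL-Probability.Probability"
begin

section \<open>Wiener space, processes and the scalar Ito integral\<close>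

definition brownian_motion :: "'w measure \<Rightarrow> real \<Rightarrow> (real \<Rightarrow> 'w \<Rightarrow> real) \<Rightarrow> bool" where
  "brownian_motion M T W \<longleftrightarrow>
     (\<forall>t\<in>{0..T}. W t \<in> borel_measurable M) \<and>
     (AE \<omega> in M. W 0 \<omega> = 0) \<and>
     (\<forall>s t. 0 \<le> s \<longrightarrow> s < t \<longrightarrow> t \<le> T \<longrightarrow>
        distributed M lborel (\<lambda>\<omega>. W t \<omega> - W s \<omega>) (normal_density 0 (sqrt (t - s)))) \<and>
     (\<forall>(n::nat) \<tau>. 0 \<le> \<tau> 0 \<longrightarrow> (\<forall>i<n. \<tau> i \<le> \<tau> (Suc i)) \<longrightarrow> \<tau> n \<le> T \<longrightarrow>
        prob_space.indep_vars M (\<lambda>_. borel) (\<lambda>i \<omega>. W (\<tau> (Suc i)) \<omega> - W (\<tau> i) \<omega>) {..<n}) \<and>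
     (AE \<omega> in M. continuous_on {0..T} (\<lambda>t. W t \<omega>))"

text \<open>As \<open>M\<close> is complete, \<open>null_sets M\<close> contains every subset of a null event.\<close>

definition bm_filtration :: "'w measure \<Rightarrow> (real \<Rightarrow> 'w \<Rightarrow> real) \<Rightarrow> real \<Rightarrow> 'w measure" where
  "bm_filtration M W t =
     sigma (space M) ({W s -` B \<inter> space M | s B. s \<in> {0..t} \<and> B \<in> sets borel} \<union> null_sets M)"

definition predictable_sigma :: "'w measure \<Rightarrow> real \<Rightarrow> (real \<Rightarrow> 'w measure) \<Rightarrow> (real \<times> 'w) measure" where
  "predictable_sigma M T F =
     sigma ({0..T} \<times> space M)
       ({{0} \<times> B | B. B \<in> sets (F 0)} \<union>
        {{s<..t} \<times> B | s t B. 0 \<le> s \<and> s < t \<and> t \<le> T \<and> B \<in> sets (F s)})"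

definition dt_dP :: "'w measure \<Rightarrow> real \<Rightarrow> (real \<times> 'w) measure" where
  "dt_dP M T = restrict_space lborel {0..T} \<Otimes>\<^sub>M M"

definition adapted :: "real \<Rightarrow> (real \<Rightarrow> 'w measure) \<Rightarrow> (real \<Rightarrow> 'w \<Rightarrow> 'e::topological_space) \<Rightarrow> bool" where
  "adapted T F f \<longleftrightarrow> (\<forall>t\<in>{0..T}. f t \<in> borel_measurable (F t))"

text \<open>Joint measurability, implicit in \<open>E \<integral> \<parallel>f\<parallel>\<^sup>2 dt < \<infinity>\<close>, is spelled out.\<close>

definition M2 :: "'w measure \<Rightarrow> real \<Rightarrow> (real \<Rightarrow> 'w measure) \<Rightarrow> (real \<Rightarrow> 'w \<Rightarrow> 'e::real_normed_vector) set" where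
  "M2 M T F = {f. adapted T F f \<and>
     (\<lambda>(t, \<omega>). f t \<omega>) \<in> borel_measurable (dt_dP M T) \<and>
     (\<integral>\<^sup>+(t, \<omega>). ennreal ((norm (f t \<omega>))\<^sup>2) \<partial>dt_dP M T) < \<infinity>}"

definition cadlag :: "real \<Rightarrow> (real \<Rightarrow> 'e::topological_space) \<Rightarrow> bool" where
  "cadlag T f \<longleftrightarrow> (\<forall>t\<in>{0..<T}. (f \<longlongrightarrow> f t) (at_right t)) \<and>
     (\<forall>t\<in>{0<..T}. \<exists>y. (f \<longlongrightarrow> y) (at_left t))"

definition S2 :: "'w measure \<Rightarrow> real \<Rightarrow> (real \<Rightarrow> 'w measure) \<Rightarrow> (real \<Rightarrow> 'w \<Rightarrow> 'e::real_normed_vector) set" where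
  "S2 M T F = {f. adapted T F f \<and> (\<forall>\<omega>\<in>space M. cadlag T (\<lambda>t. f t \<omega>)) \<and>
     (\<integral>\<^sup>+\<omega>. (SUP t\<in>{0..T}. ennreal ((norm (f t \<omega>))\<^sup>2)) \<partial>M) < \<infinity>}"

text \<open>A simple integrand \<open>\<Sum>i<n. c i * 1\<^bsub>(\<tau> i, \<tau> (i+1)]\<^esub>\<close> with \<open>c i\<close> bounded and
  measurable for the filtration at time \<open>\<tau> i\<close>.\<close>

definition simple_integrand ::
  "'w measure \<Rightarrow> real \<Rightarrow> (real \<Rightarrow> 'w measure) \<Rightarrow> nat \<Rightarrow> (nat \<Rightarrow> real) \<Rightarrow> (nat \<Rightarrow> 'w \<Rightarrow> real) \<Rightarrow> bool" where
  "simple_integrand M T F n \<tau> c \<longleftrightarrow>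
     0 \<le> \<tau> 0 \<and> (\<forall>i<n. \<tau> i \<le> \<tau> (Suc i)) \<and> \<tau> n \<le> T \<and>
     (\<forall>i<n. c i \<in> borel_measurable (F (\<tau> i)) \<and> (\<exists>K. \<forall>\<omega>\<in>space M. \<bar>c i \<omega>\<bar> \<le> K))"

definition simple_process :: "nat \<Rightarrow> (nat \<Rightarrow> real) \<Rightarrow> (nat \<Rightarrow> 'w \<Rightarrow> real) \<Rightarrow> real \<Rightarrow> 'w \<Rightarrow> real" where
  "simple_process n \<tau> c s \<omega> = (\<Sum>i<n. c i \<omega> * indicator {\<tau> i<..\<tau> (Suc i)} s)"

definition simple_integral ::
  "(real \<Rightarrow> 'w \<Rightarrow> real) \<Rightarrow> nat \<Rightarrow> (nat \<Rightarrow> real) \<Rightarrow> (nat \<Rightarrow> 'w \<Rightarrow> real) \<Rightarrow> 'w \<Rightarrow> real" where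
  "simple_integral W n \<tau> c \<omega> = (\<Sum>i<n. c i \<omega> * (W (\<tau> (Suc i)) \<omega> - W (\<tau> i) \<omega>))"

text \<open>\<open>has_ito_integral M T W f I\<close>: the random variable \<open>I\<close> is (a version of) \<open>\<integral>\<^sub>0\<^sup>T f dW\<close>, the
  \<open>L\<^sup>2\<close>-limit of integrals of simple integrands that approximate \<open>f\<close> in \<open>L\<^sup>2(dt \<otimes> dP)\<close>. By the
  Ito isometry \<open>I\<close> is unique up to almost sure equality. The integrand need only agree a.e. with
  a process in \<open>M2\<close>, because the coefficients below are only constrained a.e. Integrals over
  subintervals are obtained by multiplying \<open>f\<close> with an indicator.\<close>

definition has_ito_integral ::
  "'w measure \<Rightarrow> real \<Rightarrow> (real \<Rightarrow> 'w \<Rightarrow> real) \<Rightarrow> (real \<Rightarrow> 'w \<Rightarrow> real) \<Rightarrow> ('w \<Rightarrow> real) \<Rightarrow> bool" where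
  "has_ito_integral M T W f I \<longleftrightarrow>
     I \<in> borel_measurable M \<and>
     (\<exists>f0\<in>M2 M T (bm_filtration M W). AE (s, \<omega>) in dt_dP M T. f s \<omega> = f0 s \<omega>) \<and>
     (\<exists>n \<tau> c. (\<forall>k::nat. simple_integrand M T (bm_filtration M W) (n k) (\<tau> k) (c k)) \<and>
        (\<lambda>k. \<integral>\<^sup>+(s, \<omega>). ennreal ((simple_process (n k) (\<tau> k) (c k) s \<omega> - f s \<omega>)\<^sup>2) \<partial>dt_dP M T)
          \<longlonglongrightarrow> 0 \<and>
        (\<lambda>k. \<integral>\<^sup>+\<omega>. ennreal ((simple_integral W (n k) (\<tau> k) (c k) \<omega> - I \<omega>)\<^sup>2) \<partial>M) \<longlonglongrightarrow> 0)"

section \<open>Functional-analytic notions\<close>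

text \<open>The triple \<open>V \<subset> H = H\<^sup>* \<subset> V\<^sup>*\<close> is given by the embedding \<open>e\<close> of \<open>V\<close> into \<open>H\<close>. The dual \<open>V\<^sup>*\<close> is the
  type of bounded functionals on \<open>V\<close>, and \<open>y \<in> H\<close> acts on \<open>v \<in> V\<close> by \<open>y \<bullet> e v\<close>. The last conjunct
  is the reflexivity of \<open>V\<close>.\<close>

definition gelfand_triple ::
  "('v::banach \<Rightarrow>\<^sub>L 'h::{real_inner, banach, second_countable_topology}) \<Rightarrow> bool" where
  "gelfand_triple e \<longleftrightarrow> inj (blinfun_apply e) \<and> closure (range (blinfun_apply e)) = UNIV \<and>
     (\<forall>\<Lambda> :: ('v \<Rightarrow>\<^sub>L real) \<Rightarrow>\<^sub>L real. \<exists>v. \<forall>f. blinfun_apply \<Lambda> f = blinfun_apply f v)"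

text \<open>The adjoint \<open>A\<^sup>* : V \<rightarrow> V\<^sup>*\<close> of \<open>A : V \<rightarrow> V\<^sup>*\<close>, where \<open>V\<^sup>*\<^sup>*\<close> is identified with \<open>V\<close>.\<close>

definition adjoint_op ::
  "('v::real_normed_vector \<Rightarrow>\<^sub>L 'v \<Rightarrow>\<^sub>L real) \<Rightarrow> ('v \<Rightarrow>\<^sub>L 'v \<Rightarrow>\<^sub>L real)" where
  "adjoint_op B = Blinfun (\<lambda>y. Blinfun (\<lambda>v. blinfun_apply (blinfun_apply B v) y))"

lemma adjoint_op_apply:
  "blinfun_apply (blinfun_apply (adjoint_op B) y) v = blinfun_apply (blinfun_apply B v) y"
proof -
  have *: "bounded_linear (\<lambda>v. blinfun_apply (blinfun_apply B v) y)" for y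
    by (intro bounded_linear_intros)
  have bound: "norm (Blinfun (\<lambda>v. blinfun_apply (blinfun_apply B v) y)) \<le> norm y * norm B" for y
  proof (rule norm_blinfun_bound)
    fix v
    have "norm (blinfun_apply (blinfun_apply B v) y) \<le> norm (blinfun_apply B v) * norm y"
      by (rule norm_blinfun)
    also have "\<dots> \<le> (norm B * norm v) * norm y"
      by (intro mult_right_mono norm_blinfun norm_ge_zero)
    finally show "norm (blinfun_apply (Blinfun (\<lambda>v. blinfun_apply (blinfun_apply B v) y)) v)
        \<le> norm y * norm B * norm v"
      by (simp add: bounded_linear_Blinfun_apply[OF *] mult_ac)
  qed simp
  have "bounded_linear (\<lambda>y. Blinfun (\<lambda>v. blinfun_apply (blinfun_apply B v) y))"
    by (rule bounded_linear_intro[OF _ _ bound]; rule blinfun_eqI;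
        simp only: bounded_linear_Blinfun_apply[OF *] plus_blinfun.rep_eq scaleR_blinfun.rep_eq;
        simp only: blinfun.bilinear_simps)
  then show ?thesis
    by (simp add: adjoint_op_def bounded_linear_Blinfun_apply *)
qed

text \<open>Gateaux derivative at \<open>x\<close> relative to a convex set \<open>S\<close>: the one-sided directional derivatives
  along all directions \<open>y - x\<close> with \<open>y \<in> S\<close> are given by one bounded operator. For \<open>S = UNIV\<close> this is
  the ordinary Gateaux derivative (apply it to \<open>y - x\<close> and its negative).\<close>

definition has_gateaux_derivative ::
  "('a::real_normed_vector \<Rightarrow> 'b::real_normed_vector) \<Rightarrow> ('a \<Rightarrow>\<^sub>L 'b) \<Rightarrow> 'a \<Rightarrow> 'a set \<Rightarrow> bool" where
  "has_gateaux_derivative f D x S \<longleftrightarrow>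
     (\<forall>y\<in>S. ((\<lambda>\<epsilon>. (f (x + \<epsilon> *\<^sub>R (y - x)) - f x) /\<^sub>R \<epsilon>) \<longlongrightarrow> blinfun_apply D (y - x)) (at_right 0))"

text \<open>Gateaux derivatives of real functions on a Hilbert space are identified with vectors (Riesz).\<close>

definition has_gateaux_gradient ::
  "('a::real_inner \<Rightarrow> real) \<Rightarrow> 'a \<Rightarrow> 'a \<Rightarrow> 'a set \<Rightarrow> bool" where
  "has_gateaux_gradient f G x S \<longleftrightarrow> has_gateaux_derivative f (blinfun_inner_right G) x S"

definition gateaux_gradient :: "('a::real_inner \<Rightarrow> real) \<Rightarrow> 'a \<Rightarrow> 'a" where
  "gateaux_gradient f x = (THE G. has_gateaux_gradient f G x UNIV)"

text \<open>For a coefficient \<open>f x x' u\<close> with \<open>u\<close> ranging over \<open>S\<close>: partial Gateaux derivatives, jointly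
  continuous on \<open>H \<times> H \<times> S\<close> for the (operator) norm, and bounded by \<open>K\<close>, respectively of linear
  growth.\<close>

definition C1_bounded ::
  "real \<Rightarrow> 'u set \<Rightarrow> ('h::real_normed_vector \<Rightarrow> 'h \<Rightarrow> 'u::real_normed_vector \<Rightarrow> 'h) \<Rightarrow> bool" where
  "C1_bounded K S f \<longleftrightarrow> (\<exists>fx fx' fu.
     continuous_on (UNIV \<times> UNIV \<times> S) fx \<and>
     continuous_on (UNIV \<times> UNIV \<times> S) fx' \<and>
     continuous_on (UNIV \<times> UNIV \<times> S) fu \<and>
     (\<forall>x x'. \<forall>u\<in>S.
        has_gateaux_derivative (\<lambda>y. f y x' u) (fx (x, x', u)) x UNIV \<and>
        has_gateaux_derivative (\<lambda>y. f x y u) (fx' (x, x', u)) x' UNIV \<and>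
        has_gateaux_derivative (\<lambda>v. f x x' v) (fu (x, x', u)) u S \<and>
        norm (fx (x, x', u)) \<le> K \<and> norm (fx' (x, x', u)) \<le> K \<and> norm (fu (x, x', u)) \<le> K))"

definition C1_running_growth ::
  "real \<Rightarrow> 'u set \<Rightarrow> ('h::real_inner \<Rightarrow> 'h \<Rightarrow> 'u::real_inner \<Rightarrow> real) \<Rightarrow> bool" where
  "C1_running_growth K S f \<longleftrightarrow> (\<exists>fx fx' fu.
     continuous_on (UNIV \<times> UNIV \<times> S) fx \<and>
     continuous_on (UNIV \<times> UNIV \<times> S) fx' \<and>
     continuous_on (UNIV \<times> UNIV \<times> S) fu \<and>
     (\<forall>x x'. \<forall>u\<in>S.
        has_gateaux_gradient (\<lambda>y. f y x' u) (fx (x, x', u)) x UNIV \<and>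
        has_gateaux_gradient (\<lambda>y. f x y u) (fx' (x, x', u)) x' UNIV \<and>
        has_gateaux_gradient (\<lambda>v. f x x' v) (fu (x, x', u)) u S \<and>
        \<bar>f x x' u\<bar> \<le> K * (1 + (norm x)\<^sup>2 + (norm x')\<^sup>2 + (norm u)\<^sup>2) \<and>
        norm (fx (x, x', u)) + norm (fx' (x, x', u)) + norm (fu (x, x', u))
          \<le> K * (1 + norm x + norm x' + norm u)))"

definition C1_terminal_growth :: "real \<Rightarrow> ('h::real_inner \<Rightarrow> 'h \<Rightarrow> real) \<Rightarrow> bool" where
  "C1_terminal_growth K f \<longleftrightarrow> (\<exists>fx fx'.
     continuous_on UNIV fx \<and> continuous_on UNIV fx' \<and>
     (\<forall>x x'.
        has_gateaux_gradient (\<lambda>y. f y x') (fx (x, x')) x UNIV \<and>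
        has_gateaux_gradient (\<lambda>y. f x y) (fx' (x, x')) x' UNIV \<and>
        \<bar>f x x'\<bar> \<le> K * (1 + (norm x)\<^sup>2 + (norm x')\<^sup>2) \<and>
        norm (fx (x, x')) + norm (fx' (x, x')) \<le> K * (1 + norm x + norm x')))"

section \<open>The control problem\<close>

record (overloaded) ('w, 'v::banach, 'h::"{real_inner, banach, second_countable_topology}",
    'u::"{real_inner, banach, second_countable_topology}") control_problem =
  prob :: "'w measure"
  horizon :: real
  bm :: "real \<Rightarrow> 'w \<Rightarrow> real"
  emb :: "'v \<Rightarrow>\<^sub>L 'h"
  init_state :: 'h
  ctrl_set :: "'u set"
  opA :: "real \<Rightarrow> 'w \<Rightarrow> ('v \<Rightarrow>\<^sub>L 'v \<Rightarrow>\<^sub>L real)"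
  drift :: "real \<Rightarrow> 'w \<Rightarrow> 'h \<Rightarrow> 'h \<Rightarrow> 'u \<Rightarrow> 'h"
  diffusion :: "real \<Rightarrow> 'w \<Rightarrow> 'h \<Rightarrow> 'h \<Rightarrow> 'u \<Rightarrow> 'h"
  run_cost :: "real \<Rightarrow> 'w \<Rightarrow> 'h \<Rightarrow> 'h \<Rightarrow> 'u \<Rightarrow> real"
  term_cost :: "'w \<Rightarrow> 'h \<Rightarrow> 'h \<Rightarrow> real"

text \<open>Adaptedness, \<open>M2\<close> and \<open>S2\<close> refer to the augmented Brownian filtration.\<close>

context
  fixes D :: "('w, 'v::banach, 'h::{real_inner, banach, second_countable_topology},
    'u::{real_inner, banach, second_countable_topology}) control_problem"
begin

abbreviation filt :: "real \<Rightarrow> 'w measure" where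
  "filt \<equiv> bm_filtration (prob D) (bm D)"

abbreviation pred_sigma :: "(real \<times> 'w) measure" where
  "pred_sigma \<equiv> predictable_sigma (prob D) (horizon D) filt"

abbreviation proc_M2 :: "(real \<Rightarrow> 'w \<Rightarrow> 'e::real_normed_vector) set" where
  "proc_M2 \<equiv> M2 (prob D) (horizon D) filt"

abbreviation proc_S2 :: "(real \<Rightarrow> 'w \<Rightarrow> 'e::real_normed_vector) set" where
  "proc_S2 \<equiv> S2 (prob D) (horizon D) filt"

abbreviation mean :: "(real \<Rightarrow> 'w \<Rightarrow> 'h) \<Rightarrow> real \<Rightarrow> 'h" where
  "mean X t \<equiv> integral\<^sup>L (prob D) (X t)"

definition stochastic_setting :: bool where
  "stochastic_setting \<longleftrightarrow> 0 < horizon D \<and> prob_space (prob D) \<and> complete_measure (prob D) \<and>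
     brownian_motion (prob D) (horizon D) (bm D) \<and> gelfand_triple (emb D)"

definition C_controls :: bool where
  "C_controls \<longleftrightarrow> ctrl_set D \<noteq> {} \<and> convex (ctrl_set D) \<and> closed (ctrl_set D)"

definition C_operator :: bool where
  "C_operator \<longleftrightarrow>
     (\<lambda>(t, \<omega>). opA D t \<omega>) \<in> borel_measurable pred_sigma \<and>
     (\<exists>\<alpha> lam C. \<alpha> > 0 \<and> (\<forall>t\<in>{0..horizon D}. \<forall>\<omega>\<in>space (prob D).
        (\<forall>x. blinfun_apply (blinfun_apply (opA D t \<omega>) x) x + lam * (norm (blinfun_apply (emb D) x))\<^sup>2
               \<ge> \<alpha> * (norm x)\<^sup>2) \<and>
        norm (opA D t \<omega>) \<le> C))"

text \<open>The integrability of \<open>h(\<cdot>,0,0,0)\<close> and \<open>g(\<cdot>,0,0,0)\<close> is literally meaningful only if \<open>0\<close> is a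
  control value. It is required for some control value instead of \<open>0\<close>; since the \<open>u\<close>-derivative
  is bounded, all choices are equivalent.\<close>

definition C_coefficient :: "(real \<Rightarrow> 'w \<Rightarrow> 'h \<Rightarrow> 'h \<Rightarrow> 'u \<Rightarrow> 'h) \<Rightarrow> bool" where
  "C_coefficient f \<longleftrightarrow>
     (\<lambda>((t, \<omega>), x, x', u). f t \<omega> x x' u) \<in> borel_measurable
        (pred_sigma \<Otimes>\<^sub>M borel \<Otimes>\<^sub>M borel \<Otimes>\<^sub>M restrict_space borel (ctrl_set D)) \<and>
     (\<exists>u0\<in>ctrl_set D. (\<lambda>t \<omega>. f t \<omega> 0 0 u0) \<in> proc_M2) \<and>
     (\<exists>K. AE (t, \<omega>) in dt_dP (prob D) (horizon D). C1_bounded K (ctrl_set D) (f t \<omega>))"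

definition C_costs :: bool where
  "C_costs \<longleftrightarrow>
     (\<lambda>((t, \<omega>), x, x', u). run_cost D t \<omega> x x' u) \<in> borel_measurable
        (pred_sigma \<Otimes>\<^sub>M borel \<Otimes>\<^sub>M borel \<Otimes>\<^sub>M restrict_space borel (ctrl_set D)) \<and>
     (\<lambda>(\<omega>, x, x'). term_cost D \<omega> x x') \<in> borel_measurable
        (filt (horizon D) \<Otimes>\<^sub>M borel \<Otimes>\<^sub>M borel) \<and>
     (\<exists>K>0. (AE (t, \<omega>) in dt_dP (prob D) (horizon D).
               C1_running_growth K (ctrl_set D) (run_cost D t \<omega>)) \<and>
            (AE \<omega> in prob D. C1_terminal_growth K (term_cost D \<omega>)))"

definition assumption_C :: bool where
  "assumption_C \<longleftrightarrow> C_controls \<and> C_operator \<and> C_coefficient (drift D) \<and>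
     C_coefficient (diffusion D) \<and> C_costs"

definition admissible_controls :: "(real \<Rightarrow> 'w \<Rightarrow> 'u) set" where
  "admissible_controls = {u. u \<in> proc_M2 \<and>
     (\<lambda>(t, \<omega>). u t \<omega>) \<in> borel_measurable pred_sigma \<and>
     (AE (t, \<omega>) in dt_dP (prob D) (horizon D). u t \<omega> \<in> ctrl_set D)}"

text \<open>The \<open>H\<close>-valued process \<open>X\<close> lies in \<open>M2\<close> over \<open>V\<close>, with \<open>Y\<close> as its \<open>V\<close>-valued version.\<close>

definition V_version :: "(real \<Rightarrow> 'w \<Rightarrow> 'h) \<Rightarrow> (real \<Rightarrow> 'w \<Rightarrow> 'v) \<Rightarrow> bool" where
  "V_version X Y \<longleftrightarrow> Y \<in> proc_M2 \<and>
     (AE (t, \<omega>) in dt_dP (prob D) (horizon D). blinfun_apply (emb D) (Y t \<omega>) = X t \<omega>)"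

text \<open>The state equation tested with \<open>\<phi> \<in> V\<close>, solved for its stochastic integral over \<open>[0, t]\<close>.
  Time integrals use \<open>lebesgue\<close> because integrands may be arbitrary on null sets.\<close>

definition state_process :: "(real \<Rightarrow> 'w \<Rightarrow> 'u) \<Rightarrow> (real \<Rightarrow> 'w \<Rightarrow> 'h) \<Rightarrow> bool" where
  "state_process u X \<longleftrightarrow> X \<in> proc_S2 \<and> (\<exists>Y. V_version X Y \<and>
     (\<forall>\<phi>. \<forall>t\<in>{0..horizon D}. has_ito_integral (prob D) (horizon D) (bm D)
        (\<lambda>s \<omega>. indicator {0..t} s *
           (diffusion D s \<omega> (X s \<omega>) (mean X s) (u s \<omega>) \<bullet> blinfun_apply (emb D) \<phi>))
        (\<lambda>\<omega>. X t \<omega> \<bullet> blinfun_apply (emb D) \<phi> - init_state D \<bullet> blinfun_apply (emb D) \<phi>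
           - (LINT s:{0..t}|lebesgue.
                - blinfun_apply (blinfun_apply (opA D s \<omega>) (Y s \<omega>)) \<phi>
                + drift D s \<omega> (X s \<omega>) (mean X s) (u s \<omega>) \<bullet> blinfun_apply (emb D) \<phi>))))"

definition admissible_pair :: "(real \<Rightarrow> 'w \<Rightarrow> 'u) \<Rightarrow> (real \<Rightarrow> 'w \<Rightarrow> 'h) \<Rightarrow> bool" where
  "admissible_pair u X \<longleftrightarrow> u \<in> admissible_controls \<and> state_process u X"

definition cost :: "(real \<Rightarrow> 'w \<Rightarrow> 'u) \<Rightarrow> (real \<Rightarrow> 'w \<Rightarrow> 'h) \<Rightarrow> real" where
  "cost u X = (LINT \<omega>|prob D.
     (LINT t:{0..horizon D}|lebesgue. run_cost D t \<omega> (X t \<omega>) (mean X t) (u t \<omega>))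
     + term_cost D \<omega> (X (horizon D) \<omega>) (mean X (horizon D)))"

text \<open>The state of a control is unique up to indistinguishability, so \<open>J(u)\<close> is the cost of any
  admissible pair with control \<open>u\<close>. The infimum is taken in the extended reals, where it is never a
  default value.\<close>

definition optimal_pair :: "(real \<Rightarrow> 'w \<Rightarrow> 'u) \<Rightarrow> (real \<Rightarrow> 'w \<Rightarrow> 'h) \<Rightarrow> bool" where
  "optimal_pair u X \<longleftrightarrow> admissible_pair u X \<and>
     ereal (cost u X) = (INF (v, Y)\<in>{(v, Y). admissible_pair v Y}. ereal (cost v Y))"

definition hamiltonian :: "real \<Rightarrow> 'w \<Rightarrow> 'h \<Rightarrow> 'h \<Rightarrow> 'u \<Rightarrow> 'h \<Rightarrow> 'h \<Rightarrow> real" where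
  "hamiltonian t \<omega> x x' u p q =
     drift D t \<omega> x x' u \<bullet> p + diffusion D t \<omega> x x' u \<bullet> q + run_cost D t \<omega> x x' u"

definition hamiltonian_x :: "real \<Rightarrow> 'w \<Rightarrow> 'h \<Rightarrow> 'h \<Rightarrow> 'u \<Rightarrow> 'h \<Rightarrow> 'h \<Rightarrow> 'h" where
  "hamiltonian_x t \<omega> x x' u p q = gateaux_gradient (\<lambda>y. hamiltonian t \<omega> y x' u p q) x"

definition hamiltonian_x' :: "real \<Rightarrow> 'w \<Rightarrow> 'h \<Rightarrow> 'h \<Rightarrow> 'u \<Rightarrow> 'h \<Rightarrow> 'h \<Rightarrow> 'h" where
  "hamiltonian_x' t \<omega> x x' u p q = gateaux_gradient (\<lambda>y. hamiltonian t \<omega> x y u p q) x'"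

definition adjoint_terminal :: "(real \<Rightarrow> 'w \<Rightarrow> 'h) \<Rightarrow> 'w \<Rightarrow> 'h" where
  "adjoint_terminal X \<omega> =
     (let T = horizon D; m = mean X T in
        gateaux_gradient (\<lambda>y. term_cost D \<omega> y m) (X T \<omega>)
        + (LINT \<omega>'|prob D. gateaux_gradient (\<lambda>y. term_cost D \<omega>' (X T \<omega>') y) m))"

text \<open>Integrated over \<open>[t, T]\<close> the adjoint
  equation reads \<open>\<integral>\<^sub>t\<^sup>T q dW = p(T) - p(t) + \<integral>\<^sub>t\<^sup>T (-A\<^sup>* p + \<H>\<^sub>x + E \<H>\<^sub>x') ds\<close>;
  for \<open>t = T\<close> it contains the terminal condition.\<close>

definition adjoint_process ::
  "(real \<Rightarrow> 'w \<Rightarrow> 'u) \<Rightarrow> (real \<Rightarrow> 'w \<Rightarrow> 'h) \<Rightarrow> (real \<Rightarrow> 'w \<Rightarrow> 'h) \<Rightarrow> (real \<Rightarrow> 'w \<Rightarrow> 'h) \<Rightarrow> bool" where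
  "adjoint_process u X p q \<longleftrightarrow> p \<in> proc_S2 \<and> q \<in> proc_M2 \<and> (\<exists>P. V_version p P \<and>
     (\<forall>\<phi>. \<forall>t\<in>{0..horizon D}. has_ito_integral (prob D) (horizon D) (bm D)
        (\<lambda>s \<omega>. indicator {t..horizon D} s * (q s \<omega> \<bullet> blinfun_apply (emb D) \<phi>))
        (\<lambda>\<omega>. adjoint_terminal X \<omega> \<bullet> blinfun_apply (emb D) \<phi> - p t \<omega> \<bullet> blinfun_apply (emb D) \<phi>
           + (LINT s:{t..horizon D}|lebesgue.
                - blinfun_apply (blinfun_apply (adjoint_op (opA D s \<omega>)) (P s \<omega>)) \<phi>
                + (hamiltonian_x s \<omega> (X s \<omega>) (mean X s) (u s \<omega>) (p s \<omega>) (q s \<omega>)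
                   + (LINT \<omega>'|prob D. hamiltonian_x' s \<omega>' (X s \<omega>') (mean X s) (u s \<omega>')
                        (p s \<omega>') (q s \<omega>')))
                  \<bullet> blinfun_apply (emb D) \<phi>))))"

end

end

theory Submission
  imports Defs
begin

text \<open>Convexity of the Hamiltonian and of \<open>\<Phi>\<close>, with the minimum condition absorbing the derivative in
  \<open>u\<close>, reduces the comparison of the costs of two controls to a duality between the difference of two states and the
  adjoint process. No Ito formula in the triple is needed for it: for \<open>H\<close>-valued processes tested
  with \<open>\<phi> \<in> V\<close> the expectation of the product of two real Ito processes follows from Fubini, the
  polarised Ito isometry, and the orthogonality of the increments of an Ito integral after time \<open>s\<close>
  to \<open>F\<^sub>s\<close>. The test functions are \<open>\<phi>\<^sub>k = G\<^sub>n w\<^sub>k\<close>, where \<open>w\<^sub>k\<close> are orthonormal in \<open>H\<close> and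
  \<open>G\<^sub>n : H \<rightarrow> V\<close> are resolvents of a symmetric coercive form on \<open>V\<close>. Summing over \<open>k\<close> and then letting
  \<open>n\<close> tend to infinity restores the scalar product of \<open>H\<close>, and the terms with \<open>A\<close> and its adjoint
  cancel in the limit.\<close>

section \<open>Hilbert spaces and coercive forms\<close>

text \<open>The obstacle is the choice of test functions. Expanding the scalar product of
  \<open>H\<close> along an orthonormal basis produces terms in which \<open>A\<close> is paired
  with truncated processes, and orthogonal projections of \<open>H\<close> need neither map into
  \<open>V\<close> nor be bounded there. Resolvents cure this: \<open>G n\<close> maps
  \<open>H\<close> into \<open>V\<close>, is symmetric and contractive on \<open>H\<close>, and is
  bounded on \<open>V\<close> uniformly in \<open>n\<close>. The number of test functions can
  therefore tend to infinity for fixed \<open>n\<close>, where \<open>G n\<close> turns convergence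
  in \<open>H\<close> into convergence in \<open>V\<close>, and \<open>n\<close> afterwards under a
  bound independent of \<open>n\<close>. As \<open>A\<close> is not assumed to commute with
  \<open>G n\<close>, its two terms cancel only after the second limit. The form behind
  \<open>G n\<close> is the symmetrised and shifted operator \<open>A\<close> at a single point of
  the product space; it merely supplies an inner product equivalent to the norm of \<open>V\<close>.
  A second obstacle is measurability: coefficients, controls and gradients are prescribed only
  almost everywhere and \<open>V\<close> need not be separable, so processes are replaced throughout
  by versions that are jointly measurable and have adapted sections.\<close>

text \<open>The quadratic functional \<open>a v v - 2 * f v\<close> is minimised over
  \<open>S\<close>: the parallelogram identity makes a minimising sequence Cauchy, and the first
  variation at the limit is the claimed identity. Only completeness of the space is used, the inner
  product being supplied by \<open>a\<close>. Closed subspaces \<open>S\<close> yield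
  \<open>a\<close>-orthogonal projections, \<open>S = UNIV\<close> the theorem of Riesz and the
  symmetric case of Lax-Milgram.\<close>

lemma coercive_form_represents:
  fixes a :: "'v::banach \<Rightarrow> 'v \<Rightarrow> real"
  assumes a: "bounded_bilinear a" and sym: "\<And>x y. a x y = a y x"
    and \<alpha>: "\<alpha> > 0" and coer: "\<And>x. a x x \<ge> \<alpha> * (norm x)\<^sup>2"
    and S: "subspace S" "closed S" and f: "bounded_linear f"
  obtains x where "x \<in> S" "\<And>v. v \<in> S \<Longrightarrow> a x v = f v"
proof -
  interpret a: bounded_bilinear a by fact
  interpret f: bounded_linear f by fact
  define J where "J v = a v v - 2 * f v" for v
  obtain F where F: "\<And>x. norm (f x) \<le> norm x * F" and F0: "F > 0"
    using f.pos_bounded by blast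
  have lower: "J v \<ge> - F\<^sup>2 / \<alpha>" for v
  proof -
    have "0 \<le> (\<alpha> * norm v - F)\<^sup>2 / \<alpha>" using \<alpha> by simp
    also have "\<dots> = \<alpha> * (norm v)\<^sup>2 - 2 * (norm v * F) + F\<^sup>2 / \<alpha>"
      using \<alpha> by (simp add: field_simps power2_eq_square)
    finally show ?thesis
      using coer[of v] F[of v] unfolding J_def by (simp add: abs_le_iff)
  qed
  define m where "m = Inf (J ` S)"
  have S0: "0 \<in> S" using S(1) by (rule subspace_0)
  have bdd: "bdd_below (J ` S)" using lower by (intro bdd_belowI2)
  have m_le: "m \<le> J v" if "v \<in> S" for v
    unfolding m_def using that bdd by (intro cInf_lower) auto
  have "\<exists>v\<in>S. J v < m + 1 / real (Suc n)" for n
  proof -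
    have "Inf (J ` S) < m + 1 / real (Suc n)" by (simp add: m_def)
    then show ?thesis using S0 bdd by (subst (asm) cInf_less_iff) auto
  qed
  then obtain x where xS: "\<And>n. x n \<in> S" and xJ: "\<And>n. J (x n) < m + 1 / real (Suc n)"
    by metis
  \<comment> \<open>The midpoint of \<open>y\<close> and \<open>z\<close> lies in \<open>S\<close>,
    so \<open>J\<close> there is at least \<open>m\<close>; the parallelogram identity then bounds
    the distance of two near-minimisers.\<close>
  have par: "\<alpha> * (norm (y - z))\<^sup>2 \<le> 2 * (J y - m) + 2 * (J z - m)" if "y \<in> S" "z \<in> S" for y z
  proof -
    have "(1/2) *\<^sub>R (y + z) \<in> S" using that S(1) by (simp add: subspace_add subspace_scale)
    then have "4 * m \<le> 4 * J ((1/2) *\<^sub>R (y + z))" using m_le by simp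
    also have "4 * J ((1/2) *\<^sub>R (y + z)) = 2 * J y + 2 * J z - a (y - z) (y - z)"
      unfolding J_def by (simp add: a.scaleR_left a.scaleR_right a.add_left a.add_right a.diff_left
          a.diff_right f.scaleR f.add sym[of z y] algebra_simps)
    finally have "4 * m \<le> 2 * J y + 2 * J z - a (y - z) (y - z)" by simp
    then have "a (y - z) (y - z) \<le> 2 * (J y - m) + 2 * (J z - m)" by argo
    with coer[of "y - z"] show ?thesis by (rule order_trans)
  qed
  have "Cauchy x"
  proof (rule CauchyI)
    fix \<epsilon> :: real assume e: "\<epsilon> > 0"
    obtain N where N: "4 / (\<alpha> * \<epsilon>\<^sup>2) < real N" using reals_Archimedean2 by blast
    have "norm (x p - x q) < \<epsilon>" if "p \<ge> N" "q \<ge> N" for p q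
    proof -
      have b: "J (x k) - m < 1 / real (Suc N)" if "k \<ge> N" for k
        using xJ[of k] that by (smt (verit) frac_le of_nat_0_less_iff of_nat_mono Suc_le_mono zero_less_Suc)
      have "\<alpha> * (norm (x p - x q))\<^sup>2 \<le> 4 / real (Suc N)"
        using par[OF xS xS, of p q] b[OF that(1)] b[OF that(2)] by simp
      also have "\<dots> < \<alpha> * \<epsilon>\<^sup>2"
      proof -
        have "4 / (\<alpha> * \<epsilon>\<^sup>2) < real (Suc N)" using N by simp
        then show ?thesis using \<alpha> e by (simp add: field_simps)
      qed
      finally have "(norm (x p - x q))\<^sup>2 < \<epsilon>\<^sup>2" using \<alpha> by simp
      then show ?thesis using e by (simp add: power_less_imp_less_base)
    qed
    then show "\<exists>M. \<forall>m\<ge>M. \<forall>n\<ge>M. norm (x m - x n) < \<epsilon>" by blast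
  qed
  then obtain l where l: "x \<longlonglongrightarrow> l" using Cauchy_convergent convergent_def by blast
  have lS: "l \<in> S" using S(2) xS l by (rule closed_sequentially)
  have "(\<lambda>n. J (x n)) \<longlonglongrightarrow> J l"
    unfolding J_def by (intro tendsto_diff tendsto_mult tendsto_const a.tendsto f.tendsto l)
  moreover have "(\<lambda>n. m + 1 / real (Suc n)) \<longlonglongrightarrow> m + 0"
    by (intro tendsto_add tendsto_const LIMSEQ_Suc[OF lim_1_over_n])
  ultimately have Jl: "J l \<le> m" using xJ by (intro LIMSEQ_le) (auto intro!: exI less_imp_le)
  have "a l v = f v" if v: "v \<in> S" for v
  proof -
    define d where "d = a l v - f v"
    have "0 \<le> t\<^sup>2 * a v v + 2 * t * d" for t
    proof -
      have "l + t *\<^sub>R v \<in> S" using S(1) lS v by (simp add: subspace_add subspace_scale)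
      then have "J l \<le> J (l + t *\<^sub>R v)" using Jl m_le by fastforce
      then show ?thesis unfolding J_def d_def
        by (simp add: a.scaleR_left a.scaleR_right a.add_left a.add_right f.scaleR f.add sym[of v l]
            algebra_simps power2_eq_square)
    qed
    \<comment> \<open>The optimal step would be \<open>- d / a v v\<close>; the added
      \<open>1\<close> keeps the denominator positive also for \<open>v = 0\<close> and still makes
      the quadratic negative unless \<open>d = 0\<close>.\<close>
    from this[of "- d / (a v v + 1)"] have "0 \<le> d\<^sup>2 * (a v v / (a v v + 1)\<^sup>2 - 2 / (a v v + 1))"
      by (simp add: power2_eq_square algebra_simps)
    moreover have "a v v / (a v v + 1)\<^sup>2 - 2 / (a v v + 1) < 0"
    proof -
      have p: "a v v \<ge> 0" using coer[of v] \<alpha> by (smt (verit) mult_nonneg_nonneg zero_le_power2)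
      then have "a v v / (a v v + 1)\<^sup>2 < 2 * (a v v + 1) / (a v v + 1)\<^sup>2"
        by (intro divide_strict_right_mono) auto
      also have "\<dots> = 2 / (a v v + 1)" using p by (simp add: power2_eq_square divide_simps)
      finally show ?thesis by simp
    qed
    ultimately have "d\<^sup>2 \<le> 0" by (smt (verit) mult_pos_neg zero_less_power2)
    then show ?thesis by (simp add: d_def)
  qed
  with lS show ?thesis by (rule that)
qed

lemma riesz_representation:
  fixes f :: "'h::{real_inner, banach} \<Rightarrow>\<^sub>L real"
  obtains x where "\<And>v. blinfun_apply f v = x \<bullet> v"
proof -
  obtain x where "x \<in> UNIV" "\<And>v. v \<in> UNIV \<Longrightarrow> x \<bullet> v = blinfun_apply f v"
    by (rule coercive_form_represents[of inner 1 UNIV "blinfun_apply f"])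
      (auto simp: bounded_bilinear_inner inner_commute power2_norm_eq_inner blinfun.bounded_linear_right)
  then show ?thesis by (intro that[of x]) simp
qed

text \<open>The Gram--Schmidt process; division by zero makes dependent vectors contribute \<open>0\<close>.\<close>

fun gram_schmidt :: "(nat \<Rightarrow> 'h::real_inner) \<Rightarrow> nat \<Rightarrow> 'h" where
  "gram_schmidt d n = sgn (d n - (\<Sum>k<n. (d n \<bullet> gram_schmidt d k) *\<^sub>R gram_schmidt d k))"

declare gram_schmidt.simps[simp del]

text \<open>For a Gram-Schmidt family, whose members are orthonormal or zero, this is the orthogonal
  projection onto the span of the first \<open>N\<close> of them.\<close>

definition finite_projection :: "(nat \<Rightarrow> 'h::real_inner) \<Rightarrow> nat \<Rightarrow> 'h \<Rightarrow> 'h" where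
  "finite_projection w N x = (\<Sum>k<N. (x \<bullet> w k) *\<^sub>R w k)"

text \<open>Strong induction on the larger index: in the sum over \<open>k < j\<close> only the term
  \<open>k = i\<close> survives. As \<open>?w i\<close> is a unit vector or zero, that term cancels
  exactly the component of \<open>d j\<close> along \<open>?w i\<close>.\<close>

lemma gram_schmidt_orthogonal: "i < j \<Longrightarrow> gram_schmidt d j \<bullet> gram_schmidt d i = 0"
proof (induction j arbitrary: i rule: less_induct)
  case (less j)
  let ?w = "gram_schmidt d"
  have "(\<Sum>k<j. (d j \<bullet> ?w k) * (?w k \<bullet> ?w i)) = (\<Sum>k<j. if k = i then (d j \<bullet> ?w i) * (?w i \<bullet> ?w i) else 0)"
  proof (rule sum.cong)
    fix k assume "k \<in> {..<j}"
    then show "(d j \<bullet> ?w k) * (?w k \<bullet> ?w i) = (if k = i then (d j \<bullet> ?w i) * (?w i \<bullet> ?w i) else 0)"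
      using less.IH[of k i] less.IH[of i k] less.prems by (cases k i rule: linorder_cases) (auto simp: inner_commute)
  qed simp
  also have "\<dots> = (d j \<bullet> ?w i) * (?w i \<bullet> ?w i)" using less.prems by simp
  also have "\<dots> = d j \<bullet> ?w i"
  proof (cases "?w i = 0")
    case False
    then have "norm (?w i) = 1" by (subst (asm) gram_schmidt.simps, subst gram_schmidt.simps) (simp add: norm_sgn sgn_zero_iff)
    then show ?thesis by (simp add: norm_eq_1)
  qed simp
  finally have "(d j - (\<Sum>k<j. (d j \<bullet> ?w k) *\<^sub>R ?w k)) \<bullet> ?w i = 0"
    by (simp add: inner_diff_left inner_sum_left)
  then show ?case by (subst gram_schmidt.simps) (simp only: sgn_div_norm inner_scaleR_left mult_zero_right)
qed

lemma gram_schmidt_inner: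
  "gram_schmidt d i \<bullet> gram_schmidt d j = 0 \<or> (i = j \<and> gram_schmidt d i \<bullet> gram_schmidt d j = 1)"
proof (cases i j rule: linorder_cases)
  case equal
  have "norm (gram_schmidt d i) = 0 \<or> norm (gram_schmidt d i) = 1"
    by (subst (1 2) gram_schmidt.simps) (simp add: norm_sgn)
  then show ?thesis using equal by (auto simp: norm_eq_1)
qed (use gram_schmidt_orthogonal[of j i d] gram_schmidt_orthogonal[of i j d] in
    \<open>simp_all add: inner_commute\<close>)

lemma finite_projection_add: "finite_projection w N (x + y) = finite_projection w N x + finite_projection w N y"
  by (simp add: finite_projection_def inner_add_left scaleR_left_distrib sum.distrib)

lemma finite_projection_diff: "finite_projection w N (x - y) = finite_projection w N x - finite_projection w N y"
  by (simp add: finite_projection_def inner_diff_left scaleR_left_diff_distrib sum_subtractf)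

lemma finite_projection_scaleR: "finite_projection w N (c *\<^sub>R x) = c *\<^sub>R finite_projection w N x"
  by (simp add: finite_projection_def scaleR_sum_right)

lemma finite_projection_sum: "finite_projection w N (\<Sum>i\<in>I. x i) = (\<Sum>i\<in>I. finite_projection w N (x i))"
  by (simp add: finite_projection_def inner_sum_left scaleR_sum_left) (rule sum.swap)

lemma finite_projection_inner: "finite_projection w N x \<bullet> y = (\<Sum>k<N. (x \<bullet> w k) * (y \<bullet> w k))"
  by (simp only: finite_projection_def inner_sum_left inner_scaleR_left) (simp add: inner_commute)

lemma finite_projection_gram_schmidt:
  assumes "i < N" shows "finite_projection (gram_schmidt d) N (gram_schmidt d i) = gram_schmidt d i"
proof -
  let ?w = "gram_schmidt d"
  have "finite_projection ?w N (?w i) = (\<Sum>k<N. if k = i then (?w i \<bullet> ?w i) *\<^sub>R ?w i else 0)"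
    unfolding finite_projection_def using gram_schmidt_inner[of d i]
    by (intro sum.cong) (auto split: if_splits)
  also have "\<dots> = (?w i \<bullet> ?w i) *\<^sub>R ?w i" using assms by simp
  also have "\<dots> = ?w i" using gram_schmidt_inner[of d i i] by auto
  finally show ?thesis .
qed

text \<open>The operator is idempotent and symmetric, so the squared norm of the image is its
  product with \<open>x\<close>, and Cauchy-Schwarz finishes.\<close>

lemma norm_finite_projection_le: "norm (finite_projection (gram_schmidt d) N x) \<le> norm x"
proof -
  let ?P = "finite_projection (gram_schmidt d) N"
  have "?P (?P x) = ?P x"
    by (subst (2 3) finite_projection_def)
      (simp add: finite_projection_sum finite_projection_scaleR finite_projection_gram_schmidt)
  moreover have "?P (?P x) \<bullet> x = ?P x \<bullet> ?P x"
    by (simp add: finite_projection_inner mult.commute)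
  ultimately have "(norm (?P x))\<^sup>2 = ?P x \<bullet> x" by (simp add: power2_norm_eq_inner)
  also have "\<dots> \<le> norm (?P x) * norm x" by (rule norm_cauchy_schwarz)
  finally show ?thesis
    by (metis mult_le_cancel_left norm_ge_zero norm_zero order_less_le power2_eq_square)
qed

text \<open>Each \<open>d n\<close> lies in the span of the first \<open>n + 1\<close> Gram-Schmidt
  vectors, also when its residual vanishes. Hence the projections eventually fix every member of the
  generating sequence.\<close>

lemma finite_projection_generator:
  assumes "n < N" shows "finite_projection (gram_schmidt d) N (d n) = d n"
proof -
  let ?w = "gram_schmidt d" and ?P = "finite_projection (gram_schmidt d) N"
  let ?u = "d n - (\<Sum>k<n. (d n \<bullet> ?w k) *\<^sub>R ?w k)"
  have "norm ?u *\<^sub>R ?w n = ?u" by (subst gram_schmidt.simps[of d n]) (cases "?u = 0"; simp only: sgn_div_norm; simp)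
  then have d: "d n = norm ?u *\<^sub>R ?w n + (\<Sum>k<n. (d n \<bullet> ?w k) *\<^sub>R ?w k)" by simp
  show ?thesis
    by (subst (1 2) d) (use assms in \<open>simp add: finite_projection_add finite_projection_sum
      finite_projection_scaleR finite_projection_gram_schmidt\<close>)
qed

text \<open>A countable dense set is orthonormalised; the projections are contractions and
  eventually exact on it. Because the family may contain zero vectors, finite-dimensional
  \<open>H\<close> is covered as well.\<close>

lemma finite_projections_exist:
  obtains w :: "nat \<Rightarrow> 'h::{real_inner, second_countable_topology}"
  where "\<And>N x. norm (finite_projection w N x) \<le> norm x"
    and "\<And>x. (\<lambda>N. finite_projection w N x) \<longlonglongrightarrow> x"
proof -
  obtain S :: "'h set" where S: "countable S" "\<And>X. open X \<Longrightarrow> X \<noteq> {} \<Longrightarrow> \<exists>d\<in>S. d \<in> X"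
    using countable_dense_setE by blast
  then have "S \<noteq> {}" by blast
  define d where "d = from_nat_into S"
  have d: "range d = S" unfolding d_def using S(1) \<open>S \<noteq> {}\<close> by (simp add: range_from_nat_into)
  let ?P = "finite_projection (gram_schmidt d)"
  have "(\<lambda>N. ?P N x) \<longlonglongrightarrow> x" for x
  proof (rule LIMSEQ_I)
    fix r :: real assume r: "r > 0"
    then obtain n where n: "d n \<in> ball x (r / 2)"
      using S(2)[of "ball x (r/2)"] d by auto
    have "norm (?P N x - x) < r" if "N \<ge> Suc n" for N
    proof -
      have "?P N x - x = ?P N (x - d n) + (d n - x)"
        using that by (simp add: finite_projection_diff finite_projection_generator)
      then have "norm (?P N x - x) \<le> norm (?P N (x - d n)) + norm (d n - x)"
        by (metis norm_triangle_ineq)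
      also have "\<dots> \<le> norm (x - d n) + norm (d n - x)" by (simp add: norm_finite_projection_le)
      also have "\<dots> < r" using n by (simp add: dist_norm norm_minus_commute)
      finally show ?thesis .
    qed
    then show "\<exists>no. \<forall>N\<ge>no. norm (?P N x - x) < r" by blast
  qed
  then show ?thesis using norm_finite_projection_le that by blast
qed

section \<open>Resolvents of a symmetric coercive form\<close>

lemma bounded_bilinear_add_scaled:
  fixes f g :: "'a::real_normed_vector \<Rightarrow> 'b::real_normed_vector \<Rightarrow> real"
  assumes "bounded_bilinear f" "bounded_bilinear g"
  shows "bounded_bilinear (\<lambda>x y. f x y + c * g x y)"
proof -
  interpret f: bounded_bilinear f by fact
  interpret g: bounded_bilinear g by fact
  obtain F where F: "\<And>x y. norm (f x y) \<le> norm x * norm y * F" using f.bounded by blast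
  obtain G where G: "\<And>x y. norm (g x y) \<le> norm x * norm y * G" using g.bounded by blast
  show ?thesis
  proof (unfold_locales; (intro exI allI)?)
    fix x y
    have "norm (f x y + c * g x y) \<le> norm (f x y) + \<bar>c\<bar> * norm (g x y)"
      by (metis norm_triangle_ineq norm_mult real_norm_def)
    also have "\<dots> \<le> norm x * norm y * F + \<bar>c\<bar> * (norm x * norm y * G)"
      by (intro add_mono mult_left_mono F G) auto
    also have "\<dots> = norm x * norm y * (F + \<bar>c\<bar> * G)" by (simp add: algebra_simps)
    finally show "norm (f x y + c * g x y) \<le> norm x * norm y * (F + \<bar>c\<bar> * G)" .
  qed (simp_all add: f.add_left f.add_right g.add_left g.add_right f.scaleR_left f.scaleR_right
      g.scaleR_left g.scaleR_right algebra_simps)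
qed

text \<open>Uniformly bounded operators that converge to the identity on a dense set do so
  everywhere. It is applied on \<open>V\<close> with the constant \<open>K\<close> and on
  \<open>H\<close> with the constant 1.\<close>

lemma tendsto_of_dense:
  fixes L :: "nat \<Rightarrow> 'a::real_normed_vector \<Rightarrow> 'a"
  assumes dense: "x \<in> closure S" and lim: "\<And>s. s \<in> S \<Longrightarrow> (\<lambda>n. L n s) \<longlonglongrightarrow> s"
    and diff: "\<And>n x y. L n (x - y) = L n x - L n y" and bd: "\<And>n x. norm (L n x) \<le> K * norm x"
  shows "(\<lambda>n. L n x) \<longlonglongrightarrow> x"
proof (rule LIMSEQ_I)
  fix r :: real assume r: "r > 0"
  \<comment> \<open>Three errors arise: the operator applied to \<open>x - s\<close>, the
    convergence at \<open>s\<close>, and \<open>x - s\<close> itself. Together they stay below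
    \<open>(\<bar>K\<bar> + 2) * \<delta>\<close>.\<close>
  define \<delta> where "\<delta> = r / (\<bar>K\<bar> + 2)"
  have "\<delta> > 0" using r by (simp add: \<delta>_def)
  then obtain s where s: "s \<in> S" "norm (x - s) < \<delta>"
    using dense by (metis closure_approachable dist_norm norm_minus_commute)
  obtain N where N: "\<And>n. n \<ge> N \<Longrightarrow> norm (L n s - s) < \<delta>" using LIMSEQ_D[OF lim[OF s(1)] \<open>\<delta> > 0\<close>] by blast
  have "norm (L n x - x) < r" if "n \<ge> N" for n
  proof -
    have "L n x - x = L n (x - s) + (L n s - s) - (x - s)" by (simp add: diff)
    then have "norm (L n x - x) \<le> norm (L n (x - s)) + norm (L n s - s) + norm (x - s)"
      using norm_triangle_ineq[of "L n (x - s)" "L n s - s"]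
        norm_triangle_ineq4[of "L n (x - s) + (L n s - s)" "x - s"] by simp
    also have "norm (L n (x - s)) \<le> \<bar>K\<bar> * \<delta>"
      using bd[of n "x - s"] mult_mono[OF abs_ge_self[of K] less_imp_le[OF s(2)]] by fastforce
    finally have "norm (L n x - x) < \<bar>K\<bar> * \<delta> + \<delta> + \<delta>" using N[OF that] s(2) by linarith
    also have "\<dots> = (\<bar>K\<bar> + 2) * \<delta>" by (simp add: algebra_simps)
    also have "\<dots> = r" using abs_ge_zero[of K] unfolding \<delta>_def by simp
    finally show ?thesis .
  qed
  then show "\<exists>no. \<forall>n\<ge>no. norm (L n x - x) < r" by blast
qed

lemma subspace_closure:
  fixes S :: "'a::real_normed_vector set"
  assumes "subspace S" shows "subspace (closure S)"
proof (rule subspaceI)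
  show "0 \<in> closure S" using assms closure_subset subspace_0 by blast
  fix x y c assume "x \<in> closure S"
  then obtain f where f: "\<And>n. f n \<in> S" "f \<longlonglongrightarrow> x" unfolding closure_sequential by blast
  show "c *\<^sub>R x \<in> closure S" unfolding closure_sequential
    using f assms by (intro exI[of _ "\<lambda>n. c *\<^sub>R f n"]) (auto intro!: tendsto_intros subspace_scale)
  assume "y \<in> closure S"
  then obtain g where g: "\<And>n. g n \<in> S" "g \<longlonglongrightarrow> y" unfolding closure_sequential by blast
  show "x + y \<in> closure S" unfolding closure_sequential
    using f g assms by (intro exI[of _ "\<lambda>n. f n + g n"]) (auto intro!: tendsto_intros subspace_add)
qed

text \<open>\<open>G n\<close> is the resolvent of the operator of \<open>a\<close> in
  \<open>H\<close> with parameter \<open>\<epsilon> n = 1 / (n + 1)\<close>: \<open>G n y\<close> is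
  the \<open>x\<close> with
  \<open>e x \<bullet> e v + \<epsilon> n * a x v = y \<bullet> e v\<close> for all
  \<open>v\<close>. Symmetry of the form gives symmetry in \<open>H\<close>, testing the equation
  with its own solution gives contractivity in \<open>H\<close>, and contractivity in the energy
  \<open>a\<close> gives the bound on \<open>V\<close>. Strong convergence in \<open>V\<close> holds
  on the domain of the operator and spreads by density.\<close>

lemma resolvents_exist:
  fixes a :: "'v::banach \<Rightarrow> 'v \<Rightarrow> real" and e :: "'v \<Rightarrow>\<^sub>L 'h::real_inner"
  assumes a: "bounded_bilinear a" and sym: "\<And>x y. a x y = a y x"
    and \<alpha>: "\<alpha> > 0" and coer: "\<And>x. a x x \<ge> \<alpha> * (norm x)\<^sup>2"
    and inj: "inj (blinfun_apply e)" and dense: "closure (range (blinfun_apply e)) = UNIV"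
  obtains G :: "nat \<Rightarrow> 'h \<Rightarrow>\<^sub>L 'v" and K :: real
  where "\<And>n x y. e (G n x) \<bullet> y = x \<bullet> e (G n y)" and "\<And>n x. norm (e (G n x)) \<le> norm x"
    and "K \<ge> 0" and "\<And>n v. norm (G n (e v)) \<le> K * norm v" and "\<And>v. (\<lambda>n. G n (e v)) \<longlonglongrightarrow> v"
    and "\<And>x. (\<lambda>n. e (G n x)) \<longlonglongrightarrow> x"
proof -
  interpret a: bounded_bilinear a by fact
  have a0: "a x x \<ge> 0" for x using coer[of x] \<alpha> by (smt (verit) mult_nonneg_nonneg zero_le_power2)
  have bl: "bounded_linear (\<lambda>v. y \<bullet> e v)" for y
    by (intro bounded_linear_intros)
  have ee: "bounded_bilinear (\<lambda>x v. e x \<bullet> e v)"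
    by (intro bounded_bilinear.comp[OF bounded_bilinear_inner] blinfun.bounded_linear_right)
  define \<epsilon> :: "nat \<Rightarrow> real" where "\<epsilon> n = 1 / real (Suc n)" for n
  have \<epsilon>0: "\<epsilon> n > 0" for n by (simp add: \<epsilon>_def)
  define b where "b n x v = e x \<bullet> e v + \<epsilon> n * a x v" for n x v
  have bb: "bounded_bilinear (b n)" for n
    unfolding b_def by (rule bounded_bilinear_add_scaled[OF ee a])
  have bcoer: "b n x x \<ge> (\<epsilon> n * \<alpha>) * (norm x)\<^sup>2" for n x
    using mult_left_mono[OF coer[of x] less_imp_le[OF \<epsilon>0[of n]]] unfolding b_def
    by (simp add: mult.assoc add_increasing)
  have bsym: "b n x y = b n y x" for n x y by (simp add: b_def sym[of x y] inner_commute)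
  have "\<exists>x. \<forall>v. b n x v = y \<bullet> e v" for n y
  proof -
    have p: "\<epsilon> n * \<alpha> > 0" using \<alpha> \<epsilon>0 by simp
    obtain x where "\<And>v. v \<in> UNIV \<Longrightarrow> b n x v = y \<bullet> e v"
      using coercive_form_represents[OF bb[of n] bsym p bcoer subspace_UNIV closed_UNIV bl[of y]] by metis
    then show ?thesis by blast
  qed
  then obtain g where g: "\<And>n y v. b n (g n y) v = y \<bullet> e v" by metis
  have uniq: "z = g n y" if "\<And>v. b n z v = y \<bullet> e v" for n y z
  proof -
    interpret b: bounded_bilinear "b n" by (rule bb)
    have "b n (z - g n y) (z - g n y) = 0" by (simp add: b.diff_left that g)
    with bcoer[of n "z - g n y"] have "(\<epsilon> n * \<alpha>) * (norm (z - g n y))\<^sup>2 \<le> 0" by simp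
    then show ?thesis using \<alpha> \<epsilon>0[of n] by (simp add: mult_le_0_iff zero_less_mult_iff not_le)
  qed
  have gbl: "bounded_linear (g n)" for n
  proof
    interpret b: bounded_bilinear "b n" by (rule bb)
    show "g n (x + y) = g n x + g n y" for x y
      by (rule uniq[symmetric]) (simp add: b.add_left g inner_add_left)
    show "g n (r *\<^sub>R x) = r *\<^sub>R g n x" for r x
      by (rule uniq[symmetric]) (simp add: b.scaleR_left g)
    have "norm (g n x) \<le> norm x * (norm e / (\<epsilon> n * \<alpha>))" for x
    proof (cases "norm (g n x) = 0")
      case True
      then show ?thesis using \<alpha> \<epsilon>0[of n] by (simp add: zero_le_divide_iff mult_nonneg_nonneg)
    next
      case False
      have "(\<epsilon> n * \<alpha>) * (norm (g n x))\<^sup>2 \<le> x \<bullet> e (g n x)" using bcoer[of n "g n x"] by (simp add: g)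
      also have "\<dots> \<le> norm x * norm (e (g n x))" by (rule norm_cauchy_schwarz)
      also have "\<dots> \<le> norm x * (norm e * norm (g n x))" by (intro mult_left_mono norm_blinfun) simp
      finally have "(\<epsilon> n * \<alpha>) * norm (g n x) \<le> norm x * norm e"
        using False by (simp add: power2_eq_square)
      then show ?thesis using \<alpha> \<epsilon>0[of n] by (simp add: field_simps)
    qed
    then show "\<exists>K. \<forall>x. norm (g n x) \<le> norm x * K" by blast
  qed
  define G where "G n = Blinfun (g n)" for n
  have G: "blinfun_apply (G n) = g n" for n by (simp add: G_def bounded_linear_Blinfun_apply gbl)
  have s: "e (G n x) \<bullet> y = x \<bullet> e (G n y)" for n x y
    unfolding G using g[of n x "g n y"] g[of n y "g n x"] bsym[of n "g n x" "g n y"]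
    by (simp add: inner_commute)
  have c: "norm (e (G n x)) \<le> norm x" for n x
  proof -
    have "(norm (e (g n x)))\<^sup>2 \<le> b n (g n x) (g n x)"
      unfolding b_def using a0[of "g n x"] \<epsilon>0[of n] by (simp add: power2_norm_eq_inner)
    also have "\<dots> \<le> norm x * norm (e (g n x))" unfolding g by (rule norm_cauchy_schwarz)
    finally show ?thesis unfolding G
      by (metis mult_le_cancel_right norm_ge_zero norm_zero order_less_le power2_eq_square)
  qed
  \<comment> \<open>The defining equation for \<open>y = e v\<close>, tested with the error
    \<open>g n (e v) - v\<close>. The energy bound and both convergence estimates come from
    it.\<close>
  have key: "(norm (e (g n (e v) - v)))\<^sup>2 + \<epsilon> n * a (g n (e v)) (g n (e v) - v) = 0" for n v
    using g[of n "e v" "g n (e v) - v"]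
    by (simp add: b_def power2_norm_eq_inner blinfun.diff_right inner_diff_left algebra_simps)
  have key': "a (g n (e v)) (g n (e v) - v) \<le> 0" for n v
    using key[of n v] \<epsilon>0[of n] by (smt (verit) mult_pos_pos zero_le_power2)
  \<comment> \<open>Contractivity in the energy, from positivity of \<open>a\<close> on the error
    and the sign found in \<open>key'\<close>.\<close>
  have le_v: "a (g n (e v)) (g n (e v)) \<le> a v v" for n v
  proof -
    let ?x = "g n (e v)"
    have "0 \<le> a (?x - v) (?x - v)" by (rule a0)
    also have "\<dots> = 2 * a ?x (?x - v) - a ?x ?x + a v v"
      by (simp add: a.diff_left a.diff_right sym[of v ?x])
    finally show ?thesis using key'[of n v] by simp
  qed
  have le_d: "a (g n (e v) - v) (g n (e v) - v) \<le> a v (v - g n (e v))" for n v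
    using key'[of n v] by (simp add: a.diff_left a.diff_right)
  obtain A where A: "\<And>x y. norm (a x y) \<le> norm x * norm y * A" "A > 0" using a.pos_bounded by blast
  \<comment> \<open>\<open>K\<close> converts the energy bound into a bound in \<open>V\<close>: the
    form lies between \<open>\<alpha>\<close> and \<open>A\<close> times the squared norm.\<close>
  define K where "K = sqrt (A / \<alpha>)"
  have K0: "K \<ge> 0" using A \<alpha> by (simp add: K_def)
  have bd: "norm (G n (e v)) \<le> K * norm v" for n v
  proof (rule power2_le_imp_le)
    have "\<alpha> * (norm (g n (e v)))\<^sup>2 \<le> norm v * norm v * A"
      using coer[of "g n (e v)"] le_v[of n v] A(1)[of v v] by (simp add: abs_le_iff)
    then show "(norm (G n (e v)))\<^sup>2 \<le> (K * norm v)\<^sup>2"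
      using A \<alpha> by (simp add: G K_def power_mult_distrib field_simps power2_eq_square)
    show "0 \<le> K * norm v" using K0 by simp
  qed
  have eg: "(\<lambda>n. e (g n (e v))) \<longlonglongrightarrow> e v" for v
  proof -
    \<comment> \<open>As \<open>g n (e v)\<close> stays bounded in \<open>V\<close>,
      \<open>key\<close> bounds the squared error in \<open>H\<close> by \<open>\<epsilon> n\<close>
      times this constant.\<close>
    define B where "B = norm v * ((K + 1) * norm v) * A * K"
    have "norm (e (g n (e v) - v)) \<le> sqrt (\<epsilon> n * B)" for n
    proof (rule real_le_rsqrt)
      have "norm (g n (e v) - v) \<le> K * norm v + norm v"
        using norm_triangle_ineq4[of "g n (e v)" v] bd[of n v] by (simp add: G)
      then have "norm (g n (e v)) * norm (g n (e v) - v) * A \<le> (K * norm v) * (K * norm v + norm v) * A"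
        using A(2) bd[of n v] K0 unfolding G by (intro mult_right_mono mult_mono) simp_all
      then have "- a (g n (e v)) (g n (e v) - v) \<le> (K * norm v) * (K * norm v + norm v) * A"
        using A(1)[of "g n (e v)" "g n (e v) - v"] by (simp add: abs_le_iff)
      also have "\<dots> = B" by (simp add: B_def algebra_simps)
      finally show "(norm (e (g n (e v) - v)))\<^sup>2 \<le> \<epsilon> n * B"
        using key[of n v] mult_left_mono[of _ B "\<epsilon> n"] \<epsilon>0[of n] by fastforce
    qed
    moreover have "(\<lambda>n. sqrt (\<epsilon> n * B)) \<longlonglongrightarrow> 0"
    proof -
      have "(\<lambda>n. sqrt (\<epsilon> n * B)) \<longlonglongrightarrow> sqrt (0 * B)"
        unfolding \<epsilon>_def by (intro tendsto_intros LIMSEQ_Suc[OF lim_1_over_n])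
      then show ?thesis by simp
    qed
    ultimately have "(\<lambda>n. e (g n (e v) - v)) \<longlonglongrightarrow> 0"
      by (rule Lim_null_comparison[OF always_eventually[OF allI]])
    then show ?thesis unfolding blinfun.diff_right by (rule LIM_zero_cancel)
  qed
  \<comment> \<open>The domain of the operator: the vectors \<open>s\<close> for which the
    functional \<open>a s\<close> is represented by an element of \<open>H\<close>. On it the energy
    of the error is controlled by the error in \<open>H\<close>, which is already known to
    vanish.\<close>
  define S where "S = {s. \<exists>y. \<forall>v. a s v = y \<bullet> e v}"
  have subS: "subspace S"
  proof (unfold subspace_def S_def, safe)
    show "\<exists>y. \<forall>v. a 0 v = y \<bullet> e v" by (intro exI[of _ 0]) (simp add: a.zero_left)
    fix s t y z assume "\<forall>v. a s v = y \<bullet> e v" "\<forall>v. a t v = z \<bullet> e v"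
    then show "\<exists>y. \<forall>v. a (s + t) v = y \<bullet> e v"
      by (intro exI[of _ "y + z"]) (simp add: a.add_left inner_add_left)
  next
    fix c s y assume "\<forall>v. a s v = y \<bullet> e v"
    then show "\<exists>y. \<forall>v. a (c *\<^sub>R s) v = y \<bullet> e v"
      by (intro exI[of _ "c *\<^sub>R y"]) (simp add: a.scaleR_left)
  qed
  have limS: "(\<lambda>n. g n (e v)) \<longlonglongrightarrow> v" if vS: "v \<in> S" for v
  proof -
    obtain y where y: "\<And>z. a v z = y \<bullet> e z" using vS unfolding S_def by blast
    have "(\<lambda>n. y \<bullet> (e v - e (g n (e v))) / \<alpha>) \<longlonglongrightarrow> y \<bullet> (e v - e v) / \<alpha>"
      by (intro tendsto_intros eg) (use \<alpha> in auto)
    then have lim0: "(\<lambda>n. sqrt (y \<bullet> (e v - e (g n (e v))) / \<alpha>)) \<longlonglongrightarrow> 0"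
      using tendsto_real_sqrt by fastforce
    have "norm (g n (e v) - v) \<le> sqrt (y \<bullet> (e v - e (g n (e v))) / \<alpha>)" for n
      using coer[of "g n (e v) - v"] le_d[of n v] \<alpha>
      by (intro real_le_rsqrt) (simp add: y blinfun.diff_right field_simps)
    from this lim0 have "(\<lambda>n. g n (e v) - v) \<longlonglongrightarrow> 0"
      by (rule Lim_null_comparison[OF always_eventually[OF allI]])
    then show ?thesis by (rule LIM_zero_cancel)
  qed
  \<comment> \<open>Density of the domain: let \<open>w\<close> be the \<open>a\<close>-orthogonal
    projection of \<open>v\<close> onto \<open>closure S\<close>. Every \<open>y\<close> in
    \<open>H\<close> is represented by some \<open>s\<close> in \<open>S\<close>, so
    \<open>e (v - w)\<close> is orthogonal to all of \<open>H\<close>, and injectivity of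
    \<open>e\<close> gives \<open>v = w\<close>.\<close>
  have "v \<in> closure S" for v
  proof -
    obtain w where w: "w \<in> closure S" "\<And>r. r \<in> closure S \<Longrightarrow> a w r = a v r"
      using coercive_form_represents[OF a sym \<alpha> coer subspace_closure[OF subS] closed_closure
          a.bounded_linear_right] by metis
    have "y \<bullet> e (v - w) = 0" for y
    proof -
      obtain s where s: "\<And>z. a s z = y \<bullet> e z"
        using coercive_form_represents[OF a sym \<alpha> coer subspace_UNIV closed_UNIV bl[of y]]
        by (metis UNIV_I)
      then have "s \<in> closure S" using closure_subset[of S] by (auto simp: S_def)
      then have "a s (v - w) = 0" using w(2)[of s] sym by (simp add: a.diff_right)
      then show ?thesis by (simp add: s)
    qed
    then have "e (v - w) = e 0" by (metis blinfun.zero_right inner_eq_zero_iff)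
    then have "v = w" using inj by (metis injD right_minus_eq)
    then show ?thesis using w by simp
  qed
  then have lim: "(\<lambda>n. G n (e v)) \<longlonglongrightarrow> v" for v
    by (rule tendsto_of_dense) (use limS bd in \<open>auto simp: G[symmetric] blinfun.diff_right\<close>)
  have "x \<in> closure (range (blinfun_apply e))" for x using dense by simp
  then have "(\<lambda>n. e (G n x)) \<longlonglongrightarrow> x" for x
    by (rule tendsto_of_dense[where K = 1]) (use eg c in \<open>auto simp: G[symmetric] blinfun.diff_right\<close>)
  then show ?thesis using s c K0 bd lim by (intro that[of G K])
qed

section \<open>Square integrable functions\<close>

text \<open>Separability of the value space is part of the type. Processes in \<open>V\<close>,
  which need not be separable, are therefore treated through their norms or their images in
  \<open>H\<close>.\<close>

definition square_integrable :: "'a measure \<Rightarrow> ('a \<Rightarrow> 'b::{banach, second_countable_topology}) \<Rightarrow> bool" where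
  "square_integrable M f \<longleftrightarrow> f \<in> borel_measurable M \<and> integrable M (\<lambda>x. (norm (f x))\<^sup>2)"

lemma square_integrable_measurable[measurable_dest]: "square_integrable M f \<Longrightarrow> f \<in> borel_measurable M"
  by (simp add: square_integrable_def)

lemma square_integrable_norm: "square_integrable M f \<Longrightarrow> square_integrable M (\<lambda>x. norm (f x))"
  by (auto simp: square_integrable_def)

lemma square_integrableI_bound:
  fixes f :: "'a \<Rightarrow> 'b::{banach, second_countable_topology}" and g :: "'a \<Rightarrow> 'c::{banach, second_countable_topology}"
  assumes "square_integrable M g" "f \<in> borel_measurable M" "AE x in M. norm (f x) \<le> norm (g x)"
  shows "square_integrable M f"
  unfolding square_integrable_def
proof
  show "integrable M (\<lambda>x. (norm (f x))\<^sup>2)"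
  proof (rule Bochner_Integration.integrable_bound)
    show "integrable M (\<lambda>x. (norm (g x))\<^sup>2)" using assms(1) by (simp add: square_integrable_def)
    show "(\<lambda>x. (norm (f x))\<^sup>2) \<in> borel_measurable M" using assms(2) by measurable
    show "AE x in M. norm ((norm (f x))\<^sup>2) \<le> norm ((norm (g x))\<^sup>2)"
      using assms(3) by eventually_elim (simp add: power_mono)
  qed
qed fact

lemma square_integrable_scaleR: "square_integrable M f \<Longrightarrow> square_integrable M (\<lambda>x. c *\<^sub>R f x)"
  by (auto simp: square_integrable_def power_mult_distrib)

lemma square_integrable_mult_const: "square_integrable M f \<Longrightarrow> square_integrable M (\<lambda>x. c * f x :: real)"
  using square_integrable_scaleR[of M f c] by simp

lemma square_integrable_add:
  assumes "square_integrable M f" "square_integrable M g"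
  shows "square_integrable M (\<lambda>x. f x + g x)"
  unfolding square_integrable_def
proof
  show "(\<lambda>x. f x + g x) \<in> borel_measurable M" using assms by measurable
  have "(norm (f x + g x))\<^sup>2 \<le> 2 * (norm (f x))\<^sup>2 + 2 * (norm (g x))\<^sup>2" for x
  proof -
    have "(norm (f x + g x))\<^sup>2 \<le> (norm (f x) + norm (g x))\<^sup>2"
      by (intro power_mono norm_triangle_ineq) simp
    also have "\<dots> \<le> 2 * (norm (f x))\<^sup>2 + 2 * (norm (g x))\<^sup>2"
      using sum_squares_bound[of "norm (f x)" "norm (g x)"] by (simp add: power2_sum)
    finally show ?thesis .
  qed
  then have le: "AE x in M. norm ((norm (f x + g x))\<^sup>2) \<le> norm (2 * (norm (f x))\<^sup>2 + 2 * (norm (g x))\<^sup>2)"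
    by simp
  have "integrable M (\<lambda>x. 2 * (norm (f x))\<^sup>2 + 2 * (norm (g x))\<^sup>2)"
    using assms by (simp add: square_integrable_def)
  moreover have "(\<lambda>x. (norm (f x + g x))\<^sup>2) \<in> borel_measurable M" using assms by measurable
  ultimately show "integrable M (\<lambda>x. (norm (f x + g x))\<^sup>2)"
    using le by (rule Bochner_Integration.integrable_bound)
qed

lemma square_integrable_diff:
  assumes "square_integrable M f" "square_integrable M g"
  shows "square_integrable M (\<lambda>x. f x - g x)"
  using square_integrable_add[OF assms(1) square_integrable_scaleR[OF assms(2), of "-1"]] by simp

lemma square_integrable_sum:
  "(\<And>i. i \<in> I \<Longrightarrow> square_integrable M (f i)) \<Longrightarrow> square_integrable M (\<lambda>x. \<Sum>i\<in>I. f i x)"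
proof (induction I rule: infinite_finite_induct)
  case (insert i I)
  then show ?case using square_integrable_add[of M "f i" "\<lambda>x. \<Sum>i\<in>I. f i x"] by simp
qed (simp_all add: square_integrable_def)

lemma square_integrable_bounded_linear:
  assumes "bounded_linear L" "square_integrable M f"
  shows "square_integrable M (\<lambda>x. L (f x))"
proof -
  obtain K where K: "\<And>x. norm (L x) \<le> norm x * K" "K > 0"
    using bounded_linear.pos_bounded[OF assms(1)] by blast
  have [measurable]: "L \<in> borel_measurable borel"
    using assms(1) by (intro borel_measurable_continuous_onI linear_continuous_on)
  show ?thesis
  proof (rule square_integrableI_bound[OF square_integrable_scaleR[OF assms(2), of K]])
    show "(\<lambda>x. L (f x)) \<in> borel_measurable M" using assms(2) by measurable
    show "AE x in M. norm (L (f x)) \<le> norm (K *\<^sub>R f x)" using K by (simp add: mult.commute)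
  qed
qed

lemma square_integrable_inner_integrable:
  fixes f g :: "'a \<Rightarrow> 'b::{real_inner, banach, second_countable_topology}"
  assumes "square_integrable M f" "square_integrable M g"
  shows "integrable M (\<lambda>x. f x \<bullet> g x)"
proof (rule Bochner_Integration.integrable_bound[of M "\<lambda>x. (norm (f x))\<^sup>2 + (norm (g x))\<^sup>2"])
  show "(\<lambda>x. f x \<bullet> g x) \<in> borel_measurable M" using assms by measurable
  have "\<bar>f x \<bullet> g x\<bar> \<le> (norm (f x))\<^sup>2 + (norm (g x))\<^sup>2" for x
  proof -
    have "0 \<le> norm (f x) * norm (g x)" by simp
    moreover have "2 * (norm (f x) * norm (g x)) \<le> (norm (f x))\<^sup>2 + (norm (g x))\<^sup>2"
      using sum_squares_bound[of "norm (f x)" "norm (g x)"] by (simp add: mult.assoc)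
    ultimately show ?thesis using Cauchy_Schwarz_ineq2[of "f x" "g x"] by linarith
  qed
  then show "AE x in M. norm (f x \<bullet> g x) \<le> norm ((norm (f x))\<^sup>2 + (norm (g x))\<^sup>2)" by simp
qed (use assms in \<open>auto simp: square_integrable_def\<close>)

lemma square_integrable_mult_integrable:
  fixes f g :: "'a \<Rightarrow> real"
  shows "square_integrable M f \<Longrightarrow> square_integrable M g \<Longrightarrow> integrable M (\<lambda>x. f x * g x)"
  using square_integrable_inner_integrable[of M f g] by simp

lemma square_integrable_const: "finite_measure M \<Longrightarrow> square_integrable M (\<lambda>_. c)"
  by (simp add: square_integrable_def finite_measure.integrable_const)

lemma square_integrable_integrable:
  assumes "finite_measure M" "square_integrable M f" shows "integrable M f"
proof -
  have "integrable M (\<lambda>x. norm (f x) * 1)"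
    using assms by (intro square_integrable_mult_integrable square_integrable_norm square_integrable_const) 
  then have "integrable M (\<lambda>x. norm (f x))" by simp
  then show ?thesis by (rule integrable_norm_cancel) (use assms(2) in \<open>simp add: square_integrable_def\<close>)
qed

lemma square_integrable_cong_AE:
  assumes "square_integrable M f" "g \<in> borel_measurable M" "AE x in M. f x = g x"
  shows "square_integrable M g"
  using assms(1,2) by (rule square_integrableI_bound) (use assms(3) in auto)

lemma square_integrable_nn:
  "square_integrable M f \<longleftrightarrow> f \<in> borel_measurable M \<and> (\<integral>\<^sup>+x. ennreal ((norm (f x))\<^sup>2) \<partial>M) < \<infinity>"
  by (auto simp: square_integrable_def integrable_iff_bounded)

text \<open>The integral of \<open>(f - t * g)\<^sup>2\<close> is nonnegative at the minimising
  \<open>t = C / B\<close>; in the degenerate case \<open>B = 0\<close> the function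
  \<open>g\<close> vanishes almost everywhere.\<close>

lemma integral_Cauchy_Schwarz:
  fixes f g :: "'a \<Rightarrow> real"
  assumes f: "square_integrable M f" and g: "square_integrable M g"
  shows "(\<integral>x. f x * g x \<partial>M)\<^sup>2 \<le> (\<integral>x. (f x)\<^sup>2 \<partial>M) * (\<integral>x. (g x)\<^sup>2 \<partial>M)"
proof -
  define A B C where "A = (\<integral>x. (f x)\<^sup>2 \<partial>M)" and "B = (\<integral>x. (g x)\<^sup>2 \<partial>M)" and "C = (\<integral>x. f x * g x \<partial>M)"
  have i: "integrable M (\<lambda>x. (f x)\<^sup>2)" "integrable M (\<lambda>x. (g x)\<^sup>2)" "integrable M (\<lambda>x. f x * g x)"
    using f g square_integrable_mult_integrable[OF f g] by (auto simp: square_integrable_def)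
  have q: "0 \<le> A - 2 * t * C + t\<^sup>2 * B" for t
  proof -
    have "0 \<le> (\<integral>x. (f x - t * g x)\<^sup>2 \<partial>M)" by simp
    also have "\<dots> = (\<integral>x. (f x)\<^sup>2 - 2 * t * (f x * g x) + t\<^sup>2 * (g x)\<^sup>2 \<partial>M)"
      by (simp add: power2_diff power_mult_distrib algebra_simps)
    also have "\<dots> = A - 2 * t * C + t\<^sup>2 * B" using i by (simp add: A_def B_def C_def)
    finally show ?thesis .
  qed
  have B: "B \<ge> 0" by (simp add: B_def)
  show ?thesis
  proof (cases "B = 0")
    case True
    then have "AE x in M. g x = 0" using i(2) by (simp add: B_def integral_nonneg_eq_0_iff_AE)
    then have "C = (\<integral>x. 0 \<partial>M)" unfolding C_def using f g by (intro integral_cong_AE) auto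
    then show ?thesis unfolding A_def[symmetric] B_def[symmetric] C_def[symmetric] using B True by simp
  next
    case False
    with B have "B > 0" by simp
    then show ?thesis using q[of "C / B"]
      unfolding A_def[symmetric] B_def[symmetric] C_def[symmetric]
      by (simp add: power2_eq_square field_simps)
  qed
qed

lemma tendsto_zero_dominated:
  fixes f :: "nat \<Rightarrow> real"
  assumes "g \<longlonglongrightarrow> 0" "\<And>k. \<bar>f k\<bar> \<le> g k"
  shows "f \<longlonglongrightarrow> 0"
  using assms(1) by (rule Lim_null_comparison[OF always_eventually, rotated]) (use assms(2) in simp)

definition L2_tendsto :: "'a measure \<Rightarrow> (nat \<Rightarrow> 'a \<Rightarrow> real) \<Rightarrow> ('a \<Rightarrow> real) \<Rightarrow> bool" where
  "L2_tendsto M F f \<longleftrightarrow> (\<forall>k. square_integrable M (F k)) \<and> square_integrable M f \<and>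
     (\<lambda>k. \<integral>x. (F k x - f x)\<^sup>2 \<partial>M) \<longlonglongrightarrow> 0"

text \<open>The extended-real distance is below 1 for some \<open>k\<close>, so \<open>f\<close>
  differs from that \<open>F k\<close> by a square integrable function and inherits its
  integrability. This is the bridge from the extended-real integrals in the notion of the Ito
  integral to Bochner integrals.\<close>

lemma L2_tendstoI_nn:
  fixes f :: "'a \<Rightarrow> real"
  assumes F: "\<And>k. square_integrable M (F k)" and f: "f \<in> borel_measurable M"
    and lim: "(\<lambda>k. \<integral>\<^sup>+x. ennreal ((F k x - f x)\<^sup>2) \<partial>M) \<longlonglongrightarrow> 0"
  shows "L2_tendsto M F f"
proof -
  have "\<exists>k. (\<integral>\<^sup>+x. ennreal ((F k x - f x)\<^sup>2) \<partial>M) < 1"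
    using order_tendstoD(2)[OF lim, of 1] by (auto simp: eventually_sequentially)
  then obtain k where k: "(\<integral>\<^sup>+x. ennreal ((F k x - f x)\<^sup>2) \<partial>M) < 1" by blast
  have "square_integrable M (\<lambda>x. F k x - f x)"
    using F[of k] f k order_less_trans[OF k, of \<infinity>] by (auto simp: square_integrable_nn)
  from square_integrable_diff[OF F[of k] this] have sf: "square_integrable M f" by simp
  have "(\<integral>\<^sup>+x. ennreal ((F k x - f x)\<^sup>2) \<partial>M) = ennreal (\<integral>x. (F k x - f x)\<^sup>2 \<partial>M)" for k
    using square_integrable_diff[OF F[of k] sf]
    by (intro nn_integral_eq_integral) (auto simp: square_integrable_def)
  with lim have "(\<lambda>k. ennreal (\<integral>x. (F k x - f x)\<^sup>2 \<partial>M)) \<longlonglongrightarrow> ennreal 0" by simp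
  then have "(\<lambda>k. \<integral>x. (F k x - f x)\<^sup>2 \<partial>M) \<longlonglongrightarrow> 0"
    by (subst (asm) tendsto_ennreal_iff) auto
  with F sf show ?thesis by (simp add: L2_tendsto_def)
qed

text \<open>The limit passages from simple integrands to general ones rest on this continuity of the
  inner product.\<close>

lemma L2_tendsto_inner:
  assumes F: "L2_tendsto M F f" and G: "L2_tendsto M G g"
  shows "(\<lambda>k. \<integral>x. F k x * G k x \<partial>M) \<longlonglongrightarrow> (\<integral>x. f x * g x \<partial>M)"
proof -
  define a where "a k = (\<integral>x. (F k x - f x)\<^sup>2 \<partial>M)" for k
  define b where "b k = (\<integral>x. (G k x - g x)\<^sup>2 \<partial>M)" for k
  have sq: "square_integrable M (F k)" "square_integrable M f" "square_integrable M (G k)" "square_integrable M g"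
      "square_integrable M (\<lambda>x. F k x - f x)" "square_integrable M (\<lambda>x. G k x - g x)" for k
    using F G by (auto simp: L2_tendsto_def intro: square_integrable_diff)
  have lim: "a \<longlonglongrightarrow> 0" "b \<longlonglongrightarrow> 0" using F G unfolding L2_tendsto_def a_def b_def by blast+
  have z: "(\<lambda>k. \<integral>x. u k x * v k x \<partial>M) \<longlonglongrightarrow> 0"
    if "\<And>k. square_integrable M (u k)" "\<And>k. square_integrable M (v k)"
      and "(\<lambda>k. (\<integral>x. (u k x)\<^sup>2 \<partial>M) * (\<integral>x. (v k x)\<^sup>2 \<partial>M)) \<longlonglongrightarrow> 0" for u v :: "nat \<Rightarrow> 'a \<Rightarrow> real"
  proof -
    have "(\<lambda>k. sqrt ((\<integral>x. (u k x)\<^sup>2 \<partial>M) * (\<integral>x. (v k x)\<^sup>2 \<partial>M))) \<longlonglongrightarrow> 0"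
      using tendsto_real_sqrt[OF that(3)] by simp
    moreover have "\<bar>\<integral>x. u k x * v k x \<partial>M\<bar> \<le> sqrt ((\<integral>x. (u k x)\<^sup>2 \<partial>M) * (\<integral>x. (v k x)\<^sup>2 \<partial>M))" for k
      using integral_Cauchy_Schwarz[OF that(1,2), of k k] by (intro real_le_rsqrt) simp
    ultimately show ?thesis by (rule tendsto_zero_dominated)
  qed
  have "(\<lambda>k. \<integral>x. (F k x - f x) * (G k x - g x) \<partial>M) \<longlonglongrightarrow> 0"
    using tendsto_mult[OF lim] unfolding a_def b_def by (intro z sq) simp
  moreover have "(\<lambda>k. \<integral>x. (F k x - f x) * g x \<partial>M) \<longlonglongrightarrow> 0"
    using tendsto_mult_right[OF lim(1), of "\<integral>x. (g x)\<^sup>2 \<partial>M"] unfolding a_def by (intro z sq) simp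
  moreover have "(\<lambda>k. \<integral>x. f x * (G k x - g x) \<partial>M) \<longlonglongrightarrow> 0"
    using tendsto_mult_left[OF lim(2), of "\<integral>x. (f x)\<^sup>2 \<partial>M"] unfolding b_def by (intro z sq) simp
  ultimately have "(\<lambda>k. (\<integral>x. (F k x - f x) * (G k x - g x) \<partial>M) + (\<integral>x. (F k x - f x) * g x \<partial>M)
      + (\<integral>x. f x * (G k x - g x) \<partial>M) + (\<integral>x. f x * g x \<partial>M)) \<longlonglongrightarrow> 0 + 0 + 0 + (\<integral>x. f x * g x \<partial>M)"
    by (intro tendsto_add tendsto_const)
  moreover have "(\<integral>x. (F k x - f x) * (G k x - g x) \<partial>M) + (\<integral>x. (F k x - f x) * g x \<partial>M)
      + (\<integral>x. f x * (G k x - g x) \<partial>M) + (\<integral>x. f x * g x \<partial>M) = (\<integral>x. F k x * G k x \<partial>M)" for k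
  proof -
    have i: "integrable M (\<lambda>x. (F k x - f x) * (G k x - g x))" "integrable M (\<lambda>x. (F k x - f x) * g x)"
      "integrable M (\<lambda>x. f x * (G k x - g x))" "integrable M (\<lambda>x. f x * g x)"
      by (intro square_integrable_mult_integrable sq)+
    have "(\<integral>x. F k x * G k x \<partial>M) = (\<integral>x. (F k x - f x) * (G k x - g x) + (F k x - f x) * g x
        + f x * (G k x - g x) + f x * g x \<partial>M)" by (simp add: algebra_simps)
    also have "\<dots> = (\<integral>x. (F k x - f x) * (G k x - g x) \<partial>M) + (\<integral>x. (F k x - f x) * g x \<partial>M)
      + (\<integral>x. f x * (G k x - g x) \<partial>M) + (\<integral>x. f x * g x \<partial>M)"
      by (simp only: Bochner_Integration.integral_add Bochner_Integration.integrable_add i)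
    finally show ?thesis ..
  qed
  ultimately show ?thesis by simp
qed

lemma L2_tendsto_const: "square_integrable M f \<Longrightarrow> L2_tendsto M (\<lambda>_. f) f"
  by (simp add: L2_tendsto_def)

lemma L2_tendsto_indicator:
  assumes "L2_tendsto M F f" "A \<in> sets M"
  shows "L2_tendsto M (\<lambda>k x. indicator A x * F k x) (\<lambda>x. indicator A x * f x)"
proof -
  have s: "square_integrable M (\<lambda>x. indicator A x * h x)" if "square_integrable M h" for h :: "_ \<Rightarrow> real"
  proof (rule square_integrableI_bound[OF that])
    show "(\<lambda>x. indicator A x * h x) \<in> borel_measurable M" using that assms(2) by measurable
    show "AE x in M. norm (indicator A x * h x) \<le> norm (h x)" by (simp add: indicator_def)
  qed
  have sq: "square_integrable M (\<lambda>x. F k x - f x)" for k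
    using assms(1) by (auto simp: L2_tendsto_def intro: square_integrable_diff)
  have "(\<integral>x. (indicator A x * F k x - indicator A x * f x)\<^sup>2 \<partial>M) \<le> (\<integral>x. (F k x - f x)\<^sup>2 \<partial>M)" for k
  proof (rule integral_mono)
    show "integrable M (\<lambda>x. (F k x - f x)\<^sup>2)" using sq[of k] by (simp add: square_integrable_def)
    show "integrable M (\<lambda>x. (indicator A x * F k x - indicator A x * f x)\<^sup>2)"
      using s[OF sq[of k]] by (simp add: square_integrable_def right_diff_distrib)
  qed (simp add: indicator_def)
  then have le: "\<bar>\<integral>x. (indicator A x * F k x - indicator A x * f x)\<^sup>2 \<partial>M\<bar> \<le> (\<integral>x. (F k x - f x)\<^sup>2 \<partial>M)" for k
    by simp
  have "(\<lambda>k. \<integral>x. (F k x - f x)\<^sup>2 \<partial>M) \<longlonglongrightarrow> 0" using assms(1) by (simp add: L2_tendsto_def)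
  then have "(\<lambda>k. \<integral>x. (indicator A x * F k x - indicator A x * f x)\<^sup>2 \<partial>M) \<longlonglongrightarrow> 0"
    using le by (rule tendsto_zero_dominated)
  with s assms(1) show ?thesis by (simp add: L2_tendsto_def)
qed

section \<open>The Ito integral\<close>

locale wiener = prob_space M for M :: "'w measure" +
  fixes T :: real and W :: "real \<Rightarrow> 'w \<Rightarrow> real"
  assumes T_pos: "0 < T" and complete: "complete_measure M" and bm: "brownian_motion M T W"
begin

section \<open>The augmented filtration and the independence of increments\<close>

abbreviation F :: "real \<Rightarrow> 'w measure" where "F \<equiv> bm_filtration M W"

lemma W_measurable: "0 \<le> t \<Longrightarrow> t \<le> T \<Longrightarrow> W t \<in> borel_measurable M"
  using bm by (simp add: brownian_motion_def)

lemma space_F [simp]: "space (F t) = space M"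
  by (simp add: bm_filtration_def space_measure_of_conv)

lemma sets_F: "sets (F t) = sigma_sets (space M)
    ({W s -` B \<inter> space M | s B. s \<in> {0..t} \<and> B \<in> sets borel} \<union> null_sets M)"
  unfolding bm_filtration_def by (rule sets_measure_of) (auto dest!: null_setsD2 dest: sets.sets_into_space)

lemma sets_F_subset: "t \<le> T \<Longrightarrow> sets (F t) \<subseteq> sets M"
  unfolding sets_F using W_measurable by (intro sets.sigma_sets_subset) (auto intro: measurable_sets)

lemma sets_F_mono: "s \<le> t \<Longrightarrow> sets (F s) \<subseteq> sets (F t)"
  unfolding sets_F by (rule sigma_sets_mono') fastforce

lemma measurable_F_mono: "f \<in> borel_measurable (F s) \<Longrightarrow> s \<le> t \<Longrightarrow> f \<in> borel_measurable (F t)"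
  using sets_F_mono[of s t] by (auto simp: measurable_def)

lemma measurable_F_M: "f \<in> borel_measurable (F s) \<Longrightarrow> s \<le> T \<Longrightarrow> f \<in> borel_measurable M"
  using sets_F_subset[of s] by (auto simp: measurable_def)

lemma W_adapted: "0 \<le> s \<Longrightarrow> s \<le> t \<Longrightarrow> W s \<in> borel_measurable (F t)"
  by (rule measurableI) (auto simp: sets_F intro!: sigma_sets.Basic)

text \<open>Independence is given for increments along ordered times, while the past at
  \<open>a\<close> is described by values of \<open>W\<close>. Sorting the times in \<open>S\<close>
  turns these values into partial sums of increments, so a cylinder event depends on the increments
  before \<open>a\<close>, and \<open>W b - W a\<close> is the last increment of the same
  partition.\<close>

lemma cylinder_indep:
  assumes ab: "0 \<le> a" "a < b" "b \<le> T" and S: "finite S" "S \<subseteq> {0..a}"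
    and B: "\<And>s. s \<in> S \<Longrightarrow> B s \<in> sets (borel :: real measure)" and D: "D \<in> sets (borel :: real measure)"
  shows "prob ({\<omega>\<in>space M. \<forall>s\<in>S. W s \<omega> \<in> B s} \<inter> ((\<lambda>\<omega>. W b \<omega> - W a \<omega>) -` D \<inter> space M)) =
    prob {\<omega>\<in>space M. \<forall>s\<in>S. W s \<omega> \<in> B s} * prob ((\<lambda>\<omega>. W b \<omega> - W a \<omega>) -` D \<inter> space M)"
proof -
  define xs where "xs = sorted_list_of_set S"
  define n where "n = length xs"
  have xs: "set xs = S" "sorted xs" using S by (auto simp: xs_def)
  \<comment> \<open>The partition consists of 0, the \<open>n\<close> times in \<open>xs\<close>,
    then \<open>a\<close> and \<open>b\<close>. Time number \<open>i\<close> is the entry of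
    \<open>xs\<close> with index \<open>i - 1\<close>, and the increment with index
    \<open>Suc n\<close> runs from \<open>a\<close> to \<open>b\<close>.\<close>
  define \<tau> where "\<tau> i = (if i = 0 then 0 else if i \<le> n then xs ! (i - 1) else if i = Suc n then a else b)" for i
  have \<tau>S: "xs ! i \<in> {0..a}" if "i < n" for i using that xs S(2) by (metis n_def nth_mem subsetD)
  have \<tau>0: "\<tau> 0 = 0" and \<tau>n: "\<tau> (Suc n) = a" "\<tau> (Suc (Suc n)) = b" by (auto simp: \<tau>_def)
  have mono: "\<tau> i \<le> \<tau> (Suc i)" if "i < Suc (Suc n)" for i
  proof -
    consider "i = 0" | "0 < i" "i < n" | "0 < i" "i = n" | "i = Suc n" using \<open>i < Suc (Suc n)\<close> by linarith
    then show ?thesis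
    proof cases
      case 1
      then show ?thesis using \<tau>S[of 0] ab by (cases "n = 0") (simp_all add: \<tau>_def)
    next
      case 2
      then show ?thesis using sorted_nth_mono[OF xs(2), of "i - 1" i] by (simp add: \<tau>_def n_def)
    next
      case 3
      then show ?thesis using \<tau>S[of "n - 1"] by (simp add: \<tau>_def)
    next
      case 4
      then show ?thesis using ab by (simp add: \<tau>_def)
    qed
  qed
  have indep: "indep_vars (\<lambda>_. borel) (\<lambda>i \<omega>. W (\<tau> (Suc i)) \<omega> - W (\<tau> i) \<omega>) {..<Suc (Suc n)}"
  proof -
    have "\<forall>(n::nat) \<tau>. 0 \<le> \<tau> 0 \<longrightarrow> (\<forall>i<n. \<tau> i \<le> \<tau> (Suc i)) \<longrightarrow> \<tau> n \<le> T \<longrightarrow>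
        indep_vars (\<lambda>_. borel) (\<lambda>i \<omega>. W (\<tau> (Suc i)) \<omega> - W (\<tau> i) \<omega>) {..<n}"
      using bm unfolding brownian_motion_def by blast
    from this[rule_format, of \<tau> "Suc (Suc n)"] show ?thesis using mono \<tau>0 \<tau>n ab by simp
  qed
  let ?X = "\<lambda>i \<omega>. W (\<tau> (Suc i)) \<omega> - W (\<tau> i) \<omega>"
  have iv: "indep_var (PiM {..<Suc n} (\<lambda>_. borel)) (\<lambda>\<omega>. restrict (\<lambda>i. ?X i \<omega>) {..<Suc n})
      (PiM {Suc n} (\<lambda>_. borel)) (\<lambda>\<omega>. restrict (\<lambda>i. ?X i \<omega>) {Suc n})"
    by (rule indep_var_restrict[OF indep]) auto
  \<comment> \<open>The cylinder event in terms of increments: if \<open>W\<close> starts at 0, the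
    first \<open>j + 1\<close> of them add up to the value of \<open>W\<close> at
    \<open>xs ! j\<close>.\<close>
  define E where "E = {x\<in>space (PiM {..<Suc n} (\<lambda>_. borel :: real measure)). \<forall>j<n. (\<Sum>i<Suc j. x i) \<in> B (xs ! j)}"
  have Bj[measurable]: "j < n \<Longrightarrow> B (xs ! j) \<in> sets borel" for j using B xs by (metis n_def nth_mem)
  have m: "(\<lambda>x. \<Sum>i<Suc j. x i) \<in> borel_measurable (PiM {..<Suc n} (\<lambda>_. borel :: real measure))" if "j < n" for j
    using that by (intro borel_measurable_sum measurable_component_singleton) auto
  have "{x\<in>space (PiM {..<Suc n} (\<lambda>_. borel :: real measure)). \<forall>j\<in>{..<n}. (\<Sum>i<Suc j. x i) \<in> B (xs ! j)}
      \<in> sets (PiM {..<Suc n} (\<lambda>_. borel))"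
  proof (rule sets.sets_Collect_finite_All)
    fix j assume "j \<in> {..<n}"
    then have "j < n" by simp
    from measurable_sets[OF m[OF this] Bj[OF this]]
    show "{x\<in>space (PiM {..<Suc n} (\<lambda>_. borel :: real measure)). (\<Sum>i<Suc j. x i) \<in> B (xs ! j)}
      \<in> sets (PiM {..<Suc n} (\<lambda>_. borel))" by (simp add: vimage_def Int_def conj_commute)
  qed simp
  then have E: "E \<in> sets (PiM {..<Suc n} (\<lambda>_. borel :: real measure))" by (simp add: E_def Ball_def)
  define E' where "E' = (\<lambda>x. x (Suc n)) -` D \<inter> space (PiM {Suc n} (\<lambda>_. borel :: real measure))"
  have E': "E' \<in> sets (PiM {Suc n} (\<lambda>_. borel :: real measure))"
    unfolding E'_def using D by (intro measurable_sets[OF measurable_component_singleton]) auto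
  let ?R = "\<lambda>\<omega>. restrict (\<lambda>i. ?X i \<omega>) {..<Suc n}" and ?R' = "\<lambda>\<omega>. restrict (\<lambda>i. ?X i \<omega>) {Suc n}"
  let ?C = "{\<omega>\<in>space M. \<forall>s\<in>S. W s \<omega> \<in> B s}" and ?D = "(\<lambda>\<omega>. W b \<omega> - W a \<omega>) -` D \<inter> space M"
  have Ws: "W s \<in> borel_measurable M" if "s \<in> S" for s using that S(2) ab by (intro W_measurable) auto
  have Wab: "W a \<in> borel_measurable M" "W b \<in> borel_measurable M" using ab by (auto intro: W_measurable)
  have C: "?C \<in> sets M"
    using S(1) Ws B by (intro sets.sets_Collect_finite_All) (auto intro: measurable_sets_Collect simp: pred_def)
  have D': "?D \<in> sets M" using Wab D by (intro measurable_sets[of _ M borel]) auto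
  have D_eq: "?R' -` E' \<inter> space M = ?D" by (auto simp: E'_def \<tau>n space_PiM)
  have R: "?R \<in> measurable M (PiM {..<Suc n} (\<lambda>_. borel))"
    using iv by (rule indep_var_rv1)
  have RE: "?R -` E \<inter> space M \<in> sets M" using R E by (rule measurable_sets)
  \<comment> \<open>\<open>W\<close> starts at zero only almost surely, so the two descriptions of
    the cylinder event agree only up to a null set.\<close>
  have "AE \<omega> in M. W 0 \<omega> = 0" using bm by (simp add: brownian_motion_def)
  then have C_eq: "AE \<omega> in M. \<omega> \<in> ?C \<longleftrightarrow> \<omega> \<in> ?R -` E \<inter> space M"
  proof (eventually_elim, intro iffI)
    fix \<omega> assume W0: "W 0 \<omega> = 0"
    have tele: "(\<Sum>i<Suc j. ?X i \<omega>) = W (xs ! j) \<omega>" if "j < n" for j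
    proof -
      have "(\<Sum>i<Suc j. ?X i \<omega>) = W (\<tau> (Suc j)) \<omega> - W (\<tau> 0) \<omega>"
        using sum_lessThan_telescope[of "\<lambda>i. W (\<tau> i) \<omega>" "Suc j"] by simp
      then show ?thesis using that W0 by (simp add: \<tau>_def)
    qed
    have "(\<forall>s\<in>S. W s \<omega> \<in> B s) \<longleftrightarrow> (\<forall>j<n. W (xs ! j) \<omega> \<in> B (xs ! j))"
      unfolding xs(1)[symmetric] n_def by (metis in_set_conv_nth)
    moreover have "(\<Sum>i<Suc j. ?R \<omega> i) = W (xs ! j) \<omega>" if "j < n" for j
      using that by (subst tele[symmetric]) (auto intro!: sum.cong)
    then have "?R \<omega> \<in> E \<longleftrightarrow> (\<forall>j<n. W (xs ! j) \<omega> \<in> B (xs ! j))"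
      unfolding E_def by (auto simp: space_PiM simp del: sum.lessThan_Suc)
    ultimately show "\<omega> \<in> ?C \<Longrightarrow> \<omega> \<in> ?R -` E \<inter> space M" "\<omega> \<in> ?R -` E \<inter> space M \<Longrightarrow> \<omega> \<in> ?C"
      by auto
  qed
  have "prob (?C \<inter> ?D) = prob ((?R -` E \<inter> space M) \<inter> ?D)"
    using C_eq C D' RE by (intro finite_measure_eq_AE) auto
  also have "\<dots> = prob ((\<lambda>\<omega>. (?R \<omega>, ?R' \<omega>)) -` (E \<times> E') \<inter> space M)"
    by (subst D_eq[symmetric]) (auto intro!: arg_cong[where f = prob])
  also have "\<dots> = prob (?R -` E \<inter> space M) * prob ?D"
    using indep_varD[OF iv E E'] unfolding D_eq .
  also have "prob (?R -` E \<inter> space M) = prob ?C"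
    using C_eq C RE by (intro finite_measure_eq_AE) auto
  finally show ?thesis .
qed

text \<open>The events that agree almost everywhere with a cylinder are stable under intersection
  and generate a sigma-algebra containing \<open>F a\<close>; working up to null sets is what brings
  the augmentation under the same generator. Independence then extends from the generators.\<close>

lemma indep_increment:
  assumes ab: "0 \<le> a" "a < b" "b \<le> T" and Z: "Z \<in> borel_measurable (F a)"
  shows "indep_var borel Z borel (\<lambda>\<omega>. W b \<omega> - W a \<omega>)"
proof -
  let ?D = "\<lambda>\<omega>. W b \<omega> - W a \<omega>"
  define \<D> where "\<D> = {?D -` D \<inter> space M | D. D \<in> sets borel}"
  define cyl where "cyl A S B \<longleftrightarrow> A \<in> sets M \<and> finite S \<and> S \<subseteq> {0..a} \<and> (\<forall>s\<in>S. B s \<in> sets borel) \<and>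
    (AE \<omega> in M. \<omega> \<in> A \<longleftrightarrow> (\<forall>s\<in>S. W s \<omega> \<in> B s))" for A S and B :: "real \<Rightarrow> real set"
  define \<C> where "\<C> = {A. \<exists>S B. cyl A S B}"
  have Wab: "W a \<in> borel_measurable M" "W b \<in> borel_measurable M" using ab by (auto intro: W_measurable)
  then have D[measurable]: "?D \<in> borel_measurable M" by measurable
  have \<D>: "\<D> \<subseteq> sets M" using D by (auto simp: \<D>_def intro: measurable_sets)
  have "indep_set \<C> \<D>"
  proof (rule indep_setI)
    fix A d assume "A \<in> \<C>" "d \<in> \<D>"
    then obtain S B E where SB: "cyl A S B"
      and E: "E \<in> sets borel" "d = ?D -` E \<inter> space M" unfolding \<C>_def \<D>_def by blast
    from SB have S: "finite S" "S \<subseteq> {0..a}" "\<And>s. s\<in>S \<Longrightarrow> B s \<in> sets borel"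
      and A: "A \<in> sets M" "AE \<omega> in M. \<omega> \<in> A \<longleftrightarrow> (\<forall>s\<in>S. W s \<omega> \<in> B s)" by (simp_all add: cyl_def)
    let ?C = "{\<omega>\<in>space M. \<forall>s\<in>S. W s \<omega> \<in> B s}"
    have Ws: "W s \<in> borel_measurable M" if "s \<in> S" for s using that S(2) ab by (intro W_measurable) auto
    have C: "?C \<in> sets M"
      using S Ws by (intro sets.sets_Collect_finite_All) (auto intro: measurable_sets_Collect simp: pred_def)
    have d: "d \<in> sets M" using E D by (auto intro: measurable_sets)
    have AC: "AE \<omega> in M. \<omega> \<in> A \<longleftrightarrow> \<omega> \<in> ?C" using A(2) AE_space by eventually_elim auto
    have "prob (A \<inter> d) = prob (?C \<inter> d)" using AC A(1) C d by (intro finite_measure_eq_AE) auto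
    also have "\<dots> = prob ?C * prob d" unfolding E(2) by (rule cylinder_indep[OF ab S E(1)])
    also have "prob ?C = prob A" using AC A(1) C by (intro finite_measure_eq_AE) auto
    finally show "prob (A \<inter> d) = prob A * prob d" .
  qed (use \<D> in \<open>auto simp: \<C>_def cyl_def\<close>)
  moreover have "Int_stable \<C>"
  proof (rule Int_stableI)
    fix A A' assume "A \<in> \<C>" "A' \<in> \<C>"
    then obtain S B S' B' where c: "cyl A S B" "cyl A' S' B'" unfolding \<C>_def by blast
    \<comment> \<open>Padding with \<open>UNIV\<close> lets both cylinders refer to the union of
      their times.\<close>
    let ?B = "\<lambda>s. (if s \<in> S then B s else UNIV) \<inter> (if s \<in> S' then B' s else UNIV)"
    have "AE \<omega> in M. \<omega> \<in> A \<inter> A' \<longleftrightarrow> (\<forall>s\<in>S \<union> S'. W s \<omega> \<in> ?B s)"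
    proof -
      have "AE \<omega> in M. \<omega> \<in> A \<longleftrightarrow> (\<forall>s\<in>S. W s \<omega> \<in> B s)" "AE \<omega> in M. \<omega> \<in> A' \<longleftrightarrow> (\<forall>s\<in>S'. W s \<omega> \<in> B' s)"
        using c by (simp_all add: cyl_def)
      then show ?thesis by eventually_elim auto
    qed
    then have "cyl (A \<inter> A') (S \<union> S') ?B" using c unfolding cyl_def by (simp add: sets.Int)
    then show "A \<inter> A' \<in> \<C>" unfolding \<C>_def by blast
  qed
  moreover have "Int_stable \<D>"
  proof (rule Int_stableI)
    fix A A' assume "A \<in> \<D>" "A' \<in> \<D>"
    then obtain E E' where "E \<in> sets borel" "E' \<in> sets borel" "A = ?D -` E \<inter> space M" "A' = ?D -` E' \<inter> space M"
      by (auto simp: \<D>_def)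
    then show "A \<inter> A' \<in> \<D>" unfolding \<D>_def by (intro CollectI exI[of _ "E \<inter> E'"]) auto
  qed
  ultimately have ind: "indep_set (sigma_sets (space M) \<C>) (sigma_sets (space M) \<D>)"
    by (rule indep_set_sigma_sets)
  have "sets (F a) \<subseteq> sigma_sets (space M) \<C>"
    unfolding sets_F
  proof (rule sigma_sets_mono', safe)
    fix s and B :: "real set" assume s: "s \<in> {0..a}" and B: "B \<in> sets borel"
    then have "W s -` B \<inter> space M \<in> sets M" using ab by (intro measurable_sets[OF W_measurable]) auto
    then have "cyl (W s -` B \<inter> space M) {s} (\<lambda>_. B)" unfolding cyl_def using s B by simp
    then show "W s -` B \<inter> space M \<in> \<C>" unfolding \<C>_def by blast
  next
    fix N assume N: "N \<in> null_sets M"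
    have "AE \<omega> in M. \<omega> \<notin> N" using N by (rule AE_not_in)
    \<comment> \<open>A null set agrees almost everywhere with the impossible cylinder that requires
      \<open>W 0\<close> to lie in the empty set.\<close>
    then have "AE \<omega> in M. \<omega> \<in> N \<longleftrightarrow> (\<forall>s\<in>{0::real}. W s \<omega> \<in> {})" by eventually_elim simp
    then have "cyl N {0} (\<lambda>_. {})" unfolding cyl_def using N ab by auto
    then show "N \<in> \<C>" unfolding \<C>_def by blast
  qed
  moreover have "sigma_sets (space M) {Z -` A \<inter> space M |A. A \<in> sets borel} \<subseteq> sets (F a)"
    using sets.sigma_sets_subset[of "{Z -` A \<inter> space M |A. A \<in> sets borel}" "F a"] measurable_sets[OF Z]
    by auto
  ultimately have "sigma_sets (space M) {Z -` A \<inter> space M |A. A \<in> sets borel} \<subseteq> sigma_sets (space M) \<C>" by blast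
  then have "indep_set (sigma_sets (space M) {Z -` A \<inter> space M |A. A \<in> sets borel}) (sigma_sets (space M) \<D>)"
    using indep_setD_ev1[OF ind] indep_setD_ev2[OF ind] indep_setD[OF ind]
    by (intro indep_setI) (auto intro: subset_trans)
  then show ?thesis
    unfolding indep_var_eq \<D>_def using D measurable_F_M[OF Z] ab by auto
qed

text \<open>Independence factors the expectations, and the normal density supplies the moments 0 and
  \<open>b - a\<close>. The case \<open>a = b\<close> is separate because there the increment is
  zero and has no density.\<close>

lemma increment_moments:
  assumes ab: "0 \<le> a" "a \<le> b" "b \<le> T" and Z: "Z \<in> borel_measurable (F a)" "integrable M Z"
  shows "integrable M (\<lambda>\<omega>. Z \<omega> * (W b \<omega> - W a \<omega>))" "expectation (\<lambda>\<omega>. Z \<omega> * (W b \<omega> - W a \<omega>)) = 0"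
    "integrable M (\<lambda>\<omega>. Z \<omega> * (W b \<omega> - W a \<omega>)\<^sup>2)"
    "expectation (\<lambda>\<omega>. Z \<omega> * (W b \<omega> - W a \<omega>)\<^sup>2) = expectation Z * (b - a)"
proof -
  let ?D = "\<lambda>\<omega>. W b \<omega> - W a \<omega>"
  have "integrable M (\<lambda>\<omega>. Z \<omega> * ?D \<omega>) \<and> expectation (\<lambda>\<omega>. Z \<omega> * ?D \<omega>) = 0 \<and>
    integrable M (\<lambda>\<omega>. Z \<omega> * (?D \<omega>)\<^sup>2) \<and> expectation (\<lambda>\<omega>. Z \<omega> * (?D \<omega>)\<^sup>2) = expectation Z * (b - a)"
  proof (cases "a = b")
    case False
    then have "a < b" using ab by simp
    have dist: "distributed M lborel ?D (normal_density 0 (sqrt (b - a)))"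
      using bm ab \<open>a < b\<close> by (auto simp: brownian_motion_def)
    have sig: "0 < sqrt (b - a)" using \<open>a < b\<close> by simp
    have E1: "expectation ?D = 0" by (rule normal_distributed_expectation[OF sig dist])
    have E2: "expectation (\<lambda>\<omega>. (?D \<omega>)\<^sup>2) = b - a"
      using normal_distributed_variance[OF sig dist] E1 \<open>a < b\<close> by simp
    have I1: "integrable M ?D"
      using distributed_integrable[OF dist, of "\<lambda>x. x"] integrable_normal_moment_nz_1[OF sig, of 0] by simp
    have I2: "integrable M (\<lambda>\<omega>. (?D \<omega>)\<^sup>2)"
      using distributed_integrable[OF dist, of "\<lambda>x. x\<^sup>2"] integrable_normal_moment[OF sig, of 0 2] by simp
    have ind: "indep_var borel Z borel ?D" by (rule indep_increment) (use ab \<open>a < b\<close> Z in auto)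
    have "indep_var borel (id \<circ> Z) borel ((\<lambda>x. x\<^sup>2) \<circ> ?D)"
      by (rule indep_var_compose[OF ind]) auto
    then have ind2: "indep_var borel Z borel (\<lambda>\<omega>. (?D \<omega>)\<^sup>2)" by (simp add: comp_def)
    show ?thesis
      using indep_var_integrable[OF ind Z(2) I1] indep_var_lebesgue_integral[OF ind Z(2) I1]
        indep_var_integrable[OF ind2 Z(2) I2] indep_var_lebesgue_integral[OF ind2 Z(2) I2] E1 E2 by simp
  qed simp
  then show "integrable M (\<lambda>\<omega>. Z \<omega> * (W b \<omega> - W a \<omega>))" "expectation (\<lambda>\<omega>. Z \<omega> * (W b \<omega> - W a \<omega>)) = 0"
    "integrable M (\<lambda>\<omega>. Z \<omega> * (W b \<omega> - W a \<omega>)\<^sup>2)"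
    "expectation (\<lambda>\<omega>. Z \<omega> * (W b \<omega> - W a \<omega>)\<^sup>2) = expectation Z * (b - a)" by auto
qed


section \<open>The isometry for simple integrands\<close>

abbreviation L :: "real measure" where "L \<equiv> restrict_space lborel {0..T}"
abbreviation \<mu> :: "(real \<times> 'w) measure" where "\<mu> \<equiv> dt_dP M T"

lemma finite_measure_L: "finite_measure L"
  by (rule finite_measureI) (simp add: emeasure_restrict_space space_restrict_space emeasure_lborel_Icc_eq)

lemma pair_sigma_finite_LM: "pair_sigma_finite L M"
proof -
  interpret L: finite_measure L by (rule finite_measure_L)
  show ?thesis by unfold_locales
qed

lemma finite_measure_mu: "finite_measure \<mu>"
proof (rule finite_measureI)
  interpret L: finite_measure L by (rule finite_measure_L)
  have "emeasure \<mu> (space \<mu>) = emeasure L (space L) * emeasure M (space M)"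
    unfolding dt_dP_def space_pair_measure by (rule emeasure_pair_measure_Times) (rule sets.top)+
  then show "emeasure \<mu> (space \<mu>) \<noteq> \<infinity>"
    using L.emeasure_finite[of "space L"] by (simp add: emeasure_space_1)
qed

lemma integrable_bounded_mult:
  fixes c X :: "'w \<Rightarrow> real"
  assumes "integrable M X" "c \<in> borel_measurable M" "\<And>\<omega>. \<omega> \<in> space M \<Longrightarrow> \<bar>c \<omega>\<bar> \<le> K"
  shows "integrable M (\<lambda>\<omega>. c \<omega> * X \<omega>)"
proof (rule Bochner_Integration.integrable_bound)
  show "integrable M (\<lambda>\<omega>. K * X \<omega>)" using assms(1) by simp
  show "(\<lambda>\<omega>. c \<omega> * X \<omega>) \<in> borel_measurable M" using assms by measurable
  show "AE \<omega> in M. norm (c \<omega> * X \<omega>) \<le> norm (K * X \<omega>)"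
  proof (rule AE_I2)
    fix \<omega> assume "\<omega> \<in> space M"
    from assms(3)[OF this] have "\<bar>c \<omega>\<bar> \<le> \<bar>K\<bar>" by linarith
    then show "norm (c \<omega> * X \<omega>) \<le> norm (K * X \<omega>)" by (simp add: abs_mult mult_right_mono)
  qed
qed

lemma integrable_bounded:
  fixes c :: "'w \<Rightarrow> real"
  assumes "c \<in> borel_measurable M" "\<And>\<omega>. \<omega> \<in> space M \<Longrightarrow> \<bar>c \<omega>\<bar> \<le> K"
  shows "integrable M c"
  using integrable_bounded_mult[of "\<lambda>_. 1" c K] assms by simp

text \<open>If the first interval ends by \<open>a'\<close>, the second increment is centred and
  independent of the remaining factors, so the mean is zero. Otherwise the intervals are cut at
  \<open>a'\<close> and at \<open>m = min b b'\<close>: each mixed product contains a centred factor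
  independent of the others, and only the squared increment over the overlap survives.\<close>

lemma increment_cross_le:
  assumes ab: "0 \<le> a" "a \<le> b" "b \<le> T" and ab': "a \<le> a'" "a' \<le> b'" "b' \<le> T"
    and c: "c \<in> borel_measurable (F a)" "\<And>\<omega>. \<omega> \<in> space M \<Longrightarrow> \<bar>c \<omega>\<bar> \<le> K"
    and c': "c' \<in> borel_measurable (F a')" "\<And>\<omega>. \<omega> \<in> space M \<Longrightarrow> \<bar>c' \<omega>\<bar> \<le> K'"
  shows "integrable M (\<lambda>\<omega>. (c \<omega> * (W b \<omega> - W a \<omega>)) * (c' \<omega> * (W b' \<omega> - W a' \<omega>)))"
    and "expectation (\<lambda>\<omega>. (c \<omega> * (W b \<omega> - W a \<omega>)) * (c' \<omega> * (W b' \<omega> - W a' \<omega>)))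
      = expectation (\<lambda>\<omega>. c \<omega> * c' \<omega>) * max 0 (min b b' - a')"
proof -
  have cM: "c \<in> borel_measurable M" "c' \<in> borel_measurable M"
    using c(1) c'(1) ab ab' by (auto intro: measurable_F_M)
  have cF: "c \<in> borel_measurable (F a')" using c(1) ab' by (auto intro: measurable_F_mono)
  have ic: "integrable M c" using cM(1) c(2) by (rule integrable_bounded)
  have icc: "integrable M (\<lambda>\<omega>. c \<omega> * c' \<omega>)"
    using integrable_bounded_mult[OF integrable_bounded[OF cM(2) c'(2)] cM(1) c(2)] .
  have "integrable M (\<lambda>\<omega>. (c \<omega> * (W b \<omega> - W a \<omega>)) * (c' \<omega> * (W b' \<omega> - W a' \<omega>))) \<and>
    expectation (\<lambda>\<omega>. (c \<omega> * (W b \<omega> - W a \<omega>)) * (c' \<omega> * (W b' \<omega> - W a' \<omega>)))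
      = expectation (\<lambda>\<omega>. c \<omega> * c' \<omega>) * max 0 (min b b' - a')"
  proof (cases "b \<le> a'")
    case True
    let ?Z = "\<lambda>\<omega>. c' \<omega> * (c \<omega> * (W b \<omega> - W a \<omega>))"
    have "W b \<in> borel_measurable (F a')" "W a \<in> borel_measurable (F a')"
      using ab ab' True by (auto intro: W_adapted)
    then have Z: "?Z \<in> borel_measurable (F a')" using cF c'(1) by measurable
    have iZ: "integrable M ?Z"
      using integrable_bounded_mult[OF increment_moments(1)[OF ab c(1) ic] cM(2) c'(2)] .
    have eq: "(\<lambda>\<omega>. (c \<omega> * (W b \<omega> - W a \<omega>)) * (c' \<omega> * (W b' \<omega> - W a' \<omega>))) = (\<lambda>\<omega>. ?Z \<omega> * (W b' \<omega> - W a' \<omega>))"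
      by (simp add: mult_ac)
    have "0 \<le> a'" using ab ab' by simp
    from increment_moments(1,2)[OF this ab'(2,3) Z iZ] show ?thesis
      unfolding eq using True by simp
  next
    case False
    define m where "m = min b b'"
    have m: "a' \<le> m" "m \<le> b" "m \<le> b'" "m \<le> T" "0 \<le> m" "0 \<le> a'" using False ab ab' by (auto simp: m_def)
    let ?Z1 = "\<lambda>\<omega>. c' \<omega> * (c \<omega> * (W a' \<omega> - W a \<omega>))" and ?Z2 = "\<lambda>\<omega>. c \<omega> * c' \<omega>"
    let ?Z3 = "\<lambda>\<omega>. c \<omega> * c' \<omega> * (W m \<omega> - W a' \<omega>)"
    have Wa: "W a' \<in> borel_measurable (F a')" "W a \<in> borel_measurable (F a')"
      using ab ab' m by (auto intro: W_adapted)
    have Z1: "?Z1 \<in> borel_measurable (F a')" using cF c'(1) Wa by measurable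
    have iZ1: "integrable M ?Z1"
      using integrable_bounded_mult[OF increment_moments(1)[OF ab(1) ab'(1) _ c(1) ic] cM(2) c'(2)] ab' by simp
    have Z2: "?Z2 \<in> borel_measurable (F a')" using cF c'(1) by measurable
    have iZ3: "integrable M ?Z3" using increment_moments(1)[OF m(6,1,4) Z2 icc] .
    have "W a' \<in> borel_measurable (F m)" "W m \<in> borel_measurable (F m)" using m by (auto intro: W_adapted)
    then have Z3: "?Z3 \<in> borel_measurable (F m)" using measurable_F_mono[OF Z2 m(1)] by measurable
    note 1 = increment_moments(1,2)[OF m(6) ab'(2,3) Z1 iZ1]
    note 2 = increment_moments(3,4)[OF m(6,1,4) Z2 icc]
    note 3 = increment_moments(1,2)[OF m(5,3) ab'(3) Z3 iZ3]
    note 4 = increment_moments(1,2)[OF m(5,2) ab(3) Z3 iZ3]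
    \<comment> \<open>As \<open>m\<close> is one of the two right end points, one of the two
      increments starting at \<open>m\<close> is zero; so the product of both drops out of the
      expansion.\<close>
    have eq: "(\<lambda>\<omega>. (c \<omega> * (W b \<omega> - W a \<omega>)) * (c' \<omega> * (W b' \<omega> - W a' \<omega>)))
      = (\<lambda>\<omega>. ?Z1 \<omega> * (W b' \<omega> - W a' \<omega>) + ?Z2 \<omega> * (W m \<omega> - W a' \<omega>)\<^sup>2 + ?Z3 \<omega> * (W b' \<omega> - W m \<omega>)
          + ?Z3 \<omega> * (W b \<omega> - W m \<omega>))"
    proof
      fix \<omega>
      have "W b \<omega> - W m \<omega> = 0 \<or> W b' \<omega> - W m \<omega> = 0" by (auto simp: m_def min_def)
      then show "(c \<omega> * (W b \<omega> - W a \<omega>)) * (c' \<omega> * (W b' \<omega> - W a' \<omega>))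
        = ?Z1 \<omega> * (W b' \<omega> - W a' \<omega>) + ?Z2 \<omega> * (W m \<omega> - W a' \<omega>)\<^sup>2 + ?Z3 \<omega> * (W b' \<omega> - W m \<omega>)
          + ?Z3 \<omega> * (W b \<omega> - W m \<omega>)"
        by (elim disjE) (simp_all add: power2_eq_square algebra_simps)
    qed
    show ?thesis unfolding eq using 1 2 3 4 m by (simp add: m_def[symmetric] max_def)
  qed
  then show "integrable M (\<lambda>\<omega>. (c \<omega> * (W b \<omega> - W a \<omega>)) * (c' \<omega> * (W b' \<omega> - W a' \<omega>)))"
    and "expectation (\<lambda>\<omega>. (c \<omega> * (W b \<omega> - W a \<omega>)) * (c' \<omega> * (W b' \<omega> - W a' \<omega>)))
      = expectation (\<lambda>\<omega>. c \<omega> * c' \<omega>) * max 0 (min b b' - a')" by auto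
qed

lemma increment_cross:
  assumes ab: "0 \<le> a" "a \<le> b" "b \<le> T" and ab': "0 \<le> a'" "a' \<le> b'" "b' \<le> T"
    and c: "c \<in> borel_measurable (F a)" "\<And>\<omega>. \<omega> \<in> space M \<Longrightarrow> \<bar>c \<omega>\<bar> \<le> K"
    and c': "c' \<in> borel_measurable (F a')" "\<And>\<omega>. \<omega> \<in> space M \<Longrightarrow> \<bar>c' \<omega>\<bar> \<le> K'"
  shows "integrable M (\<lambda>\<omega>. (c \<omega> * (W b \<omega> - W a \<omega>)) * (c' \<omega> * (W b' \<omega> - W a' \<omega>)))"
    and "expectation (\<lambda>\<omega>. (c \<omega> * (W b \<omega> - W a \<omega>)) * (c' \<omega> * (W b' \<omega> - W a' \<omega>)))
      = expectation (\<lambda>\<omega>. c \<omega> * c' \<omega>) * max 0 (min b b' - max a a')"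
proof -
  consider "a \<le> a'" | "a' \<le> a" by linarith
  note cs = this
  show "integrable M (\<lambda>\<omega>. (c \<omega> * (W b \<omega> - W a \<omega>)) * (c' \<omega> * (W b' \<omega> - W a' \<omega>)))"
    using cs
  proof cases
    case 1 then show ?thesis using increment_cross_le(1)[OF ab 1 ab'(2,3) c c'] by simp
  next
    case 2 then show ?thesis using increment_cross_le(1)[OF ab' 2 ab(2,3) c' c] by (simp add: mult.commute)
  qed
  show "expectation (\<lambda>\<omega>. (c \<omega> * (W b \<omega> - W a \<omega>)) * (c' \<omega> * (W b' \<omega> - W a' \<omega>)))
      = expectation (\<lambda>\<omega>. c \<omega> * c' \<omega>) * max 0 (min b b' - max a a')"
    using cs
  proof cases
    case 1 then show ?thesis using increment_cross_le(2)[OF ab 1 ab'(2,3) c c'] by (simp add: max_absorb2)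
  next
    case 2 then show ?thesis using increment_cross_le(2)[OF ab' 2 ab(2,3) c' c]
      by (simp add: mult.commute min.commute max_absorb1)
  qed
qed

text \<open>The same overlap length appears as a factor in \<open>increment_cross\<close>. This
  agreement replaces a common refinement of two partitions in the isometry.\<close>

lemma integral_interval_overlap:
  assumes "0 \<le> a" "b \<le> T" "0 \<le> a'" "b' \<le> T"
  shows "(\<integral>s. indicator {a<..b} s * indicator {a'<..b'} s \<partial>L) = (max 0 (min b b' - max a a') :: real)"
proof -
  have "(\<integral>s. indicator {a<..b} s * indicator {a'<..b'} s \<partial>L)
      = (\<integral>s. indicator {0..T} s *\<^sub>R (indicator {a<..b} s * indicator {a'<..b'} s :: real) \<partial>lborel)"
    by (subst integral_restrict_space) auto
  also have "\<dots> = (\<integral>s. indicator {max a a'<..min b b'} s \<partial>lborel)"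
    using assms by (intro Bochner_Integration.integral_cong) (auto simp: indicator_def)
  also have "\<dots> = max 0 (min b b' - max a a')"
  proof (cases "max a a' \<le> min b b'")
    case True
    then have "measure lborel {max a a'<..min b b'} = min b b' - max a a'" by (rule measure_lborel_Ioc)
    moreover have "(\<integral>s. indicator {max a a'<..min b b'} s \<partial>lborel) = measure lborel {max a a'<..min b b'}"
      by simp
    ultimately show ?thesis using True by linarith
  next
    case False
    then have "{max a a'<..min b b'} = {}" by auto
    then have "(\<integral>s. indicator {max a a'<..min b b'} s \<partial>lborel) = (0::real)" by (simp only:) simp
    moreover have "max 0 (min b b' - max a a') = 0" using False by (intro max_absorb1) linarith
    ultimately show ?thesis by simp
  qed
  finally show ?thesis .
qed

lemma measurable_tensor:
  assumes "f \<in> borel_measurable L" "c \<in> borel_measurable M"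
  shows "(\<lambda>(s, \<omega>). f s * c \<omega> :: real) \<in> borel_measurable \<mu>"
proof -
  have "(\<lambda>x. f (fst x) * c (snd x)) \<in> borel_measurable (L \<Otimes>\<^sub>M M)"
    using assms by (intro borel_measurable_times measurable_compose[OF measurable_fst] measurable_compose[OF measurable_snd])
  then show ?thesis unfolding dt_dP_def case_prod_beta .
qed

lemma measurable_tensor':
  assumes "f \<in> borel_measurable L" "c \<in> borel_measurable M"
  shows "(\<lambda>x. f (fst x) * c (snd x) :: real) \<in> borel_measurable \<mu>"
  using measurable_tensor[OF assms] unfolding case_prod_beta .

lemma simple_integrand_times:
  assumes "simple_integrand M T F n \<tau> c" "i \<le> n" shows "0 \<le> \<tau> i" "\<tau> i \<le> T"
proof -
  have mono: "\<tau> i \<le> \<tau> j" if "i \<le> j" "j \<le> n" for i j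
    using that
  proof (induction j rule: dec_induct)
    case (step k)
    then have "\<tau> k \<le> \<tau> (Suc k)" using assms(1) by (simp add: simple_integrand_def)
    with step show ?case by simp
  qed simp
  show "0 \<le> \<tau> i" "\<tau> i \<le> T"
    using mono[of 0 i] mono[of i n] assms by (auto simp: simple_integrand_def)
qed

lemma simple_integrand_dest:
  assumes "simple_integrand M T F n \<tau> c" "i < n"
  obtains K where "0 \<le> \<tau> i" "\<tau> i \<le> \<tau> (Suc i)" "\<tau> (Suc i) \<le> T" "c i \<in> borel_measurable (F (\<tau> i))"
    "\<And>\<omega>. \<omega> \<in> space M \<Longrightarrow> \<bar>c i \<omega>\<bar> \<le> K" "c i \<in> borel_measurable M"
proof -
  have t: "0 \<le> \<tau> i" "\<tau> i \<le> \<tau> (Suc i)" "\<tau> (Suc i) \<le> T" "c i \<in> borel_measurable (F (\<tau> i))"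
    using assms simple_integrand_times[OF assms(1), of i] simple_integrand_times[OF assms(1), of "Suc i"]
    by (auto simp: simple_integrand_def)
  moreover have "\<exists>K. \<forall>\<omega>\<in>space M. \<bar>c i \<omega>\<bar> \<le> K" using assms by (simp add: simple_integrand_def)
  then obtain K where "\<And>\<omega>. \<omega> \<in> space M \<Longrightarrow> \<bar>c i \<omega>\<bar> \<le> K" by blast
  moreover have "c i \<in> borel_measurable M" using t by (intro measurable_F_M[OF t(4)]) simp
  ultimately show ?thesis by (rule that)
qed

lemma simple_integral_square_integrable:
  assumes "simple_integrand M T F n \<tau> c"
  shows "square_integrable M (simple_integral W n \<tau> c)"
proof -
  have "square_integrable M (\<lambda>\<omega>. c i \<omega> * (W (\<tau> (Suc i)) \<omega> - W (\<tau> i) \<omega>))" if i: "i < n" for i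
  proof -
    obtain K where K: "0 \<le> \<tau> i" "\<tau> i \<le> \<tau> (Suc i)" "\<tau> (Suc i) \<le> T" "c i \<in> borel_measurable (F (\<tau> i))"
      "\<And>\<omega>. \<omega> \<in> space M \<Longrightarrow> \<bar>c i \<omega>\<bar> \<le> K" "c i \<in> borel_measurable M"
      using simple_integrand_dest[OF assms i] by blast
    have "W (\<tau> i) \<in> borel_measurable M" "W (\<tau> (Suc i)) \<in> borel_measurable M"
      using K by (auto intro: W_measurable)
    then have m: "(\<lambda>\<omega>. c i \<omega> * (W (\<tau> (Suc i)) \<omega> - W (\<tau> i) \<omega>)) \<in> borel_measurable M"
      using K(6) by measurable
    show ?thesis
      unfolding square_integrable_def using m increment_cross(1)[OF K(1-3) K(1-3) K(4,5) K(4,5)]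
      by (simp add: power2_eq_square)
  qed
  then show ?thesis unfolding simple_integral_def by (intro square_integrable_sum) simp
qed

lemma simple_process_square_integrable:
  assumes "simple_integrand M T F n \<tau> c"
  shows "square_integrable \<mu> (\<lambda>(s, \<omega>). simple_process n \<tau> c s \<omega>)"
proof -
  have "square_integrable \<mu> (\<lambda>(s, \<omega>). indicator {\<tau> i<..\<tau> (Suc i)} s * c i \<omega>)" if i: "i < n" for i
  proof -
    obtain K where K: "\<And>\<omega>. \<omega> \<in> space M \<Longrightarrow> \<bar>c i \<omega>\<bar> \<le> K" "c i \<in> borel_measurable M"
      using simple_integrand_dest[OF assms i] by metis
    have m: "indicator {\<tau> i<..\<tau> (Suc i)} \<in> borel_measurable L" by (intro measurable_restrict_space1) simp
    show ?thesis
    proof (rule square_integrableI_bound[OF square_integrable_const[OF finite_measure_mu, of K] measurable_tensor[OF m K(2)]])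
      show "AE x in \<mu>. norm (case x of (s, \<omega>) \<Rightarrow> indicator {\<tau> i<..\<tau> (Suc i)} s * c i \<omega>) \<le> norm K"
      proof (rule AE_I2)
        fix x assume "x \<in> space \<mu>"
        then have "snd x \<in> space M" by (auto simp: dt_dP_def space_pair_measure)
        from K(1)[OF this] show "norm (case x of (s, \<omega>) \<Rightarrow> indicator {\<tau> i<..\<tau> (Suc i)} s * c i \<omega>) \<le> norm K"
          by (auto simp: indicator_def case_prod_beta)
      qed
    qed
  qed
  then have "square_integrable \<mu> (\<lambda>x. \<Sum>i<n. (\<lambda>(s, \<omega>). indicator {\<tau> i<..\<tau> (Suc i)} s * c i \<omega>) x)"
    by (intro square_integrable_sum) simp
  moreover have "(\<lambda>x. \<Sum>i<n. (\<lambda>(s, \<omega>). indicator {\<tau> i<..\<tau> (Suc i)} s * c i \<omega>) x)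
      = (\<lambda>(s, \<omega>). simple_process n \<tau> c s \<omega>)"
    by (simp only: fun_eq_iff simple_process_def mult.commute split_paired_all split_conv) simp
  ultimately show ?thesis by simp
qed

lemma integral_double_sum:
  fixes f :: "nat \<Rightarrow> nat \<Rightarrow> 'a \<Rightarrow> real"
  assumes "\<And>i j. i < n \<Longrightarrow> j < m \<Longrightarrow> integrable N (f i j)"
  shows "(\<integral>x. (\<Sum>i<n. \<Sum>j<m. f i j x) \<partial>N) = (\<Sum>i<n. \<Sum>j<m. (\<integral>x. f i j x \<partial>N))"
proof -
  have "(\<integral>x. (\<Sum>i<n. \<Sum>j<m. f i j x) \<partial>N) = (\<Sum>i<n. (\<integral>x. (\<Sum>j<m. f i j x) \<partial>N))"
    by (rule Bochner_Integration.integral_sum, rule Bochner_Integration.integrable_sum, rule assms) auto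
  also have "\<dots> = (\<Sum>i<n. \<Sum>j<m. (\<integral>x. f i j x \<partial>N))"
    by (rule sum.cong[OF refl], rule Bochner_Integration.integral_sum, rule assms) auto
  finally show ?thesis .
qed

text \<open>The polarised form, for unrelated partitions. Expanding both products gives double sums
  that match term by term: each term is the expectation of the product of two coefficients, times
  the length of the overlap.\<close>

lemma simple_isometry:
  assumes s: "simple_integrand M T F n \<tau> c" and s': "simple_integrand M T F n' \<tau>' c'"
  shows "expectation (\<lambda>\<omega>. simple_integral W n \<tau> c \<omega> * simple_integral W n' \<tau>' c' \<omega>) =
    (\<integral>(s, \<omega>). simple_process n \<tau> c s \<omega> * simple_process n' \<tau>' c' s \<omega> \<partial>\<mu>)"
proof -
  interpret P: pair_sigma_finite L M by (rule pair_sigma_finite_LM)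
  let ?I = "\<lambda>i j \<omega>. (c i \<omega> * (W (\<tau> (Suc i)) \<omega> - W (\<tau> i) \<omega>)) * (c' j \<omega> * (W (\<tau>' (Suc j)) \<omega> - W (\<tau>' j) \<omega>))"
  let ?f = "\<lambda>i j s. indicator {\<tau> i<..\<tau> (Suc i)} s * indicator {\<tau>' j<..\<tau>' (Suc j)} s :: real"
  let ?P = "\<lambda>i j (x :: real \<times> 'w). ?f i j (fst x) * (c i (snd x) * c' j (snd x))"
  have ij: "integrable M (?I i j)" "integrable \<mu> (?P i j)" "expectation (?I i j) = (\<integral>x. ?P i j x \<partial>\<mu>)"
    if i: "i < n" and j: "j < n'" for i j
  proof -
    obtain K where K: "0 \<le> \<tau> i" "\<tau> i \<le> \<tau> (Suc i)" "\<tau> (Suc i) \<le> T" "c i \<in> borel_measurable (F (\<tau> i))"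
      "\<And>\<omega>. \<omega> \<in> space M \<Longrightarrow> \<bar>c i \<omega>\<bar> \<le> K" "c i \<in> borel_measurable M"
      using simple_integrand_dest[OF s i] by blast
    obtain K' where K': "0 \<le> \<tau>' j" "\<tau>' j \<le> \<tau>' (Suc j)" "\<tau>' (Suc j) \<le> T" "c' j \<in> borel_measurable (F (\<tau>' j))"
      "\<And>\<omega>. \<omega> \<in> space M \<Longrightarrow> \<bar>c' j \<omega>\<bar> \<le> K'" "c' j \<in> borel_measurable M"
      using simple_integrand_dest[OF s' j] by blast
    note cr = increment_cross[OF K(1-3) K'(1-3) K(4,5) K'(4,5)]
    show "integrable M (?I i j)" by (rule cr(1))
    have icc: "integrable M (\<lambda>\<omega>. c i \<omega> * c' j \<omega>)"
      using integrable_bounded_mult[OF integrable_bounded[OF K'(6,5)] K(6,5)] .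
    have fm: "?f i j \<in> borel_measurable L" by (intro borel_measurable_times measurable_restrict_space1) simp_all
    have m: "?P i j \<in> borel_measurable \<mu>"
      by (rule measurable_tensor'[OF fm]) (use icc in simp)
    show int: "integrable \<mu> (?P i j)"
    proof (rule Bochner_Integration.integrable_bound[OF _ m])
      interpret mu: finite_measure \<mu> by (rule finite_measure_mu)
      show "integrable \<mu> (\<lambda>_. K * K')" by simp
      show "AE x in \<mu>. norm (?P i j x) \<le> norm (K * K')"
      proof (rule AE_I2)
        fix x assume "x \<in> space \<mu>"
        then have "snd x \<in> space M" by (auto simp: dt_dP_def space_pair_measure)
        then have "\<bar>c i (snd x)\<bar> * \<bar>c' j (snd x)\<bar> \<le> \<bar>K\<bar> * \<bar>K'\<bar>"
          using K(5) K'(5) by (intro mult_mono) (auto intro: order_trans[OF _ abs_ge_self])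
        then show "norm (?P i j x) \<le> norm (K * K')" by (simp add: indicator_def abs_mult)
      qed
    qed
    have "(\<integral>x. ?P i j x \<partial>\<mu>) = (\<integral>s. (\<integral>\<omega>. ?f i j s * (c i \<omega> * c' j \<omega>) \<partial>M) \<partial>L)"
      using P.integral_fst'[of "?P i j"] int by (simp add: dt_dP_def)
    also have "\<dots> = (\<integral>s. ?f i j s \<partial>L) * expectation (\<lambda>\<omega>. c i \<omega> * c' j \<omega>)"
      using icc by simp
    also have "\<dots> = expectation (?I i j)"
      using K(1,3) K'(1,3) cr(2) by (simp add: integral_interval_overlap)
    finally show "expectation (?I i j) = (\<integral>x. ?P i j x \<partial>\<mu>)" ..
  qed
  have "expectation (\<lambda>\<omega>. simple_integral W n \<tau> c \<omega> * simple_integral W n' \<tau>' c' \<omega>)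
      = expectation (\<lambda>\<omega>. \<Sum>i<n. \<Sum>j<n'. ?I i j \<omega>)" by (simp only: simple_integral_def sum_product)
  also have "\<dots> = (\<Sum>i<n. \<Sum>j<n'. expectation (?I i j))"
    by (rule integral_double_sum) (rule ij(1))
  also have "\<dots> = (\<Sum>i<n. \<Sum>j<n'. (\<integral>x. ?P i j x \<partial>\<mu>))" using ij(3) by simp
  also have "\<dots> = (\<integral>x. (\<Sum>i<n. \<Sum>j<n'. ?P i j x) \<partial>\<mu>)"
    by (rule integral_double_sum[symmetric]) (rule ij(2))
  also have "\<dots> = (\<integral>(s, \<omega>). simple_process n \<tau> c s \<omega> * simple_process n' \<tau>' c' s \<omega> \<partial>\<mu>)"
    by (intro Bochner_Integration.integral_cong refl)
      (simp only: simple_process_def sum_product case_prod_beta mult_ac)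
  finally show ?thesis .
qed

text \<open>What the integral gains after time \<open>r\<close> is invisible to \<open>F r\<close>:
  the martingale property in weak form, with bounded test variables \<open>Z\<close> in place of a
  conditional expectation.\<close>

lemma simple_truncate:
  assumes s: "simple_integrand M T F n \<tau> c" and r: "0 \<le> r" "r \<le> T"
  obtains \<tau>' c' where "simple_integrand M T F n \<tau>' c'"
    "\<And>s \<omega>. simple_process n \<tau>' c' s \<omega> = indicator {..r} s * simple_process n \<tau> c s \<omega>"
    "\<And>(Z :: 'w \<Rightarrow> real) K. Z \<in> borel_measurable (F r) \<Longrightarrow> (\<And>\<omega>. \<omega> \<in> space M \<Longrightarrow> \<bar>Z \<omega>\<bar> \<le> K) \<Longrightarrow>
      expectation (\<lambda>\<omega>. Z \<omega> * simple_integral W n \<tau> c \<omega>) = expectation (\<lambda>\<omega>. Z \<omega> * simple_integral W n \<tau>' c' \<omega>)"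
proof
  \<comment> \<open>Coefficients of intervals starting after \<open>r\<close> are set to zero,
    because clipping moves their left end point to \<open>r\<close>, where they need not be
    measurable.\<close>
  let ?\<tau> = "\<lambda>i. min (\<tau> i) r" and ?c = "\<lambda>i. if \<tau> i \<le> r then c i else (\<lambda>_. 0)"
  show s': "simple_integrand M T F n ?\<tau> ?c"
    unfolding simple_integrand_def
  proof (intro conjI allI impI)
    show "0 \<le> min (\<tau> 0) r" "min (\<tau> n) r \<le> T" using s r by (simp_all add: simple_integrand_def min.coboundedI2)
    fix i assume i: "i < n"
    show "min (\<tau> i) r \<le> min (\<tau> (Suc i)) r" using s i by (intro min.mono) (simp_all add: simple_integrand_def)
    show "?c i \<in> borel_measurable (F (min (\<tau> i) r))" using s i by (simp add: simple_integrand_def min_absorb1)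
    show "\<exists>K. \<forall>\<omega>\<in>space M. \<bar>?c i \<omega>\<bar> \<le> K" using s i by (cases "\<tau> i \<le> r") (auto simp: simple_integrand_def)
  qed
  show "simple_process n ?\<tau> ?c s \<omega> = indicator {..r} s * simple_process n \<tau> c s \<omega>" for s \<omega>
    unfolding simple_process_def sum_distrib_left by (intro sum.cong) (auto simp: indicator_def)
  fix Z :: "'w \<Rightarrow> real" and K assume Z: "Z \<in> borel_measurable (F r)" and K: "\<And>\<omega>. \<omega> \<in> space M \<Longrightarrow> \<bar>Z \<omega>\<bar> \<le> K"
  have ZM: "Z \<in> borel_measurable M" using Z r by (auto intro: measurable_F_M)
  let ?D = "\<lambda>i \<omega>. c i \<omega> * (W (\<tau> (Suc i)) \<omega> - W (\<tau> i) \<omega>)"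
  let ?D' = "\<lambda>i \<omega>. ?c i \<omega> * (W (?\<tau> (Suc i)) \<omega> - W (?\<tau> i) \<omega>)"
  have i: "integrable M (\<lambda>\<omega>. Z \<omega> * ?D i \<omega>) \<and> integrable M (\<lambda>\<omega>. Z \<omega> * ?D' i \<omega>) \<and>
      expectation (\<lambda>\<omega>. Z \<omega> * ?D i \<omega>) = expectation (\<lambda>\<omega>. Z \<omega> * ?D' i \<omega>)" if i: "i < n" for i
  proof -
    obtain B where B: "0 \<le> \<tau> i" "\<tau> i \<le> \<tau> (Suc i)" "\<tau> (Suc i) \<le> T" "c i \<in> borel_measurable (F (\<tau> i))"
      "\<And>\<omega>. \<omega> \<in> space M \<Longrightarrow> \<bar>c i \<omega>\<bar> \<le> B" "c i \<in> borel_measurable M"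
      using simple_integrand_dest[OF s i] by blast
    have ic: "integrable M (c i)" using B(6,5) by (rule integrable_bounded)
    have iZ: "integrable M (\<lambda>\<omega>. Z \<omega> * c i \<omega>)" using integrable_bounded_mult[OF ic ZM K] .
    have i1: "integrable M (\<lambda>\<omega>. Z \<omega> * ?D i \<omega>)"
      using integrable_bounded_mult[OF increment_moments(1)[OF B(1-4) ic] ZM K] .
    show ?thesis
    proof (cases "\<tau> i \<le> r")
      case False
      then have "Z \<in> borel_measurable (F (\<tau> i))" using Z by (auto intro: measurable_F_mono)
      then have "(\<lambda>\<omega>. Z \<omega> * c i \<omega>) \<in> borel_measurable (F (\<tau> i))" using B(4) by measurable
      from increment_moments(2)[OF B(1-3) this iZ] i1 False show ?thesis by (simp add: mult.assoc)
    next
      case True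
      then have cr: "c i \<in> borel_measurable (F r)" using B(4) by (auto intro: measurable_F_mono)
      show ?thesis
      proof (cases "\<tau> (Suc i) \<le> r")
        case True
        then show ?thesis using i1 \<open>\<tau> i \<le> r\<close> by (simp add: min_absorb1)
      next
        case False
        then have Sr: "r \<le> \<tau> (Suc i)" by simp
        have Zc: "(\<lambda>\<omega>. Z \<omega> * c i \<omega>) \<in> borel_measurable (F r)" using Z cr by measurable
        note m = increment_moments(1,2)[OF r(1) Sr B(3) Zc iZ]
        \<comment> \<open>This interval straddles \<open>r\<close>. The piece cut off is an
          increment after \<open>r\<close> with the \<open>F r\<close>-measurable factor
          \<open>Z * c i\<close>, hence of mean zero.\<close>
        have eq: "(\<lambda>\<omega>. Z \<omega> * ?D' i \<omega>) = (\<lambda>\<omega>. Z \<omega> * ?D i \<omega> - Z \<omega> * c i \<omega> * (W (\<tau> (Suc i)) \<omega> - W r \<omega>))"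
          using True Sr by (simp add: min_absorb1 min_absorb2 algebra_simps)
        show ?thesis unfolding eq using i1 m by simp
      qed
    qed
  qed
  have "expectation (\<lambda>\<omega>. Z \<omega> * simple_integral W n \<tau> c \<omega>) = (\<Sum>i<n. expectation (\<lambda>\<omega>. Z \<omega> * ?D i \<omega>))"
    unfolding simple_integral_def sum_distrib_left using i by (intro Bochner_Integration.integral_sum) simp
  also have "\<dots> = (\<Sum>i<n. expectation (\<lambda>\<omega>. Z \<omega> * ?D' i \<omega>))" using i by (intro sum.cong) auto
  also have "\<dots> = expectation (\<lambda>\<omega>. Z \<omega> * simple_integral W n ?\<tau> ?c \<omega>)"
    unfolding simple_integral_def sum_distrib_left using i by (intro Bochner_Integration.integral_sum[symmetric]) simp
  finally show "expectation (\<lambda>\<omega>. Z \<omega> * simple_integral W n \<tau> c \<omega>)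
    = expectation (\<lambda>\<omega>. Z \<omega> * simple_integral W n ?\<tau> ?c \<omega>)" .
qed

section \<open>Passage to general integrands\<close>

definition ito_approximation where
  "ito_approximation f I n \<tau> c f0 \<longleftrightarrow> (\<forall>k::nat. simple_integrand M T F (n k) (\<tau> k) (c k)) \<and>
    (AE x in \<mu>. f (fst x) (snd x) = f0 x) \<and>
    L2_tendsto \<mu> (\<lambda>k x. simple_process (n k) (\<tau> k) (c k) (fst x) (snd x)) f0 \<and>
    L2_tendsto M (\<lambda>k. simple_integral W (n k) (\<tau> k) (c k)) I"

lemma ito_approximationD:
  assumes "ito_approximation f I n \<tau> c f0"
  shows "\<And>k. simple_integrand M T F (n k) (\<tau> k) (c k)" "AE x in \<mu>. f (fst x) (snd x) = f0 x"
    "L2_tendsto \<mu> (\<lambda>k x. simple_process (n k) (\<tau> k) (c k) (fst x) (snd x)) f0"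
    "L2_tendsto M (\<lambda>k. simple_integral W (n k) (\<tau> k) (c k)) I"
  using assms by (simp_all add: ito_approximation_def)

text \<open>The integrand \<open>f\<close> itself may fail to be measurable, being constrained only
  almost everywhere. \<open>f0\<close> is a jointly measurable version of it, so that Bochner
  integrals can be formed.\<close>

lemma has_ito_integral_approximation:
  assumes "has_ito_integral M T W f I"
  shows "\<exists>n \<tau> c f0. ito_approximation f I n \<tau> c f0"
proof -
  obtain n \<tau> c where s: "\<And>k::nat. simple_integrand M T F (n k) (\<tau> k) (c k)"
    and 1: "(\<lambda>k. \<integral>\<^sup>+(s, \<omega>). ennreal ((simple_process (n k) (\<tau> k) (c k) s \<omega> - f s \<omega>)\<^sup>2) \<partial>\<mu>) \<longlonglongrightarrow> 0"
    and 2: "(\<lambda>k. \<integral>\<^sup>+\<omega>. ennreal ((simple_integral W (n k) (\<tau> k) (c k) \<omega> - I \<omega>)\<^sup>2) \<partial>M) \<longlonglongrightarrow> 0"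
  proof -
    have "\<exists>n \<tau> c. (\<forall>k::nat. simple_integrand M T F (n k) (\<tau> k) (c k)) \<and>
        (\<lambda>k. \<integral>\<^sup>+(s, \<omega>). ennreal ((simple_process (n k) (\<tau> k) (c k) s \<omega> - f s \<omega>)\<^sup>2) \<partial>\<mu>) \<longlonglongrightarrow> 0 \<and>
        (\<lambda>k. \<integral>\<^sup>+\<omega>. ennreal ((simple_integral W (n k) (\<tau> k) (c k) \<omega> - I \<omega>)\<^sup>2) \<partial>M) \<longlonglongrightarrow> 0"
      using assms unfolding has_ito_integral_def by (elim conjE)
    then show ?thesis by (elim exE conjE) (rule that, simp_all)
  qed
  from assms obtain g where g: "g \<in> M2 M T F" "AE (s, \<omega>) in \<mu>. f s \<omega> = g s \<omega>"
    unfolding has_ito_integral_def by blast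
  let ?f0 = "\<lambda>(s, \<omega>). g s \<omega>"
  have AE: "AE x in \<mu>. f (fst x) (snd x) = ?f0 x" using g(2) by (simp add: case_prod_beta)
  have m: "?f0 \<in> borel_measurable \<mu>" using g(1) by (simp add: M2_def)
  have eq: "(\<integral>\<^sup>+(s, \<omega>). ennreal ((simple_process (n k) (\<tau> k) (c k) s \<omega> - f s \<omega>)\<^sup>2) \<partial>\<mu>)
      = (\<integral>\<^sup>+x. ennreal ((simple_process (n k) (\<tau> k) (c k) (fst x) (snd x) - ?f0 x)\<^sup>2) \<partial>\<mu>)" for k
    using AE by (intro nn_integral_cong_AE) (auto simp: case_prod_beta)
  have "ito_approximation f I n \<tau> c ?f0"
    unfolding ito_approximation_def
  proof (intro conjI allI s AE)
    show "L2_tendsto \<mu> (\<lambda>k x. simple_process (n k) (\<tau> k) (c k) (fst x) (snd x)) ?f0"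
    proof (rule L2_tendstoI_nn)
      show "square_integrable \<mu> (\<lambda>x. simple_process (n k) (\<tau> k) (c k) (fst x) (snd x))" for k
        using simple_process_square_integrable[OF s] unfolding case_prod_beta .
    qed (use m 1 eq in auto)
    show "L2_tendsto M (\<lambda>k. simple_integral W (n k) (\<tau> k) (c k)) I"
      using simple_integral_square_integrable[OF s] 2 assms
      by (intro L2_tendstoI_nn) (simp_all add: has_ito_integral_def)
  qed
  then show ?thesis by blast
qed

lemma has_ito_integral_square_integrable:
  "has_ito_integral M T W f I \<Longrightarrow> square_integrable M I"
  using has_ito_integral_approximation ito_approximationD(4) unfolding L2_tendsto_def by blast

lemma L2_tendsto_unique_AE:
  assumes "L2_tendsto N h f" "AE x in N. f x = g x" "g \<in> borel_measurable N"
  shows "L2_tendsto N h g"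
proof -
  have f: "square_integrable N f" "\<And>k. square_integrable N (h k)" using assms(1) by (auto simp: L2_tendsto_def)
  then have g: "square_integrable N g" using square_integrable_cong_AE assms by blast
  have "(\<integral>x. (h k x - g x)\<^sup>2 \<partial>N) = (\<integral>x. (h k x - f x)\<^sup>2 \<partial>N)" for k
    using f(1) f(2)[of k] g assms(2) by (intro integral_cong_AE) auto
  with assms(1) f g show ?thesis by (simp add: L2_tendsto_def)
qed

lemma ito_isometry:
  assumes f: "has_ito_integral M T W f I" "AE x in \<mu>. f (fst x) (snd x) = f0 x" "f0 \<in> borel_measurable \<mu>"
    and g: "has_ito_integral M T W g J" "AE x in \<mu>. g (fst x) (snd x) = g0 x" "g0 \<in> borel_measurable \<mu>"
  shows "expectation (\<lambda>\<omega>. I \<omega> * J \<omega>) = (\<integral>x. f0 x * g0 x \<partial>\<mu>)"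
proof -
  obtain n \<tau> c f1 where F0: "ito_approximation f I n \<tau> c f1"
    using has_ito_integral_approximation[OF f(1)] by blast
  note F = ito_approximationD[OF F0]
  obtain n' \<tau>' c' g1 where G0: "ito_approximation g J n' \<tau>' c' g1"
    using has_ito_integral_approximation[OF g(1)] by blast
  note G = ito_approximationD[OF G0]
  have "AE x in \<mu>. f1 x = f0 x" using F(2) f(2) by eventually_elim simp
  from L2_tendsto_unique_AE[OF F(3) this f(3)]
  have f0: "L2_tendsto \<mu> (\<lambda>k x. simple_process (n k) (\<tau> k) (c k) (fst x) (snd x)) f0" .
  have "AE x in \<mu>. g1 x = g0 x" using G(2) g(2) by eventually_elim simp
  from L2_tendsto_unique_AE[OF G(3) this g(3)]
  have g0: "L2_tendsto \<mu> (\<lambda>k x. simple_process (n' k) (\<tau>' k) (c' k) (fst x) (snd x)) g0" .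
  have "(\<lambda>k. expectation (\<lambda>\<omega>. simple_integral W (n k) (\<tau> k) (c k) \<omega> * simple_integral W (n' k) (\<tau>' k) (c' k) \<omega>))
      \<longlonglongrightarrow> (\<integral>x. f0 x * g0 x \<partial>\<mu>)"
    using L2_tendsto_inner[OF f0 g0] unfolding simple_isometry[OF F(1) G(1)] case_prod_beta .
  with L2_tendsto_inner[OF F(4) G(4)] show ?thesis by (rule LIMSEQ_unique)
qed

text \<open>Truncating at \<open>r\<close> leaves the expectations against \<open>Z\<close>
  unchanged and makes both approximating sequences converge to the same process. By the isometry the
  truncated simple integrals then differ by a null sequence in mean square, so \<open>Z\<close> sees
  the same limit on both sides.\<close>

lemma ito_integral_past_bounded:
  assumes f: "has_ito_integral M T W f I" and g: "has_ito_integral M T W g J"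
    and r: "0 \<le> r" "r \<le> T" and fg: "AE x in \<mu>. fst x \<le> r \<longrightarrow> f (fst x) (snd x) = g (fst x) (snd x)"
    and Z: "Z \<in> borel_measurable (F r)" "\<And>\<omega>. \<omega> \<in> space M \<Longrightarrow> \<bar>Z \<omega>\<bar> \<le> K"
  shows "expectation (\<lambda>\<omega>. Z \<omega> * I \<omega>) = expectation (\<lambda>\<omega>. Z \<omega> * J \<omega>)"
proof -
  obtain n \<tau> c f0 where F0: "ito_approximation f I n \<tau> c f0"
    using has_ito_integral_approximation[OF f] by blast
  note F = ito_approximationD[OF F0]
  obtain n' \<tau>' c' g0 where G0: "ito_approximation g J n' \<tau>' c' g0"
    using has_ito_integral_approximation[OF g] by blast
  note G = ito_approximationD[OF G0]
  have "\<exists>\<tau>' c'. simple_integrand M T F (n k) \<tau>' c' \<and>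
    (\<forall>s \<omega>. simple_process (n k) \<tau>' c' s \<omega> = indicator {..r} s * simple_process (n k) (\<tau> k) (c k) s \<omega>) \<and>
    expectation (\<lambda>\<omega>. Z \<omega> * simple_integral W (n k) (\<tau> k) (c k) \<omega>) = expectation (\<lambda>\<omega>. Z \<omega> * simple_integral W (n k) \<tau>' c' \<omega>)" for k
    by (rule simple_truncate[OF F(1)[of k] r]) (use Z in blast)
  then obtain \<sigma> d where F': "\<And>k. simple_integrand M T F (n k) (\<sigma> k) (d k)"
    "\<And>k s \<omega>. simple_process (n k) (\<sigma> k) (d k) s \<omega> = indicator {..r} s * simple_process (n k) (\<tau> k) (c k) s \<omega>"
    "\<And>k. expectation (\<lambda>\<omega>. Z \<omega> * simple_integral W (n k) (\<tau> k) (c k) \<omega>) = expectation (\<lambda>\<omega>. Z \<omega> * simple_integral W (n k) (\<sigma> k) (d k) \<omega>)"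
    by metis
  have "\<exists>\<tau>'' c''. simple_integrand M T F (n' k) \<tau>'' c'' \<and>
    (\<forall>s \<omega>. simple_process (n' k) \<tau>'' c'' s \<omega> = indicator {..r} s * simple_process (n' k) (\<tau>' k) (c' k) s \<omega>) \<and>
    expectation (\<lambda>\<omega>. Z \<omega> * simple_integral W (n' k) (\<tau>' k) (c' k) \<omega>) = expectation (\<lambda>\<omega>. Z \<omega> * simple_integral W (n' k) \<tau>'' c'' \<omega>)" for k
    by (rule simple_truncate[OF G(1)[of k] r]) (use Z in blast)
  then obtain \<sigma>' d' where G': "\<And>k. simple_integrand M T F (n' k) (\<sigma>' k) (d' k)"
    "\<And>k s \<omega>. simple_process (n' k) (\<sigma>' k) (d' k) s \<omega> = indicator {..r} s * simple_process (n' k) (\<tau>' k) (c' k) s \<omega>"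
    "\<And>k. expectation (\<lambda>\<omega>. Z \<omega> * simple_integral W (n' k) (\<tau>' k) (c' k) \<omega>) = expectation (\<lambda>\<omega>. Z \<omega> * simple_integral W (n' k) (\<sigma>' k) (d' k) \<omega>)"
    by metis
  define A where "A = {x \<in> space \<mu>. fst x \<le> r}"
  have "fst \<in> borel_measurable \<mu>"
    unfolding dt_dP_def by (rule measurable_compose[OF measurable_fst measurable_restrict_space1]) simp
  then have A: "A \<in> sets \<mu>" unfolding A_def by measurable
  have ind: "indicator A x = (indicator {..r} (fst x) :: real)" if "x \<in> space \<mu>" for x
    using that by (simp add: A_def indicator_def)
  let ?p = "\<lambda>k x. simple_process (n k) (\<sigma> k) (d k) (fst x) (snd x)"
  let ?p' = "\<lambda>k x. simple_process (n' k) (\<sigma>' k) (d' k) (fst x) (snd x)"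
  let ?i = "\<lambda>k. simple_integral W (n k) (\<sigma> k) (d k)" and ?i' = "\<lambda>k. simple_integral W (n' k) (\<sigma>' k) (d' k)"
  have cong: "L2_tendsto \<mu> h f" if "L2_tendsto \<mu> h' f" "\<And>k x. x \<in> space \<mu> \<Longrightarrow> h k x = h' k x" for h h' f
  proof -
    have "(\<integral>x. (h k x - f x)\<^sup>2 \<partial>\<mu>) = (\<integral>x. (h' k x - f x)\<^sup>2 \<partial>\<mu>)" for k
      using that(2) by (intro Bochner_Integration.integral_cong) auto
    moreover have "square_integrable \<mu> (h k)" if "square_integrable \<mu> (h' k)" for k
      using that \<open>\<And>k x. x \<in> space \<mu> \<Longrightarrow> h k x = h' k x\<close> measurable_cong[of \<mu> "h k" "h' k"]
        Bochner_Integration.integrable_cong[of \<mu> \<mu> "\<lambda>x. (norm (h k x))\<^sup>2" "\<lambda>x. (norm (h' k x))\<^sup>2"]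
      by (simp add: square_integrable_def)
    ultimately show ?thesis using that(1) by (simp add: L2_tendsto_def)
  qed
  have lp: "L2_tendsto \<mu> ?p (\<lambda>x. indicator A x * f0 x)"
    by (rule cong[OF L2_tendsto_indicator[OF F(3) A]]) (simp add: F'(2) ind)
  have "L2_tendsto \<mu> ?p' (\<lambda>x. indicator A x * g0 x)"
    by (rule cong[OF L2_tendsto_indicator[OF G(3) A]]) (simp add: G'(2) ind)
  moreover have "AE x in \<mu>. indicator A x * g0 x = indicator A x * f0 x"
    using F(2) G(2) fg by eventually_elim (auto simp: A_def indicator_def)
  ultimately have lp': "L2_tendsto \<mu> ?p' (\<lambda>x. indicator A x * f0 x)"
    by (rule L2_tendsto_unique_AE) (use lp in \<open>simp add: L2_tendsto_def square_integrable_def\<close>)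
  \<comment> \<open>The limits of the truncated integrals need not be identified: their three mutual
    inner products converge to the common value \<open>e\<close>, so the mean square of the
    difference tends to \<open>e - 2 * e + e = 0\<close>.\<close>
  define e where "e = (\<integral>x. (indicator A x * f0 x) * (indicator A x * f0 x) \<partial>\<mu>)"
  have lim: "(\<lambda>k. expectation (\<lambda>\<omega>. ?i k \<omega> * ?i k \<omega>)) \<longlonglongrightarrow> e"
    "(\<lambda>k. expectation (\<lambda>\<omega>. ?i k \<omega> * ?i' k \<omega>)) \<longlonglongrightarrow> e"
    "(\<lambda>k. expectation (\<lambda>\<omega>. ?i' k \<omega> * ?i' k \<omega>)) \<longlonglongrightarrow> e"
    using L2_tendsto_inner[OF lp lp] L2_tendsto_inner[OF lp lp'] L2_tendsto_inner[OF lp' lp']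
    unfolding e_def simple_isometry[OF F'(1) F'(1)] simple_isometry[OF F'(1) G'(1)] simple_isometry[OF G'(1) G'(1)]
      case_prod_beta by auto
  have si: "square_integrable M (?i k)" "square_integrable M (?i' k)" for k
    by (rule simple_integral_square_integrable[OF F'(1)], rule simple_integral_square_integrable[OF G'(1)])
  have diff: "expectation (\<lambda>\<omega>. (?i k \<omega> - ?i' k \<omega> - 0)\<^sup>2) = expectation (\<lambda>\<omega>. ?i k \<omega> * ?i k \<omega>)
      - 2 * expectation (\<lambda>\<omega>. ?i k \<omega> * ?i' k \<omega>) + expectation (\<lambda>\<omega>. ?i' k \<omega> * ?i' k \<omega>)" for k
  proof -
    have "(\<lambda>\<omega>. (?i k \<omega> - ?i' k \<omega> - 0)\<^sup>2) = (\<lambda>\<omega>. ?i k \<omega> * ?i k \<omega> - 2 * (?i k \<omega> * ?i' k \<omega>) + ?i' k \<omega> * ?i' k \<omega>)"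
      by (simp add: power2_eq_square algebra_simps)
    then show ?thesis
      using square_integrable_mult_integrable[OF si(1) si(1), of k k] square_integrable_mult_integrable[OF si, of k k]
        square_integrable_mult_integrable[OF si(2) si(2), of k k] by simp
  qed
  have "(\<lambda>k. expectation (\<lambda>\<omega>. (?i k \<omega> - ?i' k \<omega> - 0)\<^sup>2)) \<longlonglongrightarrow> e - 2 * e + e"
    unfolding diff by (intro tendsto_intros lim)
  then have D: "L2_tendsto M (\<lambda>k \<omega>. ?i k \<omega> - ?i' k \<omega>) (\<lambda>_. 0)"
    using si by (simp add: L2_tendsto_def square_integrable_diff square_integrable_const finite_measure_axioms)
  have ZM: "square_integrable M Z"
    by (rule square_integrableI_bound[OF square_integrable_const[OF finite_measure_axioms, of K]])
      (use Z measurable_F_M[OF Z(1) r(2)] in \<open>auto intro!: AE_I2 order_trans[OF _ abs_ge_self]\<close>)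
  have "(\<lambda>k. expectation (\<lambda>\<omega>. Z \<omega> * (?i k \<omega> - ?i' k \<omega>))) \<longlonglongrightarrow> 0"
    using L2_tendsto_inner[OF L2_tendsto_const[OF ZM] D] by simp
  moreover have "expectation (\<lambda>\<omega>. Z \<omega> * (?i k \<omega> - ?i' k \<omega>)) = expectation (\<lambda>\<omega>. Z \<omega> * ?i k \<omega>) - expectation (\<lambda>\<omega>. Z \<omega> * ?i' k \<omega>)" for k
    unfolding right_diff_distrib
    by (intro Bochner_Integration.integral_diff square_integrable_mult_integrable ZM si)
  moreover have "(\<lambda>k. expectation (\<lambda>\<omega>. Z \<omega> * ?i k \<omega>) - expectation (\<lambda>\<omega>. Z \<omega> * ?i' k \<omega>))
      \<longlonglongrightarrow> expectation (\<lambda>\<omega>. Z \<omega> * I \<omega>) - expectation (\<lambda>\<omega>. Z \<omega> * J \<omega>)"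
    unfolding F'(3)[symmetric] G'(3)[symmetric]
    by (intro tendsto_diff L2_tendsto_inner[OF L2_tendsto_const[OF ZM]] F(4) G(4))
  ultimately have "expectation (\<lambda>\<omega>. Z \<omega> * I \<omega>) - expectation (\<lambda>\<omega>. Z \<omega> * J \<omega>) = 0"
    using LIMSEQ_unique by fastforce
  then show ?thesis by simp
qed

text \<open>\<open>Z\<close> is set to zero where its modulus exceeds \<open>n\<close>, and
  dominated convergence removes the cut-off. With the zero integrand for \<open>g\<close> the
  statement says that integrals over times after \<open>r\<close> are orthogonal to
  \<open>F r\<close>; with a truncated integrand it is the martingale property.\<close>

lemma ito_integral_past:
  assumes f: "has_ito_integral M T W f I" and g: "has_ito_integral M T W g J"
    and r: "0 \<le> r" "r \<le> T" and fg: "AE x in \<mu>. fst x \<le> r \<longrightarrow> f (fst x) (snd x) = g (fst x) (snd x)"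
    and Z: "Z \<in> borel_measurable (F r)" "square_integrable M Z"
  shows "expectation (\<lambda>\<omega>. Z \<omega> * I \<omega>) = expectation (\<lambda>\<omega>. Z \<omega> * J \<omega>)"
proof -
  define Zn where "Zn n \<omega> = (if \<bar>Z \<omega>\<bar> \<le> real n then Z \<omega> else 0)" for n \<omega>
  have lim: "(\<lambda>n. expectation (\<lambda>\<omega>. Zn n \<omega> * I \<omega>)) \<longlonglongrightarrow> expectation (\<lambda>\<omega>. Z \<omega> * I \<omega>)" if "square_integrable M I" for I
  proof (rule integral_dominated_convergence)
    show "integrable M (\<lambda>\<omega>. norm (Z \<omega> * I \<omega>))"
      by (intro integrable_norm square_integrable_mult_integrable Z that)
    show "(\<lambda>\<omega>. Z \<omega> * I \<omega>) \<in> borel_measurable M" using Z(2) that by measurable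
    show "(\<lambda>\<omega>. Zn n \<omega> * I \<omega>) \<in> borel_measurable M" for n unfolding Zn_def using Z(2) that by measurable
    show "AE \<omega> in M. norm (Zn n \<omega> * I \<omega>) \<le> norm (Z \<omega> * I \<omega>)" for n by (simp add: Zn_def)
    show "AE \<omega> in M. (\<lambda>n. Zn n \<omega> * I \<omega>) \<longlonglongrightarrow> Z \<omega> * I \<omega>"
    proof (rule AE_I2)
      fix \<omega>
      obtain N :: nat where "\<bar>Z \<omega>\<bar> \<le> real N" using real_arch_simple by blast
      then have "eventually (\<lambda>n. Z \<omega> * I \<omega> = Zn n \<omega> * I \<omega>) sequentially"
        unfolding eventually_sequentially by (intro exI[of _ N]) (auto simp: Zn_def)
      then show "(\<lambda>n. Zn n \<omega> * I \<omega>) \<longlonglongrightarrow> Z \<omega> * I \<omega>" by (rule Lim_transform_eventually[OF tendsto_const])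
    qed
  qed
  have "Zn n \<in> borel_measurable (F r)" for n unfolding Zn_def[abs_def] using Z(1) by measurable
  then have "expectation (\<lambda>\<omega>. Zn n \<omega> * I \<omega>) = expectation (\<lambda>\<omega>. Zn n \<omega> * J \<omega>)" for n
    by (rule ito_integral_past_bounded[OF f g r fg, of _ "real n"]) (simp add: Zn_def)
  then show ?thesis
    using LIMSEQ_unique[OF lim[OF has_ito_integral_square_integrable[OF f]]] lim[OF has_ito_integral_square_integrable[OF g]]
    by simp
qed

lemma has_ito_integral_zero: "has_ito_integral M T W (\<lambda>_ _. 0) (\<lambda>_. 0)"
proof -
  have [simp]: "(\<lambda>(s::real, \<omega>::'w). 0::ennreal) = (\<lambda>_. 0)" by auto
  have 0: "(\<lambda>_ _. 0) \<in> M2 M T F" by (simp add: M2_def adapted_def)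
  have "simple_integrand M T F 0 (\<lambda>_. 0) (\<lambda>_ _. 0)" using T_pos by (simp add: simple_integrand_def)
  then show ?thesis unfolding has_ito_integral_def using 0
    by (intro conjI bexI[OF _ 0] exI[of _ "\<lambda>_. 0"] exI[of _ "\<lambda>_ _. 0"] exI[of _ "\<lambda>_ _ _. 0"])
      (simp_all add: simple_process_def simple_integral_def case_prod_beta)
qed

end

section \<open>The product rule\<close>

text \<open>This is how completeness enters: an expression built from arbitrary versions is
  measurable as soon as it agrees almost everywhere with a measurable one.\<close>

lemma borel_measurable_AE_eq:
  assumes N: "complete_measure N" and g: "g \<in> borel_measurable N" and fg: "AE x in N. f x = g x"
  shows "f \<in> borel_measurable N"
proof (rule measurableI)
  have "\<exists>Z. Z \<in> null_sets N \<and> {x\<in>space N. \<not> f x = g x} \<subseteq> Z"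
    using eventually_ae_filter[THEN iffD1, OF fg] by (simp only: Bex_def)
  then obtain Z where "Z \<in> null_sets N \<and> {x\<in>space N. \<not> f x = g x} \<subseteq> Z" ..
  then have Z: "{x\<in>space N. \<not> f x = g x} \<subseteq> Z" "Z \<in> null_sets N" by simp_all
  fix B assume B: "B \<in> sets (borel :: 'b measure)"
  have eq: "f -` B \<inter> space N = (g -` B \<inter> space N - Z) \<union> (f -` B \<inter> space N \<inter> Z)" using Z(1) by auto
  have "f -` B \<inter> space N \<inter> Z \<in> sets N"
    using complete_measure.complete[OF N _ Z(2)] by blast
  then show "f -` B \<inter> space N \<in> sets N"
    by (subst eq) (intro sets.Un sets.Diff measurable_sets[OF g B] null_setsD2[OF Z(2)])
qed simp

context wiener
begin

section \<open>Time integrals, sections and null sets of the product space\<close>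

lemma AE_L_iff: "(AE s in L. P s) \<longleftrightarrow> (AE s in lborel. s \<in> {0..T} \<longrightarrow> P s)"
  by (rule AE_restrict_space_iff) simp

text \<open>The equations integrate over completed Lebesgue measure, whereas Fubini is applied over
  \<open>L\<close>. For integrands with a measurable version the two integrals coincide.\<close>

lemma set_integral_lebesgue_L:
  fixes f :: "real \<Rightarrow> real"
  assumes f': "f' \<in> borel_measurable L" and ff': "AE s in L. f s = f' s" and ab: "0 \<le> a" "b \<le> T"
  shows "(LINT s:{a..b}|lebesgue. f s) = (\<integral>s. indicator {a..b} s * f' s \<partial>L)"
proof -
  define h where "h s = indicator {0..T} s *\<^sub>R (indicator {a..b} s * f' s)" for s
  have "(\<lambda>s. indicator {a..b} s * f' s) \<in> borel_measurable L"
    by (intro borel_measurable_times[OF measurable_restrict_space1 f']) simp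
  then have h: "h \<in> borel_measurable lborel"
    unfolding h_def by (subst (asm) borel_measurable_restrict_space_iff) auto
  have "(\<integral>s. indicator {a..b} s * f' s \<partial>L) = integral\<^sup>L lborel h"
    unfolding h_def by (subst integral_restrict_space) auto
  also have "\<dots> = integral\<^sup>L lebesgue h" using h by (rule integral_completion[symmetric])
  also have "\<dots> = (LINT s:{a..b}|lebesgue. f s)"
    unfolding set_lebesgue_integral_def
  proof (rule integral_cong_AE)
    show hl: "h \<in> borel_measurable lebesgue" using h by (rule measurable_completion)
    have "AE s in lborel. indicator {a..b} s *\<^sub>R f s = h s"
      using ff' unfolding AE_L_iff by eventually_elim (use ab in \<open>auto simp: h_def indicator_def\<close>)
    then have AE: "AE s in lebesgue. indicator {a..b} s *\<^sub>R f s = h s" by (rule AE_completion)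
    show "(\<lambda>s. indicator {a..b} s *\<^sub>R f s) \<in> borel_measurable lebesgue"
      by (rule borel_measurable_AE_eq[OF completion.complete_measure_axioms hl AE])
    show "AE s in lebesgue. h s = indicator {a..b} s *\<^sub>R f s" using AE by eventually_elim simp
  qed
  finally show ?thesis ..
qed

lemma has_ito_integral_cong:
  assumes I: "has_ito_integral M T W f I" and J: "J \<in> borel_measurable M" "AE \<omega> in M. I \<omega> = J \<omega>"
  shows "has_ito_integral M T W f J"
proof -
  have "(\<integral>\<^sup>+\<omega>. ennreal ((h \<omega> - I \<omega>)\<^sup>2) \<partial>M) = (\<integral>\<^sup>+\<omega>. ennreal ((h \<omega> - J \<omega>)\<^sup>2) \<partial>M)" for h
    using J(2) by (intro nn_integral_cong_AE) auto
  then show ?thesis using I J(1) unfolding has_ito_integral_def by simp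
qed

lemma AE_mu_snd: "AE \<omega> in M. P \<omega> \<Longrightarrow> AE x in \<mu>. P (snd x)"
proof -
  assume "AE \<omega> in M. P \<omega>"
  from AE_E3[OF this] obtain N where N: "\<And>\<omega>. \<omega> \<in> space M - N \<Longrightarrow> P \<omega>" "N \<in> null_sets M" by blast
  have "emeasure \<mu> (space L \<times> N) = emeasure L (space L) * emeasure M N"
    unfolding dt_dP_def by (rule emeasure_pair_measure_Times[OF sets.top null_setsD2[OF N(2)]])
  moreover have "space L \<times> N \<in> sets \<mu>" unfolding dt_dP_def by (rule pair_measureI[OF sets.top null_setsD2[OF N(2)]])
  ultimately have "space L \<times> N \<in> null_sets \<mu>" using N(2) by (intro null_setsI) auto
  then have "AE x in \<mu>. x \<notin> space L \<times> N" by (rule AE_not_in)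
  then show ?thesis using AE_space
  proof eventually_elim
    case (elim x)
    then have "snd x \<in> space M - N" by (auto simp: dt_dP_def space_pair_measure mem_Times_iff)
    then show ?case by (rule N(1))
  qed
qed

lemma AE_mu_fst: "AE s in L. P s \<Longrightarrow> AE x in \<mu>. P (fst x)"
proof -
  assume "AE s in L. P s"
  from AE_E3[OF this] obtain N where N: "\<And>s. s \<in> space L - N \<Longrightarrow> P s" "N \<in> null_sets L" by blast
  have "emeasure \<mu> (N \<times> space M) = emeasure L N * emeasure M (space M)"
    unfolding dt_dP_def by (rule emeasure_pair_measure_Times[OF null_setsD2[OF N(2)] sets.top])
  moreover have "N \<times> space M \<in> sets \<mu>" unfolding dt_dP_def by (rule pair_measureI[OF null_setsD2[OF N(2)] sets.top])
  ultimately have "N \<times> space M \<in> null_sets \<mu>" using N(2) by (intro null_setsI) auto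
  then have "AE x in \<mu>. x \<notin> N \<times> space M" by (rule AE_not_in)
  then show ?thesis using AE_space
  proof eventually_elim
    case (elim x)
    then have "fst x \<in> space L - N" by (auto simp: dt_dP_def space_pair_measure mem_Times_iff)
    then show ?case by (rule N(1))
  qed
qed

lemma AE_mu_sections: "AE x in \<mu>. P x \<Longrightarrow> AE s in L. AE \<omega> in M. P (s, \<omega>)"
  unfolding dt_dP_def by (rule pair_sigma_finite.AE_pair[OF pair_sigma_finite_LM])

lemma AE_mu_sections':
  assumes "AE x in \<mu>. P x" shows "AE \<omega> in M. AE s in L. P (s, \<omega>)"
proof -
  interpret P: pair_sigma_finite L M by (rule pair_sigma_finite_LM)
  interpret Q: pair_sigma_finite M L by unfold_locales
  \<comment> \<open>The exceptional set is enlarged to a measurable null set, because the two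
    almost-everywhere quantifiers are exchanged for measurable predicates.\<close>
  from AE_E3[OF assms] obtain N where N: "N \<in> null_sets \<mu>" "\<And>x. x \<in> space \<mu> - N \<Longrightarrow> P x" by blast
  have *: "{x \<in> space \<mu>. x \<notin> N} \<in> sets \<mu>" using N(1) by auto
  have "AE x in L \<Otimes>\<^sub>M M. x \<notin> N" using N(1) AE_not_in unfolding dt_dP_def by blast
  then have "AE s in L. AE \<omega> in M. (s, \<omega>) \<notin> N" by (rule P.AE_pair)
  then have "AE \<omega> in M. AE s in L. (s, \<omega>) \<notin> N"
    using P.AE_commute[of "\<lambda>s \<omega>. (s, \<omega>) \<notin> N"] * by (simp add: dt_dP_def)
  moreover have "AE \<omega> in M. (AE s in L. (s, \<omega>) \<notin> N) \<longrightarrow> (AE s in L. P (s, \<omega>))"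
  proof (rule AE_I2, rule impI)
    fix \<omega> assume w: "\<omega> \<in> space M" "AE s in L. (s, \<omega>) \<notin> N"
    show "AE s in L. P (s, \<omega>)"
      using w(2) AE_space
    proof eventually_elim
      case (elim s)
      then have "(s, \<omega>) \<in> space \<mu> - N" using w(1) by (simp add: dt_dP_def space_pair_measure)
      then show ?case by (rule N(2))
    qed
  qed
  ultimately show ?thesis by (rule AE_mp)
qed

lemma measurable_mu_fst: "f \<in> borel_measurable L \<Longrightarrow> (\<lambda>x. f (fst x)) \<in> borel_measurable \<mu>"
  unfolding dt_dP_def by (rule measurable_compose[OF measurable_fst])

lemma measurable_mu_snd: "f \<in> borel_measurable M \<Longrightarrow> (\<lambda>x. f (snd x)) \<in> borel_measurable \<mu>"
  unfolding dt_dP_def by (rule measurable_compose[OF measurable_snd])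

lemma measurable_mu_section:
  "f \<in> borel_measurable \<mu> \<Longrightarrow> s \<in> {0..T} \<Longrightarrow> (\<lambda>\<omega>. f (s, \<omega>)) \<in> borel_measurable M"
  unfolding dt_dP_def by (rule measurable_compose[OF measurable_Pair1']) (simp_all add: space_restrict_space)

lemma measurable_mu_section':
  "f \<in> borel_measurable \<mu> \<Longrightarrow> \<omega> \<in> space M \<Longrightarrow> (\<lambda>s. f (s, \<omega>)) \<in> borel_measurable L"
  unfolding dt_dP_def by (rule measurable_compose[OF measurable_Pair2'])

lemma square_integrable_mu_snd:
  fixes f :: "'w \<Rightarrow> 'b::{banach, second_countable_topology}"
  assumes f: "square_integrable M f" shows "square_integrable \<mu> (\<lambda>x. f (snd x))"
  unfolding square_integrable_nn
proof
  show m: "(\<lambda>x. f (snd x)) \<in> borel_measurable \<mu>" using f by (intro measurable_mu_snd) (simp add: square_integrable_def)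
  interpret L: finite_measure L by (rule finite_measure_L)
  have "(\<integral>\<^sup>+x. ennreal ((norm (f (snd x)))\<^sup>2) \<partial>\<mu>) = (\<integral>\<^sup>+s. (\<integral>\<^sup>+\<omega>. ennreal ((norm (f \<omega>))\<^sup>2) \<partial>M) \<partial>L)"
    using m unfolding dt_dP_def by (subst nn_integral_fst[symmetric]) auto
  also have "\<dots> < \<infinity>"
    using f L.emeasure_finite[of "{0..T}", unfolded infinity_ennreal_def less_top]
    by (simp del: L.emeasure_finite add: square_integrable_nn ennreal_mult_less_top)
  finally show "(\<integral>\<^sup>+x. ennreal ((norm (f (snd x)))\<^sup>2) \<partial>\<mu>) < \<infinity>" .
qed

lemma square_integrable_mu_sections:
  fixes f :: "real \<times> 'w \<Rightarrow> 'b::{banach, second_countable_topology}"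
  assumes f: "square_integrable \<mu> f"
  shows "AE s in L. square_integrable M (\<lambda>\<omega>. f (s, \<omega>))" "AE \<omega> in M. square_integrable L (\<lambda>s. f (s, \<omega>))"
proof -
  interpret P: pair_sigma_finite L M by (rule pair_sigma_finite_LM)
  interpret Q: pair_sigma_finite M L by unfold_locales
  have i: "integrable (L \<Otimes>\<^sub>M M) (\<lambda>x. (norm (f x))\<^sup>2)" using f by (simp add: square_integrable_def dt_dP_def)
  have m: "f \<in> borel_measurable \<mu>" using f by (simp add: square_integrable_def)
  show "AE s in L. square_integrable M (\<lambda>\<omega>. f (s, \<omega>))"
    using P.AE_integrable_fst'[OF i] AE_space
    by eventually_elim (simp add: square_integrable_def measurable_mu_section[OF m] space_restrict_space)
  have "integrable (M \<Otimes>\<^sub>M L) (\<lambda>(y, x). (norm (f (x, y)))\<^sup>2)"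
    using P.integrable_product_swap[OF i] .
  then have "AE \<omega> in M. integrable L (\<lambda>s. (norm (f (s, \<omega>)))\<^sup>2)"
    using Q.AE_integrable_fst'[of "\<lambda>(y, x). (norm (f (x, y)))\<^sup>2"] by simp
  then show "AE \<omega> in M. square_integrable L (\<lambda>s. f (s, \<omega>))"
    using AE_space by eventually_elim (simp add: square_integrable_def measurable_mu_section'[OF m])
qed

lemma integral_mu_fst:
  fixes f :: "real \<times> 'w \<Rightarrow> real"
  assumes "integrable \<mu> f" shows "integral\<^sup>L \<mu> f = (\<integral>s. (\<integral>\<omega>. f (s, \<omega>) \<partial>M) \<partial>L)"
  using pair_sigma_finite.integral_fst'[OF pair_sigma_finite_LM, of f] assms by (simp add: dt_dP_def)

lemma integral_mu_snd:
  fixes f :: "real \<times> 'w \<Rightarrow> real"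
  assumes "integrable \<mu> f"
  shows "integral\<^sup>L \<mu> f = (\<integral>\<omega>. (\<integral>s. f (s, \<omega>) \<partial>L) \<partial>M)" "integrable M (\<lambda>\<omega>. \<integral>s. f (s, \<omega>) \<partial>L)"
  using pair_sigma_finite.integral_snd[OF pair_sigma_finite_LM, of "\<lambda>s \<omega>. f (s, \<omega>)"]
    pair_sigma_finite.integrable_snd[OF pair_sigma_finite_LM, of "\<lambda>s \<omega>. f (s, \<omega>)"] assms by (simp_all add: dt_dP_def)

text \<open>A general relation \<open>R\<close> serves both the integrals over \<open>[0, r]\<close>
  and those over \<open>[r, T]\<close>. By Cauchy-Schwarz in time they are dominated, for all
  \<open>r\<close> at once, by the square integrable variable \<open>\<beta>\<close>.\<close>

lemma partial_integral:
  fixes b :: "real \<times> 'w \<Rightarrow> real" and R :: "real \<Rightarrow> real \<Rightarrow> bool"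
  assumes b: "square_integrable \<mu> b" and R: "Measurable.pred (borel \<Otimes>\<^sub>M borel) (\<lambda>(s, r). R s r)"
  shows "square_integrable \<mu> (\<lambda>(r, \<omega>). \<integral>s. (if R s r then b (s, \<omega>) else 0) \<partial>L)"
    "\<And>r. r \<in> {0..T} \<Longrightarrow> square_integrable M (\<lambda>\<omega>. \<integral>s. (if R s r then b (s, \<omega>) else 0) \<partial>L)"
proof -
  interpret L: finite_measure L by (rule finite_measure_L)
  have bm: "b \<in> borel_measurable (L \<Otimes>\<^sub>M M)" using b by (simp add: square_integrable_def dt_dP_def)
  let ?B = "\<lambda>(r, \<omega>). \<integral>s. (if R s r then b (s, \<omega>) else 0) \<partial>L"
  have id: "(\<lambda>x. x) \<in> borel_measurable L" by (rule measurable_restrict_space1) simp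
  have m1: "(\<lambda>z. (snd z, fst (fst z))) \<in> measurable ((L \<Otimes>\<^sub>M M) \<Otimes>\<^sub>M L) (borel \<Otimes>\<^sub>M borel)"
    by (intro measurable_Pair measurable_compose[OF measurable_snd id]
        measurable_compose[OF measurable_fst measurable_compose[OF measurable_fst id]])
  have "Measurable.pred ((L \<Otimes>\<^sub>M M) \<Otimes>\<^sub>M L) (\<lambda>z. R (snd z) (fst (fst z)))"
    using measurable_compose[OF m1 R] by (simp add: comp_def)
  moreover have "(\<lambda>z. b (snd z, snd (fst z))) \<in> borel_measurable ((L \<Otimes>\<^sub>M M) \<Otimes>\<^sub>M L)"
    by (rule measurable_compose[OF _ bm]) simp
  ultimately have "(\<lambda>z. if R (snd z) (fst (fst z)) then b (snd z, snd (fst z)) else 0) \<in> borel_measurable ((L \<Otimes>\<^sub>M M) \<Otimes>\<^sub>M L)"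
    by measurable
  then have Bm: "?B \<in> borel_measurable \<mu>"
    unfolding dt_dP_def case_prod_beta
    by (intro L.borel_measurable_lebesgue_integral) (simp add: case_prod_beta)
  define \<beta> where "\<beta> \<omega> = sqrt (measure L (space L) * (\<integral>s. (b (s, \<omega>))\<^sup>2 \<partial>L))" for \<omega>
  have b2: "integrable \<mu> (\<lambda>x. (b x)\<^sup>2)" using b by (simp add: square_integrable_def)
  note s = integral_mu_snd(2)[OF b2]
  have \<beta>: "square_integrable M \<beta>"
    unfolding square_integrable_def \<beta>_def using s by (auto intro!: integrable_mult_right)
  have bound: "AE \<omega> in M. \<forall>r. \<bar>\<integral>s. (if R s r then b (s, \<omega>) else 0) \<partial>L\<bar> \<le> \<beta> \<omega>"
    using square_integrable_mu_sections(2)[OF b]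
  proof (rule AE_mp, intro AE_I2 impI allI)
    fix \<omega> and r :: real assume sq: "square_integrable L (\<lambda>s. b (s, \<omega>))"
    have "(\<lambda>s. (s, r)) \<in> measurable L (borel \<Otimes>\<^sub>M borel)" by (intro measurable_Pair id) simp
    from measurable_compose[OF this R] have Rm: "Measurable.pred L (\<lambda>s. R s r)" by simp
    define h where "h s = (if R s r then b (s, \<omega>) else 0)" for s
    have hm: "h \<in> borel_measurable L" unfolding h_def using Rm sq by measurable
    have h: "square_integrable L h" using sq hm by (rule square_integrableI_bound) (simp add: h_def)
    have "(integral\<^sup>L L h)\<^sup>2 \<le> (\<integral>s. 1\<^sup>2 \<partial>L) * (\<integral>s. (h s)\<^sup>2 \<partial>L)"
      using integral_Cauchy_Schwarz[OF square_integrable_const[OF finite_measure_L, of 1] h] by simp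
    also have "\<dots> \<le> measure L (space L) * (\<integral>s. (b (s, \<omega>))\<^sup>2 \<partial>L)"
    proof -
      have "(\<integral>s. (h s)\<^sup>2 \<partial>L) \<le> (\<integral>s. (b (s, \<omega>))\<^sup>2 \<partial>L)"
        using h sq by (intro integral_mono) (auto simp: square_integrable_def h_def)
      then show ?thesis by (simp add: mult_left_mono)
    qed
    finally show "\<bar>\<integral>s. (if R s r then b (s, \<omega>) else 0) \<partial>L\<bar> \<le> \<beta> \<omega>"
      unfolding \<beta>_def h_def[symmetric] by (intro real_le_rsqrt) simp
  qed
  have bn: "AE \<omega> in M. \<forall>r. norm (\<integral>s. (if R s r then b (s, \<omega>) else 0) \<partial>L) \<le> norm (\<beta> \<omega>)"
    using bound by eventually_elim (auto intro: order_trans)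
  show "square_integrable \<mu> ?B"
    by (rule square_integrableI_bound[OF square_integrable_mu_snd[OF \<beta>] Bm])
      (use AE_mu_snd[OF bn] in \<open>eventually_elim, simp only: case_prod_beta\<close>)
  show "square_integrable M (\<lambda>\<omega>. \<integral>s. (if R s r then b (s, \<omega>) else 0) \<partial>L)" if "r \<in> {0..T}" for r
    using measurable_mu_section[OF Bm that]
    by (intro square_integrableI_bound[OF \<beta>]) (use bn in \<open>simp, eventually_elim, simp\<close>)
qed

text \<open>Expected integration by parts for \<open>\<zeta>\<close> with drift \<open>b\<close> and
  diffusion \<open>g\<close>, and for \<open>\<eta>\<close> with drift \<open>- c\<close>, diffusion
  \<open>q\<close> and terminal value \<open>\<theta>\<close>; the factor of \<open>z0\<close> is
  the expectation of \<open>\<eta> 0\<close>. The decomposition of \<open>\<theta>\<close> as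
  \<open>\<eta> s - C s + J s\<close>, with the stochastic integral \<open>J s\<close> over
  \<open>[s, T]\<close>, replaces the pathwise product formula: \<open>J s\<close> is orthogonal to
  the past, and the double time integrals that are left cancel. The primed functions are jointly
  measurable versions.\<close>

lemma ito_product_rule:
  fixes b c \<eta>' \<zeta>' q' g' :: "real \<times> 'w \<Rightarrow> real" and \<eta> \<zeta> :: "real \<Rightarrow> 'w \<Rightarrow> real" and \<theta> :: "'w \<Rightarrow> real"
  assumes b: "square_integrable \<mu> b" "\<And>s. s \<in> {0..T} \<Longrightarrow> (\<lambda>\<omega>. b (s, \<omega>)) \<in> borel_measurable (F s)"
    and c: "square_integrable \<mu> c" "\<And>s. s \<in> {0..T} \<Longrightarrow> (\<lambda>\<omega>. c (s, \<omega>)) \<in> borel_measurable (F s)"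
    and \<eta>': "square_integrable \<mu> \<eta>'" "AE x in \<mu>. \<eta> (fst x) (snd x) = \<eta>' x"
    and \<zeta>': "square_integrable \<mu> \<zeta>'" "AE x in \<mu>. \<zeta> (fst x) (snd x) = \<zeta>' x"
    and q': "q' \<in> borel_measurable \<mu>" "AE x in \<mu>. q (fst x) (snd x) = q' x"
    and g': "g' \<in> borel_measurable \<mu>" "AE x in \<mu>. g (fst x) (snd x) = g' x"
    and \<theta>: "square_integrable M \<theta>" and \<eta>0: "\<eta> 0 \<in> borel_measurable (F 0)"
    and \<eta>: "\<And>t. t \<in> {0..T} \<Longrightarrow> square_integrable M (\<eta> t)" and \<zeta>: "\<And>t. t \<in> {0..T} \<Longrightarrow> square_integrable M (\<zeta> t)"
    and ito_\<zeta>: "\<And>t. t \<in> {0..T} \<Longrightarrow> has_ito_integral M T W (\<lambda>s \<omega>. indicator {0..t} s * g s \<omega>)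
      (\<lambda>\<omega>. \<zeta> t \<omega> - z0 - (\<integral>s. (if s \<le> t then b (s, \<omega>) else 0) \<partial>L))"
    and ito_\<eta>: "\<And>t. t \<in> {0..T} \<Longrightarrow> has_ito_integral M T W (\<lambda>s \<omega>. indicator {t..T} s * q s \<omega>)
      (\<lambda>\<omega>. \<theta> \<omega> - \<eta> t \<omega> + (\<integral>s. (if t \<le> s then c (s, \<omega>) else 0) \<partial>L))"
  shows "expectation (\<lambda>\<omega>. \<theta> \<omega> * \<zeta> T \<omega>) = z0 * (expectation \<theta> + integral\<^sup>L \<mu> c)
    + (\<integral>x. \<eta>' x * b x - c x * \<zeta>' x + q' x * g' x \<partial>\<mu>)"
proof -
  interpret mu: finite_measure \<mu> by (rule finite_measure_mu)
  interpret L: finite_measure L by (rule finite_measure_L)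
  interpret LL: pair_sigma_finite L L ..
  have T0: "0 \<in> {0..T}" "T \<in> {0..T}" using T_pos by auto
  define B where "B x = (\<integral>s. (if s \<le> fst x then b (s, snd x) else 0) \<partial>L)" for x :: "real \<times> 'w"
  define C where "C x = (\<integral>s. (if fst x \<le> s then c (s, snd x) else 0) \<partial>L)" for x :: "real \<times> 'w"
  have R: "Measurable.pred (borel \<Otimes>\<^sub>M borel) (\<lambda>(s, r). s \<le> (r::real))" "Measurable.pred (borel \<Otimes>\<^sub>M borel) (\<lambda>(s, r). r \<le> (s::real))"
    by measurable
  have B: "square_integrable \<mu> B" "\<And>r. r \<in> {0..T} \<Longrightarrow> square_integrable M (\<lambda>\<omega>. B (r, \<omega>))"
  proof -
    have eq: "B = (\<lambda>(r, \<omega>). \<integral>s. (if s \<le> r then b (s, \<omega>) else 0) \<partial>L)" by (rule ext) (simp add: B_def case_prod_beta)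
    show "square_integrable \<mu> B" unfolding eq by (rule partial_integral(1)[OF b(1) R(1)])
    show "square_integrable M (\<lambda>\<omega>. B (r, \<omega>))" if "r \<in> {0..T}" for r
      unfolding eq prod.case by (rule partial_integral(2)[OF b(1) R(1) that])
  qed
  have C: "square_integrable \<mu> C" "\<And>r. r \<in> {0..T} \<Longrightarrow> square_integrable M (\<lambda>\<omega>. C (r, \<omega>))"
  proof -
    have eq: "C = (\<lambda>(r, \<omega>). \<integral>s. (if r \<le> s then c (s, \<omega>) else 0) \<partial>L)" by (rule ext) (simp add: C_def case_prod_beta)
    show "square_integrable \<mu> C" unfolding eq by (rule partial_integral(1)[OF c(1) R(2)])
    show "square_integrable M (\<lambda>\<omega>. C (r, \<omega>))" if "r \<in> {0..T}" for r
      unfolding eq prod.case by (rule partial_integral(2)[OF c(1) R(2) that])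
  qed
  define I where "I t \<omega> = \<zeta> t \<omega> - z0 - B (t, \<omega>)" for t \<omega>
  define J where "J t \<omega> = \<theta> \<omega> - \<eta> t \<omega> + C (t, \<omega>)" for t \<omega>
  have I: "has_ito_integral M T W (\<lambda>s \<omega>. indicator {0..t} s * g s \<omega>) (I t)" if "t \<in> {0..T}" for t
    using ito_\<zeta>[OF that] unfolding I_def[abs_def] B_def fst_conv snd_conv .
  have J: "has_ito_integral M T W (\<lambda>s \<omega>. indicator {t..T} s * q s \<omega>) (J t)" if "t \<in> {0..T}" for t
    using ito_\<eta>[OF that] unfolding J_def[abs_def] C_def fst_conv snd_conv .
  note sqI = has_ito_integral_square_integrable[OF I] and sqJ = has_ito_integral_square_integrable[OF J]
  have spL: "AE s in L. s \<in> {0..T}" using AE_space by eventually_elim (simp add: space_restrict_space)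
  have J_zero: "expectation (\<lambda>\<omega>. Z \<omega> * J s \<omega>) = 0" if s: "s \<in> {0..T}" and Z: "Z \<in> borel_measurable (F s)" "square_integrable M Z" for s Z
  proof -
    \<comment> \<open>The closed interval \<open>{s..T}\<close> meets the times up to
      \<open>s\<close> in the single point \<open>s\<close>, which has measure zero.\<close>
    have "AE x in \<mu>. fst x \<noteq> s"
      by (rule AE_mu_fst) (use AE_lborel_singleton[of s] in \<open>auto simp: AE_L_iff\<close>)
    then have "AE x in \<mu>. fst x \<le> s \<longrightarrow> indicator {s..T} (fst x) * q (fst x) (snd x) = 0"
      by eventually_elim auto
    from ito_integral_past[OF J[OF s] has_ito_integral_zero _ _ this Z] s show ?thesis by simp
  qed
  have I_past: "expectation (\<lambda>\<omega>. Z \<omega> * I T \<omega>) = expectation (\<lambda>\<omega>. Z \<omega> * I r \<omega>)"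
    if r: "r \<in> {0..T}" and Z: "Z \<in> borel_measurable (F r)" "square_integrable M Z" for r Z
  proof (rule ito_integral_past[OF I[OF T0(2)] I[OF r] _ _ _ Z])
    have "AE x in \<mu>. fst x \<in> {0..T}" by (rule AE_mu_fst[OF spL])
    then show "AE x in \<mu>. fst x \<le> r \<longrightarrow> indicator {0..T} (fst x) * g (fst x) (snd x) = indicator {0..r} (fst x) * g (fst x) (snd x)"
      by eventually_elim (auto simp: indicator_def)
  qed (use r in auto)
  \<comment> \<open>Under the time integral \<open>\<theta>\<close> is replaced by its decomposition
    at time \<open>s\<close>; the part \<open>J s\<close> drops out against the adapted
    \<open>b\<close>.\<close>
  have e1: "expectation (\<lambda>\<omega>. \<theta> \<omega> * B (T, \<omega>)) = (\<integral>x. (\<eta>' x - C x) * b x \<partial>\<mu>)"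
  proof -
    have i: "integrable \<mu> (\<lambda>x. \<theta> (snd x) * b x)"
      by (intro square_integrable_mult_integrable square_integrable_mu_snd \<theta> b)
    have i': "integrable \<mu> (\<lambda>x. (\<eta>' x - C x) * b x)"
      by (intro square_integrable_mult_integrable square_integrable_diff \<eta>' C b)
    have "B (T, \<omega>) = (\<integral>s. b (s, \<omega>) \<partial>L)" for \<omega>
      unfolding B_def by (intro Bochner_Integration.integral_cong) (auto simp: space_restrict_space)
    then have "expectation (\<lambda>\<omega>. \<theta> \<omega> * B (T, \<omega>)) = (\<integral>x. \<theta> (snd x) * b x \<partial>\<mu>)"
      using integral_mu_snd(1)[OF i] by simp
    also have "\<dots> = (\<integral>s. expectation (\<lambda>\<omega>. \<theta> \<omega> * b (s, \<omega>)) \<partial>L)" using integral_mu_fst[OF i] by simp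
    also have "\<dots> = (\<integral>s. expectation (\<lambda>\<omega>. (\<eta>' (s, \<omega>) - C (s, \<omega>)) * b (s, \<omega>)) \<partial>L)"
    proof (rule integral_cong_AE)
      have "AE s in L. AE \<omega> in M. \<eta> s \<omega> = \<eta>' (s, \<omega>)" using AE_mu_sections[OF \<eta>'(2)] by simp
      then show "AE s in L. expectation (\<lambda>\<omega>. \<theta> \<omega> * b (s, \<omega>)) = expectation (\<lambda>\<omega>. (\<eta>' (s, \<omega>) - C (s, \<omega>)) * b (s, \<omega>))"
        using square_integrable_mu_sections(1)[OF b(1)] square_integrable_mu_sections(1)[OF \<eta>'(1)] spL
      proof eventually_elim
        case (elim s)
        note sq = elim(2) \<eta>[OF elim(4)] C(2)[OF elim(4)] sqJ[OF elim(4)]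
        have i3: "integrable M (\<lambda>\<omega>. (\<eta> s \<omega> - C (s, \<omega>)) * b (s, \<omega>))" "integrable M (\<lambda>\<omega>. b (s, \<omega>) * J s \<omega>)"
          by (intro square_integrable_mult_integrable square_integrable_diff sq)+
        have "expectation (\<lambda>\<omega>. \<theta> \<omega> * b (s, \<omega>)) = expectation (\<lambda>\<omega>. (\<eta> s \<omega> - C (s, \<omega>)) * b (s, \<omega>) + b (s, \<omega>) * J s \<omega>)"
          by (simp add: J_def algebra_simps)
        also have "\<dots> = expectation (\<lambda>\<omega>. (\<eta> s \<omega> - C (s, \<omega>)) * b (s, \<omega>)) + expectation (\<lambda>\<omega>. b (s, \<omega>) * J s \<omega>)"
          by (rule Bochner_Integration.integral_add[OF i3])
        also have "expectation (\<lambda>\<omega>. b (s, \<omega>) * J s \<omega>) = 0" by (rule J_zero[OF elim(4) b(2)[OF elim(4)] elim(2)])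
        also have "expectation (\<lambda>\<omega>. (\<eta> s \<omega> - C (s, \<omega>)) * b (s, \<omega>)) = expectation (\<lambda>\<omega>. (\<eta>' (s, \<omega>) - C (s, \<omega>)) * b (s, \<omega>))"
        proof (rule integral_cong_AE)
          show "AE \<omega> in M. (\<eta> s \<omega> - C (s, \<omega>)) * b (s, \<omega>) = (\<eta>' (s, \<omega>) - C (s, \<omega>)) * b (s, \<omega>)"
            using elim(1) by eventually_elim simp
          show "(\<lambda>\<omega>. (\<eta>' (s, \<omega>) - C (s, \<omega>)) * b (s, \<omega>)) \<in> borel_measurable M" using elim(2,3) sq(3) by measurable
        qed (use i3 in auto)
        finally show ?case by simp
      qed
    qed (use pair_sigma_finite.integrable_fst'[OF pair_sigma_finite_LM] i i' in \<open>force simp: dt_dP_def\<close>)+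
    also have "\<dots> = (\<integral>x. (\<eta>' x - C x) * b x \<partial>\<mu>)" using integral_mu_fst[OF i'] by simp
    finally show ?thesis .
  qed
  \<comment> \<open>Symmetrically, against the adapted \<open>c\<close> the integral
    \<open>I T\<close> may be stopped at the current time, where it equals
    \<open>\<zeta> - z0 - B\<close>.\<close>
  have e2: "expectation (\<lambda>\<omega>. C (0, \<omega>) * I T \<omega>) = (\<integral>x. c x * (\<zeta>' x - z0 - B x) \<partial>\<mu>)"
  proof -
    have i: "integrable \<mu> (\<lambda>x. c x * I T (snd x))"
      by (intro square_integrable_mult_integrable square_integrable_mu_snd sqI c T0)
    have i': "integrable \<mu> (\<lambda>x. c x * (\<zeta>' x - z0 - B x))"
      by (intro square_integrable_mult_integrable square_integrable_diff square_integrable_const \<zeta>' B c finite_measure_mu)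
    have "C (0, \<omega>) = (\<integral>s. c (s, \<omega>) \<partial>L)" for \<omega>
      unfolding C_def by (intro Bochner_Integration.integral_cong) (auto simp: space_restrict_space)
    then have "expectation (\<lambda>\<omega>. C (0, \<omega>) * I T \<omega>) = (\<integral>x. c x * I T (snd x) \<partial>\<mu>)"
      using integral_mu_snd(1)[OF i] by simp
    also have "\<dots> = (\<integral>s. expectation (\<lambda>\<omega>. c (s, \<omega>) * I T \<omega>) \<partial>L)" using integral_mu_fst[OF i] by simp
    also have "\<dots> = (\<integral>s. expectation (\<lambda>\<omega>. c (s, \<omega>) * (\<zeta>' (s, \<omega>) - z0 - B (s, \<omega>))) \<partial>L)"
    proof (rule integral_cong_AE)
      have "AE s in L. AE \<omega> in M. \<zeta> s \<omega> = \<zeta>' (s, \<omega>)" using AE_mu_sections[OF \<zeta>'(2)] by simp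
      then show "AE s in L. expectation (\<lambda>\<omega>. c (s, \<omega>) * I T \<omega>) = expectation (\<lambda>\<omega>. c (s, \<omega>) * (\<zeta>' (s, \<omega>) - z0 - B (s, \<omega>)))"
        using square_integrable_mu_sections(1)[OF c(1)] square_integrable_mu_sections(1)[OF \<zeta>'(1)] spL
      proof eventually_elim
        case (elim s)
        have "expectation (\<lambda>\<omega>. c (s, \<omega>) * I T \<omega>) = expectation (\<lambda>\<omega>. c (s, \<omega>) * I s \<omega>)"
          by (rule I_past[OF elim(4) c(2)[OF elim(4)] elim(2)])
        also have "\<dots> = expectation (\<lambda>\<omega>. c (s, \<omega>) * (\<zeta>' (s, \<omega>) - z0 - B (s, \<omega>)))"
        proof (rule integral_cong_AE)
          show "AE \<omega> in M. c (s, \<omega>) * I s \<omega> = c (s, \<omega>) * (\<zeta>' (s, \<omega>) - z0 - B (s, \<omega>))"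
            using elim(1) by eventually_elim (simp add: I_def)
          show "(\<lambda>\<omega>. c (s, \<omega>) * (\<zeta>' (s, \<omega>) - z0 - B (s, \<omega>))) \<in> borel_measurable M"
            using elim(2,3) B(2)[OF elim(4)] by measurable
          show "(\<lambda>\<omega>. c (s, \<omega>) * I s \<omega>) \<in> borel_measurable M" using elim(2) sqI[OF elim(4)] by measurable
        qed
        finally show ?case .
      qed
    qed (use pair_sigma_finite.integrable_fst'[OF pair_sigma_finite_LM] i i' in \<open>force simp: dt_dP_def\<close>)+
    also have "\<dots> = (\<integral>x. c x * (\<zeta>' x - z0 - B x) \<partial>\<mu>)" using integral_mu_fst[OF i'] by simp
    finally show ?thesis .
  qed
  have e3: "expectation (\<lambda>\<omega>. J 0 \<omega> * I T \<omega>) = (\<integral>x. q' x * g' x \<partial>\<mu>)"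
  proof (rule ito_isometry[OF J[OF T0(1)] _ q'(1) I[OF T0(2)] _ g'(1)])
    have "AE x in \<mu>. fst x \<in> {0..T}" by (rule AE_mu_fst[OF spL])
    then show "AE x in \<mu>. indicator {0..T} (fst x) * q (fst x) (snd x) = q' x" "AE x in \<mu>. indicator {0..T} (fst x) * g (fst x) (snd x) = g' x"
      using q'(2) g'(2) by (eventually_elim, simp)+
  qed
  \<comment> \<open>\<open>\<eta> 0\<close> is measurable for the initial sigma-algebra, to which
    the whole integral \<open>I T\<close> is orthogonal.\<close>
  have e4: "expectation (\<lambda>\<omega>. \<eta> 0 \<omega> * I T \<omega>) = 0"
  proof -
    have "AE x in \<mu>. fst x \<noteq> 0"
      by (rule AE_mu_fst) (use AE_lborel_singleton[of 0] in \<open>auto simp: AE_L_iff\<close>)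
    then have "AE x in \<mu>. fst x \<le> 0 \<longrightarrow> indicator {0..T} (fst x) * g (fst x) (snd x) = 0"
      by eventually_elim auto
    from ito_integral_past[OF I[OF T0(2)] has_ito_integral_zero _ _ this \<eta>0 \<eta>[OF T0(1)]] T_pos show ?thesis by simp
  qed
  \<comment> \<open>For almost every \<open>\<omega>\<close> both sides are the integral of
    \<open>c r * b s\<close> over the triangle \<open>s \<le> r\<close>, with the two orders of
    integration.\<close>
  have e5: "(\<integral>x. C x * b x \<partial>\<mu>) = (\<integral>x. c x * B x \<partial>\<mu>)"
  proof -
    have i: "integrable \<mu> (\<lambda>x. C x * b x)" "integrable \<mu> (\<lambda>x. c x * B x)"
      by (intro square_integrable_mult_integrable B C b c)+
    have "(\<integral>x. C x * b x \<partial>\<mu>) = expectation (\<lambda>\<omega>. \<integral>s. C (s, \<omega>) * b (s, \<omega>) \<partial>L)" using integral_mu_snd(1)[OF i(1)] by simp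
    also have "\<dots> = expectation (\<lambda>\<omega>. \<integral>r. c (r, \<omega>) * B (r, \<omega>) \<partial>L)"
    proof (rule integral_cong_AE)
      show "AE \<omega> in M. (\<integral>s. C (s, \<omega>) * b (s, \<omega>) \<partial>L) = (\<integral>r. c (r, \<omega>) * B (r, \<omega>) \<partial>L)"
        using square_integrable_mu_sections(2)[OF b(1)] square_integrable_mu_sections(2)[OF c(1)]
      proof eventually_elim
        case (elim \<omega>)
        let ?b = "\<lambda>s. b (s, \<omega>)" and ?c = "\<lambda>s. c (s, \<omega>)"
        have bi: "integrable L ?b" "integrable L ?c" using elim by (auto intro: square_integrable_integrable L.finite_measure_axioms)
        let ?f = "\<lambda>s r. if s \<le> r then ?c r * ?b s else 0"
        have id: "(\<lambda>x. x) \<in> borel_measurable L" by (rule measurable_restrict_space1) simp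
        have fm: "(\<lambda>z. ?f (fst z) (snd z)) \<in> borel_measurable (L \<Otimes>\<^sub>M L)"
        proof -
          have "(\<lambda>z. (fst z, snd z)) \<in> measurable (L \<Otimes>\<^sub>M L) (borel \<Otimes>\<^sub>M borel)"
            by (intro measurable_Pair measurable_compose[OF measurable_fst id] measurable_compose[OF measurable_snd id])
          from measurable_compose[OF this R(1)] have "Measurable.pred (L \<Otimes>\<^sub>M L) (\<lambda>z. fst z \<le> snd z)" by simp
          moreover have "(\<lambda>z. ?c (snd z) * ?b (fst z)) \<in> borel_measurable (L \<Otimes>\<^sub>M L)"
            using bi by (intro borel_measurable_times measurable_compose[OF measurable_fst] measurable_compose[OF measurable_snd]) auto
          ultimately show ?thesis by measurable
        qed
        have "integrable (L \<Otimes>\<^sub>M L) (\<lambda>z. ?b (fst z) * ?c (snd z))"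
          by (rule LL.Fubini_integrable)
            (use bi in \<open>auto simp: abs_mult intro!: borel_measurable_times measurable_compose[OF measurable_fst]
              measurable_compose[OF measurable_snd] integrable_mult_left integrable_mult_right\<close>)
        then have fi: "integrable (L \<Otimes>\<^sub>M L) (\<lambda>(s, r). ?f s r)"
          by (rule Bochner_Integration.integrable_bound) (use fm in \<open>auto simp: case_prod_beta abs_mult mult.commute\<close>)
        have "(\<integral>s. C (s, \<omega>) * ?b s \<partial>L) = (\<integral>s. (\<integral>r. ?f s r \<partial>L) \<partial>L)"
          by (intro Bochner_Integration.integral_cong refl)
            (simp add: C_def integral_mult_left_zero[symmetric] if_distrib[of "\<lambda>x. x * _"] cong: if_cong del: integral_mult_left_zero)
        also have "\<dots> = (\<integral>r. (\<integral>s. ?f s r \<partial>L) \<partial>L)" by (rule LL.Fubini_integral[OF fi, symmetric])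
        also have "\<dots> = (\<integral>r. ?c r * B (r, \<omega>) \<partial>L)"
          by (intro Bochner_Integration.integral_cong refl)
            (simp add: B_def integral_mult_right_zero[symmetric] if_distrib[of "\<lambda>x. _ * x"] cong: if_cong del: integral_mult_right_zero)
        finally show ?case .
      qed
    qed (use integral_mu_snd(2)[OF i(1)] integral_mu_snd(2)[OF i(2)] in auto)
    also have "\<dots> = (\<integral>x. c x * B x \<partial>\<mu>)" using integral_mu_snd(1)[OF i(2)] by simp
    finally show ?thesis .
  qed
  have sT: "square_integrable M (I T)" "square_integrable M (J 0)" "square_integrable M (\<eta> 0)"
      "square_integrable M (\<lambda>\<omega>. C (0, \<omega>))" "square_integrable M (\<lambda>\<omega>. B (T, \<omega>))"
    using T0 sqI sqJ \<eta> B C by auto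
  have \<theta>I: "expectation (\<lambda>\<omega>. \<theta> \<omega> * I T \<omega>) = expectation (\<lambda>\<omega>. \<eta> 0 \<omega> * I T \<omega>) - expectation (\<lambda>\<omega>. C (0, \<omega>) * I T \<omega>) + expectation (\<lambda>\<omega>. J 0 \<omega> * I T \<omega>)"
  proof -
    have "expectation (\<lambda>\<omega>. \<theta> \<omega> * I T \<omega>) = expectation (\<lambda>\<omega>. \<eta> 0 \<omega> * I T \<omega> - C (0, \<omega>) * I T \<omega> + J 0 \<omega> * I T \<omega>)"
      by (simp add: J_def algebra_simps)
    then show ?thesis
      using square_integrable_mult_integrable[OF sT(3,1)] square_integrable_mult_integrable[OF sT(4,1)] square_integrable_mult_integrable[OF sT(2,1)]
      by simp
  qed
  have "expectation (\<lambda>\<omega>. \<theta> \<omega> * \<zeta> T \<omega>) = expectation (\<lambda>\<omega>. z0 * \<theta> \<omega> + \<theta> \<omega> * B (T, \<omega>) + \<theta> \<omega> * I T \<omega>)"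
    by (simp add: I_def algebra_simps)
  also have "\<dots> = z0 * expectation \<theta> + expectation (\<lambda>\<omega>. \<theta> \<omega> * B (T, \<omega>)) + expectation (\<lambda>\<omega>. \<theta> \<omega> * I T \<omega>)"
    using square_integrable_integrable[OF finite_measure_axioms \<theta>] square_integrable_mult_integrable[OF \<theta> sT(5)] square_integrable_mult_integrable[OF \<theta> sT(1)]
    by simp
  also have "\<dots> = z0 * expectation \<theta> + (\<integral>x. (\<eta>' x - C x) * b x \<partial>\<mu>) - (\<integral>x. c x * (\<zeta>' x - z0 - B x) \<partial>\<mu>) + (\<integral>x. q' x * g' x \<partial>\<mu>)"
    unfolding \<theta>I e1 e2 e3 e4 by simp
  also have "(\<integral>x. (\<eta>' x - C x) * b x \<partial>\<mu>) = (\<integral>x. \<eta>' x * b x \<partial>\<mu>) - (\<integral>x. C x * b x \<partial>\<mu>)"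
    unfolding left_diff_distrib
    by (intro Bochner_Integration.integral_diff square_integrable_mult_integrable \<eta>' C b)
  also have "(\<integral>x. c x * (\<zeta>' x - z0 - B x) \<partial>\<mu>) = (\<integral>x. c x * \<zeta>' x \<partial>\<mu>) - z0 * integral\<^sup>L \<mu> c - (\<integral>x. c x * B x \<partial>\<mu>)"
  proof -
    have "(\<integral>x. c x * (\<zeta>' x - z0 - B x) \<partial>\<mu>) = (\<integral>x. c x * \<zeta>' x - z0 * c x - c x * B x \<partial>\<mu>)" by (simp add: algebra_simps)
    then show ?thesis
      using square_integrable_mult_integrable[OF c(1) \<zeta>'(1)] square_integrable_mult_integrable[OF c(1) B(1)]
        square_integrable_integrable[OF finite_measure_mu c(1)] by simp
  qed
  finally have "expectation (\<lambda>\<omega>. \<theta> \<omega> * \<zeta> T \<omega>) = z0 * (expectation \<theta> + integral\<^sup>L \<mu> c)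
      + ((\<integral>x. \<eta>' x * b x \<partial>\<mu>) - (\<integral>x. c x * \<zeta>' x \<partial>\<mu>) + (\<integral>x. q' x * g' x \<partial>\<mu>))"
    unfolding e5 by (simp add: algebra_simps)
  \<comment> \<open>\<open>q'\<close> and \<open>g'\<close> are given as measurable versions only;
    their square integrability is recovered from the existence of the two Ito integrals.\<close>
  moreover have "integrable \<mu> (\<lambda>x. q' x * g' x)"
  proof (rule square_integrable_mult_integrable)
    obtain n \<tau> d f0 where "ito_approximation (\<lambda>s \<omega>. indicator {0..T} s * q s \<omega>) (J 0) n \<tau> d f0"
      using has_ito_integral_approximation[OF J[OF T0(1)]] by blast
    note F = ito_approximationD[OF this]
    have sp: "AE x in \<mu>. fst x \<in> {0..T}" by (rule AE_mu_fst[OF spL])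
    have "AE x in \<mu>. f0 x = q' x" using sp F(2) q'(2) by eventually_elim simp
    with F(3) q'(1) show "square_integrable \<mu> q'" unfolding L2_tendsto_def by (blast intro: square_integrable_cong_AE)
    obtain n \<tau> d f0 where "ito_approximation (\<lambda>s \<omega>. indicator {0..T} s * g s \<omega>) (I T) n \<tau> d f0"
      using has_ito_integral_approximation[OF I[OF T0(2)]] by blast
    note F = ito_approximationD[OF this]
    have "AE x in \<mu>. f0 x = g' x" using sp F(2) g'(2) by eventually_elim simp
    with F(3) g'(1) show "square_integrable \<mu> g'" unfolding L2_tendsto_def by (blast intro: square_integrable_cong_AE)
  qed
  ultimately show ?thesis
    using square_integrable_mult_integrable[OF \<eta>'(1) b(1)] square_integrable_mult_integrable[OF c(1) \<zeta>'(1)] by simp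
qed

end

section \<open>Duality in the Gelfand triple\<close>

text \<open>A simple approximation of \<open>\<xi>\<close> takes finitely many values, so the
  composition is pieced together from finitely many measurable functions; continuity in
  \<open>y\<close> passes to the limit.\<close>

lemma caratheodory_measurable:
  fixes f :: "'a \<Rightarrow> 'h::{metric_space, second_countable_topology} \<Rightarrow> real"
  assumes f: "\<And>y. (\<lambda>x. f x y) \<in> borel_measurable N"
    and cont: "\<And>x. x \<in> space N \<Longrightarrow> continuous_on UNIV (f x)" and \<xi>: "\<xi> \<in> borel_measurable N"
  shows "(\<lambda>x. f x (\<xi> x)) \<in> borel_measurable N"
proof -
  obtain z :: 'h where True by blast
  from borel_measurable_implies_sequence_metric[OF \<xi>, of z] obtain s where
    s: "\<And>i. simple_function N (s i)" "\<And>x. x \<in> space N \<Longrightarrow> (\<lambda>i. s i x) \<longlonglongrightarrow> \<xi> x" by blast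
  show ?thesis
  proof (rule borel_measurable_LIMSEQ_real)
    show "(\<lambda>i. f x (s i x)) \<longlonglongrightarrow> f x (\<xi> x)" if "x \<in> space N" for x
      using continuous_on_tendsto_compose[OF cont[OF that] s(2)[OF that]] by simp
    show "(\<lambda>x. f x (s i x)) \<in> borel_measurable N" for i
    proof (rule measurable_compose_countable'[where I = "s i ` space N"])
      show "countable (s i ` space N)" using s(1)[of i] by (simp add: simple_function_def countable_finite)
      show "s i \<in> measurable N (count_space (s i ` space N))"
        using s(1)[of i] by (simp add: measurable_count_space_eq2 simple_function_def)
    qed (rule f)
  qed
qed

context wiener
begin

text \<open>Joint measurability with adapted sections is weaker than progressive measurability, but it is all
  that the Ito integral and the product rule need, and it holds for every adapted process that is jointly measurable.\<close>

definition progressive :: "(real \<times> 'w) measure" where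
  "progressive = sigma (space \<mu>) {S \<in> sets \<mu>. \<forall>s\<in>{0..T}. Pair s -` S \<inter> space M \<in> sets (F s)}"

lemma space_mu: "space \<mu> = {0..T} \<times> space M"
  by (simp add: dt_dP_def space_pair_measure space_restrict_space)

lemma space_progressive [simp]: "space progressive = space \<mu>"
  unfolding progressive_def by (rule space_measure_of) (auto dest: sets.sets_into_space)

text \<open>The generating family is already a sigma-algebra, so membership can be tested on joint
  measurability and sections alone.\<close>

lemma sets_progressive:
  "sets progressive = {S \<in> sets \<mu>. \<forall>s\<in>{0..T}. Pair s -` S \<inter> space M \<in> sets (F s)}" (is "_ = ?\<G>")
proof -
  have "sigma_algebra (space \<mu>) ?\<G>"
    unfolding sigma_algebra_iff2
    proof (intro conjI ballI allI impI)
      show "?\<G> \<subseteq> Pow (space \<mu>)" by (auto dest: sets.sets_into_space)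
      show "{} \<in> ?\<G>" by simp
      show "space \<mu> - S \<in> ?\<G>" if S: "S \<in> ?\<G>" for S
      proof (intro CollectI conjI ballI)
        fix s assume s: "s \<in> {0..T}"
        have "Pair s -` (space \<mu> - S) \<inter> space M = space (F s) - (Pair s -` S \<inter> space M)"
          using s by (auto simp: space_mu)
        moreover have "space (F s) - (Pair s -` S \<inter> space M) \<in> sets (F s)" using S s by (intro sets.compl_sets) blast
        ultimately show "Pair s -` (space \<mu> - S) \<inter> space M \<in> sets (F s)" by simp
      qed (use S in auto)
      show "(\<Union>i. S i) \<in> ?\<G>" if S: "range S \<subseteq> ?\<G>" for S :: "nat \<Rightarrow> _"
      proof (intro CollectI conjI ballI)
        fix s assume s: "s \<in> {0..T}"
        have "Pair s -` (\<Union>i. S i) \<inter> space M = (\<Union>i. Pair s -` S i \<inter> space M)" by auto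
        moreover have "Pair s -` S i \<inter> space M \<in> sets (F s)" for i using S s by blast
        then have "(\<Union>i. Pair s -` S i \<inter> space M) \<in> sets (F s)" by blast
        ultimately show "Pair s -` (\<Union>i. S i) \<inter> space M \<in> sets (F s)" by (simp only:)
      qed (use S in auto)
    qed
  then show ?thesis
    unfolding progressive_def by (rule sigma_algebra.sets_measure_of_eq)
qed

lemma measurable_progressiveI:
  assumes "f \<in> measurable \<mu> N" "\<And>s. s \<in> {0..T} \<Longrightarrow> (\<lambda>\<omega>. f (s, \<omega>)) \<in> measurable (F s) N"
  shows "f \<in> measurable progressive N"
proof (rule measurableI)
  show "f x \<in> space N" if "x \<in> space progressive" for x using measurable_space[OF assms(1)] that by simp
  fix B assume B: "B \<in> sets N"
  have "Pair s -` (f -` B \<inter> space progressive) \<inter> space M \<in> sets (F s)" if s: "s \<in> {0..T}" for s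
  proof -
    have "Pair s -` (f -` B \<inter> space progressive) \<inter> space M = (\<lambda>\<omega>. f (s, \<omega>)) -` B \<inter> space (F s)"
      using s by (auto simp: space_mu)
    then show ?thesis using measurable_sets[OF assms(2)[OF s] B] by simp
  qed
  then show "f -` B \<inter> space progressive \<in> sets progressive"
    using measurable_sets[OF assms(1) B] by (simp add: sets_progressive)
qed

lemma measurable_progressive_mu: "f \<in> measurable progressive N \<Longrightarrow> f \<in> measurable \<mu> N"
  by (rule measurableI) (auto dest: measurable_space measurable_sets simp: sets_progressive)

lemma measurable_progressive_section:
  assumes f: "f \<in> measurable progressive N" and s: "s \<in> {0..T}"
  shows "(\<lambda>\<omega>. f (s, \<omega>)) \<in> measurable (F s) N"
proof (rule measurableI)
  show "f (s, \<omega>) \<in> space N" if "\<omega> \<in> space (F s)" for \<omega>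
    using measurable_space[OF f] that s by (simp add: space_mu)
  fix B assume "B \<in> sets N"
  from measurable_sets[OF f this] have "Pair s -` (f -` B \<inter> space progressive) \<inter> space M \<in> sets (F s)"
    using s by (simp add: sets_progressive)
  moreover have "Pair s -` (f -` B \<inter> space progressive) \<inter> space M = (\<lambda>\<omega>. f (s, \<omega>)) -` B \<inter> space (F s)"
    using s by (auto simp: space_mu)
  ultimately show "(\<lambda>\<omega>. f (s, \<omega>)) -` B \<inter> space (F s) \<in> sets (F s)" by simp
qed

lemma progressive_time: "f \<in> borel_measurable L \<Longrightarrow> (\<lambda>x. f (fst x)) \<in> borel_measurable progressive"
  by (rule measurable_progressiveI) (auto intro: measurable_mu_fst)

lemma progressive_M2: "f \<in> M2 M T F \<Longrightarrow> (\<lambda>x. f (fst x) (snd x)) \<in> borel_measurable progressive"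
  by (rule measurable_progressiveI) (auto simp: M2_def adapted_def case_prod_unfold)

text \<open>The section of a generator \<open>{s<..t} \<times> B\<close> at time \<open>r\<close> is
  empty or equal to \<open>B\<close>, and it is \<open>B\<close> only for \<open>r > s\<close>,
  where \<open>F s\<close> is contained in \<open>F r\<close>. Predictable coefficients thereby
  become processes with adapted sections.\<close>

lemma sets_predictable_subset: "sets (predictable_sigma M T F) \<subseteq> sets progressive"
proof -
  let ?S = "{{0} \<times> B | B. B \<in> sets (F 0)} \<union> {{s<..t} \<times> B | s t B. 0 \<le> s \<and> s < t \<and> t \<le> T \<and> B \<in> sets (F s)}"
  have gen: "S \<in> sets progressive" if "S \<in> ?S" for S
  proof -
    consider (0) B where "S = {0} \<times> B" "B \<in> sets (F 0)"
      | (1) s t B where "S = {s<..t} \<times> B" "0 \<le> s" "s < t" "t \<le> T" "B \<in> sets (F s)" using \<open>S \<in> ?S\<close> by blast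
    then show ?thesis
    proof cases
      case 0
      have "{0} \<in> sets L" using T_pos by (auto simp: sets_restrict_space intro!: image_eqI[of _ _ "{0}"])
      then have "S \<in> sets \<mu>" using 0 sets_F_subset[of 0] T_pos unfolding dt_dP_def by (auto intro!: pair_measureI)
      moreover have "Pair r -` S \<inter> space M \<in> sets (F r)" if "r \<in> {0..T}" for r
      proof (cases "r = 0")
        case True
        then have "Pair r -` S \<inter> space M = B" using 0 sets.sets_into_space[OF 0(2)] by auto
        then show ?thesis using 0 True by simp
      next
        case False
        then have "Pair r -` S \<inter> space M = {}" using 0 by auto
        then show ?thesis by simp
      qed
      ultimately show ?thesis by (simp add: sets_progressive)
    next
      case 1
      have "{s<..t} \<in> sets L" using 1 by (auto simp: sets_restrict_space intro!: image_eqI[of _ _ "{s<..t}"])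
      then have "S \<in> sets \<mu>" using 1 sets_F_subset[of s] unfolding dt_dP_def by (auto intro!: pair_measureI)
      moreover have "Pair r -` S \<inter> space M \<in> sets (F r)" if "r \<in> {0..T}" for r
      proof (cases "r \<in> {s<..t}")
        case True
        then have "Pair r -` S \<inter> space M = B" using 1 sets.sets_into_space[OF 1(5)] by auto
        then show ?thesis using 1 True sets_F_mono[of s r] by auto
      next
        case False
        then have "Pair r -` S \<inter> space M = {}" using 1 by auto
        then show ?thesis by simp
      qed
      ultimately show ?thesis by (simp add: sets_progressive)
    qed
  qed
  have "?S \<subseteq> Pow ({0..T} \<times> space M)"
  proof
    fix S assume "S \<in> ?S"
    from sets.sets_into_space[OF gen[OF this]] show "S \<in> Pow ({0..T} \<times> space M)" by (simp add: space_mu)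
  qed
  then have "sets (predictable_sigma M T F) = sigma_sets ({0..T} \<times> space M) ?S"
    unfolding predictable_sigma_def by (rule sets_measure_of)
  also have "\<dots> \<subseteq> sets progressive"
  proof -
    have "?S \<subseteq> sets progressive" using gen by (rule subsetI)
    from sets.sigma_sets_subset[OF this] show ?thesis by (simp add: space_mu)
  qed
  finally show ?thesis .
qed

lemma measurable_predictable_progressive:
  assumes "f \<in> measurable (predictable_sigma M T F) N" shows "f \<in> measurable progressive N"
proof (rule measurableI)
  have sp: "space (predictable_sigma M T F) = space progressive"
    by (simp add: predictable_sigma_def space_mu space_measure_of_conv)
  show "f x \<in> space N" if "x \<in> space progressive" for x
    using measurable_space[OF assms] that sp by simp
  show "f -` B \<inter> space progressive \<in> sets progressive" if "B \<in> sets N" for B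
    using measurable_sets[OF assms that] sets_predictable_subset sp by auto
qed

lemma progressive_id: "(\<lambda>x. x) \<in> measurable progressive (predictable_sigma M T F)"
  by (rule measurable_predictable_progressive) simp

lemma S2_square_integrable:
  fixes f :: "real \<Rightarrow> 'w \<Rightarrow> 'b::{banach, second_countable_topology}"
  assumes f: "f \<in> S2 M T F" and t: "t \<in> {0..T}"
  shows "square_integrable M (f t)" "f t \<in> borel_measurable (F t)"
proof -
  show ft: "f t \<in> borel_measurable (F t)" using f t by (simp add: S2_def adapted_def)
  have "(\<integral>\<^sup>+\<omega>. ennreal ((norm (f t \<omega>))\<^sup>2) \<partial>M) \<le> (\<integral>\<^sup>+\<omega>. (SUP t\<in>{0..T}. ennreal ((norm (f t \<omega>))\<^sup>2)) \<partial>M)"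
    using t by (intro nn_integral_mono SUP_upper)
  also have "\<dots> < \<infinity>" using f by (simp add: S2_def)
  finally show "square_integrable M (f t)"
    using measurable_F_M[OF ft] t by (simp add: square_integrable_nn)
qed

lemma M2_square_integrable_norm:
  fixes f :: "real \<Rightarrow> 'w \<Rightarrow> 'b::real_normed_vector"
  assumes f: "f \<in> M2 M T F"
  shows "square_integrable \<mu> (\<lambda>x. norm (f (fst x) (snd x)))"
proof -
  have "(\<lambda>x. f (fst x) (snd x)) \<in> borel_measurable \<mu>" using f by (simp add: M2_def case_prod_unfold)
  then have "(\<lambda>x. norm (f (fst x) (snd x))) \<in> borel_measurable \<mu>"
    by (rule measurable_compose) (intro borel_measurable_continuous_onI continuous_intros)
  then show ?thesis using f by (simp add: square_integrable_nn M2_def case_prod_unfold)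
qed

lemma M2_square_integrable:
  fixes f :: "real \<Rightarrow> 'w \<Rightarrow> 'b::{banach, second_countable_topology}"
  assumes f: "f \<in> M2 M T F" shows "square_integrable \<mu> (\<lambda>x. f (fst x) (snd x))"
  by (rule square_integrableI_bound[OF M2_square_integrable_norm[OF f]])
    (use f in \<open>simp_all add: M2_def case_prod_unfold\<close>)

end

locale gelfand_wiener = wiener M T W for M :: "'w measure" and T W +
  fixes e :: "'v::banach \<Rightarrow>\<^sub>L 'h::{real_inner, banach, second_countable_topology}"
    and A :: "real \<times> 'w \<Rightarrow> ('v \<Rightarrow>\<^sub>L 'v \<Rightarrow>\<^sub>L real)" and \<alpha> lam C :: real
  assumes gelfand: "gelfand_triple e" and A_meas: "A \<in> borel_measurable progressive"
    and \<alpha>: "\<alpha> > 0"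
    and coercive: "\<And>x v. x \<in> space \<mu> \<Longrightarrow> A x v v + lam * (norm (e v))\<^sup>2 \<ge> \<alpha> * (norm v)\<^sup>2"
    and A_bound: "\<And>x. x \<in> space \<mu> \<Longrightarrow> norm (A x) \<le> C"
begin

definition resolvent_family :: "(nat \<Rightarrow> 'h \<Rightarrow>\<^sub>L 'v) \<Rightarrow> real \<Rightarrow> bool" where
  "resolvent_family G K \<longleftrightarrow> (\<forall>n x y. e (G n x) \<bullet> y = x \<bullet> e (G n y)) \<and> (\<forall>n x. norm (e (G n x)) \<le> norm x) \<and>
    0 \<le> K \<and> (\<forall>n v. norm (G n (e v)) \<le> K * norm v) \<and> (\<forall>v. (\<lambda>n. G n (e v)) \<longlonglongrightarrow> v) \<and>
    (\<forall>x. (\<lambda>n. e (G n x)) \<longlonglongrightarrow> x)"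

text \<open>The form is \<open>A\<close> at an arbitrary fixed point of the product space,
  symmetrised and shifted by \<open>2 * lam\<close>; symmetrising doubles the coercivity inequality,
  whence \<open>2 * \<alpha>\<close>. What matters later are the mapping properties between
  \<open>H\<close> and \<open>V\<close>, which are tied to no particular point.\<close>

lemma resolvents: "\<exists>G K. resolvent_family G K"
proof -
  obtain \<omega>0 where "\<omega>0 \<in> space M" using not_empty by blast
  then have x0: "(0, \<omega>0) \<in> space \<mu>" using T_pos by (simp add: space_mu)
  define f where "f x y = A (0, \<omega>0) x y" for x y
  define a where "a x y = (f x y + 1 * f y x) + (2 * lam) * (e x \<bullet> e y)" for x y
  have f: "bounded_bilinear f"
    unfolding f_def by (rule bounded_bilinear.comp1[OF bounded_bilinear_blinfun_apply blinfun.bounded_linear_right])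
  have ee: "bounded_bilinear (\<lambda>x v. e x \<bullet> e v)"
    by (intro bounded_bilinear.comp[OF bounded_bilinear_inner] blinfun.bounded_linear_right)
  have a: "bounded_bilinear a"
    unfolding a_def by (intro bounded_bilinear_add_scaled f bounded_bilinear.flip[OF f] ee)
  have sym: "a x y = a y x" for x y by (simp add: a_def inner_commute)
  have coer: "a x x \<ge> (2 * \<alpha>) * (norm x)\<^sup>2" for x
    using coercive[OF x0, of x] by (simp add: a_def f_def power2_norm_eq_inner)
  show ?thesis
  proof (rule resolvents_exist[OF a sym _ coer])
    show "2 * \<alpha> > 0" using \<alpha> by simp
    show "inj (blinfun_apply e)" "closure (range (blinfun_apply e)) = UNIV"
      using gelfand by (simp_all add: gelfand_triple_def)
    show ?thesis
      if "\<And>n x y. e (G n x) \<bullet> y = x \<bullet> e (G n y)" "\<And>n x. norm (e (G n x)) \<le> norm x" "0 \<le> K"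
        "\<And>n v. norm (G n (e v)) \<le> K * norm v" "\<And>v. (\<lambda>n. G n (e v)) \<longlonglongrightarrow> v" "\<And>x. (\<lambda>n. e (G n x)) \<longlonglongrightarrow> x"
      for G :: "nat \<Rightarrow> 'h \<Rightarrow>\<^sub>L 'v" and K
      unfolding resolvent_family_def using that by (intro exI conjI allI)
  qed
qed

definition V_process :: "(real \<Rightarrow> 'w \<Rightarrow> 'h) \<Rightarrow> (real \<times> 'w \<Rightarrow> 'v) \<Rightarrow> bool" where
  "V_process X Y \<longleftrightarrow> (\<lambda>t \<omega>. Y (t, \<omega>)) \<in> M2 M T F \<and> (AE x in \<mu>. e (Y x) = X (fst x) (snd x))"

lemma V_process_H:
  assumes "V_process X Y"
  shows "square_integrable \<mu> (\<lambda>x. e (Y x))" "(\<lambda>x. e (Y x)) \<in> borel_measurable progressive"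
    "square_integrable \<mu> (\<lambda>x. norm (Y x))"
proof -
  have M2: "(\<lambda>t \<omega>. Y (t, \<omega>)) \<in> M2 M T F" using assms by (simp add: V_process_def)
  show n: "square_integrable \<mu> (\<lambda>x. norm (Y x))" using M2_square_integrable_norm[OF M2] by simp
  have ec: "blinfun_apply e \<in> borel_measurable borel"
    by (intro borel_measurable_continuous_onI linear_continuous_on blinfun.bounded_linear_right)
  have "Y \<in> borel_measurable progressive" using progressive_M2[OF M2] by simp
  then show p: "(\<lambda>x. e (Y x)) \<in> borel_measurable progressive" by (rule measurable_compose[OF _ ec])
  show "square_integrable \<mu> (\<lambda>x. e (Y x))"
  proof (rule square_integrableI_bound[OF square_integrable_mult_const[OF n, of "norm e"] measurable_progressive_mu[OF p]])
    show "AE x in \<mu>. norm (e (Y x)) \<le> norm (norm e * norm (Y x))"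
      using norm_blinfun[of e] by (simp add: abs_mult)
  qed
qed

lemma A_eval_measurable: "(\<lambda>x. A x v w) \<in> borel_measurable progressive"
  by (rule measurable_compose[OF A_meas]) (intro borel_measurable_continuous_onI continuous_intros)

text \<open>As \<open>V\<close> is not assumed to be separable, joint measurability of \<open>A x (Y x)\<close> is obtained by
  smoothing \<open>Y\<close> with the resolvents, which factor through the separable space \<open>H\<close>.\<close>

lemma A_left_measurable:
  assumes "V_process X Y" shows "(\<lambda>x. A x (Y x) v) \<in> borel_measurable progressive"
proof -
  obtain G K where "resolvent_family G K" using resolvents by blast
  then have G: "(\<lambda>n. G n (e v)) \<longlonglongrightarrow> v" for v by (simp add: resolvent_family_def)
  show ?thesis
  proof (rule borel_measurable_LIMSEQ_real)
    show "(\<lambda>n. A x (G n (e (Y x))) v) \<longlonglongrightarrow> A x (Y x) v" for x by (intro tendsto_intros G)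
    show "(\<lambda>x. A x (G n (e (Y x))) v) \<in> borel_measurable progressive" for n
      by (rule caratheodory_measurable[where f = "\<lambda>x y. A x (G n y) v"])
        (intro A_eval_measurable continuous_intros V_process_H(2)[OF assms])+
  qed
qed

lemma A_right_measurable:
  assumes "V_process X Y" shows "(\<lambda>x. A x v (Y x)) \<in> borel_measurable progressive"
proof -
  obtain G K where "resolvent_family G K" using resolvents by blast
  then have G: "(\<lambda>n. G n (e v)) \<longlonglongrightarrow> v" for v by (simp add: resolvent_family_def)
  show ?thesis
  proof (rule borel_measurable_LIMSEQ_real)
    show "(\<lambda>n. A x v (G n (e (Y x)))) \<longlonglongrightarrow> A x v (Y x)" for x by (intro tendsto_intros G)
    show "(\<lambda>x. A x v (G n (e (Y x)))) \<in> borel_measurable progressive" for n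
      by (rule caratheodory_measurable[where f = "\<lambda>x y. A x v (G n y)"])
        (intro A_eval_measurable continuous_intros V_process_H(2)[OF assms])+
  qed
qed

lemma A_le: "x \<in> space \<mu> \<Longrightarrow> \<bar>A x v w\<bar> \<le> C * norm v * norm w"
proof -
  assume "x \<in> space \<mu>"
  then have "norm (A x) \<le> C" by (rule A_bound)
  have "\<bar>A x v w\<bar> \<le> norm (A x v) * norm w" using norm_blinfun[of "A x v" w] by simp
  also have "\<dots> \<le> (norm (A x) * norm v) * norm w" by (intro mult_right_mono norm_blinfun) simp
  also have "\<dots> \<le> (C * norm v) * norm w" by (intro mult_right_mono \<open>norm (A x) \<le> C\<close>) auto
  finally show ?thesis .
qed

lemma A_left_square_integrable:
  assumes "V_process X Y" shows "square_integrable \<mu> (\<lambda>x. A x (Y x) v)"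
proof (rule square_integrableI_bound[OF square_integrable_mult_const[OF V_process_H(3)[OF assms], of "C * norm v"]
      measurable_progressive_mu[OF A_left_measurable[OF assms]]])
  show "AE x in \<mu>. norm (A x (Y x) v) \<le> norm (C * norm v * norm (Y x))"
  proof (rule AE_I2)
    fix x assume "x \<in> space \<mu>"
    from A_le[OF this, of "Y x" v] show "norm (A x (Y x) v) \<le> norm (C * norm v * norm (Y x))"
      by (simp add: mult_ac)
  qed
qed

lemma A_right_square_integrable:
  assumes "V_process X Y" shows "square_integrable \<mu> (\<lambda>x. A x v (Y x))"
proof (rule square_integrableI_bound[OF square_integrable_mult_const[OF V_process_H(3)[OF assms], of "C * norm v"]
      measurable_progressive_mu[OF A_right_measurable[OF assms]]])
  show "AE x in \<mu>. norm (A x v (Y x)) \<le> norm (C * norm v * norm (Y x))"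
  proof (rule AE_I2)
    fix x assume "x \<in> space \<mu>"
    from A_le[OF this, of v "Y x"] show "norm (A x v (Y x)) \<le> norm (C * norm v * norm (Y x))"
      by (simp add: mult_ac)
  qed
qed


text \<open>The coefficients are frozen along the trajectory: \<open>h\<close> and \<open>g\<close>
  are mere processes. Differences of two states then solve a linear equation, whatever the
  nonlinearity of the problem.\<close>

definition state_of :: "'h \<Rightarrow> (real \<Rightarrow> 'w \<Rightarrow> 'h) \<Rightarrow> (real \<times> 'w \<Rightarrow> 'v) \<Rightarrow> (real \<times> 'w \<Rightarrow> 'h) \<Rightarrow> (real \<times> 'w \<Rightarrow> 'h) \<Rightarrow> bool" where
  "state_of x0 X Y h g \<longleftrightarrow> X \<in> S2 M T F \<and> V_process X Y \<and>
     square_integrable \<mu> h \<and> h \<in> borel_measurable progressive \<and> square_integrable \<mu> g \<and>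
     (\<forall>\<phi>. \<forall>t\<in>{0..T}. has_ito_integral M T W (\<lambda>s \<omega>. indicator {0..t} s * (g (s, \<omega>) \<bullet> e \<phi>))
       (\<lambda>\<omega>. X t \<omega> \<bullet> e \<phi> - x0 \<bullet> e \<phi>
         - (\<integral>s. (if s \<le> t then h (s, \<omega>) \<bullet> e \<phi> - A (s, \<omega>) (Y (s, \<omega>)) \<phi> else 0) \<partial>L)))"

text \<open>\<open>A x \<phi> (P x)\<close> is the adjoint operator applied to \<open>P x\<close>
  and tested with \<open>\<phi>\<close>. The process \<open>k\<close> stands for the derivative in
  \<open>x\<close> plus the mean of the derivative in \<open>x'\<close> of the Hamiltonian.\<close>

definition costate_of :: "('w \<Rightarrow> 'h) \<Rightarrow> (real \<Rightarrow> 'w \<Rightarrow> 'h) \<Rightarrow> (real \<times> 'w \<Rightarrow> 'v) \<Rightarrow> (real \<times> 'w \<Rightarrow> 'h) \<Rightarrow> (real \<times> 'w \<Rightarrow> 'h) \<Rightarrow> bool" where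
  "costate_of \<theta> p P q k \<longleftrightarrow> square_integrable M \<theta> \<and> p \<in> S2 M T F \<and> V_process p P \<and>
     square_integrable \<mu> k \<and> k \<in> borel_measurable progressive \<and> square_integrable \<mu> q \<and>
     (\<forall>\<phi>. \<forall>t\<in>{0..T}. has_ito_integral M T W (\<lambda>s \<omega>. indicator {t..T} s * (q (s, \<omega>) \<bullet> e \<phi>))
       (\<lambda>\<omega>. \<theta> \<omega> \<bullet> e \<phi> - p t \<omega> \<bullet> e \<phi>
         + (\<integral>s. (if t \<le> s then k (s, \<omega>) \<bullet> e \<phi> - A (s, \<omega>) \<phi> (P (s, \<omega>)) else 0) \<partial>L)))"

lemma square_integrable_inner_const:
  fixes f :: "'a \<Rightarrow> 'h"
  assumes "square_integrable N f" shows "square_integrable N (\<lambda>x. f x \<bullet> y)"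
  by (rule square_integrable_bounded_linear[OF bounded_linear_inner_left assms])

text \<open>The product rule for the real processes obtained from costate and state by testing with
  one and the same \<open>\<phi>\<close>. The term with \<open>x0\<close> is kept in a form that
  depends on the costate alone, so it cancels when two states are subtracted.\<close>

lemma scalar_duality:
  assumes X: "state_of x0 X Y h g" and p: "costate_of \<theta> p P q k"
  shows "integrable \<mu> (\<lambda>x. (e (P x) \<bullet> e \<phi>) * (h x \<bullet> e \<phi> - A x (Y x) \<phi>)
      - (k x \<bullet> e \<phi> - A x \<phi> (P x)) * (e (Y x) \<bullet> e \<phi>) + (q x \<bullet> e \<phi>) * (g x \<bullet> e \<phi>))"
    and "expectation (\<lambda>\<omega>. (\<theta> \<omega> \<bullet> e \<phi>) * (X T \<omega> \<bullet> e \<phi>)) =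
      (x0 \<bullet> e \<phi>) * (expectation (\<lambda>\<omega>. \<theta> \<omega> \<bullet> e \<phi>) + (\<integral>x. k x \<bullet> e \<phi> - A x \<phi> (P x) \<partial>\<mu>))
      + (\<integral>x. (e (P x) \<bullet> e \<phi>) * (h x \<bullet> e \<phi> - A x (Y x) \<phi>)
        - (k x \<bullet> e \<phi> - A x \<phi> (P x)) * (e (Y x) \<bullet> e \<phi>) + (q x \<bullet> e \<phi>) * (g x \<bullet> e \<phi>) \<partial>\<mu>)"
proof -
  let ?K = "\<lambda>x. (e (P x) \<bullet> e \<phi>) * (h x \<bullet> e \<phi> - A x (Y x) \<phi>)
    - (k x \<bullet> e \<phi> - A x \<phi> (P x)) * (e (Y x) \<bullet> e \<phi>) + (q x \<bullet> e \<phi>) * (g x \<bullet> e \<phi>)"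
  have X': "X \<in> S2 M T F" "V_process X Y" "square_integrable \<mu> h" "h \<in> borel_measurable progressive" "square_integrable \<mu> g"
    using X by (simp_all add: state_of_def)
  have p': "square_integrable M \<theta>" "p \<in> S2 M T F" "V_process p P" "square_integrable \<mu> k"
      "k \<in> borel_measurable progressive" "square_integrable \<mu> q"
    using p by (simp_all add: costate_of_def)
  let ?b = "\<lambda>x. h x \<bullet> e \<phi> - A x (Y x) \<phi>" and ?c = "\<lambda>x. k x \<bullet> e \<phi> - A x \<phi> (P x)"
  have b: "square_integrable \<mu> ?b"
    by (intro square_integrable_diff square_integrable_inner_const X' A_left_square_integrable[OF X'(2)])
  have c: "square_integrable \<mu> ?c"
    by (intro square_integrable_diff square_integrable_inner_const p' A_right_square_integrable[OF p'(3)])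
  have sq: "square_integrable \<mu> (\<lambda>x. e (P x) \<bullet> e \<phi>)" "square_integrable \<mu> (\<lambda>x. e (Y x) \<bullet> e \<phi>)"
    "square_integrable \<mu> (\<lambda>x. q x \<bullet> e \<phi>)" "square_integrable \<mu> (\<lambda>x. g x \<bullet> e \<phi>)"
    using V_process_H(1)[OF X'(2)] V_process_H(1)[OF p'(3)] X' p' by (auto intro: square_integrable_inner_const)
  show "integrable \<mu> ?K"
    by (intro Bochner_Integration.integrable_add Bochner_Integration.integrable_diff square_integrable_mult_integrable b c sq)
  have bp: "?b \<in> borel_measurable progressive" using X'(4) A_left_measurable[OF X'(2)] by measurable
  have cp: "?c \<in> borel_measurable progressive" using p'(5) A_right_measurable[OF p'(3)] by measurable
  have aeX: "AE x in \<mu>. X (fst x) (snd x) \<bullet> e \<phi> = e (Y x) \<bullet> e \<phi>"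
  proof -
    have "AE x in \<mu>. e (Y x) = X (fst x) (snd x)" using X'(2) by (simp add: V_process_def)
    then show ?thesis by eventually_elim simp
  qed
  have aep: "AE x in \<mu>. p (fst x) (snd x) \<bullet> e \<phi> = e (P x) \<bullet> e \<phi>"
  proof -
    have "AE x in \<mu>. e (P x) = p (fst x) (snd x)" using p'(3) by (simp add: V_process_def)
    then show ?thesis by eventually_elim simp
  qed
  show "expectation (\<lambda>\<omega>. (\<theta> \<omega> \<bullet> e \<phi>) * (X T \<omega> \<bullet> e \<phi>)) =
      (x0 \<bullet> e \<phi>) * (expectation (\<lambda>\<omega>. \<theta> \<omega> \<bullet> e \<phi>) + integral\<^sup>L \<mu> ?c) + (\<integral>x. ?K x \<partial>\<mu>)"
  proof (rule ito_product_rule[where \<eta> = "\<lambda>t \<omega>. p t \<omega> \<bullet> e \<phi>" and \<zeta> = "\<lambda>t \<omega>. X t \<omega> \<bullet> e \<phi>"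
        and q = "\<lambda>s \<omega>. q (s, \<omega>) \<bullet> e \<phi>" and g = "\<lambda>s \<omega>. g (s, \<omega>) \<bullet> e \<phi>"])
    show "(\<lambda>\<omega>. ?b (s, \<omega>)) \<in> borel_measurable (F s)" "(\<lambda>\<omega>. ?c (s, \<omega>)) \<in> borel_measurable (F s)" if "s \<in> {0..T}" for s
      using measurable_progressive_section[OF bp that] measurable_progressive_section[OF cp that] .
    show "(\<lambda>\<omega>. p 0 \<omega> \<bullet> e \<phi>) \<in> borel_measurable (F 0)"
      using S2_square_integrable(2)[OF p'(2), of 0] T_pos by simp
    show "square_integrable M (\<lambda>\<omega>. p t \<omega> \<bullet> e \<phi>)" "square_integrable M (\<lambda>\<omega>. X t \<omega> \<bullet> e \<phi>)" if "t \<in> {0..T}" for t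
      using S2_square_integrable(1)[OF p'(2) that] S2_square_integrable(1)[OF X'(1) that]
      by (auto intro: square_integrable_inner_const)
    show "has_ito_integral M T W (\<lambda>s \<omega>. indicator {0..t} s * (g (s, \<omega>) \<bullet> e \<phi>))
      (\<lambda>\<omega>. X t \<omega> \<bullet> e \<phi> - x0 \<bullet> e \<phi> - (\<integral>s. (if s \<le> t then ?b (s, \<omega>) else 0) \<partial>L))" if "t \<in> {0..T}" for t
      using X that unfolding state_of_def by blast
    show "has_ito_integral M T W (\<lambda>s \<omega>. indicator {t..T} s * (q (s, \<omega>) \<bullet> e \<phi>))
      (\<lambda>\<omega>. \<theta> \<omega> \<bullet> e \<phi> - p t \<omega> \<bullet> e \<phi> + (\<integral>s. (if t \<le> s then ?c (s, \<omega>) else 0) \<partial>L))" if "t \<in> {0..T}" for t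
      using p that unfolding costate_of_def by blast
  qed (use b c sq aeX aep p' in \<open>auto intro: square_integrable_inner_const simp: square_integrable_measurable\<close>)
qed

text \<open>The pairing obtained from the product rule when the product \<open>(p, X)\<close> is replaced by
  \<open>(\<Lambda> p, X)\<close> for an operator \<open>\<Lambda>\<close> on \<open>H\<close> with restriction \<open>\<Gamma>\<close> to \<open>V\<close>.\<close>

definition pairing :: "('h \<Rightarrow> 'h) \<Rightarrow> ('v \<Rightarrow> 'v) \<Rightarrow> (real \<times> 'w \<Rightarrow> 'v) \<Rightarrow> (real \<times> 'w \<Rightarrow> 'h) \<Rightarrow> (real \<times> 'w \<Rightarrow> 'h) \<Rightarrow>
    (real \<times> 'w \<Rightarrow> 'v) \<Rightarrow> (real \<times> 'w \<Rightarrow> 'h) \<Rightarrow> (real \<times> 'w \<Rightarrow> 'h) \<Rightarrow> real \<times> 'w \<Rightarrow> real" where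
  "pairing \<Lambda> \<Gamma> Z h g P k q x = h x \<bullet> \<Lambda> (e (P x)) - A x (Z x) (\<Gamma> (P x))
     - k x \<bullet> \<Lambda> (e (Z x)) + A x (\<Gamma> (Z x)) (P x) + \<Lambda> (q x) \<bullet> g x"

text \<open>Dominated convergence on both sides: contractivity on \<open>H\<close> and the bound
  \<open>K\<close> on \<open>V\<close> give a majorant independent of \<open>m\<close>.
  Measurability is transported along with the identity, since it is only evident for operators of
  finite rank.\<close>

lemma pairing_limit:
  assumes h: "square_integrable \<mu> h" and g: "square_integrable \<mu> g" and k: "square_integrable \<mu> k" and q: "square_integrable \<mu> q"
    and Z: "square_integrable \<mu> (\<lambda>x. norm (Z x))" "square_integrable \<mu> (\<lambda>x. e (Z x))"
    and P: "square_integrable \<mu> (\<lambda>x. norm (P x))" "square_integrable \<mu> (\<lambda>x. e (P x))"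
    and \<theta>: "square_integrable M \<theta>" and \<xi>: "square_integrable M \<xi>"
    and \<Lambda>: "\<And>y. (\<lambda>m. \<Lambda> m y) \<longlonglongrightarrow> \<Lambda>' y" "\<And>m y. norm (\<Lambda> m y) \<le> norm y"
    and \<Gamma>: "\<And>v. (\<lambda>m. \<Gamma> m v) \<longlonglongrightarrow> \<Gamma>' v" "\<And>m v. norm (\<Gamma> m v) \<le> K * norm v"
    and meas: "\<And>m. pairing (\<Lambda> m) (\<Gamma> m) Z h g P k q \<in> borel_measurable \<mu>"
      "\<And>m. (\<lambda>\<omega>. \<Lambda> m (\<theta> \<omega>) \<bullet> \<xi> \<omega>) \<in> borel_measurable M"
    and eq: "\<And>m. expectation (\<lambda>\<omega>. \<Lambda> m (\<theta> \<omega>) \<bullet> \<xi> \<omega>) = integral\<^sup>L \<mu> (pairing (\<Lambda> m) (\<Gamma> m) Z h g P k q)"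
  shows "pairing \<Lambda>' \<Gamma>' Z h g P k q \<in> borel_measurable \<mu>"
    "(\<lambda>\<omega>. \<Lambda>' (\<theta> \<omega>) \<bullet> \<xi> \<omega>) \<in> borel_measurable M"
    "expectation (\<lambda>\<omega>. \<Lambda>' (\<theta> \<omega>) \<bullet> \<xi> \<omega>) = integral\<^sup>L \<mu> (pairing \<Lambda>' \<Gamma>' Z h g P k q)"
proof -
  have limK: "(\<lambda>m. pairing (\<Lambda> m) (\<Gamma> m) Z h g P k q x) \<longlonglongrightarrow> pairing \<Lambda>' \<Gamma>' Z h g P k q x" for x
    unfolding pairing_def by (intro tendsto_intros \<Lambda> \<Gamma>)
  have lim\<theta>: "(\<lambda>m. \<Lambda> m (\<theta> \<omega>) \<bullet> \<xi> \<omega>) \<longlonglongrightarrow> \<Lambda>' (\<theta> \<omega>) \<bullet> \<xi> \<omega>" for \<omega> by (intro tendsto_intros \<Lambda>)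
  show mK: "pairing \<Lambda>' \<Gamma>' Z h g P k q \<in> borel_measurable \<mu>"
    by (rule borel_measurable_LIMSEQ_real[OF limK meas(1)])
  show m\<theta>: "(\<lambda>\<omega>. \<Lambda>' (\<theta> \<omega>) \<bullet> \<xi> \<omega>) \<in> borel_measurable M"
    by (rule borel_measurable_LIMSEQ_real[OF lim\<theta> meas(2)])
  let ?D = "\<lambda>x. norm (h x) * norm (e (P x)) + 2 * \<bar>C * K\<bar> * (norm (Z x) * norm (P x)) + norm (k x) * norm (e (Z x)) + norm (q x) * norm (g x)"
  have "integrable \<mu> ?D"
    by (intro Bochner_Integration.integrable_add integrable_mult_right square_integrable_mult_integrable
        square_integrable_norm[OF h] square_integrable_norm[OF P(2)] square_integrable_norm[OF k]
        square_integrable_norm[OF Z(2)] square_integrable_norm[OF q] square_integrable_norm[OF g] Z(1) P(1))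
  moreover have "norm (pairing (\<Lambda> m) (\<Gamma> m) Z h g P k q x) \<le> ?D x" if x: "x \<in> space \<mu>" for m x
  proof -
    have i: "\<bar>y \<bullet> \<Lambda> m z\<bar> \<le> norm y * norm z" for y z :: 'h
      using Cauchy_Schwarz_ineq2[of y "\<Lambda> m z"] mult_left_mono[OF \<Lambda>(2)[of m z] norm_ge_zero[of y]] by linarith
    have C0: "C \<ge> 0" using A_bound[OF x] norm_ge_zero[of "A x"] by linarith
    have "\<bar>A x (Z x) (\<Gamma> m (P x))\<bar> \<le> C * norm (Z x) * norm (\<Gamma> m (P x))" by (rule A_le[OF x])
    also have "\<dots> \<le> C * norm (Z x) * (K * norm (P x))" using C0 by (intro mult_left_mono \<Gamma>(2)) auto
    also have "\<dots> = (C * K) * (norm (Z x) * norm (P x))" by simp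
    also have "\<dots> \<le> \<bar>C * K\<bar> * (norm (Z x) * norm (P x))" by (intro mult_right_mono) auto
    finally have a1: "\<bar>A x (Z x) (\<Gamma> m (P x))\<bar> \<le> \<bar>C * K\<bar> * (norm (Z x) * norm (P x))" .
    have "\<bar>A x (\<Gamma> m (Z x)) (P x)\<bar> \<le> C * norm (\<Gamma> m (Z x)) * norm (P x)" by (rule A_le[OF x])
    also have "\<dots> \<le> C * (K * norm (Z x)) * norm (P x)" using C0 by (intro mult_right_mono mult_left_mono \<Gamma>(2)) auto
    also have "\<dots> = (C * K) * (norm (Z x) * norm (P x))" by simp
    also have "\<dots> \<le> \<bar>C * K\<bar> * (norm (Z x) * norm (P x))" by (intro mult_right_mono) auto
    finally have a2: "\<bar>A x (\<Gamma> m (Z x)) (P x)\<bar> \<le> \<bar>C * K\<bar> * (norm (Z x) * norm (P x))" .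
    have "\<bar>\<Lambda> m (q x) \<bullet> g x\<bar> \<le> norm (q x) * norm (g x)" using i[of "g x" "q x"] by (simp add: inner_commute mult.commute)
    then show ?thesis unfolding pairing_def real_norm_def
      using i[of "h x" "e (P x)"] i[of "k x" "e (Z x)"] a1 a2 by linarith
  qed
  ultimately have L1: "(\<lambda>m. integral\<^sup>L \<mu> (pairing (\<Lambda> m) (\<Gamma> m) Z h g P k q)) \<longlonglongrightarrow> integral\<^sup>L \<mu> (pairing \<Lambda>' \<Gamma>' Z h g P k q)"
    using limK by (intro integral_dominated_convergence[where w = ?D] mK meas(1) AE_I2) auto
  have L2: "(\<lambda>m. expectation (\<lambda>\<omega>. \<Lambda> m (\<theta> \<omega>) \<bullet> \<xi> \<omega>)) \<longlonglongrightarrow> expectation (\<lambda>\<omega>. \<Lambda>' (\<theta> \<omega>) \<bullet> \<xi> \<omega>)"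
  proof (rule integral_dominated_convergence[OF m\<theta> meas(2), where w = "\<lambda>\<omega>. norm (\<theta> \<omega>) * norm (\<xi> \<omega>)"])
    show "integrable M (\<lambda>\<omega>. norm (\<theta> \<omega>) * norm (\<xi> \<omega>))"
      by (intro square_integrable_mult_integrable square_integrable_norm \<theta> \<xi>)
    show "AE \<omega> in M. norm (\<Lambda> m (\<theta> \<omega>) \<bullet> \<xi> \<omega>) \<le> norm (\<theta> \<omega>) * norm (\<xi> \<omega>)" for m
    proof (rule AE_I2)
      fix \<omega>
      show "norm (\<Lambda> m (\<theta> \<omega>) \<bullet> \<xi> \<omega>) \<le> norm (\<theta> \<omega>) * norm (\<xi> \<omega>)"
        using Cauchy_Schwarz_ineq2[of "\<Lambda> m (\<theta> \<omega>)" "\<xi> \<omega>"] mult_right_mono[OF \<Lambda>(2)[of m "\<theta> \<omega>"] norm_ge_zero[of "\<xi> \<omega>"]]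
        by simp
    qed
  qed (use lim\<theta> in simp)
  show "expectation (\<lambda>\<omega>. \<Lambda>' (\<theta> \<omega>) \<bullet> \<xi> \<omega>) = integral\<^sup>L \<mu> (pairing \<Lambda>' \<Gamma>' Z h g P k q)"
    by (rule LIMSEQ_unique[OF L2]) (use L1 eq in simp)
qed

text \<open>The scalar identities for the test functions \<open>G n (w i)\<close> are summed, the
  number of test functions tends to infinity, and finally \<open>n\<close> does;
  \<open>pairing_limit\<close> performs both passages. The common initial state leaves no boundary
  term at time zero.\<close>

lemma duality:
  assumes X1: "state_of x0 X1 Y1 h1 g1" and X2: "state_of x0 X2 Y2 h2 g2" and p: "costate_of \<theta> p P q k"
  shows "expectation (\<lambda>\<omega>. \<theta> \<omega> \<bullet> (X1 T \<omega> - X2 T \<omega>)) =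
    (\<integral>x. (h1 x - h2 x) \<bullet> e (P x) - k x \<bullet> (e (Y1 x) - e (Y2 x)) + q x \<bullet> (g1 x - g2 x) \<partial>\<mu>)"
proof -
  have X1': "X1 \<in> S2 M T F" "V_process X1 Y1" "square_integrable \<mu> h1" "square_integrable \<mu> g1"
    using X1 by (simp_all add: state_of_def)
  have X2': "X2 \<in> S2 M T F" "V_process X2 Y2" "square_integrable \<mu> h2" "square_integrable \<mu> g2"
    using X2 by (simp_all add: state_of_def)
  have p': "square_integrable M \<theta>" "p \<in> S2 M T F" "V_process p P" "square_integrable \<mu> k" "square_integrable \<mu> q"
    using p by (simp_all add: costate_of_def)
  let ?h = "\<lambda>x. h1 x - h2 x" and ?g = "\<lambda>x. g1 x - g2 x" and ?Z = "\<lambda>x. Y1 x - Y2 x"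
  let ?\<xi> = "\<lambda>\<omega>. X1 T \<omega> - X2 T \<omega>"
  have TT: "T \<in> {0..T}" using T_pos by simp
  have h: "square_integrable \<mu> ?h" and g: "square_integrable \<mu> ?g" using X1' X2' by (auto intro: square_integrable_diff)
  have \<xi>: "square_integrable M ?\<xi>"
    using S2_square_integrable(1)[OF X1'(1) TT] S2_square_integrable(1)[OF X2'(1) TT] by (rule square_integrable_diff)
  have eZ: "square_integrable \<mu> (\<lambda>x. e (?Z x))"
    unfolding blinfun.diff_right using V_process_H(1)[OF X1'(2)] V_process_H(1)[OF X2'(2)] by (rule square_integrable_diff)
  have eP: "square_integrable \<mu> (\<lambda>x. e (P x))" by (rule V_process_H(1)[OF p'(3)])
  obtain G K where G: "resolvent_family G K" using resolvents by blast
  obtain w :: "nat \<Rightarrow> 'h" where w: "\<And>N x. norm (finite_projection w N x) \<le> norm x"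
    "\<And>x. (\<lambda>N. finite_projection w N x) \<longlonglongrightarrow> x" using finite_projections_exist by blast
  have Gs: "e (G n x) \<bullet> y = x \<bullet> e (G n y)" and Gc: "norm (e (G n x)) \<le> norm x" and K0: "0 \<le> K"
    and GK: "norm (G n (e v)) \<le> K * norm v" and Gl: "(\<lambda>n. G n (e v)) \<longlonglongrightarrow> v" and Gl': "(\<lambda>n. e (G n x)) \<longlonglongrightarrow> x"
    for n x y v using G by (simp_all add: resolvent_family_def)
  \<comment> \<open>Without separability of \<open>V\<close> the difference of two measurable
    \<open>V\<close>-valued processes is not evidently measurable; its norm is a limit of functions
    that factor through \<open>H\<close>.\<close>
  have Znm: "(\<lambda>x. norm (?Z x)) \<in> borel_measurable \<mu>"
  proof (rule borel_measurable_LIMSEQ_real)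
    show "(\<lambda>n. norm (G n (e (?Z x)))) \<longlonglongrightarrow> norm (?Z x)" for x by (intro tendsto_intros Gl)
    have "(\<lambda>y. norm (G n y)) \<in> borel_measurable borel" for n by (intro borel_measurable_continuous_onI continuous_intros)
    then show "(\<lambda>x. norm (G n (e (?Z x)))) \<in> borel_measurable \<mu>" for n
      by (rule measurable_compose[OF square_integrable_measurable[OF eZ]])
  qed
  have Z: "square_integrable \<mu> (\<lambda>x. norm (?Z x))"
  proof (rule square_integrableI_bound[OF square_integrable_add[OF V_process_H(3)[OF X1'(2)] V_process_H(3)[OF X2'(2)]] Znm])
    show "AE x in \<mu>. norm (norm (?Z x)) \<le> norm (norm (Y1 x) + norm (Y2 x))" by (simp add: norm_triangle_ineq4)
  qed
  have P: "square_integrable \<mu> (\<lambda>x. norm (P x))" by (rule V_process_H(3)[OF p'(3)])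
  \<comment> \<open>By symmetry of \<open>G n\<close>, placing the projection between two resolvents
    gives exactly the finite sum belonging to the test functions \<open>G n (w i)\<close>.\<close>
  define \<Psi> where "\<Psi> n N y = G n (finite_projection w N (e (G n y)))" for n N y
  have \<Psi>: "\<Psi> n N y = (\<Sum>i<N. (y \<bullet> e (G n (w i))) *\<^sub>R G n (w i))" for n N y
    by (simp add: \<Psi>_def finite_projection_def blinfun.sum_right blinfun.scaleR_right Gs)
  have fin: "pairing (\<lambda>y. e (\<Psi> n N y)) (\<lambda>v. \<Psi> n N (e v)) ?Z ?h ?g P k q \<in> borel_measurable \<mu>"
    "(\<lambda>\<omega>. e (\<Psi> n N (\<theta> \<omega>)) \<bullet> ?\<xi> \<omega>) \<in> borel_measurable M"
    "expectation (\<lambda>\<omega>. e (\<Psi> n N (\<theta> \<omega>)) \<bullet> ?\<xi> \<omega>) =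
      integral\<^sup>L \<mu> (pairing (\<lambda>y. e (\<Psi> n N y)) (\<lambda>v. \<Psi> n N (e v)) ?Z ?h ?g P k q)" for n N
  proof -
    let ?\<phi> = "\<lambda>i. G n (w i)"
    let ?Kp = "\<lambda>Y h g \<phi> x. (e (P x) \<bullet> e \<phi>) * (h x \<bullet> e \<phi> - A x (Y x) \<phi>)
      - (k x \<bullet> e \<phi> - A x \<phi> (P x)) * (e (Y x) \<bullet> e \<phi>) + (q x \<bullet> e \<phi>) * (g x \<bullet> e \<phi>)"
    note d1 = scalar_duality[OF X1 p] and d2 = scalar_duality[OF X2 p]
    have Keq: "pairing (\<lambda>y. e (\<Psi> n N y)) (\<lambda>v. \<Psi> n N (e v)) ?Z ?h ?g P k q
      = (\<lambda>x. \<Sum>i<N. ?Kp Y1 h1 g1 (?\<phi> i) x - ?Kp Y2 h2 g2 (?\<phi> i) x)"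
    proof
      fix x
      have "pairing (\<lambda>y. e (\<Psi> n N y)) (\<lambda>v. \<Psi> n N (e v)) ?Z ?h ?g P k q x =
        (\<Sum>i<N. (e (P x) \<bullet> e (?\<phi> i)) * (?h x \<bullet> e (?\<phi> i))) - (\<Sum>i<N. (e (P x) \<bullet> e (?\<phi> i)) * A x (?Z x) (?\<phi> i))
        - (\<Sum>i<N. (e (?Z x) \<bullet> e (?\<phi> i)) * (k x \<bullet> e (?\<phi> i))) + (\<Sum>i<N. (e (?Z x) \<bullet> e (?\<phi> i)) * A x (?\<phi> i) (P x))
        + (\<Sum>i<N. (q x \<bullet> e (?\<phi> i)) * (e (?\<phi> i) \<bullet> ?g x))"
        unfolding pairing_def \<Psi> blinfun.sum_right blinfun.sum_left blinfun.scaleR_right blinfun.scaleR_left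
          inner_sum_left inner_sum_right inner_scaleR_left inner_scaleR_right real_scaleR_def ..
      also have "\<dots> = (\<Sum>i<N. ?Kp Y1 h1 g1 (?\<phi> i) x - ?Kp Y2 h2 g2 (?\<phi> i) x)"
        unfolding sum.distrib[symmetric] sum_subtractf[symmetric]
        by (intro sum.cong refl) (simp add: blinfun.diff_right blinfun.diff_left inner_diff_left inner_diff_right
            inner_commute[of "e (?\<phi> _)"] algebra_simps)
      finally show "pairing (\<lambda>y. e (\<Psi> n N y)) (\<lambda>v. \<Psi> n N (e v)) ?Z ?h ?g P k q x
        = (\<Sum>i<N. ?Kp Y1 h1 g1 (?\<phi> i) x - ?Kp Y2 h2 g2 (?\<phi> i) x)" .
    qed
    show "pairing (\<lambda>y. e (\<Psi> n N y)) (\<lambda>v. \<Psi> n N (e v)) ?Z ?h ?g P k q \<in> borel_measurable \<mu>"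
      unfolding Keq by (intro borel_measurable_sum borel_measurable_diff borel_measurable_integrable[OF d1(1)] borel_measurable_integrable[OF d2(1)])
    have \<theta>eq: "(\<lambda>\<omega>. e (\<Psi> n N (\<theta> \<omega>)) \<bullet> ?\<xi> \<omega>) = (\<lambda>\<omega>. \<Sum>i<N. (\<theta> \<omega> \<bullet> e (?\<phi> i)) * (X1 T \<omega> \<bullet> e (?\<phi> i)) - (\<theta> \<omega> \<bullet> e (?\<phi> i)) * (X2 T \<omega> \<bullet> e (?\<phi> i)))"
      by (rule ext) (simp add: \<Psi> blinfun.sum_right blinfun.scaleR_right inner_sum_left inner_diff_right sum_subtractf inner_commute[of "e _"] algebra_simps)
    have i: "integrable M (\<lambda>\<omega>. (\<theta> \<omega> \<bullet> e \<phi>) * (X1 T \<omega> \<bullet> e \<phi>))" "integrable M (\<lambda>\<omega>. (\<theta> \<omega> \<bullet> e \<phi>) * (X2 T \<omega> \<bullet> e \<phi>))" for \<phi>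
      by (intro square_integrable_mult_integrable square_integrable_inner_const p' S2_square_integrable(1)[OF X1'(1) TT]
          S2_square_integrable(1)[OF X2'(1) TT])+
    show "(\<lambda>\<omega>. e (\<Psi> n N (\<theta> \<omega>)) \<bullet> ?\<xi> \<omega>) \<in> borel_measurable M"
      unfolding \<theta>eq by (intro borel_measurable_sum borel_measurable_diff borel_measurable_integrable[OF i(1)] borel_measurable_integrable[OF i(2)])
    have "expectation (\<lambda>\<omega>. e (\<Psi> n N (\<theta> \<omega>)) \<bullet> ?\<xi> \<omega>)
      = (\<Sum>i<N. expectation (\<lambda>\<omega>. (\<theta> \<omega> \<bullet> e (?\<phi> i)) * (X1 T \<omega> \<bullet> e (?\<phi> i))) - expectation (\<lambda>\<omega>. (\<theta> \<omega> \<bullet> e (?\<phi> i)) * (X2 T \<omega> \<bullet> e (?\<phi> i))))"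
      unfolding \<theta>eq using i by simp
    \<comment> \<open>Both states have the same initial value and the same costate, so the initial
      terms of the two dualities cancel.\<close>
    also have "\<dots> = (\<Sum>i<N. integral\<^sup>L \<mu> (?Kp Y1 h1 g1 (?\<phi> i)) - integral\<^sup>L \<mu> (?Kp Y2 h2 g2 (?\<phi> i)))"
      unfolding d1(2) d2(2) by simp
    also have "\<dots> = integral\<^sup>L \<mu> (\<lambda>x. \<Sum>i<N. ?Kp Y1 h1 g1 (?\<phi> i) x - ?Kp Y2 h2 g2 (?\<phi> i) x)"
      by (subst Bochner_Integration.integral_sum) (intro Bochner_Integration.integrable_diff d1(1) d2(1),
        intro sum.cong refl Bochner_Integration.integral_diff[symmetric] d1(1) d2(1))
    finally show "expectation (\<lambda>\<omega>. e (\<Psi> n N (\<theta> \<omega>)) \<bullet> ?\<xi> \<omega>) =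
      integral\<^sup>L \<mu> (pairing (\<lambda>y. e (\<Psi> n N y)) (\<lambda>v. \<Psi> n N (e v)) ?Z ?h ?g P k q)" unfolding Keq .
  qed
  note base = h g p'(4,5) Z eZ P eP p'(1) \<xi>
  have step: "pairing (\<lambda>y. e (G n (e (G n y)))) (\<lambda>v. G n (e (G n (e v)))) ?Z ?h ?g P k q \<in> borel_measurable \<mu>"
    "(\<lambda>\<omega>. e (G n (e (G n (\<theta> \<omega>)))) \<bullet> ?\<xi> \<omega>) \<in> borel_measurable M"
    "expectation (\<lambda>\<omega>. e (G n (e (G n (\<theta> \<omega>)))) \<bullet> ?\<xi> \<omega>) =
      integral\<^sup>L \<mu> (pairing (\<lambda>y. e (G n (e (G n y)))) (\<lambda>v. G n (e (G n (e v)))) ?Z ?h ?g P k q)" for n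
  proof -
    have c1: "(\<lambda>N. e (\<Psi> n N y)) \<longlonglongrightarrow> e (G n (e (G n y)))" for y unfolding \<Psi>_def by (intro tendsto_intros w)
    have c2: "norm (e (\<Psi> n N y)) \<le> norm y" for N y
      unfolding \<Psi>_def by (intro order_trans[OF Gc] order_trans[OF w(1)] order_trans[OF Gc order_refl])
    have c3: "(\<lambda>N. \<Psi> n N (e v)) \<longlonglongrightarrow> G n (e (G n (e v)))" for v unfolding \<Psi>_def by (intro tendsto_intros w)
    \<comment> \<open>The bound may depend on \<open>n\<close>, which is fixed while
      \<open>N\<close> grows; the detour through \<open>H\<close> is necessary because the
      projections need not be bounded on \<open>V\<close>.\<close>
    have c4: "norm (\<Psi> n N (e v)) \<le> norm (G n) * norm e * norm v" for N v
    proof -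
      have "norm (\<Psi> n N (e v)) \<le> norm (G n) * norm (finite_projection w N (e (G n (e v))))"
        unfolding \<Psi>_def by (rule norm_blinfun)
      also have "\<dots> \<le> norm (G n) * (norm e * norm v)"
        by (intro mult_left_mono order_trans[OF w(1)] order_trans[OF Gc] norm_blinfun) simp
      finally show ?thesis by (simp add: mult.assoc)
    qed
    note lim = pairing_limit[OF base, where \<Lambda> = "\<lambda>N y. e (\<Psi> n N y)" and \<Gamma> = "\<lambda>N v. \<Psi> n N (e v)"
        and K = "norm (G n) * norm e", OF c1 c2 c3 c4 fin]
    show "pairing (\<lambda>y. e (G n (e (G n y)))) (\<lambda>v. G n (e (G n (e v)))) ?Z ?h ?g P k q \<in> borel_measurable \<mu>"
      "(\<lambda>\<omega>. e (G n (e (G n (\<theta> \<omega>)))) \<bullet> ?\<xi> \<omega>) \<in> borel_measurable M"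
      "expectation (\<lambda>\<omega>. e (G n (e (G n (\<theta> \<omega>)))) \<bullet> ?\<xi> \<omega>) =
        integral\<^sup>L \<mu> (pairing (\<lambda>y. e (G n (e (G n y)))) (\<lambda>v. G n (e (G n (e v)))) ?Z ?h ?g P k q)"
      by (rule lim(1), rule lim(2), rule lim(3))
  qed
  \<comment> \<open>In the second limit the operators on \<open>V\<close> are bounded by
    \<open>K * K\<close> for all \<open>n\<close>. Both operators become the identity, and the two
    terms with \<open>A\<close> are then equal with opposite signs.\<close>
  have "expectation (\<lambda>\<omega>. (\<lambda>y. y) (\<theta> \<omega>) \<bullet> ?\<xi> \<omega>) = integral\<^sup>L \<mu> (pairing (\<lambda>y. y) (\<lambda>v. v) ?Z ?h ?g P k q)"
  proof (rule pairing_limit(3)[OF base, where \<Lambda> = "\<lambda>n y. e (G n (e (G n y)))" and \<Gamma> = "\<lambda>n v. G n (e (G n (e v)))" and K = "K * K"])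
    show "(\<lambda>n. e (G n (e (G n y)))) \<longlonglongrightarrow> y" for y
    proof -
      have "(\<lambda>n. e (G n (e (G n y) - y))) \<longlonglongrightarrow> 0"
        by (rule Lim_null_comparison[OF always_eventually[OF allI[OF Gc]]])
          (use tendsto_norm[OF LIM_zero[OF Gl'[of y]]] in simp)
      from tendsto_add[OF this Gl'[of y]] show ?thesis by (simp add: blinfun.diff_right)
    qed
    show "norm (e (G n (e (G n y)))) \<le> norm y" for n y by (intro order_trans[OF Gc] order_trans[OF Gc order_refl])
    show "(\<lambda>n. G n (e (G n (e v)))) \<longlonglongrightarrow> v" for v
    proof -
      have "(\<lambda>n. G n (e (G n (e v) - v))) \<longlonglongrightarrow> 0"
        by (rule Lim_null_comparison[OF always_eventually[OF allI[OF GK]]])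
          (use tendsto_mult_left[OF tendsto_norm[OF LIM_zero[OF Gl[of v]]], of K] in simp)
      from tendsto_add[OF this Gl[of v]] show ?thesis by (simp add: blinfun.diff_right)
    qed
    show "norm (G n (e (G n (e v)))) \<le> K * K * norm v" for n v
      using GK[of n "G n (e v)"] mult_left_mono[OF GK[of n v] K0] by simp
  qed (rule step)+
  then show ?thesis
    by (simp add: pairing_def[abs_def] blinfun.diff_right blinfun.diff_left algebra_simps inner_commute)
qed

end

section \<open>Gateaux derivatives and convexity\<close>

lemma has_gateaux_derivativeD:
  assumes "has_gateaux_derivative f D x S" "x + v \<in> S"
  shows "((\<lambda>\<epsilon>. (f (x + \<epsilon> *\<^sub>R v) - f x) /\<^sub>R \<epsilon>) \<longlongrightarrow> blinfun_apply D v) (at_right 0)"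
  using assms(1)[unfolded has_gateaux_derivative_def, rule_format, OF assms(2)] by simp

lemma has_gateaux_gradientD:
  assumes "has_gateaux_gradient f G x S" "x + v \<in> S"
  shows "((\<lambda>\<epsilon>. (f (x + \<epsilon> *\<^sub>R v) - f x) /\<^sub>R \<epsilon>) \<longlongrightarrow> G \<bullet> v) (at_right 0)"
  using has_gateaux_derivativeD[OF assms(1)[unfolded has_gateaux_gradient_def] assms(2)]
  by (simp add: blinfun_inner_right.rep_eq)

lemma gateaux_gradient_eq:
  assumes "has_gateaux_gradient f G x UNIV" shows "gateaux_gradient f x = G"
  unfolding gateaux_gradient_def
proof (rule the_equality[where P = "\<lambda>G. has_gateaux_gradient f G x UNIV", OF assms])
  fix G' assume G': "has_gateaux_gradient f G' x UNIV"
  have "G' \<bullet> v = G \<bullet> v" for v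
    by (rule tendsto_unique[OF _ has_gateaux_gradientD[OF G'] has_gateaux_gradientD[OF assms]]) auto
  then show "G' = G" by (metis inner_commute vector_eq_ldot)
qed

text \<open>Relative to a convex set only directions that reach the set are available, so the
  derivative at a point of a segment is known for a positive multiple \<open>c\<close> of the
  direction of interest. Rescaling the step removes the factor.\<close>

lemma right_derivative_rescale:
  fixes f :: "'a::real_normed_vector \<Rightarrow> real"
  assumes lim: "((\<lambda>\<epsilon>. (f (z + \<epsilon> *\<^sub>R (c *\<^sub>R d)) - f z) /\<^sub>R \<epsilon>) \<longlongrightarrow> c * l) (at_right 0)" and c: "c > 0"
  shows "((\<lambda>\<epsilon>. (f (z + \<epsilon> *\<^sub>R d) - f z) / \<epsilon>) \<longlongrightarrow> l) (at_right 0)"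
proof -
  have "filterlim (\<lambda>\<epsilon>. \<epsilon> / c) (at_right 0) (at_right (0::real))"
  proof (rule tendsto_imp_filterlim_at_right)
    show "((\<lambda>\<epsilon>. \<epsilon> / c) \<longlongrightarrow> 0) (at_right 0)"
      using tendsto_divide[OF tendsto_ident_at tendsto_const, of c 0 "{0<..}"] c by simp
    show "\<forall>\<^sub>F \<epsilon> in at_right 0. 0 < \<epsilon> / c" using c by (simp add: eventually_at_filter)
  qed
  from filterlim_compose[OF lim this]
  have "((\<lambda>\<epsilon>. (f (z + \<epsilon> *\<^sub>R d) - f z) /\<^sub>R (\<epsilon> / c)) \<longlongrightarrow> c * l) (at_right 0)" using c by simp
  from tendsto_mult[OF tendsto_const[of "1 / c"] this]
  have "((\<lambda>\<epsilon>. 1 / c * ((f (z + \<epsilon> *\<^sub>R d) - f z) /\<^sub>R (\<epsilon> / c))) \<longlongrightarrow> l) (at_right 0)" using c by simp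
  moreover have "1 / c * (a /\<^sub>R (\<epsilon> / c)) = a / \<epsilon>" for a \<epsilon> using c by (cases "\<epsilon> = 0") (simp_all add: field_simps)
  ultimately show ?thesis by (simp only:)
qed

text \<open>On the segment from \<open>x\<close> to \<open>y\<close> the one-sided directional
  derivatives towards the two end points glue to an ordinary derivative in the interior; at the ends
  one-sided continuity suffices for the classical mean value theorem.\<close>

lemma gateaux_mvt:
  fixes f :: "'a::real_normed_vector \<Rightarrow> real"
  assumes S: "convex S" "x \<in> S" "y \<in> S" and f: "\<And>z. z \<in> S \<Longrightarrow> has_gateaux_derivative f (D z) z S"
  obtains t where "0 < t" "t < 1" "f y - f x = D (x + t *\<^sub>R (y - x)) (y - x)"
proof -
  define z where "z t = x + t *\<^sub>R (y - x)" for t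
  have zS: "z t \<in> S" if "0 \<le> t" "t \<le> 1" for t
  proof -
    have "z t = (1 - t) *\<^sub>R x + t *\<^sub>R y" by (simp add: z_def algebra_simps)
    then show ?thesis using convexD[OF S(1,2,3), of "1 - t" t] that by simp
  qed
  have right: "((\<lambda>\<epsilon>. (f (z (t + \<epsilon>)) - f (z t)) / \<epsilon>) \<longlongrightarrow> D (z t) (y - x)) (at_right 0)" if t: "0 \<le> t" "t < 1" for t
  proof -
    have "z t + (1 - t) *\<^sub>R (y - x) = y" by (simp add: z_def algebra_simps)
    then have "z t + (1 - t) *\<^sub>R (y - x) \<in> S" using S by simp
    from has_gateaux_derivativeD[OF f[OF zS] this]
    have "((\<lambda>\<epsilon>. (f (z t + \<epsilon> *\<^sub>R ((1 - t) *\<^sub>R (y - x))) - f (z t)) /\<^sub>R \<epsilon>) \<longlongrightarrow> (1 - t) * D (z t) (y - x)) (at_right 0)"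
      using t by (simp add: blinfun.scaleR_right)
    from right_derivative_rescale[OF this] t
    have "((\<lambda>\<epsilon>. (f (z t + \<epsilon> *\<^sub>R (y - x)) - f (z t)) / \<epsilon>) \<longlongrightarrow> D (z t) (y - x)) (at_right 0)" by simp
    moreover have "z (t + \<epsilon>) = z t + \<epsilon> *\<^sub>R (y - x)" for \<epsilon> by (simp add: z_def algebra_simps)
    ultimately show ?thesis by simp
  qed
  \<comment> \<open>The derivative from the left is the derivative in the direction back to
    \<open>x\<close>, which is \<open>t\<close> times \<open>x - y\<close>.\<close>
  have left: "((\<lambda>\<epsilon>. (f (z (t + \<epsilon>)) - f (z t)) / \<epsilon>) \<longlongrightarrow> D (z t) (y - x)) (at_left 0)" if t: "0 < t" "t \<le> 1" for t
  proof -
    have "z t + t *\<^sub>R (- (y - x)) = x" by (simp add: z_def algebra_simps)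
    then have "z t + t *\<^sub>R (- (y - x)) \<in> S" using S by simp
    from has_gateaux_derivativeD[OF f[OF zS] this]
    have "((\<lambda>\<epsilon>. (f (z t + \<epsilon> *\<^sub>R (t *\<^sub>R (- (y - x)))) - f (z t)) /\<^sub>R \<epsilon>) \<longlongrightarrow> t * (- D (z t) (y - x))) (at_right 0)"
      using t by (simp add: blinfun.scaleR_right blinfun.minus_right blinfun.diff_right)
    from right_derivative_rescale[OF this t(1)]
    have "((\<lambda>\<epsilon>. (f (z t + \<epsilon> *\<^sub>R (- (y - x))) - f (z t)) / \<epsilon>) \<longlongrightarrow> - D (z t) (y - x)) (at_right 0)" .
    from tendsto_minus[OF this]
    have "((\<lambda>\<epsilon>. (f (z t + \<epsilon> *\<^sub>R (- (y - x))) - f (z t)) / (- \<epsilon>)) \<longlongrightarrow> D (z t) (y - x)) (at_right 0)" by simp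
    moreover have "z (t - \<epsilon>) = z t + \<epsilon> *\<^sub>R (- (y - x))" for \<epsilon> by (simp add: z_def algebra_simps)
    ultimately have "((\<lambda>\<epsilon>. (f (z (t + - \<epsilon>)) - f (z t)) / (- \<epsilon>)) \<longlongrightarrow> D (z t) (y - x)) (at_right 0)" by simp
    then show ?thesis by (subst filterlim_at_left_to_right) simp
  qed
  have deriv: "DERIV (\<lambda>t. f (z t)) t :> D (z t) (y - x)" if "0 < t" "t < 1" for t
    unfolding DERIV_def using filterlim_split_at[OF left right] that by simp
  have cont: "continuous_on {0..1} (\<lambda>t. f (z t))"
    unfolding continuous_on_def
  proof
    fix t :: real assume t: "t \<in> {0..1}"
    have r: "((\<lambda>t. f (z t)) \<longlongrightarrow> f (z t)) (at_right t)" if "t < 1"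
    proof -
      have "((\<lambda>\<epsilon>. \<epsilon> * ((f (z (t + \<epsilon>)) - f (z t)) / \<epsilon>)) \<longlongrightarrow> 0 * D (z t) (y - x)) (at_right 0)"
        using right t that by (intro tendsto_mult tendsto_ident_at) auto
      moreover have "\<forall>\<^sub>F \<epsilon> in at_right 0. \<epsilon> * ((f (z (t + \<epsilon>)) - f (z t)) / \<epsilon>) = f (z (t + \<epsilon>)) - f (z t)"
        by (simp add: eventually_at_filter)
      ultimately have "((\<lambda>\<epsilon>. f (z (t + \<epsilon>)) - f (z t)) \<longlongrightarrow> 0) (at_right 0)"
        by (simp add: tendsto_cong)
      then show ?thesis
        by (subst filterlim_at_right_to_0) (simp add: LIM_zero_iff add.commute)
    qed
    have l: "((\<lambda>t. f (z t)) \<longlongrightarrow> f (z t)) (at_left t)" if "0 < t"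
    proof -
      have "((\<lambda>\<epsilon>. \<epsilon> * ((f (z (t + \<epsilon>)) - f (z t)) / \<epsilon>)) \<longlongrightarrow> 0 * D (z t) (y - x)) (at_left 0)"
        using left t that by (intro tendsto_mult tendsto_ident_at) auto
      moreover have "\<forall>\<^sub>F \<epsilon> in at_left 0. \<epsilon> * ((f (z (t + \<epsilon>)) - f (z t)) / \<epsilon>) = f (z (t + \<epsilon>)) - f (z t)"
        by (simp add: eventually_at_filter)
      ultimately have "((\<lambda>\<epsilon>. f (z (t + \<epsilon>)) - f (z t)) \<longlongrightarrow> 0) (at_left 0)"
        by (simp add: tendsto_cong)
      then show ?thesis
        unfolding filterlim_at_left_to_right[of _ _ 0] filterlim_at_left_to_right[of _ _ t]
        by (subst filterlim_at_right_to_0) (simp add: LIM_zero_iff)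
    qed
    consider "t = 0" | "t = 1" | "0 < t" "t < 1" using t by fastforce
    then show "((\<lambda>t. f (z t)) \<longlongrightarrow> f (z t)) (at t within {0..1})"
    proof cases
      case 1
      then show ?thesis using r by (simp add: at_within_Icc_at_right)
    next
      case 2
      then show ?thesis using l by (simp add: at_within_Icc_at_left)
    next
      case 3
      have "((\<lambda>t. f (z t)) \<longlongrightarrow> f (z t)) (at t)" using l[OF 3(1)] r[OF 3(2)] by (rule filterlim_split_at)
      then show ?thesis by (rule tendsto_within_subset) simp
    qed
  qed
  have "(\<lambda>t. f (z t)) differentiable (at t)" if "0 < t" "t < 1" for t
    using deriv[OF that] real_differentiable_def by blast
  from MVT[OF zero_less_one cont this] obtain l t where t: "0 < t" "t < 1" "DERIV (\<lambda>t. f (z t)) t :> l"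
    "f (z 1) - f (z 0) = (1 - 0) * l" by blast
  have "l = D (z t) (y - x)" using t(3) deriv[OF t(1,2)] by (rule DERIV_unique)
  with t have "0 < t" "t < 1" "f (z 1) - f (z 0) = D (z t) (y - x)" by simp_all
  then show ?thesis using that[of t] by (simp add: z_def)
qed

lemma has_gateaux_derivative_inner:
  assumes "has_gateaux_derivative f D x S"
  shows "has_gateaux_derivative (\<lambda>z. f z \<bullet> v) (blinfun_inner_left v o\<^sub>L D) x S"
  unfolding has_gateaux_derivative_def
proof
  fix y assume "y \<in> S"
  with assms have "((\<lambda>\<epsilon>. ((f (x + \<epsilon> *\<^sub>R (y - x)) - f x) /\<^sub>R \<epsilon>) \<bullet> v) \<longlongrightarrow> D (y - x) \<bullet> v) (at_right 0)"
    unfolding has_gateaux_derivative_def by (intro tendsto_inner tendsto_const) blast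
  then show "((\<lambda>\<epsilon>. (f (x + \<epsilon> *\<^sub>R (y - x)) \<bullet> v - f x \<bullet> v) /\<^sub>R \<epsilon>) \<longlongrightarrow> (blinfun_inner_left v o\<^sub>L D) (y - x)) (at_right 0)"
    by (simp add: inner_diff_left blinfun_inner_left.rep_eq)
qed

text \<open>The mean value theorem needs real values, so \<open>f\<close> is tested with the
  increment \<open>f y - f x\<close> itself.\<close>

lemma gateaux_lipschitz:
  fixes f :: "'a::real_normed_vector \<Rightarrow> 'h::real_inner"
  assumes S: "convex S" "x \<in> S" "y \<in> S" and f: "\<And>z. z \<in> S \<Longrightarrow> has_gateaux_derivative f (D z) z S"
    and K: "\<And>z. z \<in> S \<Longrightarrow> norm (D z) \<le> K"
  shows "norm (f y - f x) \<le> K * norm (y - x)"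
proof -
  define v where "v = f y - f x"
  have "has_gateaux_derivative (\<lambda>z. f z \<bullet> v) (blinfun_inner_left v o\<^sub>L D z) z S" if "z \<in> S" for z
    by (rule has_gateaux_derivative_inner[OF f[OF that]])
  from gateaux_mvt[OF S this] obtain t where t: "0 < t" "t < 1"
    and eq: "f y \<bullet> v - f x \<bullet> v = (blinfun_inner_left v o\<^sub>L D (x + t *\<^sub>R (y - x))) (y - x)" by blast
  have "x + t *\<^sub>R (y - x) = (1 - t) *\<^sub>R x + t *\<^sub>R y" by (simp add: algebra_simps)
  then have z: "x + t *\<^sub>R (y - x) \<in> S" using convexD[OF S(1,2,3), of "1 - t" t] t by simp
  have "norm v * norm v = D (x + t *\<^sub>R (y - x)) (y - x) \<bullet> v"
    using eq by (simp add: v_def inner_diff_left[symmetric] power2_norm_eq_inner[symmetric] power2_eq_square blinfun_inner_left.rep_eq)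
  also have "\<dots> \<le> norm (D (x + t *\<^sub>R (y - x)) (y - x)) * norm v" by (rule norm_cauchy_schwarz)
  also have "\<dots> \<le> (K * norm (y - x)) * norm v"
    by (intro mult_right_mono order_trans[OF norm_blinfun] K[OF z]) auto
  finally have le: "norm v * norm v \<le> (K * norm (y - x)) * norm v" .
  have "0 \<le> K" using norm_ge_zero K[OF z] by (rule order_trans)
  with le show ?thesis unfolding v_def[symmetric] by (cases "v = 0") simp_all
qed

text \<open>Only partial Gateaux derivatives are at hand, so the gradient inequality is not
  immediate in the joint variable. A step of length \<open>\<epsilon> n\<close> towards
  \<open>(y, y', v)\<close> is split into steps in \<open>u\<close>, in \<open>x'\<close> and in
  \<open>x\<close>. The last two are evaluated by the mean value theorem, the first is nonnegative
  by minimality, and joint continuity of the partial derivatives gives the limit. Thus minimality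
  replaces a derivative in the control at a point that may lie on the boundary of
  \<open>S\<close>.\<close>

lemma convex_gateaux_inequality:
  fixes f :: "'h::real_normed_vector \<times> 'h \<times> 'u::real_normed_vector \<Rightarrow> real"
  assumes conv: "convex_on (UNIV \<times> UNIV \<times> S) f" and S: "convex S" "u \<in> S" "v \<in> S"
    and fx: "\<And>x x' u. u \<in> S \<Longrightarrow> has_gateaux_derivative (\<lambda>y. f (y, x', u)) (fx (x, x', u)) x UNIV"
    and fx': "\<And>x x' u. u \<in> S \<Longrightarrow> has_gateaux_derivative (\<lambda>y. f (x, y, u)) (fx' (x, x', u)) x' UNIV"
    and cont: "continuous_on (UNIV \<times> UNIV \<times> S) fx" "continuous_on (UNIV \<times> UNIV \<times> S) fx'"
    and min: "\<And>w. w \<in> S \<Longrightarrow> f (x, x', u) \<le> f (x, x', w)"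
  shows "f (y, y', v) - f (x, x', u) \<ge> fx (x, x', u) (y - x) + fx' (x, x', u) (y' - x')"
proof -
  define d d' c where "d = y - x" and "d' = y' - x'" and "c = v - u"
  define \<epsilon> where "\<epsilon> n = 1 / real (Suc n)" for n
  have \<epsilon>: "0 < \<epsilon> n" "\<epsilon> n \<le> 1" for n by (simp_all add: \<epsilon>_def)
  have \<epsilon>0: "\<epsilon> \<longlonglongrightarrow> 0" unfolding \<epsilon>_def by (rule LIMSEQ_Suc[OF lim_1_over_n])
  let ?u = "\<lambda>n. u + \<epsilon> n *\<^sub>R c" and ?x' = "\<lambda>n. x' + \<epsilon> n *\<^sub>R d'"
  have uS: "?u n \<in> S" for n
  proof -
    have "?u n = (1 - \<epsilon> n) *\<^sub>R u + \<epsilon> n *\<^sub>R v" by (simp add: c_def algebra_simps)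
    then show ?thesis using convexD[OF S(1,2,3), of "1 - \<epsilon> n" "\<epsilon> n"] \<epsilon>[of n] by simp
  qed
  \<comment> \<open>The intermediate point depends on \<open>n\<close> and lies off the base point
    in all three variables; this is where joint continuity will be needed.\<close>
  have "\<exists>t. 0 < t \<and> t < 1 \<and> f (x + \<epsilon> n *\<^sub>R d, ?x' n, ?u n) - f (x, ?x' n, ?u n)
      = fx (x + t *\<^sub>R \<epsilon> n *\<^sub>R d, ?x' n, ?u n) (\<epsilon> n *\<^sub>R d)" for n
    by (rule gateaux_mvt[of UNIV x "x + \<epsilon> n *\<^sub>R d" "\<lambda>y. f (y, ?x' n, ?u n)" "\<lambda>z. fx (z, ?x' n, ?u n)"])
      (use fx[OF uS] in auto)
  then obtain t where t: "\<And>n. 0 < t n" "\<And>n. t n < 1" "\<And>n. f (x + \<epsilon> n *\<^sub>R d, ?x' n, ?u n) - f (x, ?x' n, ?u n)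
      = fx (x + t n *\<^sub>R \<epsilon> n *\<^sub>R d, ?x' n, ?u n) (\<epsilon> n *\<^sub>R d)" by metis
  have "\<exists>t. 0 < t \<and> t < 1 \<and> f (x, ?x' n, ?u n) - f (x, x', ?u n) = fx' (x, x' + t *\<^sub>R \<epsilon> n *\<^sub>R d', ?u n) (\<epsilon> n *\<^sub>R d')" for n
    by (rule gateaux_mvt[of UNIV x' "x' + \<epsilon> n *\<^sub>R d'" "\<lambda>y. f (x, y, ?u n)" "\<lambda>z. fx' (x, z, ?u n)"])
      (use fx'[OF uS] in auto)
  then obtain t' where t': "\<And>n. 0 < t' n" "\<And>n. t' n < 1"
    "\<And>n. f (x, ?x' n, ?u n) - f (x, x', ?u n) = fx' (x, x' + t' n *\<^sub>R \<epsilon> n *\<^sub>R d', ?u n) (\<epsilon> n *\<^sub>R d')" by metis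
  have te: "(\<lambda>n. t n * \<epsilon> n) \<longlonglongrightarrow> 0" "(\<lambda>n. t' n * \<epsilon> n) \<longlonglongrightarrow> 0"
    by (rule tendsto_zero_dominated[OF \<epsilon>0], use t t' \<epsilon> in \<open>simp add: abs_mult less_imp_le\<close>)+
  have l1: "(\<lambda>n. fx (x + t n *\<^sub>R \<epsilon> n *\<^sub>R d, ?x' n, ?u n)) \<longlonglongrightarrow> fx (x, x', u)"
  proof (rule continuous_on_tendsto_compose[OF cont(1)])
    have "(\<lambda>n. (x + (t n * \<epsilon> n) *\<^sub>R d, ?x' n, ?u n)) \<longlonglongrightarrow> (x + 0 *\<^sub>R d, x' + 0 *\<^sub>R d', u + 0 *\<^sub>R c)"
      by (intro tendsto_intros te \<epsilon>0)
    then show "(\<lambda>n. (x + t n *\<^sub>R \<epsilon> n *\<^sub>R d, ?x' n, ?u n)) \<longlonglongrightarrow> (x, x', u)" by simp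
  qed (use S uS in auto)
  have l2: "(\<lambda>n. fx' (x, x' + t' n *\<^sub>R \<epsilon> n *\<^sub>R d', ?u n)) \<longlonglongrightarrow> fx' (x, x', u)"
  proof (rule continuous_on_tendsto_compose[OF cont(2)])
    have "(\<lambda>n. (x, x' + (t' n * \<epsilon> n) *\<^sub>R d', ?u n)) \<longlonglongrightarrow> (x, x' + 0 *\<^sub>R d', u + 0 *\<^sub>R c)"
      by (intro tendsto_intros te \<epsilon>0)
    then show "(\<lambda>n. (x, x' + t' n *\<^sub>R \<epsilon> n *\<^sub>R d', ?u n)) \<longlonglongrightarrow> (x, x', u)" by simp
  qed (use S uS in auto)
  \<comment> \<open>Convexity bounds the increment over the short step by
    \<open>\<epsilon> n\<close> times the full increment; minimality discards the part due to the
    control.\<close>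
  have "fx (x + t n *\<^sub>R \<epsilon> n *\<^sub>R d, ?x' n, ?u n) d + fx' (x, x' + t' n *\<^sub>R \<epsilon> n *\<^sub>R d', ?u n) d' \<le> f (y, y', v) - f (x, x', u)" for n
  proof -
    have "(x + \<epsilon> n *\<^sub>R d, ?x' n, ?u n) = (1 - \<epsilon> n) *\<^sub>R (x, x', u) + \<epsilon> n *\<^sub>R (y, y', v)"
      by (simp add: d_def d'_def c_def algebra_simps)
    then have "f (x + \<epsilon> n *\<^sub>R d, ?x' n, ?u n) \<le> (1 - \<epsilon> n) * f (x, x', u) + \<epsilon> n * f (y, y', v)"
      using convex_onD[OF conv, of "\<epsilon> n" "(x, x', u)" "(y, y', v)"] \<epsilon>[of n] S by simp
    moreover have "f (x, x', u) \<le> f (x, x', ?u n)" by (rule min[OF uS])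
    ultimately have "\<epsilon> n * (fx (x + t n *\<^sub>R \<epsilon> n *\<^sub>R d, ?x' n, ?u n) d + fx' (x, x' + t' n *\<^sub>R \<epsilon> n *\<^sub>R d', ?u n) d')
        \<le> \<epsilon> n * (f (y, y', v) - f (x, x', u))"
      using t(3)[of n] t'(3)[of n] by (simp add: blinfun.scaleR_right algebra_simps)
    then show ?thesis using \<epsilon>[of n] by simp
  qed
  moreover have "(\<lambda>n. fx (x + t n *\<^sub>R \<epsilon> n *\<^sub>R d, ?x' n, ?u n) d + fx' (x, x' + t' n *\<^sub>R \<epsilon> n *\<^sub>R d', ?u n) d')
    \<longlonglongrightarrow> fx (x, x', u) d + fx' (x, x', u) d'" by (intro tendsto_intros l1 l2)
  ultimately show ?thesis unfolding d_def[symmetric] d'_def[symmetric] by (intro LIMSEQ_le_const2) auto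
qed

section \<open>Gradients and their measurable versions\<close>

lemma has_gateaux_gradient_riesz:
  fixes f :: "'h::{real_inner, banach} \<Rightarrow> real"
  assumes "has_gateaux_derivative f D x UNIV"
  obtains G where "has_gateaux_gradient f G x UNIV" "\<And>v. D v = G \<bullet> v"
proof -
  obtain G where G: "\<And>v. D v = G \<bullet> v" using riesz_representation[of D] by metis
  then have "blinfun_inner_right G = D" by (intro blinfun_eqI) (simp add: blinfun_inner_right.rep_eq)
  then have "has_gateaux_gradient f G x UNIV" using assms by (simp add: has_gateaux_gradient_def)
  then show ?thesis using G by (rule that)
qed

lemma gateaux_gradient_norm_le:
  assumes "has_gateaux_gradient f G x UNIV" and D: "has_gateaux_derivative f D x UNIV"
  shows "norm G \<le> norm D"
proof -
  have "D G = G \<bullet> G"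
    by (rule tendsto_unique[OF _ has_gateaux_derivativeD[OF D] has_gateaux_gradientD[OF assms(1)]]) auto
  then have "norm G * norm G = D G" by (simp add: power2_norm_eq_inner[symmetric] power2_eq_square)
  also have "\<dots> \<le> norm D * norm G" using norm_blinfun[of D G] by simp
  finally show ?thesis by (cases "G = 0") auto
qed

text \<open>A version of the gradient that is measurable by construction.\<close>

definition limit_gradient :: "(nat \<Rightarrow> 'h::{real_inner, banach}) \<Rightarrow> ('h \<Rightarrow> real) \<Rightarrow> 'h \<Rightarrow> 'h" where
  "limit_gradient w f x = lim (\<lambda>N. \<Sum>k<N. lim (\<lambda>n. real (Suc n) * (f (x + (1 / real (Suc n)) *\<^sub>R w k) - f x)) *\<^sub>R w k)"

text \<open>The inner limit is the directional derivative along \<open>w k\<close>, that is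
  \<open>G \<bullet> w k\<close>; the outer limit reassembles \<open>G\<close> from its finite
  projections.\<close>

lemma limit_gradient_eq:
  assumes w: "\<And>x. (\<lambda>N. finite_projection w N x) \<longlonglongrightarrow> x" and G: "has_gateaux_gradient f G x UNIV"
  shows "limit_gradient w f x = G"
proof -
  have "lim (\<lambda>n. real (Suc n) * (f (x + (1 / real (Suc n)) *\<^sub>R w k) - f x)) = G \<bullet> w k" for k
  proof (rule limI)
    have "filterlim (\<lambda>n. 1 / real (Suc n)) (at_right 0) sequentially"
      by (rule tendsto_imp_filterlim_at_right[OF LIMSEQ_Suc[OF lim_1_over_n]]) simp
    from filterlim_compose[OF has_gateaux_gradientD[OF G, of "w k"] this]
    show "(\<lambda>n. real (Suc n) * (f (x + (1 / real (Suc n)) *\<^sub>R w k) - f x)) \<longlonglongrightarrow> G \<bullet> w k"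
      by (simp add: field_simps)
  qed
  then show ?thesis unfolding limit_gradient_def using limI[OF w[of G]] by (simp add: finite_projection_def)
qed

lemma limit_gradient_measurable:
  fixes f :: "'a \<Rightarrow> 'h::{real_inner, banach, second_countable_topology} \<Rightarrow> real"
  assumes f: "(\<lambda>(z, y). f z y) \<in> borel_measurable (N \<Otimes>\<^sub>M borel)" and \<xi>: "\<xi> \<in> borel_measurable N"
  shows "(\<lambda>z. limit_gradient w (f z) (\<xi> z)) \<in> borel_measurable N"
proof -
  have "(\<lambda>z. (z, \<xi> z + c)) \<in> measurable N (N \<Otimes>\<^sub>M borel)" for c using \<xi> by measurable
  from measurable_compose[OF this f] have m: "(\<lambda>z. f z (\<xi> z + c)) \<in> borel_measurable N" for c by simp
  have m0: "(\<lambda>z. f z (\<xi> z)) \<in> borel_measurable N" using m[of 0] by simp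
  show ?thesis unfolding limit_gradient_def
    by (intro borel_measurable_lim_metric borel_measurable_sum borel_measurable_scaleR borel_measurable_times
        borel_measurable_diff borel_measurable_const m m0)
qed

lemma norm_blinfun_inner_left_le: "norm (blinfun_inner_left p) \<le> norm p"
  by (rule norm_blinfun_bound) (simp_all add: blinfun_inner_left.rep_eq Cauchy_Schwarz_ineq2 mult.commute)

lemma norm_blinfun_inner_right_le: "norm (blinfun_inner_right p) \<le> norm p"
  by (rule norm_blinfun_bound) (simp_all add: blinfun_inner_right.rep_eq Cauchy_Schwarz_ineq2)

lemma has_gateaux_derivative_add:
  assumes "has_gateaux_derivative f D x S" "has_gateaux_derivative g E x S"
  shows "has_gateaux_derivative (\<lambda>z. f z + g z) (D + E) x S"
  unfolding has_gateaux_derivative_def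
proof
  fix y assume "y \<in> S"
  with assms have "((\<lambda>\<epsilon>. (f (x + \<epsilon> *\<^sub>R (y - x)) - f x) /\<^sub>R \<epsilon> + (g (x + \<epsilon> *\<^sub>R (y - x)) - g x) /\<^sub>R \<epsilon>) \<longlongrightarrow> D (y - x) + E (y - x)) (at_right 0)"
    unfolding has_gateaux_derivative_def by (intro tendsto_add) blast+
  then show "((\<lambda>\<epsilon>. (f (x + \<epsilon> *\<^sub>R (y - x)) + g (x + \<epsilon> *\<^sub>R (y - x)) - (f x + g x)) /\<^sub>R \<epsilon>) \<longlongrightarrow> (D + E) (y - x)) (at_right 0)"
    by (simp add: blinfun.add_left scaleR_add_right[symmetric] add_diff_add)
qed

section \<open>Derivatives and growth of the coefficients\<close>

definition C1_partial ::
  "'u::real_normed_vector set \<Rightarrow> ('h::real_normed_vector \<Rightarrow> 'h \<Rightarrow> 'u \<Rightarrow> real) \<Rightarrow> ('h \<Rightarrow> 'h \<Rightarrow> 'u \<Rightarrow> real) \<Rightarrow> bool" where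
  "C1_partial S f B \<longleftrightarrow> (\<exists>fx fx'. continuous_on (UNIV \<times> UNIV \<times> S) fx \<and> continuous_on (UNIV \<times> UNIV \<times> S) fx' \<and>
    (\<forall>x x'. \<forall>u\<in>S. has_gateaux_derivative (\<lambda>y. f y x' u) (fx (x, x', u)) x UNIV \<and>
      has_gateaux_derivative (\<lambda>y. f x y u) (fx' (x, x', u)) x' UNIV \<and>
      norm (fx (x, x', u)) \<le> B x x' u \<and> norm (fx' (x, x', u)) \<le> B x x' u))"

lemma hamiltonian_derivatives:
  fixes h g :: "'h::real_inner \<Rightarrow> 'h \<Rightarrow> 'u::real_inner \<Rightarrow> 'h" and l :: "'h \<Rightarrow> 'h \<Rightarrow> 'u \<Rightarrow> real"
  assumes h: "C1_bounded K1 S h" and g: "C1_bounded K2 S g" and l: "C1_running_growth K3 S l"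
  shows "C1_partial S (\<lambda>x x' u. h x x' u \<bullet> p + g x x' u \<bullet> q + l x x' u)
    (\<lambda>x x' u. K1 * norm p + K2 * norm q + K3 * (1 + norm x + norm x' + norm u))"
proof -
  obtain hx hx' where hc: "continuous_on (UNIV \<times> UNIV \<times> S) hx" "continuous_on (UNIV \<times> UNIV \<times> S) hx'"
    and hd: "\<And>x x' u. u \<in> S \<Longrightarrow> has_gateaux_derivative (\<lambda>y. h y x' u) (hx (x, x', u)) x UNIV \<and>
        has_gateaux_derivative (\<lambda>y. h x y u) (hx' (x, x', u)) x' UNIV \<and> norm (hx (x, x', u)) \<le> K1 \<and> norm (hx' (x, x', u)) \<le> K1"
    using h unfolding C1_bounded_def by blast
  obtain gx gx' where gc: "continuous_on (UNIV \<times> UNIV \<times> S) gx" "continuous_on (UNIV \<times> UNIV \<times> S) gx'"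
    and gd: "\<And>x x' u. u \<in> S \<Longrightarrow> has_gateaux_derivative (\<lambda>y. g y x' u) (gx (x, x', u)) x UNIV \<and>
        has_gateaux_derivative (\<lambda>y. g x y u) (gx' (x, x', u)) x' UNIV \<and> norm (gx (x, x', u)) \<le> K2 \<and> norm (gx' (x, x', u)) \<le> K2"
    using g unfolding C1_bounded_def by blast
  obtain lx lx' lu where lc: "continuous_on (UNIV \<times> UNIV \<times> S) lx" "continuous_on (UNIV \<times> UNIV \<times> S) lx'"
    and ld: "\<And>x x' u. u \<in> S \<Longrightarrow> has_gateaux_gradient (\<lambda>y. l y x' u) (lx (x, x', u)) x UNIV \<and>
        has_gateaux_gradient (\<lambda>y. l x y u) (lx' (x, x', u)) x' UNIV \<and>
        norm (lx (x, x', u)) + norm (lx' (x, x', u)) + norm (lu (x, x', u) :: 'u) \<le> K3 * (1 + norm x + norm x' + norm u)"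
    using l unfolding C1_running_growth_def by blast
  let ?D = "\<lambda>a b c z. (blinfun_inner_left p o\<^sub>L a z) + (blinfun_inner_left q o\<^sub>L b z) + blinfun_inner_right (c z)"
  have cont: "continuous_on (UNIV \<times> UNIV \<times> S) (?D hx gx lx)" "continuous_on (UNIV \<times> UNIV \<times> S) (?D hx' gx' lx')"
    by (intro continuous_intros hc gc lc bounded_linear.continuous_on[OF bounded_linear_blinfun_inner_right])+
  have nb: "norm ((blinfun_inner_left p o\<^sub>L a) + (blinfun_inner_left q o\<^sub>L b) + blinfun_inner_right c)
      \<le> K1 * norm p + K2 * norm q + norm c"
    if "norm a \<le> K1" "norm b \<le> K2" for a b :: "'h \<Rightarrow>\<^sub>L 'h" and c
  proof -
    have "norm (blinfun_inner_left p o\<^sub>L a) \<le> norm p * K1"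
      by (rule order_trans[OF norm_blinfun_compose mult_mono[OF norm_blinfun_inner_left_le that(1)]]) auto
    moreover have "norm (blinfun_inner_left q o\<^sub>L b) \<le> norm q * K2"
      by (rule order_trans[OF norm_blinfun_compose mult_mono[OF norm_blinfun_inner_left_le that(2)]]) auto
    ultimately show ?thesis
      using norm_triangle_ineq[of "(blinfun_inner_left p o\<^sub>L a) + (blinfun_inner_left q o\<^sub>L b)" "blinfun_inner_right c"]
        norm_triangle_ineq[of "blinfun_inner_left p o\<^sub>L a" "blinfun_inner_left q o\<^sub>L b"] norm_blinfun_inner_right_le[of c]
      by (simp add: mult.commute)
  qed
  show ?thesis
    unfolding C1_partial_def
  proof (rule exI[of _ "?D hx gx lx"], rule exI[of _ "?D hx' gx' lx'"], intro conjI allI ballI cont)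
    fix x x' u assume u: "u \<in> S"
    note d = hd[OF u] gd[OF u] ld[OF u]
    show "has_gateaux_derivative (\<lambda>y. h y x' u \<bullet> p + g y x' u \<bullet> q + l y x' u) (?D hx gx lx (x, x', u)) x UNIV"
      using d unfolding has_gateaux_gradient_def by (intro has_gateaux_derivative_add has_gateaux_derivative_inner) blast+
    show "has_gateaux_derivative (\<lambda>y. h x y u \<bullet> p + g x y u \<bullet> q + l x y u) (?D hx' gx' lx' (x, x', u)) x' UNIV"
      using d unfolding has_gateaux_gradient_def by (intro has_gateaux_derivative_add has_gateaux_derivative_inner) blast+
    have "norm (lx (x, x', u)) \<le> K3 * (1 + norm x + norm x' + norm u)" "norm (lx' (x, x', u)) \<le> K3 * (1 + norm x + norm x' + norm u)"
      using ld[OF u, where x = x and x' = x'] norm_ge_zero[of "lx (x, x', u)"] norm_ge_zero[of "lx' (x, x', u)"] norm_ge_zero[of "lu (x, x', u)"]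
      by linarith+
    then show "norm (?D hx gx lx (x, x', u)) \<le> K1 * norm p + K2 * norm q + K3 * (1 + norm x + norm x' + norm u)"
      "norm (?D hx' gx' lx' (x, x', u)) \<le> K1 * norm p + K2 * norm q + K3 * (1 + norm x + norm x' + norm u)"
      using nb[of "hx (x, x', u)" "gx (x, x', u)" "lx (x, x', u)"] nb[of "hx' (x, x', u)" "gx' (x, x', u)" "lx' (x, x', u)"] hd[OF u] gd[OF u]
      by (auto intro: order_trans add_left_mono)
  qed
qed

text \<open>The three variables are changed one at a time, each by the Lipschitz bound from the
  derivative. The reference control is some \<open>v\<close> in \<open>S\<close>, as 0 need not
  belong to \<open>S\<close>.\<close>

lemma C1_bounded_linear_growth:
  fixes f :: "'h::real_inner \<Rightarrow> 'h \<Rightarrow> 'u::real_normed_vector \<Rightarrow> 'h"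
  assumes f: "C1_bounded K S f" and S: "convex S" "u \<in> S" "v \<in> S"
  shows "norm (f x x' u) \<le> norm (f 0 0 v) + K * (norm x + norm x' + norm (u - v))"
proof -
  obtain fx fx' fu where D: "\<And>x x' u. u \<in> S \<Longrightarrow>
      has_gateaux_derivative (\<lambda>y. f y x' u) (fx (x, x', u)) x UNIV \<and>
      has_gateaux_derivative (\<lambda>y. f x y u) (fx' (x, x', u)) x' UNIV \<and>
      has_gateaux_derivative (\<lambda>v. f x x' v) (fu (x, x', u)) u S \<and>
      norm (fx (x, x', u)) \<le> K \<and> norm (fx' (x, x', u)) \<le> K \<and> norm (fu (x, x', u)) \<le> K"
    using f unfolding C1_bounded_def by blast
  then have d: "\<And>x x' u. u \<in> S \<Longrightarrow> has_gateaux_derivative (\<lambda>y. f y x' u) (fx (x, x', u)) x UNIV"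
    "\<And>x x' u. u \<in> S \<Longrightarrow> has_gateaux_derivative (\<lambda>y. f x y u) (fx' (x, x', u)) x' UNIV"
    "\<And>x x' u. u \<in> S \<Longrightarrow> has_gateaux_derivative (\<lambda>v. f x x' v) (fu (x, x', u)) u S"
    and K: "\<And>x x' u. u \<in> S \<Longrightarrow> norm (fx (x, x', u)) \<le> K" "\<And>x x' u. u \<in> S \<Longrightarrow> norm (fx' (x, x', u)) \<le> K"
      "\<And>x x' u. u \<in> S \<Longrightarrow> norm (fu (x, x', u)) \<le> K"
    by blast+
  have "norm (f x x' u - f 0 x' u) \<le> K * norm (x - 0)"
    by (rule gateaux_lipschitz[of UNIV _ _ _ "\<lambda>y. fx (y, x', u)"]) (use d(1)[OF S(2)] K(1)[OF S(2)] in auto)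
  moreover have "norm (f 0 x' u - f 0 0 u) \<le> K * norm (x' - 0)"
    by (rule gateaux_lipschitz[of UNIV _ _ _ "\<lambda>y. fx' (0, y, u)"]) (use d(2)[OF S(2)] K(2)[OF S(2)] in auto)
  moreover have "norm (f 0 0 u - f 0 0 v) \<le> K * norm (u - v)"
    by (rule gateaux_lipschitz[of S _ _ _ "\<lambda>y. fu (0, 0, y)"]) (use S d(3) K(3) in auto)
  moreover have "norm (f x x' u) \<le> norm (f x x' u - f 0 x' u) + norm (f 0 x' u - f 0 0 u) + norm (f 0 0 u - f 0 0 v) + norm (f 0 0 v)"
  proof -
    have "norm (f x x' u) \<le> norm (f x x' u - f 0 x' u) + norm (f 0 x' u)" using norm_triangle_sub[of "f x x' u" "f 0 x' u"] by simp
    moreover have "norm (f 0 x' u) \<le> norm (f 0 0 u) + norm (f 0 x' u - f 0 0 u)" by (rule norm_triangle_sub)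
    moreover have "norm (f 0 0 u) \<le> norm (f 0 0 v) + norm (f 0 0 u - f 0 0 v)" by (rule norm_triangle_sub)
    ultimately show ?thesis by linarith
  qed
  ultimately show ?thesis by (simp add: algebra_simps)
qed

text \<open>A dummy control ranging over \<open>{0}\<close> makes the terminal cost an instance of
  \<open>convex_gateaux_inequality\<close>, with a trivially satisfied minimum condition.\<close>

lemma C1_terminal_inequality:
  fixes f :: "'h::real_inner \<Rightarrow> 'h \<Rightarrow> real"
  assumes f: "C1_terminal_growth K f" and conv: "convex_on UNIV (\<lambda>(x, x'). f x x')"
  obtains G G' where "has_gateaux_gradient (\<lambda>y. f y x') G x UNIV" "has_gateaux_gradient (\<lambda>y. f x y) G' x' UNIV"
    "norm G \<le> K * (1 + norm x + norm x')" "norm G' \<le> K * (1 + norm x + norm x')"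
    "\<And>y y'. f y y' - f x x' \<ge> G \<bullet> (y - x) + G' \<bullet> (y' - x')"
proof -
  obtain fx fx' where c: "continuous_on UNIV fx" "continuous_on UNIV fx'"
    and d: "\<And>x x'. has_gateaux_gradient (\<lambda>y. f y x') (fx (x, x')) x UNIV \<and>
        has_gateaux_gradient (\<lambda>y. f x y) (fx' (x, x')) x' UNIV \<and>
        norm (fx (x, x')) + norm (fx' (x, x')) \<le> K * (1 + norm x + norm x')"
    using f unfolding C1_terminal_growth_def by blast
  let ?f = "\<lambda>(x, x', u :: real). f x x'"
  have conv': "convex_on (UNIV \<times> UNIV \<times> {0}) ?f"
  proof (rule convex_onI)
    fix t :: real and z y assume "0 < t" "t < 1"
    then show "?f ((1 - t) *\<^sub>R z + t *\<^sub>R y) \<le> (1 - t) * ?f z + t * ?f y"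
      using convex_onD[OF conv, of t "(fst z, fst (snd z))" "(fst y, fst (snd y))"] by (simp add: case_prod_beta)
  qed (intro convex_Times convex_UNIV convex_singleton)
  have cc: "continuous_on (UNIV \<times> UNIV \<times> {0}) (\<lambda>(x, x', u::real). blinfun_inner_right (fx (x, x')))"
    "continuous_on (UNIV \<times> UNIV \<times> {0}) (\<lambda>(x, x', u::real). blinfun_inner_right (fx' (x, x')))"
    unfolding case_prod_beta
    by (intro bounded_linear.continuous_on[OF bounded_linear_blinfun_inner_right] continuous_on_compose2[OF c(1)]
        continuous_on_compose2[OF c(2)] continuous_intros subset_UNIV)+
  have "f y y' - f x x' \<ge> fx (x, x') \<bullet> (y - x) + fx' (x, x') \<bullet> (y' - x')" for y y'
    using convex_gateaux_inequality[OF conv' _ _ _ _ _ cc, of 0 0 x x' y y'] d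
    by (simp add: has_gateaux_gradient_def blinfun_inner_right.rep_eq)
  moreover have "norm (fx (x, x')) + norm (fx' (x, x')) \<le> K * (1 + norm x + norm x')" using d by blast
  then have "norm (fx (x, x')) \<le> K * (1 + norm x + norm x')" "norm (fx' (x, x')) \<le> K * (1 + norm x + norm x')"
    using norm_ge_zero[of "fx (x, x')"] norm_ge_zero[of "fx' (x, x')"] by linarith+
  moreover have "has_gateaux_gradient (\<lambda>y. f y x') (fx (x, x')) x UNIV" "has_gateaux_gradient (\<lambda>y. f x y) (fx' (x, x')) x' UNIV"
    using d by blast+
  ultimately show ?thesis by (intro that)
qed

section \<open>Sufficiency of the minimum condition\<close>

lemma (in wiener) has_ito_integral_cong_integrand:
  assumes "has_ito_integral M T W f I" "AE x in \<mu>. f (fst x) (snd x) = g (fst x) (snd x)"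
  shows "has_ito_integral M T W g I"
proof -
  have "(\<integral>\<^sup>+(s, \<omega>). ennreal ((h s \<omega> - f s \<omega>)\<^sup>2) \<partial>\<mu>) = (\<integral>\<^sup>+(s, \<omega>). ennreal ((h s \<omega> - g s \<omega>)\<^sup>2) \<partial>\<mu>)" for h
    using assms(2) by (intro nn_integral_cong_AE) (auto simp: case_prod_beta)
  moreover have "AE (s, \<omega>) in \<mu>. g s \<omega> = f0 s \<omega>" if "AE (s, \<omega>) in \<mu>. f s \<omega> = f0 s \<omega>" for f0
    using that assms(2) by eventually_elim (simp add: case_prod_beta)
  ultimately show ?thesis using assms(1) unfolding has_ito_integral_def by auto
qed

locale control_setting = gelfand_wiener "prob D" "horizon D" "bm D" "emb D" "\<lambda>x. opA D (fst x) (snd x)" \<alpha> lam C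
  for D :: "('w, 'v::banach, 'h::{real_inner, banach, second_countable_topology},
      'u::{real_inner, banach, second_countable_topology}) control_problem"
    and \<alpha> lam C +
  assumes C: "assumption_C D"
begin

abbreviation \<P> :: "'w measure" where "\<P> \<equiv> control_problem.prob D"

lemma controls: "ctrl_set D \<noteq> {}" "convex (ctrl_set D)" "closed (ctrl_set D)"
  using C by (simp_all add: assumption_C_def C_controls_def)

definition u0 where "u0 = (SOME u. u \<in> ctrl_set D)"

lemma u0: "u0 \<in> ctrl_set D" unfolding u0_def using controls(1) some_in_eq by blast

text \<open>A control is admissible only almost everywhere, and the coefficients are measurable only on
  the admissible set; hence the modification.\<close>

definition ctrl :: "(real \<Rightarrow> 'w \<Rightarrow> 'u) \<Rightarrow> real \<times> 'w \<Rightarrow> 'u" where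
  "ctrl u x = (if u (fst x) (snd x) \<in> ctrl_set D then u (fst x) (snd x) else u0)"

text \<open>Stands in for the state \<open>X\<close>, which is given as an adapted process with
  regular paths: the image of its \<open>V\<close>-valued version carries joint measurability by
  definition and agrees with \<open>X\<close> almost everywhere.\<close>

definition stateH :: "(real \<times> 'w \<Rightarrow> 'v) \<Rightarrow> real \<times> 'w \<Rightarrow> 'h" where "stateH Y x = emb D (Y x)"

definition meanH :: "(real \<times> 'w \<Rightarrow> 'v) \<Rightarrow> real \<Rightarrow> 'h" where "meanH Y s = (\<integral>\<omega>. stateH Y (s, \<omega>) \<partial>\<P>)"

definition along :: "(real \<Rightarrow> 'w \<Rightarrow> 'h \<Rightarrow> 'h \<Rightarrow> 'u \<Rightarrow> 'b) \<Rightarrow> (real \<Rightarrow> 'w \<Rightarrow> 'u) \<Rightarrow> (real \<times> 'w \<Rightarrow> 'v) \<Rightarrow> real \<times> 'w \<Rightarrow> 'b" where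
  "along f u Y x = f (fst x) (snd x) (stateH Y x) (meanH Y (fst x)) (ctrl u x)"

lemma ctrl_in: "ctrl u x \<in> ctrl_set D" using u0 by (simp add: ctrl_def)

lemma ctrl_properties:
  assumes u: "u \<in> admissible_controls D"
  shows "ctrl u \<in> borel_measurable progressive" "AE x in \<mu>. ctrl u x = u (fst x) (snd x)" "square_integrable \<mu> (ctrl u)"
proof -
  have um: "(\<lambda>x. u (fst x) (snd x)) \<in> borel_measurable progressive"
    using u by (intro measurable_predictable_progressive) (simp add: admissible_controls_def case_prod_unfold)
  have "ctrl_set D \<in> sets borel" using controls by simp
  from measurable_sets[OF um this]
  have "{x \<in> space progressive. u (fst x) (snd x) \<in> ctrl_set D} \<in> sets progressive"
    by (simp add: vimage_def Int_def conj_commute)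
  then show cm: "ctrl u \<in> borel_measurable progressive"
    unfolding ctrl_def[abs_def] using um by (intro measurable_If) auto
  show ae: "AE x in \<mu>. ctrl u x = u (fst x) (snd x)"
    using u unfolding admissible_controls_def by (auto simp: ctrl_def case_prod_beta elim!: eventually_mono)
  have "square_integrable \<mu> (\<lambda>x. u (fst x) (snd x))"
    using u by (intro M2_square_integrable) (simp add: admissible_controls_def)
  then show "square_integrable \<mu> (ctrl u)"
    by (rule square_integrableI_bound[OF _ measurable_progressive_mu[OF cm]]) (use ae in \<open>eventually_elim, simp\<close>)
qed

lemma stateH_properties:
  assumes "V_process X Y"
  shows "square_integrable \<mu> (stateH Y)" "stateH Y \<in> borel_measurable progressive" "AE x in \<mu>. stateH Y x = X (fst x) (snd x)"
  using V_process_H(1,2)[OF assms] assms unfolding stateH_def[abs_def] V_process_def by simp_all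

text \<open>The mean of \<open>X\<close> is bounded uniformly in time, because \<open>norm\<close>
  is at most \<open>1 + norm\<^sup>2\<close> and the expectation of the supremum of the squared norm
  is finite. The mean of the version agrees with it at almost every time.\<close>

lemma meanH_properties:
  assumes X: "X \<in> proc_S2 D" and Y: "V_process X Y"
  shows "meanH Y \<in> borel_measurable L" "AE s in L. meanH Y s = mean D X s"
    "square_integrable \<mu> (\<lambda>x. meanH Y (fst x))"
proof -
  note stateH = stateH_properties[OF Y]
  have "stateH Y \<in> borel_measurable (L \<Otimes>\<^sub>M \<P>)" using stateH(1) by (simp add: square_integrable_def dt_dP_def)
  then show m: "meanH Y \<in> borel_measurable L"
    unfolding meanH_def[abs_def] by (intro borel_measurable_lebesgue_integral) simp
  show ae: "AE s in L. meanH Y s = mean D X s"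
    using AE_mu_sections[OF stateH(3)] AE_space
  proof eventually_elim
    case (elim s)
    then have s: "s \<in> {0..horizon D}" by (simp add: space_restrict_space)
    show ?case unfolding meanH_def
    proof (rule integral_cong_AE)
      show "AE \<omega> in \<P>. stateH Y (s, \<omega>) = X s \<omega>" using elim(1) by simp
      show "(\<lambda>\<omega>. stateH Y (s, \<omega>)) \<in> borel_measurable \<P>"
        by (rule measurable_mu_section[OF square_integrable_measurable[OF stateH(1)] s])
      show "X s \<in> borel_measurable \<P>" using S2_square_integrable(1)[OF X s] by (simp add: square_integrable_def)
    qed
  qed
  define B where "B = (\<integral>\<^sup>+\<omega>. (SUP t\<in>{0..horizon D}. ennreal ((norm (X t \<omega>))\<^sup>2)) \<partial>\<P>)"
  have B: "B < \<infinity>" using X by (simp add: S2_def B_def)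
  have bound: "norm (mean D X s) \<le> 1 + enn2real B" if s: "s \<in> {0..horizon D}" for s
  proof -
    note sq = S2_square_integrable(1)[OF X s]
    have i: "integrable \<P> (X s)" by (rule square_integrable_integrable[OF finite_measure_axioms sq])
    have i2: "integrable \<P> (\<lambda>\<omega>. (norm (X s \<omega>))\<^sup>2)" using sq by (simp add: square_integrable_def)
    have "norm (mean D X s) \<le> (\<integral>\<omega>. norm (X s \<omega>) \<partial>\<P>)" by (rule integral_norm_bound)
    also have "\<dots> \<le> (\<integral>\<omega>. 1 + (norm (X s \<omega>))\<^sup>2 \<partial>\<P>)"
    proof (rule integral_mono)
      show "norm (X s \<omega>) \<le> 1 + (norm (X s \<omega>))\<^sup>2" for \<omega>
      proof -
        have "2 * norm (X s \<omega>) \<le> 1 + (norm (X s \<omega>))\<^sup>2" using sum_squares_bound[of 1 "norm (X s \<omega>)"] by simp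
        then show ?thesis using norm_ge_zero[of "X s \<omega>"] by linarith
      qed
    qed (use i i2 in auto)
    also have "\<dots> = 1 + (\<integral>\<omega>. (norm (X s \<omega>))\<^sup>2 \<partial>\<P>)" using i2 by (simp add: prob_space)
    also have "(\<integral>\<omega>. (norm (X s \<omega>))\<^sup>2 \<partial>\<P>) \<le> enn2real B"
    proof -
      have "ennreal (\<integral>\<omega>. (norm (X s \<omega>))\<^sup>2 \<partial>\<P>) = (\<integral>\<^sup>+\<omega>. ennreal ((norm (X s \<omega>))\<^sup>2) \<partial>\<P>)"
        by (rule nn_integral_eq_integral[symmetric, OF i2]) simp
      also have "\<dots> \<le> B" unfolding B_def using s by (intro nn_integral_mono SUP_upper)
      finally have "ennreal (\<integral>\<omega>. (norm (X s \<omega>))\<^sup>2 \<partial>\<P>) \<le> B" .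
      from enn2real_mono[OF this] B show ?thesis by simp
    qed
    finally show ?thesis by simp
  qed
  have "AE s in L. norm (meanH Y s) \<le> norm (1 + enn2real B)"
    using ae AE_space by eventually_elim (use bound in \<open>auto simp: space_restrict_space intro: order_trans[OF _ abs_ge_self]\<close>)
  from AE_mu_fst[OF this]
  show "square_integrable \<mu> (\<lambda>x. meanH Y (fst x))"
    by (rule square_integrableI_bound[OF square_integrable_const[OF finite_measure_mu] measurable_mu_fst[OF m]])
qed

section \<open>Coefficients and costs along an admissible pair\<close>

text \<open>The domain \<open>N\<close> is left open because the composition is needed along a
  trajectory, with \<open>N\<close> the progressive space, and also with a free state variable
  adjoined, for measurability of the gradients.\<close>

lemma coefficient_measurable:
  fixes f :: "real \<Rightarrow> 'w \<Rightarrow> 'h \<Rightarrow> 'h \<Rightarrow> 'u \<Rightarrow> 'b::topological_space"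
  assumes f: "(\<lambda>((t, \<omega>), x, x', u). f t \<omega> x x' u) \<in> borel_measurable
        (pred_sigma D \<Otimes>\<^sub>M borel \<Otimes>\<^sub>M borel \<Otimes>\<^sub>M restrict_space borel (ctrl_set D))"
    and a: "a \<in> measurable N progressive" and b: "b \<in> borel_measurable N" and c: "c \<in> borel_measurable N"
    and d: "d \<in> borel_measurable N" "\<And>z. d z \<in> ctrl_set D"
  shows "(\<lambda>z. f (fst (a z)) (snd (a z)) (b z) (c z) (d z)) \<in> borel_measurable N"
proof -
  have "d \<in> measurable N (restrict_space borel (ctrl_set D))"
    using d by (intro measurable_restrict_space2) auto
  then have "(\<lambda>z. (a z, b z, c z, d z)) \<in> measurable N
      (pred_sigma D \<Otimes>\<^sub>M borel \<Otimes>\<^sub>M borel \<Otimes>\<^sub>M restrict_space borel (ctrl_set D))"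
    by (intro measurable_Pair measurable_compose[OF a progressive_id] b c)
  from measurable_compose[OF this f] show ?thesis by (simp add: case_prod_beta)
qed

lemma along_measurable:
  fixes f :: "real \<Rightarrow> 'w \<Rightarrow> 'h \<Rightarrow> 'h \<Rightarrow> 'u \<Rightarrow> 'b::topological_space"
  assumes f: "(\<lambda>((t, \<omega>), x, x', u). f t \<omega> x x' u) \<in> borel_measurable
        (pred_sigma D \<Otimes>\<^sub>M borel \<Otimes>\<^sub>M borel \<Otimes>\<^sub>M restrict_space borel (ctrl_set D))"
    and u: "u \<in> admissible_controls D" and X: "X \<in> proc_S2 D" "V_process X Y"
  shows "along f u Y \<in> borel_measurable progressive"
  unfolding along_def[abs_def]
  using coefficient_measurable[OF f measurable_ident stateH_properties(2)[OF X(2)]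
      progressive_time[OF meanH_properties(1)[OF X]] ctrl_properties(1)[OF u] ctrl_in] by simp

lemma along_AE:
  assumes u: "u \<in> admissible_controls D" and X: "X \<in> proc_S2 D" "V_process X Y"
  shows "AE x in \<mu>. stateH Y x = X (fst x) (snd x) \<and> meanH Y (fst x) = mean D X (fst x) \<and> ctrl u x = u (fst x) (snd x)"
  using stateH_properties(3)[OF X(2)] AE_mu_fst[OF meanH_properties(2)[OF X]] ctrl_properties(2)[OF u]
  by eventually_elim simp

lemma along_square_integrable:
  assumes f: "C_coefficient D f" and u: "u \<in> admissible_controls D" and X: "X \<in> proc_S2 D" "V_process X Y"
  shows "square_integrable \<mu> (along f u Y)" "along f u Y \<in> borel_measurable progressive"
proof -
  show m: "along f u Y \<in> borel_measurable progressive"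
    by (rule along_measurable[OF _ u X]) (use f in \<open>simp add: C_coefficient_def\<close>)
  obtain v where v: "v \<in> ctrl_set D" "(\<lambda>t \<omega>. f t \<omega> 0 0 v) \<in> proc_M2 D" using f by (auto simp: C_coefficient_def)
  obtain K where K: "AE (t, \<omega>) in \<mu>. C1_bounded K (ctrl_set D) (f t \<omega>)" using f by (auto simp: C_coefficient_def)
  have ctrl: "square_integrable \<mu> (\<lambda>x. ctrl u x - v)"
    by (intro square_integrable_diff ctrl_properties(3)[OF u] square_integrable_const finite_measure_mu)
  show "square_integrable \<mu> (along f u Y)"
  proof (rule square_integrableI_bound[OF _ measurable_progressive_mu[OF m]])
    show "square_integrable \<mu> (\<lambda>x. norm (f (fst x) (snd x) 0 0 v) + \<bar>K\<bar> * (norm (stateH Y x) + norm (meanH Y (fst x)) + norm (ctrl u x - v)))"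
      by (intro square_integrable_add square_integrable_mult_const square_integrable_norm stateH_properties(1)[OF X(2)]
          meanH_properties(3)[OF X] ctrl M2_square_integrable_norm[OF v(2)])
    show "AE x in \<mu>. norm (along f u Y x)
        \<le> norm (norm (f (fst x) (snd x) 0 0 v) + \<bar>K\<bar> * (norm (stateH Y x) + norm (meanH Y (fst x)) + norm (ctrl u x - v)))"
      using K
    proof eventually_elim
      case (elim x)
      then have "C1_bounded K (ctrl_set D) (f (fst x) (snd x))" by (simp add: case_prod_beta)
      from C1_bounded_linear_growth[OF this controls(2) ctrl_in v(1), of "stateH Y x" "meanH Y (fst x)" u x]
      have "norm (along f u Y x) \<le> norm (f (fst x) (snd x) 0 0 v) + K * (norm (stateH Y x) + norm (meanH Y (fst x)) + norm (ctrl u x - v))"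
        by (simp add: along_def)
      also have "\<dots> \<le> norm (f (fst x) (snd x) 0 0 v) + \<bar>K\<bar> * (norm (stateH Y x) + norm (meanH Y (fst x)) + norm (ctrl u x - v))"
        by (intro add_left_mono mult_right_mono) auto
      finally show ?case by (rule order_trans) (simp only: real_norm_def abs_ge_self)
    qed
  qed
qed

lemma V_versionD: "V_version D X Y \<Longrightarrow> V_process X (\<lambda>x. Y (fst x) (snd x))"
  by (simp add: V_version_def V_process_def case_prod_beta)

lemma coefficients: "C_coefficient D (drift D)" "C_coefficient D (diffusion D)"
  using C by (simp_all add: assumption_C_def)

lemma time_integral_AE:
  fixes b :: "real \<times> 'w \<Rightarrow> real"
  assumes b: "square_integrable \<mu> b" and ae: "AE x in \<mu>. f (fst x) (snd x) = b x" and t: "0 \<le> a" "c \<le> horizon D"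
  shows "AE \<omega> in \<P>. (LINT s:{a..c}|lebesgue. f s \<omega>) = (\<integral>s. indicator {a..c} s * b (s, \<omega>) \<partial>L)"
  using AE_mu_sections'[OF ae] AE_space
proof eventually_elim
  case (elim \<omega>)
  show ?case
    by (rule set_integral_lebesgue_L[OF measurable_mu_section'[OF square_integrable_measurable[OF b] elim(2)] _ t])
      (use elim(1) in simp)
qed

text \<open>Integrand and integral are exchanged for versions that differ on null sets only: the
  coefficients become \<open>along\<close> processes and the Lebesgue time integral becomes an
  integral over \<open>L\<close>.\<close>

lemma state_of_admissible_pair:
  assumes uX: "admissible_pair D u X"
  shows "\<exists>Y. state_of (init_state D) X Y (along (drift D) u Y) (along (diffusion D) u Y)"
proof -
  have u: "u \<in> admissible_controls D" and X: "X \<in> proc_S2 D"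
    using uX by (simp_all add: admissible_pair_def state_process_def)
  obtain Y' where Y': "V_version D X Y'" and eq: "\<And>\<phi> t. t \<in> {0..horizon D} \<Longrightarrow> has_ito_integral \<P> (horizon D) (bm D)
        (\<lambda>s \<omega>. indicator {0..t} s *
           (diffusion D s \<omega> (X s \<omega>) (mean D X s) (u s \<omega>) \<bullet> blinfun_apply (emb D) \<phi>))
        (\<lambda>\<omega>. X t \<omega> \<bullet> blinfun_apply (emb D) \<phi> - init_state D \<bullet> blinfun_apply (emb D) \<phi>
           - (LINT s:{0..t}|lebesgue.
                - blinfun_apply (blinfun_apply (opA D s \<omega>) (Y' s \<omega>)) \<phi>
                + drift D s \<omega> (X s \<omega>) (mean D X s) (u s \<omega>) \<bullet> blinfun_apply (emb D) \<phi>))"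
    using uX unfolding admissible_pair_def state_process_def by blast
  define Y where "Y x = Y' (fst x) (snd x)" for x
  have Y: "V_process X Y" using V_versionD[OF Y'] by (simp add: Y_def[abs_def])
  note h = along_square_integrable[OF coefficients(1) u X Y] and g = along_square_integrable[OF coefficients(2) u X Y]
  note ae = along_AE[OF u X Y]
  have "has_ito_integral \<P> (horizon D) (bm D) (\<lambda>s \<omega>. indicator {0..t} s * (along (diffusion D) u Y (s, \<omega>) \<bullet> emb D \<phi>))
       (\<lambda>\<omega>. X t \<omega> \<bullet> emb D \<phi> - init_state D \<bullet> emb D \<phi>
         - (\<integral>s. (if s \<le> t then along (drift D) u Y (s, \<omega>) \<bullet> emb D \<phi> - opA D (fst (s, \<omega>)) (snd (s, \<omega>)) (Y (s, \<omega>)) \<phi> else 0) \<partial>L))"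
    if t: "t \<in> {0..horizon D}" for \<phi> t
  proof (rule has_ito_integral_cong[OF has_ito_integral_cong_integrand[OF eq[OF t]]])
    show "AE x in \<mu>. indicator {0..t} (fst x) * (diffusion D (fst x) (snd x) (X (fst x) (snd x)) (mean D X (fst x)) (u (fst x) (snd x)) \<bullet> emb D \<phi>)
      = indicator {0..t} (fst x) * (along (diffusion D) u Y (fst x, snd x) \<bullet> emb D \<phi>)"
      using ae by eventually_elim (simp add: along_def)
    let ?b = "\<lambda>x. along (drift D) u Y x \<bullet> emb D \<phi> - opA D (fst x) (snd x) (Y x) \<phi>"
    have b: "square_integrable \<mu> ?b"
      by (intro square_integrable_diff square_integrable_inner_const h A_left_square_integrable[OF Y])
    have R: "Measurable.pred (borel \<Otimes>\<^sub>M borel) (\<lambda>(s, r). s \<le> (r::real))" by measurable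
    have "square_integrable \<P> (\<lambda>\<omega>. X t \<omega> \<bullet> emb D \<phi> - init_state D \<bullet> emb D \<phi> - (\<integral>s. (if s \<le> t then ?b (s, \<omega>) else 0) \<partial>L))"
      by (intro square_integrable_diff square_integrable_inner_const S2_square_integrable(1)[OF X t] square_integrable_const
          finite_measure_axioms partial_integral(2)[OF b R t])
    then show "(\<lambda>\<omega>. X t \<omega> \<bullet> emb D \<phi> - init_state D \<bullet> emb D \<phi> - (\<integral>s. (if s \<le> t then ?b (s, \<omega>) else 0) \<partial>L)) \<in> borel_measurable \<P>"
      by (simp add: square_integrable_def)
    have "AE x in \<mu>. - blinfun_apply (blinfun_apply (opA D (fst x) (snd x)) (Y' (fst x) (snd x))) \<phi>
        + drift D (fst x) (snd x) (X (fst x) (snd x)) (mean D X (fst x)) (u (fst x) (snd x)) \<bullet> emb D \<phi> = ?b x"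
      using ae by eventually_elim (simp add: along_def Y_def)
    from time_integral_AE[OF b this, of 0 t] t
    have "AE \<omega> in \<P>. (LINT s:{0..t}|lebesgue. - blinfun_apply (blinfun_apply (opA D s \<omega>) (Y' s \<omega>)) \<phi>
                + drift D s \<omega> (X s \<omega>) (mean D X s) (u s \<omega>) \<bullet> emb D \<phi>) = (\<integral>s. indicator {0..t} s * ?b (s, \<omega>) \<partial>L)" by simp
    moreover have "(\<integral>s. indicator {0..t} s * ?b (s, \<omega>) \<partial>L) = (\<integral>s. (if s \<le> t then ?b (s, \<omega>) else 0) \<partial>L)" for \<omega>
      by (intro Bochner_Integration.integral_cong) (auto simp: space_restrict_space)
    ultimately show "AE \<omega> in \<P>. X t \<omega> \<bullet> emb D \<phi> - init_state D \<bullet> emb D \<phi>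
           - (LINT s:{0..t}|lebesgue. - blinfun_apply (blinfun_apply (opA D s \<omega>) (Y' s \<omega>)) \<phi>
                + drift D s \<omega> (X s \<omega>) (mean D X s) (u s \<omega>) \<bullet> emb D \<phi>)
      = X t \<omega> \<bullet> emb D \<phi> - init_state D \<bullet> emb D \<phi> - (\<integral>s. (if s \<le> t then ?b (s, \<omega>) else 0) \<partial>L)"
      by simp
  qed
  then show ?thesis
    unfolding state_of_def using X Y h g(1) by blast
qed

lemma running_cost_integrable:
  assumes u: "u \<in> admissible_controls D" and X: "X \<in> proc_S2 D" "V_process X Y"
  shows "integrable \<mu> (along (run_cost D) u Y)"
proof -
  have m: "along (run_cost D) u Y \<in> borel_measurable progressive"
    by (rule along_measurable[OF _ u X]) (use C in \<open>simp add: assumption_C_def C_costs_def\<close>)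
  obtain K where K: "K > 0" "AE (t, \<omega>) in \<mu>. C1_running_growth K (ctrl_set D) (run_cost D t \<omega>)"
    using C by (auto simp: assumption_C_def C_costs_def)
  interpret mu: finite_measure \<mu> by (rule finite_measure_mu)
  show ?thesis
  proof (rule Bochner_Integration.integrable_bound)
    show "integrable \<mu> (\<lambda>x. K * (1 + (norm (stateH Y x))\<^sup>2 + (norm (meanH Y (fst x)))\<^sup>2 + (norm (ctrl u x))\<^sup>2))"
      using stateH_properties(1)[OF X(2)] meanH_properties(3)[OF X] ctrl_properties(3)[OF u] by (simp add: square_integrable_def)
    show "along (run_cost D) u Y \<in> borel_measurable \<mu>" by (rule measurable_progressive_mu[OF m])
    show "AE x in \<mu>. norm (along (run_cost D) u Y x) \<le> norm (K * (1 + (norm (stateH Y x))\<^sup>2 + (norm (meanH Y (fst x)))\<^sup>2 + (norm (ctrl u x))\<^sup>2))"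
      using K(2)
    proof eventually_elim
      case (elim x)
      then have "C1_running_growth K (ctrl_set D) (run_cost D (fst x) (snd x))" by (simp add: case_prod_beta)
      then have "\<bar>along (run_cost D) u Y x\<bar> \<le> K * (1 + (norm (stateH Y x))\<^sup>2 + (norm (meanH Y (fst x)))\<^sup>2 + (norm (ctrl u x))\<^sup>2)"
        unfolding C1_running_growth_def along_def using ctrl_in by blast
      then show ?case by simp
    qed
  qed
qed

lemma terminal_measurable:
  assumes "\<xi> \<in> borel_measurable (F (horizon D))" "\<zeta> \<in> borel_measurable (F (horizon D))"
  shows "(\<lambda>\<omega>. term_cost D \<omega> (\<xi> \<omega>) (\<zeta> \<omega>)) \<in> borel_measurable (F (horizon D))"
proof -
  have "(\<lambda>(\<omega>, x, x'). term_cost D \<omega> x x') \<in> borel_measurable (F (horizon D) \<Otimes>\<^sub>M borel \<Otimes>\<^sub>M borel)"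
    using C by (simp add: assumption_C_def C_costs_def)
  from measurable_compose[OF measurable_Pair[OF measurable_ident measurable_Pair[OF assms]] this]
  show ?thesis by simp
qed

lemma terminal_growth: "\<exists>K>0. AE \<omega> in \<P>. C1_terminal_growth K (term_cost D \<omega>)"
  using C by (auto simp: assumption_C_def C_costs_def)

lemma T_in: "horizon D \<in> {0..horizon D}" using T_pos by simp

lemma terminal_cost_integrable:
  assumes X: "X \<in> proc_S2 D"
  shows "integrable \<P> (\<lambda>\<omega>. term_cost D \<omega> (X (horizon D) \<omega>) (mean D X (horizon D)))"
proof -
  note sq = S2_square_integrable[OF X T_in]
  obtain K where K: "K > 0" "AE \<omega> in \<P>. C1_terminal_growth K (term_cost D \<omega>)" using terminal_growth by blast
  show ?thesis
  proof (rule Bochner_Integration.integrable_bound)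
    show "integrable \<P> (\<lambda>\<omega>. K * (1 + (norm (X (horizon D) \<omega>))\<^sup>2 + (norm (mean D X (horizon D)))\<^sup>2))"
      using sq(1) by (simp add: square_integrable_def)
    show "(\<lambda>\<omega>. term_cost D \<omega> (X (horizon D) \<omega>) (mean D X (horizon D))) \<in> borel_measurable \<P>"
      by (rule measurable_F_M[OF terminal_measurable[OF sq(2)]]) auto
    show "AE \<omega> in \<P>. norm (term_cost D \<omega> (X (horizon D) \<omega>) (mean D X (horizon D)))
        \<le> norm (K * (1 + (norm (X (horizon D) \<omega>))\<^sup>2 + (norm (mean D X (horizon D)))\<^sup>2))"
      using K(2)
    proof eventually_elim
      case (elim \<omega>)
      then have "\<bar>term_cost D \<omega> (X (horizon D) \<omega>) (mean D X (horizon D))\<bar>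
          \<le> K * (1 + (norm (X (horizon D) \<omega>))\<^sup>2 + (norm (mean D X (horizon D)))\<^sup>2)"
        unfolding C1_terminal_growth_def by blast
      then show ?case by simp
    qed
  qed
qed

text \<open>The running cost is integrated in time first by definition; linear growth of state and
  control against quadratic growth of the cost makes Fubini applicable, so that running costs of two
  pairs can be compared pointwise on the product space.\<close>

lemma cost_eq:
  assumes u: "u \<in> admissible_controls D" and X: "X \<in> proc_S2 D" "V_process X Y"
  shows "cost D u X = integral\<^sup>L \<mu> (along (run_cost D) u Y)
    + expectation (\<lambda>\<omega>. term_cost D \<omega> (X (horizon D) \<omega>) (mean D X (horizon D)))"
proof -
  note i = running_cost_integrable[OF u X] and i' = terminal_cost_integrable[OF X(1)]
  note m = integral_mu_snd[OF i]
  have ae: "AE x in \<mu>. run_cost D (fst x) (snd x) (X (fst x) (snd x)) (mean D X (fst x)) (u (fst x) (snd x)) = along (run_cost D) u Y x"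
    using along_AE[OF u X] by eventually_elim (simp add: along_def)
  have aew: "AE \<omega> in \<P>. (LINT t:{0..horizon D}|lebesgue. run_cost D t \<omega> (X t \<omega>) (mean D X t) (u t \<omega>))
      = (\<integral>s. along (run_cost D) u Y (s, \<omega>) \<partial>L)"
    using AE_mu_sections'[OF ae] AE_space
  proof eventually_elim
    case (elim \<omega>)
    have "(LINT t:{0..horizon D}|lebesgue. run_cost D t \<omega> (X t \<omega>) (mean D X t) (u t \<omega>))
        = (\<integral>s. indicator {0..horizon D} s * along (run_cost D) u Y (s, \<omega>) \<partial>L)"
      by (rule set_integral_lebesgue_L[OF measurable_mu_section'[OF borel_measurable_integrable[OF i] elim(2)]])
        (use elim(1) in simp_all)
    also have "\<dots> = (\<integral>s. along (run_cost D) u Y (s, \<omega>) \<partial>L)"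
      by (intro Bochner_Integration.integral_cong) (auto simp: space_restrict_space)
    finally show ?case .
  qed
  have mm: "(\<lambda>\<omega>. (\<integral>s. along (run_cost D) u Y (s, \<omega>) \<partial>L) + term_cost D \<omega> (X (horizon D) \<omega>) (mean D X (horizon D))) \<in> borel_measurable \<P>"
    using m(2) i' by (intro borel_measurable_add borel_measurable_integrable)
  have ae2: "AE \<omega> in \<P>. (LINT t:{0..horizon D}|lebesgue. run_cost D t \<omega> (X t \<omega>) (mean D X t) (u t \<omega>))
     + term_cost D \<omega> (X (horizon D) \<omega>) (mean D X (horizon D))
     = (\<integral>s. along (run_cost D) u Y (s, \<omega>) \<partial>L) + term_cost D \<omega> (X (horizon D) \<omega>) (mean D X (horizon D))"
    using aew by eventually_elim simp
  have "cost D u X = expectation (\<lambda>\<omega>. (\<integral>s. along (run_cost D) u Y (s, \<omega>) \<partial>L) + term_cost D \<omega> (X (horizon D) \<omega>) (mean D X (horizon D)))"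
    unfolding cost_def by (rule integral_cong_AE[OF borel_measurable_AE_eq[OF complete mm ae2] mm ae2])
  also have "\<dots> = expectation (\<lambda>\<omega>. \<integral>s. along (run_cost D) u Y (s, \<omega>) \<partial>L) + expectation (\<lambda>\<omega>. term_cost D \<omega> (X (horizon D) \<omega>) (mean D X (horizon D)))"
    by (rule Bochner_Integration.integral_add[OF m(2) i'])
  finally show ?thesis using m(1) by simp
qed


section \<open>The Hamiltonian along a trajectory\<close>

text \<open>Control and adjoint variables are frozen at \<open>x\<close>, while both state arguments
  stay free: derivatives are taken in them, and another trajectory is inserted for them.\<close>

definition H_along :: "(real \<Rightarrow> 'w \<Rightarrow> 'u) \<Rightarrow> (real \<times> 'w \<Rightarrow> 'v) \<Rightarrow> (real \<times> 'w \<Rightarrow> 'v) \<Rightarrow> (real \<times> 'w \<Rightarrow> 'h) \<Rightarrow> real \<times> 'w \<Rightarrow> 'h \<Rightarrow> 'h \<Rightarrow> real" where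
  "H_along u Y P q x y y' = hamiltonian D (fst x) (snd x) y y' (ctrl u x) (stateH P x) (q x)"

definition Hx where
  "Hx w u Y P q x = limit_gradient w (\<lambda>y. H_along u Y P q x y (meanH Y (fst x))) (stateH Y x)"

definition Hx' where
  "Hx' w u Y P q x = limit_gradient w (\<lambda>y. H_along u Y P q x (stateH Y x) y) (meanH Y (fst x))"

lemma coefficient_measurability:
  "(\<lambda>((t, \<omega>), x, x', u). drift D t \<omega> x x' u) \<in> borel_measurable (pred_sigma D \<Otimes>\<^sub>M borel \<Otimes>\<^sub>M borel \<Otimes>\<^sub>M restrict_space borel (ctrl_set D))"
  "(\<lambda>((t, \<omega>), x, x', u). diffusion D t \<omega> x x' u) \<in> borel_measurable (pred_sigma D \<Otimes>\<^sub>M borel \<Otimes>\<^sub>M borel \<Otimes>\<^sub>M restrict_space borel (ctrl_set D))"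
  "(\<lambda>((t, \<omega>), x, x', u). run_cost D t \<omega> x x' u) \<in> borel_measurable (pred_sigma D \<Otimes>\<^sub>M borel \<Otimes>\<^sub>M borel \<Otimes>\<^sub>M restrict_space borel (ctrl_set D))"
  using C by (simp_all add: assumption_C_def C_coefficient_def C_costs_def)

lemma hamiltonian_measurable:
  assumes a: "a \<in> measurable N progressive" and b: "b \<in> borel_measurable N" and c: "c \<in> borel_measurable N"
    and d: "d \<in> borel_measurable N" "\<And>z. d z \<in> ctrl_set D" and p: "p \<in> borel_measurable N" and q: "q \<in> borel_measurable N"
  shows "(\<lambda>z. hamiltonian D (fst (a z)) (snd (a z)) (b z) (c z) (d z) (p z) (q z)) \<in> borel_measurable N"
  unfolding hamiltonian_def
  by (intro borel_measurable_add borel_measurable_inner p q coefficient_measurable[OF coefficient_measurability(1) a b c d]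
      coefficient_measurable[OF coefficient_measurability(2) a b c d] coefficient_measurable[OF coefficient_measurability(3) a b c d])

lemma hamiltonian_regular:
  obtains K1 K2 K3 where "AE x in \<mu>. \<forall>p q. C1_partial (ctrl_set D) (\<lambda>y y' v. hamiltonian D (fst x) (snd x) y y' v p q)
    (\<lambda>y y' v. K1 * norm p + K2 * norm q + K3 * (1 + norm y + norm y' + norm v))"
proof -
  obtain K1 where K1: "AE (t, \<omega>) in \<mu>. C1_bounded K1 (ctrl_set D) (drift D t \<omega>)"
    using C by (auto simp: assumption_C_def C_coefficient_def)
  obtain K2 where K2: "AE (t, \<omega>) in \<mu>. C1_bounded K2 (ctrl_set D) (diffusion D t \<omega>)"
    using C by (auto simp: assumption_C_def C_coefficient_def)
  obtain K3 where K3: "AE (t, \<omega>) in \<mu>. C1_running_growth K3 (ctrl_set D) (run_cost D t \<omega>)"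
    using C by (auto simp: assumption_C_def C_costs_def)
  show ?thesis
  proof (rule that)
    show "AE x in \<mu>. \<forall>p q. C1_partial (ctrl_set D) (\<lambda>y y' v. hamiltonian D (fst x) (snd x) y y' v p q)
    (\<lambda>y y' v. K1 * norm p + K2 * norm q + K3 * (1 + norm y + norm y' + norm v))"
      using K1 K2 K3
    proof eventually_elim
      case (elim x)
      then have "C1_bounded K1 (ctrl_set D) (drift D (fst x) (snd x))" "C1_bounded K2 (ctrl_set D) (diffusion D (fst x) (snd x))"
        "C1_running_growth K3 (ctrl_set D) (run_cost D (fst x) (snd x))" by (simp_all add: case_prod_beta)
      from hamiltonian_derivatives[OF this] show ?case unfolding hamiltonian_def by (intro allI)
    qed
  qed
qed

text \<open>\<open>Hx\<close> and \<open>Hx'\<close> are measurable as limits of difference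
  quotients, and they are the true gradients wherever the coefficients are regular. Bounded
  derivatives of drift and diffusion make them linear in the adjoint variables, and the derivatives
  of the running cost grow linearly, whence square integrability.\<close>

lemma hamiltonian_gradients:
  assumes u: "u \<in> admissible_controls D" and X: "X \<in> proc_S2 D" "V_process X Y" and p: "V_process p P"
    and q: "square_integrable \<mu> q" "q \<in> borel_measurable progressive"
    and w: "\<And>x :: 'h. (\<lambda>N. finite_projection w N x) \<longlonglongrightarrow> x"
  shows "Hx w u Y P q \<in> borel_measurable progressive" "Hx' w u Y P q \<in> borel_measurable progressive"
    "square_integrable \<mu> (Hx w u Y P q)" "square_integrable \<mu> (Hx' w u Y P q)"
    "AE x in \<mu>. has_gateaux_gradient (\<lambda>y. H_along u Y P q x y (meanH Y (fst x))) (Hx w u Y P q x) (stateH Y x) UNIV \<and>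
      has_gateaux_gradient (\<lambda>y. H_along u Y P q x (stateH Y x) y) (Hx' w u Y P q x) (meanH Y (fst x)) UNIV"
proof -
  note \<xi> = stateH_properties(2)[OF X(2)] and m = progressive_time[OF meanH_properties(1)[OF X]] and c = ctrl_properties(1)[OF u]
    and pm = stateH_properties(2)[OF p]
  have fst': "f \<in> borel_measurable progressive \<Longrightarrow> (\<lambda>z. f (fst z)) \<in> borel_measurable (progressive \<Otimes>\<^sub>M borel)" for f :: "real \<times> 'w \<Rightarrow> 'c::topological_space"
    by (rule measurable_compose[OF measurable_fst])
  have "(\<lambda>z. H_along u Y P q (fst z) (snd z) (meanH Y (fst (fst z)))) \<in> borel_measurable (progressive \<Otimes>\<^sub>M (borel :: 'h measure))"
    unfolding H_along_def by (intro hamiltonian_measurable measurable_fst measurable_snd fst' m c pm q(2) ctrl_in)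
  then show mx: "Hx w u Y P q \<in> borel_measurable progressive"
    unfolding Hx_def[abs_def] by (intro limit_gradient_measurable \<xi>) (simp add: case_prod_beta)
  have "(\<lambda>z. H_along u Y P q (fst z) (stateH Y (fst z)) (snd z)) \<in> borel_measurable (progressive \<Otimes>\<^sub>M (borel :: 'h measure))"
    unfolding H_along_def by (intro hamiltonian_measurable measurable_fst measurable_snd fst' \<xi> c pm q(2) ctrl_in)
  then show mx': "Hx' w u Y P q \<in> borel_measurable progressive"
    unfolding Hx'_def[abs_def] by (intro limit_gradient_measurable m) (simp add: case_prod_beta)
  obtain K1 K2 K3 where reg: "AE x in \<mu>. \<forall>p q. C1_partial (ctrl_set D) (\<lambda>y y' v. hamiltonian D (fst x) (snd x) y y' v p q)
    (\<lambda>y y' v. K1 * norm p + K2 * norm q + K3 * (1 + norm y + norm y' + norm v))"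
    by (rule hamiltonian_regular)
  \<comment> \<open>The three constants come without a sign, hence the absolute values in the
    majorant.\<close>
  let ?B = "\<lambda>x. \<bar>K1\<bar> * norm (stateH P x) + \<bar>K2\<bar> * norm (q x) + \<bar>K3\<bar> * (1 + norm (stateH Y x) + norm (meanH Y (fst x)) + norm (ctrl u x))"
  have B: "square_integrable \<mu> ?B"
    by (intro square_integrable_add square_integrable_mult_const square_integrable_norm square_integrable_const finite_measure_mu
        stateH_properties(1)[OF X(2)] stateH_properties(1)[OF p] q(1) meanH_properties(3)[OF X] ctrl_properties(3)[OF u])
  have all: "AE x in \<mu>. has_gateaux_gradient (\<lambda>y. H_along u Y P q x y (meanH Y (fst x))) (Hx w u Y P q x) (stateH Y x) UNIV \<and>
      has_gateaux_gradient (\<lambda>y. H_along u Y P q x (stateH Y x) y) (Hx' w u Y P q x) (meanH Y (fst x)) UNIV \<and>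
      norm (Hx w u Y P q x) \<le> norm (?B x) \<and> norm (Hx' w u Y P q x) \<le> norm (?B x)"
    using reg
  proof eventually_elim
    case (elim x)
    then have "C1_partial (ctrl_set D) (\<lambda>y y' v. hamiltonian D (fst x) (snd x) y y' v (stateH P x) (q x))
      (\<lambda>y y' v. K1 * norm (stateH P x) + K2 * norm (q x) + K3 * (1 + norm y + norm y' + norm v))" by blast
    then obtain fx fx' where H: "\<forall>y y'. \<forall>v\<in>ctrl_set D.
      has_gateaux_derivative (\<lambda>z. hamiltonian D (fst x) (snd x) z y' v (stateH P x) (q x)) (fx (y, y', v)) y UNIV \<and>
      has_gateaux_derivative (\<lambda>z. hamiltonian D (fst x) (snd x) y z v (stateH P x) (q x)) (fx' (y, y', v)) y' UNIV \<and>
      norm (fx (y, y', v)) \<le> K1 * norm (stateH P x) + K2 * norm (q x) + K3 * (1 + norm y + norm y' + norm v) \<and>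
      norm (fx' (y, y', v)) \<le> K1 * norm (stateH P x) + K2 * norm (q x) + K3 * (1 + norm y + norm y' + norm v)"
      unfolding C1_partial_def by blast
    from bspec[OF spec[OF spec[OF H, of "stateH Y x"], of "meanH Y (fst x)"] ctrl_in[of u x]]
    obtain Dx Dx' where D: "has_gateaux_derivative (\<lambda>y. H_along u Y P q x y (meanH Y (fst x))) Dx (stateH Y x) UNIV"
      "has_gateaux_derivative (\<lambda>y. H_along u Y P q x (stateH Y x) y) Dx' (meanH Y (fst x)) UNIV"
      "norm Dx \<le> K1 * norm (stateH P x) + K2 * norm (q x) + K3 * (1 + norm (stateH Y x) + norm (meanH Y (fst x)) + norm (ctrl u x))"
      "norm Dx' \<le> K1 * norm (stateH P x) + K2 * norm (q x) + K3 * (1 + norm (stateH Y x) + norm (meanH Y (fst x)) + norm (ctrl u x))"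
      unfolding H_along_def by blast
    have le: "K1 * norm (stateH P x) + K2 * norm (q x) + K3 * (1 + norm (stateH Y x) + norm (meanH Y (fst x)) + norm (ctrl u x)) \<le> norm (?B x)"
      unfolding real_norm_def by (intro order_trans[OF _ abs_ge_self] add_mono mult_right_mono) auto
    obtain G where G: "has_gateaux_gradient (\<lambda>y. H_along u Y P q x y (meanH Y (fst x))) G (stateH Y x) UNIV"
      using has_gateaux_gradient_riesz[OF D(1)] by metis
    obtain G' where G': "has_gateaux_gradient (\<lambda>y. H_along u Y P q x (stateH Y x) y) G' (meanH Y (fst x)) UNIV"
      using has_gateaux_gradient_riesz[OF D(2)] by metis
    have "Hx w u Y P q x = G" "Hx' w u Y P q x = G'"
      unfolding Hx_def Hx'_def using limit_gradient_eq[OF w G] limit_gradient_eq[OF w G'] by simp_all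
    then show ?case
      using G G' gateaux_gradient_norm_le[OF G D(1)] gateaux_gradient_norm_le[OF G' D(2)] D(3,4) le by force
  qed
  show "square_integrable \<mu> (Hx w u Y P q)"
    by (rule square_integrableI_bound[OF B measurable_progressive_mu[OF mx]]) (use all in \<open>eventually_elim, blast\<close>)
  show "square_integrable \<mu> (Hx' w u Y P q)"
    by (rule square_integrableI_bound[OF B measurable_progressive_mu[OF mx']]) (use all in \<open>eventually_elim, blast\<close>)
  show "AE x in \<mu>. has_gateaux_gradient (\<lambda>y. H_along u Y P q x y (meanH Y (fst x))) (Hx w u Y P q x) (stateH Y x) UNIV \<and>
      has_gateaux_gradient (\<lambda>y. H_along u Y P q x (stateH Y x) y) (Hx' w u Y P q x) (meanH Y (fst x)) UNIV"
    using all by eventually_elim blast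
qed

text \<open>The pointwise gradient inequality, comparing the Hamiltonian at two state-control pairs
  with the same adjoint variables. The convexity argument works with operators, so these have to be
  identified with the measurable gradients.\<close>

lemma hamiltonian_inequality:
  assumes grad: "AE x in \<mu>. has_gateaux_gradient (\<lambda>y. H_along u Y P q x y (meanH Y (fst x))) (G x) (stateH Y x) UNIV \<and>
      has_gateaux_gradient (\<lambda>y. H_along u Y P q x (stateH Y x) y) (G' x) (meanH Y (fst x)) UNIV"
    and conv: "AE x in \<mu>. convex_on (UNIV \<times> UNIV \<times> ctrl_set D) (\<lambda>(y, y', v). hamiltonian D (fst x) (snd x) y y' v (stateH P x) (q x))"
    and min: "AE x in \<mu>. \<forall>v\<in>ctrl_set D. H_along u Y P q x (stateH Y x) (meanH Y (fst x))
      \<le> hamiltonian D (fst x) (snd x) (stateH Y x) (meanH Y (fst x)) v (stateH P x) (q x)"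
  shows "AE x in \<mu>. G x \<bullet> (stateH Y2 x - stateH Y x) + G' x \<bullet> (meanH Y2 (fst x) - meanH Y (fst x))
    \<le> H_along u2 Y2 P q x (stateH Y2 x) (meanH Y2 (fst x)) - H_along u Y P q x (stateH Y x) (meanH Y (fst x))"
proof -
  obtain K1 K2 K3 where reg: "AE x in \<mu>. \<forall>p q. C1_partial (ctrl_set D) (\<lambda>y y' v. hamiltonian D (fst x) (snd x) y y' v p q)
    (\<lambda>y y' v. K1 * norm p + K2 * norm q + K3 * (1 + norm y + norm y' + norm v))"
    by (rule hamiltonian_regular)
  show ?thesis
    using reg grad conv min
  proof eventually_elim
    case (elim x)
    let ?f = "\<lambda>(y, y', v). hamiltonian D (fst x) (snd x) y y' v (stateH P x) (q x)"
    from elim(1) have "C1_partial (ctrl_set D) (\<lambda>y y' v. hamiltonian D (fst x) (snd x) y y' v (stateH P x) (q x))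
      (\<lambda>y y' v. K1 * norm (stateH P x) + K2 * norm (q x) + K3 * (1 + norm y + norm y' + norm v))" by blast
    then obtain fx fx' where c: "continuous_on (UNIV \<times> UNIV \<times> ctrl_set D) fx" "continuous_on (UNIV \<times> UNIV \<times> ctrl_set D) fx'"
      and d: "\<forall>y y'. \<forall>v\<in>ctrl_set D.
      has_gateaux_derivative (\<lambda>z. hamiltonian D (fst x) (snd x) z y' v (stateH P x) (q x)) (fx (y, y', v)) y UNIV \<and>
      has_gateaux_derivative (\<lambda>z. hamiltonian D (fst x) (snd x) y z v (stateH P x) (q x)) (fx' (y, y', v)) y' UNIV"
      unfolding C1_partial_def by blast
    let ?z = "(stateH Y x, meanH Y (fst x), ctrl u x)"
    have ineq: "fx ?z (stateH Y2 x - stateH Y x) + fx' ?z (meanH Y2 (fst x) - meanH Y (fst x)) \<le> ?f (stateH Y2 x, meanH Y2 (fst x), ctrl u2 x) - ?f ?z"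
    proof (rule convex_gateaux_inequality[OF elim(3) controls(2) ctrl_in ctrl_in _ _ c])
      show "has_gateaux_derivative (\<lambda>y. ?f (y, x', v)) (fx (x0, x', v)) x0 UNIV" if "v \<in> ctrl_set D" for x0 x' v
        using d that by simp
      show "has_gateaux_derivative (\<lambda>y. ?f (x0, y, v)) (fx' (x0, x', v)) x' UNIV" if "v \<in> ctrl_set D" for x0 x' v
        using d that by simp
      show "?f (stateH Y x, meanH Y (fst x), ctrl u x) \<le> ?f (stateH Y x, meanH Y (fst x), v)" if "v \<in> ctrl_set D" for v
        using elim(4) that by (simp add: H_along_def)
    qed
    \<comment> \<open>Both sides are the limit of the same one-sided difference quotients.\<close>
    have "fx ?z v = G x \<bullet> v" for v
    proof (rule tendsto_unique[OF _ has_gateaux_derivativeD has_gateaux_gradientD[OF conjunct1[OF elim(2)]]])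
      show "has_gateaux_derivative (\<lambda>y. H_along u Y P q x y (meanH Y (fst x))) (fx ?z) (stateH Y x) UNIV"
        using d ctrl_in unfolding H_along_def by blast
    qed auto
    moreover have "fx' ?z v = G' x \<bullet> v" for v
    proof (rule tendsto_unique[OF _ has_gateaux_derivativeD has_gateaux_gradientD[OF conjunct2[OF elim(2)]]])
      show "has_gateaux_derivative (\<lambda>y. H_along u Y P q x (stateH Y x) y) (fx' ?z) (meanH Y (fst x)) UNIV"
        using d ctrl_in unfolding H_along_def by blast
    qed auto
    ultimately show ?case using ineq by (simp add: H_along_def)
  qed
qed

text \<open>\<open>adjoint_terminal\<close> contains gradients chosen by definite description, about
  which nothing is known on a null set. \<open>G\<close> and \<open>G'\<close> are measurable
  versions of them, fixed before the competitor \<open>X2\<close> is.\<close>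

lemma terminal_gradients:
  assumes X: "X \<in> proc_S2 D" and conv: "AE \<omega> in \<P>. convex_on UNIV (\<lambda>(x, x'). term_cost D \<omega> x x')"
  obtains G G' where "square_integrable \<P> G" "square_integrable \<P> G'"
    "AE \<omega> in \<P>. adjoint_terminal D X \<omega> = G \<omega> + expectation G'"
    "\<forall>X2\<in>proc_S2 D. AE \<omega> in \<P>. G \<omega> \<bullet> (X2 (horizon D) \<omega> - X (horizon D) \<omega>)
        + G' \<omega> \<bullet> (mean D X2 (horizon D) - mean D X (horizon D))
      \<le> term_cost D \<omega> (X2 (horizon D) \<omega>) (mean D X2 (horizon D)) - term_cost D \<omega> (X (horizon D) \<omega>) (mean D X (horizon D))"
proof -
  let ?T = "horizon D" and ?M = "\<P>"
  let ?m = "mean D X ?T"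
  note sq = S2_square_integrable[OF X T_in]
  obtain w :: "nat \<Rightarrow> 'h" where "\<And>N x. norm (finite_projection w N x) \<le> norm x"
    and w: "\<And>x. (\<lambda>N. finite_projection w N x) \<longlonglongrightarrow> x" using finite_projections_exist by blast
  obtain K where K: "K > 0" "AE \<omega> in ?M. C1_terminal_growth K (term_cost D \<omega>)" using terminal_growth by blast
  define G where "G \<omega> = limit_gradient w (\<lambda>y. term_cost D \<omega> y ?m) (X ?T \<omega>)" for \<omega>
  define G' where "G' \<omega> = limit_gradient w (\<lambda>y. term_cost D \<omega> (X ?T \<omega>) y) ?m" for \<omega>
  have tm: "(\<lambda>(\<omega>, x, x'). term_cost D \<omega> x x') \<in> borel_measurable (F ?T \<Otimes>\<^sub>M borel \<Otimes>\<^sub>M borel)"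
    using C by (simp add: assumption_C_def C_costs_def)
  have XF: "(\<lambda>z. X ?T (fst z)) \<in> borel_measurable (F ?T \<Otimes>\<^sub>M (borel :: 'h measure))"
    by (rule measurable_compose[OF measurable_fst sq(2)])
  have "(\<lambda>(z, y). term_cost D z y ?m) \<in> borel_measurable (F ?T \<Otimes>\<^sub>M borel)"
    using measurable_compose[OF measurable_Pair[OF measurable_fst measurable_Pair[OF measurable_snd measurable_const[of ?m]]] tm]
    by (simp add: case_prod_beta)
  from limit_gradient_measurable[OF this sq(2)] have GF: "G \<in> borel_measurable (F ?T)" by (simp add: G_def[abs_def])
  have "(\<lambda>(z, y). term_cost D z (X ?T z) y) \<in> borel_measurable (F ?T \<Otimes>\<^sub>M borel)"
    using measurable_compose[OF measurable_Pair[OF measurable_fst measurable_Pair[OF XF measurable_snd]] tm]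
    by (simp add: case_prod_beta)
  from limit_gradient_measurable[OF this, of "\<lambda>_. ?m"] have GF': "G' \<in> borel_measurable (F ?T)" by (simp add: G'_def[abs_def])
  have GM: "G \<in> borel_measurable ?M" "G' \<in> borel_measurable ?M" using measurable_F_M[OF GF] measurable_F_M[OF GF'] by simp_all
  let ?B = "\<lambda>\<omega>. K * (1 + norm (X ?T \<omega>) + norm ?m)"
  have B: "square_integrable ?M ?B"
    by (intro square_integrable_mult_const square_integrable_add square_integrable_const finite_measure_axioms square_integrable_norm sq(1))
  have all: "AE \<omega> in ?M. gateaux_gradient (\<lambda>y. term_cost D \<omega> y ?m) (X ?T \<omega>) = G \<omega> \<and>
      gateaux_gradient (\<lambda>y. term_cost D \<omega> (X ?T \<omega>) y) ?m = G' \<omega> \<and> norm (G \<omega>) \<le> norm (?B \<omega>) \<and> norm (G' \<omega>) \<le> norm (?B \<omega>) \<and>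
      (\<forall>y y'. G \<omega> \<bullet> (y - X ?T \<omega>) + G' \<omega> \<bullet> (y' - ?m) \<le> term_cost D \<omega> y y' - term_cost D \<omega> (X ?T \<omega>) ?m)"
    using K(2) conv
  proof eventually_elim
    case (elim \<omega>)
    show ?case
    proof (rule C1_terminal_inequality[OF elim, of ?m "X ?T \<omega>"])
      fix g g' assume g: "has_gateaux_gradient (\<lambda>y. term_cost D \<omega> y ?m) g (X ?T \<omega>) UNIV"
        "has_gateaux_gradient (\<lambda>y. term_cost D \<omega> (X ?T \<omega>) y) g' ?m UNIV"
        "norm g \<le> ?B \<omega>" "norm g' \<le> ?B \<omega>"
        "\<And>y y'. g \<bullet> (y - X ?T \<omega>) + g' \<bullet> (y' - ?m) \<le> term_cost D \<omega> y y' - term_cost D \<omega> (X ?T \<omega>) ?m"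
      have "G \<omega> = g" "G' \<omega> = g'" unfolding G_def G'_def by (rule limit_gradient_eq[OF w g(1)], rule limit_gradient_eq[OF w g(2)])
      moreover have "?B \<omega> \<le> norm (?B \<omega>)" by simp
      ultimately show ?case
        using g(3-5) gateaux_gradient_eq[OF g(1)] gateaux_gradient_eq[OF g(2)] by (auto intro: order_trans)
    qed
  qed
  show ?thesis
  proof (rule that[of G G'])
    show "square_integrable ?M G"
      by (rule square_integrableI_bound[OF B GM(1)]) (use all in \<open>eventually_elim, blast\<close>)
    show "square_integrable ?M G'"
      by (rule square_integrableI_bound[OF B GM(2)]) (use all in \<open>eventually_elim, blast\<close>)
    have ae': "AE \<omega> in ?M. gateaux_gradient (\<lambda>y. term_cost D \<omega> (X ?T \<omega>) y) ?m = G' \<omega>" using all by eventually_elim blast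
    have "(LINT \<omega>'|?M. gateaux_gradient (\<lambda>y. term_cost D \<omega>' (X ?T \<omega>') y) ?m) = expectation G'"
      by (rule integral_cong_AE[OF borel_measurable_AE_eq[OF complete GM(2) ae'] GM(2) ae'])
    then show "AE \<omega> in ?M. adjoint_terminal D X \<omega> = G \<omega> + expectation G'"
      using all by (auto simp: adjoint_terminal_def Let_def elim!: eventually_mono)
    show "\<forall>X2\<in>proc_S2 D. AE \<omega> in ?M. G \<omega> \<bullet> (X2 ?T \<omega> - X ?T \<omega>) + G' \<omega> \<bullet> (mean D X2 ?T - mean D X ?T)
      \<le> term_cost D \<omega> (X2 ?T \<omega>) (mean D X2 ?T) - term_cost D \<omega> (X ?T \<omega>) (mean D X ?T)"
    proof
      fix X2
      show "AE \<omega> in ?M. G \<omega> \<bullet> (X2 ?T \<omega> - X ?T \<omega>) + G' \<omega> \<bullet> (mean D X2 ?T - mean D X ?T)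
        \<le> term_cost D \<omega> (X2 ?T \<omega>) (mean D X2 ?T) - term_cost D \<omega> (X ?T \<omega>) (mean D X ?T)"
        using all by eventually_elim blast
    qed
  qed
qed


text \<open>The adjoint equation is rewritten with measurable versions of the Hamiltonian gradients.
  The mean of the derivative in \<open>x'\<close> becomes a function of time alone, which is adapted
  for trivial reasons and square integrable by Jensen's inequality.\<close>

lemma costate_of_adjoint:
  assumes u: "u \<in> admissible_controls D" and X: "X \<in> proc_S2 D" "V_process X Y"
    and adj: "adjoint_process D u X p q" and \<theta>: "square_integrable \<P> (adjoint_terminal D X)"
    and w: "\<And>x :: 'h. (\<lambda>N. finite_projection w N x) \<longlonglongrightarrow> x"
  obtains P where "V_process p P"
    "costate_of (adjoint_terminal D X) p P (\<lambda>x. q (fst x) (snd x))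
      (\<lambda>x. Hx w u Y P (\<lambda>x. q (fst x) (snd x)) x + (\<integral>\<omega>. Hx' w u Y P (\<lambda>x. q (fst x) (snd x)) (fst x, \<omega>) \<partial>\<P>))"
    "square_integrable \<mu> (\<lambda>x. \<integral>\<omega>. Hx' w u Y P (\<lambda>x. q (fst x) (snd x)) (fst x, \<omega>) \<partial>\<P>)"
proof -
  let ?M = "\<P>" and ?T = "horizon D"
  define q' where "q' x = q (fst x) (snd x)" for x
  have pq: "p \<in> proc_S2 D" "q \<in> proc_M2 D" using adj by (simp_all add: adjoint_process_def)
  obtain P' where P': "V_version D p P'" and eq: "\<And>\<phi> t. t \<in> {0..?T} \<Longrightarrow> has_ito_integral ?M ?T (bm D)
        (\<lambda>s \<omega>. indicator {t..?T} s * (q s \<omega> \<bullet> blinfun_apply (emb D) \<phi>))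
        (\<lambda>\<omega>. adjoint_terminal D X \<omega> \<bullet> blinfun_apply (emb D) \<phi> - p t \<omega> \<bullet> blinfun_apply (emb D) \<phi>
           + (LINT s:{t..?T}|lebesgue.
                - blinfun_apply (blinfun_apply (adjoint_op (opA D s \<omega>)) (P' s \<omega>)) \<phi>
                + (hamiltonian_x D s \<omega> (X s \<omega>) (mean D X s) (u s \<omega>) (p s \<omega>) (q s \<omega>)
                   + (LINT \<omega>'|?M. hamiltonian_x' D s \<omega>' (X s \<omega>') (mean D X s) (u s \<omega>')
                        (p s \<omega>') (q s \<omega>')))
                  \<bullet> blinfun_apply (emb D) \<phi>))"
    using adj unfolding adjoint_process_def by blast
  define P where "P x = P' (fst x) (snd x)" for x
  have P: "V_process p P" using V_versionD[OF P'] by (simp add: P_def[abs_def])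
  have q: "square_integrable \<mu> q'" "q' \<in> borel_measurable progressive"
    unfolding q'_def[abs_def] by (rule M2_square_integrable[OF pq(2)], rule progressive_M2[OF pq(2)])
  define gx where "gx = Hx w u Y P q'"
  define gx' where "gx' = Hx' w u Y P q'"
  note G = hamiltonian_gradients[OF u X P q w, folded gx_def gx'_def]
  define \<kappa> where "\<kappa> s = (\<integral>\<omega>. gx' (s, \<omega>) \<partial>?M)" for s
  have "gx' \<in> borel_measurable (L \<Otimes>\<^sub>M ?M)" using G(4) by (simp add: square_integrable_def dt_dP_def)
  then have \<kappa>m: "\<kappa> \<in> borel_measurable L"
    unfolding \<kappa>_def[abs_def] by (intro borel_measurable_lebesgue_integral) simp
  have \<kappa>sq: "square_integrable \<mu> (\<lambda>x. \<kappa> (fst x))"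
  proof -
    \<comment> \<open>Jensen in the form of Cauchy-Schwarz against the constant 1: the norm of the
      mean is at most the root mean square \<open>b s\<close>.\<close>
    define b where "b s = sqrt (\<integral>\<omega>. (norm (gx' (s, \<omega>)))\<^sup>2 \<partial>?M)" for s
    have i: "integrable \<mu> (\<lambda>x. (norm (gx' x))\<^sup>2)" using G(4) by (simp add: square_integrable_def)
    have "integrable L (\<lambda>s. \<integral>\<omega>. (norm (gx' (s, \<omega>)))\<^sup>2 \<partial>?M)"
      using pair_sigma_finite.integrable_fst'[OF pair_sigma_finite_LM, of "\<lambda>x. (norm (gx' x))\<^sup>2"] i by (simp add: dt_dP_def)
    then have bi: "integrable L (\<lambda>s. (b s)\<^sup>2)" and bm: "b \<in> borel_measurable L" by (simp_all add: b_def[abs_def])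
    have "integrable \<mu> (\<lambda>x. (b (fst x))\<^sup>2)"
    proof -
      have "integrable (L \<Otimes>\<^sub>M ?M) (\<lambda>x. (b (fst x))\<^sup>2)"
      proof (rule pair_sigma_finite.Fubini_integrable[OF pair_sigma_finite_LM])
        show "(\<lambda>x. (b (fst x))\<^sup>2) \<in> borel_measurable (L \<Otimes>\<^sub>M ?M)"
          using measurable_mu_fst[OF bm] by (intro borel_measurable_power) (simp add: dt_dP_def)
      qed (use bi in \<open>simp_all add: prob_space\<close>)
      then show ?thesis by (simp add: dt_dP_def)
    qed
    then have bsq: "square_integrable \<mu> (\<lambda>x. b (fst x))" using measurable_mu_fst[OF bm] by (simp add: square_integrable_def)
    have "AE s in L. norm (\<kappa> s) \<le> norm (b s)"
      using square_integrable_mu_sections(1)[OF G(4)]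
    proof eventually_elim
      case (elim s)
      have "norm (\<kappa> s) \<le> (\<integral>\<omega>. norm (gx' (s, \<omega>)) \<partial>?M)" unfolding \<kappa>_def by (rule integral_norm_bound)
      also have "\<dots> \<le> b s" unfolding b_def
      proof (rule real_le_rsqrt)
        show "(\<integral>\<omega>. norm (gx' (s, \<omega>)) \<partial>?M)\<^sup>2 \<le> (\<integral>\<omega>. (norm (gx' (s, \<omega>)))\<^sup>2 \<partial>?M)"
          using integral_Cauchy_Schwarz[OF square_integrable_norm[OF elim] square_integrable_const[OF finite_measure_axioms, of 1]]
          by (simp add: prob_space)
      qed
      finally show ?case by simp
    qed
    from AE_mu_fst[OF this] show ?thesis by (rule square_integrableI_bound[OF bsq measurable_mu_fst[OF \<kappa>m]])
  qed
  define k where "k x = gx x + \<kappa> (fst x)" for x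
  have k: "square_integrable \<mu> k" "k \<in> borel_measurable progressive"
    unfolding k_def[abs_def] using G(1) progressive_time[OF \<kappa>m]
    by (auto intro: square_integrable_add[OF G(3) \<kappa>sq] borel_measurable_add)
  have ae: "AE x in \<mu>. p (fst x) (snd x) = stateH P x" using stateH_properties(3)[OF P] by eventually_elim simp
  have gae: "AE x in \<mu>. hamiltonian_x D (fst x) (snd x) (X (fst x) (snd x)) (mean D X (fst x)) (u (fst x) (snd x)) (p (fst x) (snd x)) (q (fst x) (snd x)) = gx x
    \<and> hamiltonian_x' D (fst x) (snd x) (X (fst x) (snd x)) (mean D X (fst x)) (u (fst x) (snd x)) (p (fst x) (snd x)) (q (fst x) (snd x)) = gx' x"
    using G(5) along_AE[OF u X] ae
  proof eventually_elim
    case (elim x)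
    have "gateaux_gradient (\<lambda>y. H_along u Y P q' x y (meanH Y (fst x))) (stateH Y x) = gx x"
      "gateaux_gradient (\<lambda>y. H_along u Y P q' x (stateH Y x) y) (meanH Y (fst x)) = gx' x"
      using elim(1) by (auto intro: gateaux_gradient_eq)
    then show ?case using elim(2,3) by (simp add: hamiltonian_x_def hamiltonian_x'_def H_along_def q'_def)
  qed
  have kap: "AE s in L. (LINT \<omega>'|?M. hamiltonian_x' D s \<omega>' (X s \<omega>') (mean D X s) (u s \<omega>') (p s \<omega>') (q s \<omega>')) = \<kappa> s"
    using AE_mu_sections[OF gae] AE_space
  proof eventually_elim
    case (elim s)
    then have s: "s \<in> {0..?T}" by (simp add: space_restrict_space)
    have m: "(\<lambda>\<omega>. gx' (s, \<omega>)) \<in> borel_measurable ?M"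
      by (rule measurable_mu_section[OF square_integrable_measurable[OF G(4)] s])
    have ae': "AE \<omega>' in ?M. hamiltonian_x' D s \<omega>' (X s \<omega>') (mean D X s) (u s \<omega>') (p s \<omega>') (q s \<omega>') = gx' (s, \<omega>')"
      using elim(1) by eventually_elim simp
    show ?case unfolding \<kappa>_def by (rule integral_cong_AE[OF borel_measurable_AE_eq[OF complete m ae'] m ae'])
  qed
  have co: "has_ito_integral ?M ?T (bm D) (\<lambda>s \<omega>. indicator {t..?T} s * (q' (s, \<omega>) \<bullet> emb D \<phi>))
       (\<lambda>\<omega>. adjoint_terminal D X \<omega> \<bullet> emb D \<phi> - p t \<omega> \<bullet> emb D \<phi>
         + (\<integral>s. (if t \<le> s then k (s, \<omega>) \<bullet> emb D \<phi> - opA D (fst (s, \<omega>)) (snd (s, \<omega>)) \<phi> (P (s, \<omega>)) else 0) \<partial>L))"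
    if t: "t \<in> {0..?T}" for \<phi> t
  proof -
    let ?c = "\<lambda>x. k x \<bullet> emb D \<phi> - opA D (fst x) (snd x) \<phi> (P x)"
    have c: "square_integrable \<mu> ?c"
      by (intro square_integrable_diff square_integrable_inner_const k A_right_square_integrable[OF P])
    have R: "Measurable.pred (borel \<Otimes>\<^sub>M borel) (\<lambda>(s, r). r \<le> (s::real))" by measurable
    have ci: "square_integrable ?M (\<lambda>\<omega>. \<integral>s. (if t \<le> s then ?c (s, \<omega>) else 0) \<partial>L)" by (rule partial_integral(2)[OF c R t])
    have "AE x in \<mu>. - blinfun_apply (blinfun_apply (adjoint_op (opA D (fst x) (snd x))) (P' (fst x) (snd x))) \<phi>
                + (hamiltonian_x D (fst x) (snd x) (X (fst x) (snd x)) (mean D X (fst x)) (u (fst x) (snd x)) (p (fst x) (snd x)) (q (fst x) (snd x))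
                   + (LINT \<omega>'|?M. hamiltonian_x' D (fst x) \<omega>' (X (fst x) \<omega>') (mean D X (fst x)) (u (fst x) \<omega>')
                        (p (fst x) \<omega>') (q (fst x) \<omega>'))) \<bullet> emb D \<phi> = ?c x"
      using gae AE_mu_fst[OF kap] by eventually_elim (simp add: k_def P_def adjoint_op_apply)
    from time_integral_AE[OF c this, of t ?T] t
    have i: "AE \<omega> in ?M. (LINT s:{t..?T}|lebesgue.
                - blinfun_apply (blinfun_apply (adjoint_op (opA D s \<omega>)) (P' s \<omega>)) \<phi>
                + (hamiltonian_x D s \<omega> (X s \<omega>) (mean D X s) (u s \<omega>) (p s \<omega>) (q s \<omega>)
                   + (LINT \<omega>'|?M. hamiltonian_x' D s \<omega>' (X s \<omega>') (mean D X s) (u s \<omega>')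
                        (p s \<omega>') (q s \<omega>')))
                  \<bullet> emb D \<phi>) = (\<integral>s. indicator {t..?T} s * ?c (s, \<omega>) \<partial>L)" by simp
    have ind: "(\<integral>s. indicator {t..?T} s * ?c (s, \<omega>) \<partial>L) = (\<integral>s. (if t \<le> s then ?c (s, \<omega>) else 0) \<partial>L)" for \<omega>
      by (intro Bochner_Integration.integral_cong) (auto simp: space_restrict_space)
    have I: "(\<lambda>\<omega>. adjoint_terminal D X \<omega> \<bullet> emb D \<phi> - p t \<omega> \<bullet> emb D \<phi> + (\<integral>s. (if t \<le> s then ?c (s, \<omega>) else 0) \<partial>L)) \<in> borel_measurable ?M"
      by (intro square_integrable_measurable square_integrable_add square_integrable_diff square_integrable_inner_const ci
          \<theta> S2_square_integrable(1)[OF pq(1) t])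
    note ind' = ind[unfolded fst_conv snd_conv] and i' = i[unfolded fst_conv snd_conv]
    show ?thesis
      unfolding q'_def fst_conv snd_conv
      by (rule has_ito_integral_cong[OF eq[OF t] I[unfolded fst_conv snd_conv]])
        (use i' in \<open>eventually_elim, simp only: ind'\<close>)
  qed
  show ?thesis
  proof (rule that[OF P])
    show "costate_of (adjoint_terminal D X) p P (\<lambda>x. q (fst x) (snd x))
      (\<lambda>x. Hx w u Y P (\<lambda>x. q (fst x) (snd x)) x + (\<integral>\<omega>. Hx' w u Y P (\<lambda>x. q (fst x) (snd x)) (fst x, \<omega>) \<partial>?M))"
      using co \<theta> pq(1) P k q
      unfolding costate_of_def k_def[abs_def] \<kappa>_def gx_def gx'_def q'_def[abs_def] by auto
    show "square_integrable \<mu> (\<lambda>x. \<integral>\<omega>. Hx' w u Y P (\<lambda>x. q (fst x) (snd x)) (fst x, \<omega>) \<partial>?M)"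
      using \<kappa>sq unfolding \<kappa>_def gx'_def q'_def[abs_def] .
  qed
qed

section \<open>Comparison of the costs\<close>

text \<open>Both sides are the time integral of the product of two means. The mean is thus moved
  from the state increment to the derivative in \<open>x'\<close>, which is the form in which that
  derivative enters the adjoint equation.\<close>

lemma expectation_mean_pairing:
  assumes G': "square_integrable \<mu> G'" and \<kappa>: "square_integrable \<mu> (\<lambda>x. \<integral>\<omega>. G' (fst x, \<omega>) \<partial>\<P>)"
    and \<zeta>: "square_integrable \<mu> \<zeta>" and m: "square_integrable \<mu> (\<lambda>x. m (fst x))"
    and eq: "AE s in L. (m s :: 'h) = (\<integral>\<omega>. \<zeta> (s, \<omega>) \<partial>\<P>)"
  shows "(\<integral>x. G' x \<bullet> m (fst x) \<partial>\<mu>) = (\<integral>x. (\<integral>\<omega>. G' (fst x, \<omega>) \<partial>\<P>) \<bullet> \<zeta> x \<partial>\<mu>)"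
proof -
  let ?M = "\<P>"
  have i: "integrable \<mu> (\<lambda>x. G' x \<bullet> m (fst x))" by (rule square_integrable_inner_integrable[OF G' m])
  have i': "integrable \<mu> (\<lambda>x. (\<integral>\<omega>. G' (fst x, \<omega>) \<partial>?M) \<bullet> \<zeta> x)" by (rule square_integrable_inner_integrable[OF \<kappa> \<zeta>])
  have "(\<integral>x. G' x \<bullet> m (fst x) \<partial>\<mu>) = (\<integral>s. (\<integral>\<omega>. G' (s, \<omega>) \<bullet> m s \<partial>?M) \<partial>L)"
    using integral_mu_fst[OF i] by simp
  also have "\<dots> = (\<integral>s. (\<integral>\<omega>. (\<integral>\<omega>. G' (s, \<omega>) \<partial>?M) \<bullet> \<zeta> (s, \<omega>) \<partial>?M) \<partial>L)"
  proof (rule integral_cong_AE)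
    show "AE s in L. (\<integral>\<omega>. G' (s, \<omega>) \<bullet> m s \<partial>?M) = (\<integral>\<omega>. (\<integral>\<omega>. G' (s, \<omega>) \<partial>?M) \<bullet> \<zeta> (s, \<omega>) \<partial>?M)"
      using eq square_integrable_mu_sections(1)[OF G'] square_integrable_mu_sections(1)[OF \<zeta>]
    proof eventually_elim
      case (elim s)
      note g = square_integrable_integrable[OF finite_measure_axioms elim(2)] and z = square_integrable_integrable[OF finite_measure_axioms elim(3)]
      show ?case using elim(1) g z by simp
    qed
  qed (use pair_sigma_finite.integrable_fst'[OF pair_sigma_finite_LM] i i' in \<open>force simp: dt_dP_def\<close>)+
  also have "\<dots> = (\<integral>x. (\<integral>\<omega>. G' (fst x, \<omega>) \<partial>?M) \<bullet> \<zeta> x \<partial>\<mu>)" using integral_mu_fst[OF i'] by simp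
  finally show ?thesis .
qed

lemma H_along_split:
  "H_along u Y P q x (stateH Y x) (meanH Y (fst x)) = along (drift D) u Y x \<bullet> stateH P x + along (diffusion D) u Y x \<bullet> q x + along (run_cost D) u Y x"
  by (simp add: H_along_def hamiltonian_def along_def)

text \<open>The integrated gradient inequality for the Hamiltonian bounds the running costs from
  below by terms that the duality identifies, up to sign, with the terminal pairing; convexity of
  the terminal cost bounds the latter by the difference of terminal costs. The means are matched by
  moving expectations across scalar products.\<close>

lemma sufficient_condition:
  assumes pair: "admissible_pair D ubar Xbar" and adj: "adjoint_process D ubar Xbar pbar qbar"
    and conv: "AE (t, \<omega>) in \<mu>. convex_on (UNIV \<times> UNIV \<times> ctrl_set D)
             (\<lambda>(x, x', u). hamiltonian D t \<omega> x x' u (pbar t \<omega>) (qbar t \<omega>))"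
    and conv\<Phi>: "AE \<omega> in \<P>. convex_on UNIV (\<lambda>(x, x'). term_cost D \<omega> x x')"
    and min: "AE (t, \<omega>) in \<mu>. is_arg_min (\<lambda>v. hamiltonian D t \<omega> (Xbar t \<omega>) (mean D Xbar t) v (pbar t \<omega>) (qbar t \<omega>))
             (\<lambda>v. v \<in> ctrl_set D) (ubar t \<omega>)"
    and pair2: "admissible_pair D u X"
  shows "cost D ubar Xbar \<le> cost D u X"
proof -
  let ?M = "\<P>" and ?T = "horizon D"
  have u: "ubar \<in> admissible_controls D" "u \<in> admissible_controls D" using pair pair2 by (simp_all add: admissible_pair_def)
  obtain Y1 where S1: "state_of (init_state D) Xbar Y1 (along (drift D) ubar Y1) (along (diffusion D) ubar Y1)"
    using state_of_admissible_pair[OF pair] by blast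
  obtain Y2 where S2: "state_of (init_state D) X Y2 (along (drift D) u Y2) (along (diffusion D) u Y2)"
    using state_of_admissible_pair[OF pair2] by blast
  have X1: "Xbar \<in> proc_S2 D" "V_process Xbar Y1" and X2: "X \<in> proc_S2 D" "V_process X Y2"
    using S1 S2 by (simp_all add: state_of_def)
  obtain w :: "nat \<Rightarrow> 'h" where "\<And>N x. norm (finite_projection w N x) \<le> norm x"
    and w: "\<And>x. (\<lambda>N. finite_projection w N x) \<longlonglongrightarrow> x" using finite_projections_exist by blast
  obtain g g' where g: "square_integrable ?M g" "square_integrable ?M g'"
    "AE \<omega> in ?M. adjoint_terminal D Xbar \<omega> = g \<omega> + expectation g'"
    and gineq: "\<forall>X2\<in>proc_S2 D. AE \<omega> in ?M. g \<omega> \<bullet> (X2 ?T \<omega> - Xbar ?T \<omega>) + g' \<omega> \<bullet> (mean D X2 ?T - mean D Xbar ?T)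
      \<le> term_cost D \<omega> (X2 ?T \<omega>) (mean D X2 ?T) - term_cost D \<omega> (Xbar ?T \<omega>) (mean D Xbar ?T)"
    by (rule terminal_gradients[OF X1(1) conv\<Phi>])
  have g'': "square_integrable ?M (\<lambda>\<omega>. g \<omega> + expectation g')"
    by (intro square_integrable_add g square_integrable_const finite_measure_axioms)
  have \<theta>: "square_integrable ?M (adjoint_terminal D Xbar)"
    by (rule square_integrable_cong_AE[OF g'' borel_measurable_AE_eq[OF complete square_integrable_measurable[OF g''] g(3)]])
      (use g(3) in \<open>eventually_elim, simp\<close>)
  define q where "q x = qbar (fst x) (snd x)" for x
  obtain P where P: "V_process pbar P"
    and co: "costate_of (adjoint_terminal D Xbar) pbar P q (\<lambda>x. Hx w ubar Y1 P q x + (\<integral>\<omega>. Hx' w ubar Y1 P q (fst x, \<omega>) \<partial>?M))"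
    and \<kappa>: "square_integrable \<mu> (\<lambda>x. \<integral>\<omega>. Hx' w ubar Y1 P q (fst x, \<omega>) \<partial>?M)"
    unfolding q_def[abs_def] by (rule costate_of_adjoint[OF u(1) X1 adj \<theta> w])
  have "qbar \<in> proc_M2 D" using adj by (simp add: adjoint_process_def)
  then have q: "square_integrable \<mu> q" "q \<in> borel_measurable progressive"
    unfolding q_def[abs_def] by (rule M2_square_integrable, rule progressive_M2)
  note grads = hamiltonian_gradients[OF u(1) X1 P q w]
  define G where "G = Hx w ubar Y1 P q"
  define G' where "G' = Hx' w ubar Y1 P q"
  define \<kappa>' where "\<kappa>' x = (\<integral>\<omega>. G' (fst x, \<omega>) \<partial>?M)" for x :: "real \<times> 'w"
  define \<Delta> where "\<Delta> x = stateH Y2 x - stateH Y1 x" for x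
  define \<delta> where "\<delta> s = meanH Y2 s - meanH Y1 s" for s
  have sqG: "square_integrable \<mu> G" "square_integrable \<mu> G'" "square_integrable \<mu> \<kappa>'" "square_integrable \<mu> \<Delta>" "square_integrable \<mu> (\<lambda>x. \<delta> (fst x))"
    using grads(3,4) \<kappa> square_integrable_diff[OF stateH_properties(1)[OF X2(2)] stateH_properties(1)[OF X1(2)]]
      square_integrable_diff[OF meanH_properties(3)[OF X2] meanH_properties(3)[OF X1]]
    by (simp_all add: G_def G'_def \<kappa>'_def[abs_def] \<Delta>_def[abs_def] \<delta>_def)
  have pae: "AE x in \<mu>. pbar (fst x) (snd x) = stateH P x" using stateH_properties(3)[OF P] by eventually_elim simp
  have conv': "AE x in \<mu>. convex_on (UNIV \<times> UNIV \<times> ctrl_set D) (\<lambda>(y, y', v). hamiltonian D (fst x) (snd x) y y' v (stateH P x) (q x))"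
    using conv pae by eventually_elim (simp add: case_prod_beta q_def)
  have min': "AE x in \<mu>. \<forall>v\<in>ctrl_set D. H_along ubar Y1 P q x (stateH Y1 x) (meanH Y1 (fst x))
      \<le> hamiltonian D (fst x) (snd x) (stateH Y1 x) (meanH Y1 (fst x)) v (stateH P x) (q x)"
    using min pae along_AE[OF u(1) X1]
    by eventually_elim (auto simp: case_prod_beta is_arg_min_linorder H_along_def q_def)
  define h1 where "h1 = along (drift D) ubar Y1"
  define h2 where "h2 = along (drift D) u Y2"
  define f1 where "f1 = along (diffusion D) ubar Y1"
  define f2 where "f2 = along (diffusion D) u Y2"
  define l1 where "l1 = along (run_cost D) ubar Y1"
  define l2 where "l2 = along (run_cost D) u Y2"
  have sqh: "square_integrable \<mu> (\<lambda>x. h2 x - h1 x)" "square_integrable \<mu> (\<lambda>x. f2 x - f1 x)"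
    unfolding h1_def h2_def f1_def f2_def
    by (intro square_integrable_diff along_square_integrable(1)[OF coefficients(1) u(1) X1]
        along_square_integrable(1)[OF coefficients(1) u(2) X2] along_square_integrable(1)[OF coefficients(2) u(1) X1]
        along_square_integrable(1)[OF coefficients(2) u(2) X2])+
  have il: "integrable \<mu> l1" "integrable \<mu> l2"
    unfolding l1_def l2_def by (rule running_cost_integrable[OF u(1) X1], rule running_cost_integrable[OF u(2) X2])
  have ineq: "AE x in \<mu>. G x \<bullet> \<Delta> x + G' x \<bullet> \<delta> (fst x)
      \<le> (h2 x - h1 x) \<bullet> stateH P x + (f2 x - f1 x) \<bullet> q x + (l2 x - l1 x)"
    using hamiltonian_inequality[OF grads(5) conv' min', of Y2 u]
    unfolding H_along_split G_def[symmetric] G'_def[symmetric] h1_def[symmetric] h2_def[symmetric] f1_def[symmetric] f2_def[symmetric]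
      l1_def[symmetric] l2_def[symmetric] \<Delta>_def[symmetric] \<delta>_def[symmetric]
    by eventually_elim (simp add: inner_diff_left)
  have ints: "integrable \<mu> (\<lambda>x. G x \<bullet> \<Delta> x)" "integrable \<mu> (\<lambda>x. G' x \<bullet> \<delta> (fst x))" "integrable \<mu> (\<lambda>x. \<kappa>' x \<bullet> \<Delta> x)"
    "integrable \<mu> (\<lambda>x. (h2 x - h1 x) \<bullet> stateH P x)" "integrable \<mu> (\<lambda>x. (f2 x - f1 x) \<bullet> q x)"
    by (intro square_integrable_inner_integrable sqG sqh stateH_properties(1)[OF P] q(1))+
  have I1: "(\<integral>x. G x \<bullet> \<Delta> x \<partial>\<mu>) + (\<integral>x. G' x \<bullet> \<delta> (fst x) \<partial>\<mu>)
      \<le> (\<integral>x. (h2 x - h1 x) \<bullet> stateH P x \<partial>\<mu>) + (\<integral>x. (f2 x - f1 x) \<bullet> q x \<partial>\<mu>) + (integral\<^sup>L \<mu> l2 - integral\<^sup>L \<mu> l1)"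
  proof -
    have "(\<integral>x. G x \<bullet> \<Delta> x + G' x \<bullet> \<delta> (fst x) \<partial>\<mu>) \<le> (\<integral>x. (h2 x - h1 x) \<bullet> stateH P x + (f2 x - f1 x) \<bullet> q x + (l2 x - l1 x) \<partial>\<mu>)"
      using ineq by (intro integral_mono_AE Bochner_Integration.integrable_add Bochner_Integration.integrable_diff ints il)
    then show ?thesis using ints il by simp
  qed
  have "AE s in L. \<delta> s = (\<integral>\<omega>. \<Delta> (s, \<omega>) \<partial>?M)"
    using square_integrable_mu_sections(1)[OF stateH_properties(1)[OF X1(2)]] square_integrable_mu_sections(1)[OF stateH_properties(1)[OF X2(2)]]
  proof eventually_elim
    case (elim s)
    then show ?case
      using square_integrable_integrable[OF finite_measure_axioms elim(1)] square_integrable_integrable[OF finite_measure_axioms elim(2)]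
      by (simp add: \<delta>_def \<Delta>_def meanH_def)
  qed
  from expectation_mean_pairing[OF sqG(2) sqG(3)[unfolded \<kappa>'_def[abs_def]] sqG(4,5) this]
  have I2: "(\<integral>x. G' x \<bullet> \<delta> (fst x) \<partial>\<mu>) = (\<integral>x. \<kappa>' x \<bullet> \<Delta> x \<partial>\<mu>)" by (simp add: \<kappa>'_def)
  have I3: "expectation (\<lambda>\<omega>. adjoint_terminal D Xbar \<omega> \<bullet> (X ?T \<omega> - Xbar ?T \<omega>))
      = (\<integral>x. (h2 x - h1 x) \<bullet> stateH P x \<partial>\<mu>) - ((\<integral>x. G x \<bullet> \<Delta> x \<partial>\<mu>) + (\<integral>x. \<kappa>' x \<bullet> \<Delta> x \<partial>\<mu>)) + (\<integral>x. (f2 x - f1 x) \<bullet> q x \<partial>\<mu>)"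
  proof -
    \<comment> \<open>The competitor is taken as the first state of the duality, so all increments
      are competitor minus candidate.\<close>
    have "expectation (\<lambda>\<omega>. adjoint_terminal D Xbar \<omega> \<bullet> (X ?T \<omega> - Xbar ?T \<omega>))
      = (\<integral>x. (h2 x - h1 x) \<bullet> stateH P x - (G x \<bullet> \<Delta> x + \<kappa>' x \<bullet> \<Delta> x) + (f2 x - f1 x) \<bullet> q x \<partial>\<mu>)"
      using duality[OF S2 S1 co]
      by (simp add: h1_def h2_def f1_def f2_def G_def G'_def \<kappa>'_def \<Delta>_def stateH_def inner_add_left inner_commute[of "q _"])
    then show ?thesis using ints by simp
  qed
  define E where "E Z = expectation (\<lambda>\<omega>. term_cost D \<omega> (Z ?T \<omega>) (mean D Z ?T))" for Z
  have XT: "square_integrable ?M (\<lambda>\<omega>. X ?T \<omega> - Xbar ?T \<omega>)"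
    by (intro square_integrable_diff S2_square_integrable(1)[OF X1(1) T_in] S2_square_integrable(1)[OF X2(1) T_in])
  have meanT: "mean D X ?T - mean D Xbar ?T = expectation (\<lambda>\<omega>. X ?T \<omega> - Xbar ?T \<omega>)"
    using square_integrable_integrable[OF finite_measure_axioms S2_square_integrable(1)[OF X1(1) T_in]]
      square_integrable_integrable[OF finite_measure_axioms S2_square_integrable(1)[OF X2(1) T_in]] by simp
  have I4: "expectation (\<lambda>\<omega>. adjoint_terminal D Xbar \<omega> \<bullet> (X ?T \<omega> - Xbar ?T \<omega>)) \<le> E X - E Xbar"
  proof -
    have ig: "integrable ?M (\<lambda>\<omega>. g \<omega> \<bullet> (X ?T \<omega> - Xbar ?T \<omega>))" by (rule square_integrable_inner_integrable[OF g(1) XT])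
    have ig': "integrable ?M g'" by (rule square_integrable_integrable[OF finite_measure_axioms g(2)])
    have ix: "integrable ?M (\<lambda>\<omega>. X ?T \<omega> - Xbar ?T \<omega>)" by (rule square_integrable_integrable[OF finite_measure_axioms XT])
    have "expectation (\<lambda>\<omega>. adjoint_terminal D Xbar \<omega> \<bullet> (X ?T \<omega> - Xbar ?T \<omega>))
        = expectation (\<lambda>\<omega>. g \<omega> \<bullet> (X ?T \<omega> - Xbar ?T \<omega>) + expectation g' \<bullet> (X ?T \<omega> - Xbar ?T \<omega>))"
    proof (rule integral_cong_AE)
      show "(\<lambda>\<omega>. adjoint_terminal D Xbar \<omega> \<bullet> (X ?T \<omega> - Xbar ?T \<omega>)) \<in> borel_measurable ?M"
        by (rule borel_measurable_integrable[OF square_integrable_inner_integrable[OF \<theta> XT]])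
      show "(\<lambda>\<omega>. g \<omega> \<bullet> (X ?T \<omega> - Xbar ?T \<omega>) + expectation g' \<bullet> (X ?T \<omega> - Xbar ?T \<omega>)) \<in> borel_measurable ?M"
        by (intro borel_measurable_add borel_measurable_integrable[OF ig] borel_measurable_inner borel_measurable_const square_integrable_measurable[OF XT])
      show "AE \<omega> in ?M. adjoint_terminal D Xbar \<omega> \<bullet> (X ?T \<omega> - Xbar ?T \<omega>)
          = g \<omega> \<bullet> (X ?T \<omega> - Xbar ?T \<omega>) + expectation g' \<bullet> (X ?T \<omega> - Xbar ?T \<omega>)"
        using g(3) by eventually_elim (simp add: inner_add_left)
    qed
    \<comment> \<open>A deterministic vector passes through the expectation. Used here and once more
      below, this trades \<open>expectation g'\<close> against the state increment for
      \<open>g'\<close> against the increment of the means.\<close>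
    also have "\<dots> = expectation (\<lambda>\<omega>. g \<omega> \<bullet> (X ?T \<omega> - Xbar ?T \<omega>)) + expectation g' \<bullet> (mean D X ?T - mean D Xbar ?T)"
      unfolding meanT using integral_inner_right[OF ix] integrable_inner_right[OF ix]
      by (subst Bochner_Integration.integral_add[OF ig]) auto
    also have "\<dots> = expectation (\<lambda>\<omega>. g \<omega> \<bullet> (X ?T \<omega> - Xbar ?T \<omega>) + g' \<omega> \<bullet> (mean D X ?T - mean D Xbar ?T))"
      using integral_inner_left[OF ig'] integrable_inner_left[OF ig']
      by (subst Bochner_Integration.integral_add[OF ig]) auto
    also have "\<dots> \<le> expectation (\<lambda>\<omega>. term_cost D \<omega> (X ?T \<omega>) (mean D X ?T) - term_cost D \<omega> (Xbar ?T \<omega>) (mean D Xbar ?T))"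
      using bspec[OF gineq X2(1)] integrable_inner_left[OF ig']
      by (intro integral_mono_AE Bochner_Integration.integrable_add Bochner_Integration.integrable_diff ig terminal_cost_integrable X1 X2) auto
    also have "\<dots> = E X - E Xbar"
      unfolding E_def by (intro Bochner_Integration.integral_diff terminal_cost_integrable X1 X2)
    finally show ?thesis .
  qed
  have "cost D u X = integral\<^sup>L \<mu> l2 + E X" "cost D ubar Xbar = integral\<^sup>L \<mu> l1 + E Xbar"
    unfolding E_def l1_def l2_def by (rule cost_eq[OF u(2) X2], rule cost_eq[OF u(1) X1])
  \<comment> \<open>\<open>I4\<close> bounds the terminal difference below by the pairing,
    \<open>I3\<close> turns the pairing into time integrals, and \<open>I1\<close> with
    \<open>I2\<close> shows that these and the difference of running costs have a nonnegative
    sum.\<close>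
  then show ?thesis using I1 I2 I3 I4 by linarith
qed

end

theorem theorem5p5:
  fixes D :: "('w, 'v::banach, 'h::{real_inner, banach, second_countable_topology},
      'u::{real_inner, banach, second_countable_topology}) control_problem"
    and ubar :: "real \<Rightarrow> 'w \<Rightarrow> 'u" and Xbar pbar qbar :: "real \<Rightarrow> 'w \<Rightarrow> 'h"
  assumes "stochastic_setting D" and "assumption_C D"
    and "admissible_pair D ubar Xbar"
    and "adjoint_process D ubar Xbar pbar qbar"
    and "AE (t, \<omega>) in dt_dP (prob D) (horizon D).
           convex_on (UNIV \<times> UNIV \<times> ctrl_set D)
             (\<lambda>(x, x', u). hamiltonian D t \<omega> x x' u (pbar t \<omega>) (qbar t \<omega>))"
    and "AE \<omega> in prob D. convex_on UNIV (\<lambda>(x, x'). term_cost D \<omega> x x')"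
    and "AE (t, \<omega>) in dt_dP (prob D) (horizon D).
           is_arg_min (\<lambda>v. hamiltonian D t \<omega> (Xbar t \<omega>) (mean D Xbar t) v (pbar t \<omega>) (qbar t \<omega>))
             (\<lambda>v. v \<in> ctrl_set D) (ubar t \<omega>)"
  shows "optimal_pair D ubar Xbar"
proof -
  interpret W: wiener "prob D" "horizon D" "bm D"
    using assms(1) unfolding stochastic_setting_def by (simp add: wiener_def wiener_axioms_def)
  from assms(2) have "C_operator D" by (simp add: assumption_C_def)
  then obtain \<alpha> lam C where m: "(\<lambda>(t, \<omega>). opA D t \<omega>) \<in> borel_measurable (pred_sigma D)" and \<alpha>: "\<alpha> > 0"
    and c: "\<And>t \<omega>. t \<in> {0..horizon D} \<Longrightarrow> \<omega> \<in> space (prob D) \<Longrightarrow>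
        (\<forall>x. blinfun_apply (blinfun_apply (opA D t \<omega>) x) x + lam * (norm (blinfun_apply (emb D) x))\<^sup>2
               \<ge> \<alpha> * (norm x)\<^sup>2) \<and> norm (opA D t \<omega>) \<le> C"
    unfolding C_operator_def by blast
  interpret control_setting D \<alpha> lam C
  proof
    show "gelfand_triple (emb D)" using assms(1) by (simp add: stochastic_setting_def)
    show "(\<lambda>x. opA D (fst x) (snd x)) \<in> borel_measurable W.progressive"
      using W.measurable_predictable_progressive[OF m] by (simp add: case_prod_unfold)
    show "\<alpha> * (norm v)\<^sup>2 \<le> opA D (fst x) (snd x) v v + lam * (norm (emb D v))\<^sup>2"
      if "x \<in> space (dt_dP (prob D) (horizon D))" for x v
      using c[of "fst x" "snd x"] that by (auto simp: W.space_mu)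
    show "norm (opA D (fst x) (snd x)) \<le> C" if "x \<in> space (dt_dP (prob D) (horizon D))" for x
      using c[of "fst x" "snd x"] that by (auto simp: W.space_mu)
  qed (use \<alpha> assms(2) in auto)
  have "cost D ubar Xbar \<le> cost D u X" if "admissible_pair D u X" for u X
    by (rule sufficient_condition[OF assms(3-7) that])
  \<comment> \<open>The candidate is itself admissible, so the infimum is attained at it.\<close>
  then have "ereal (cost D ubar Xbar) = (INF (v, Y)\<in>{(v, Y). admissible_pair D v Y}. ereal (cost D v Y))"
    using assms(3) by (intro antisym INF_greatest INF_lower2[of "(ubar, Xbar)"]) auto
  then show ?thesis using assms(3) by (simp add: optimal_pair_def)
qed

end
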